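(* Let $\mathcal{C}$ be a Nakayama category. Then, for any map $f\colon X\to Y$ of essentially finite groupoids, the Nakayama map defines a canonical isomorphism $$\nu_f\colon f_*V\to f_!V$$ for any functor $V\colon X\to\mathcal{C}$.
   Context: Monoidal category means symmetric monoidal category (tensor $\otimes$, unit $1$); monoidal functor means strong symmetric monoidal functor. $\mathcal{C}$ has duals if every object $A$ has a dual $A^d$, with maps $1\to A^d\otimes A$ and $A\otimes A^d\to 1$ satisfying the triangle identities. Pre-Nakayama map. Let $f^*\colon\mathcal{A}\to\mathcal{B}$ be a monoidal functor between monoidal categories with duals, with left adjoint $f_!$ and right adjoint $f_*$; write $\eta_!\colon \mathrm{id}\to f^*f_!$, $\epsilon_!\colon f_!f^*\to\mathrm{id}$, $\eta_*\colon\mathrm{id}\to f_*f^*$, $\epsilon_*\colon f^*f_*\to\mathrm{id}$ for units and counits. The projection maps are $\lambda\colon f_!(A\otimes f^*B)\xrightarrow{f_!(\eta_!\otimes \mathrm{id})}f_!(f^*f_!A\otimes f^*B)\cong f_!f^*(f_!A\otimes B)\xrightarrow{\epsilon_!}f_!A\otimes B$ and $\rho\colon A\otimes f_*B\xrightarrow{\eta_*}f_*f^*(A\otimes f_*B)\cong f_*(f^*A\otimes f^*f_*B)\xrightarrow{f_*(\mathrm{id}\otimes\epsilon_* )}f_*(f^*A\otimes B)$; both are isomorphisms. The pre-Nakayama map $\gamma_f\colon f_*\to f_!$ is, at $A$, $f_*A\cong f_*(A\otimes 1)\xrightarrow{f_*(\eta_!\otimes \mathrm{id})}f_*(f^*f_!A\otimes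 1)\xrightarrow{\rho^{-1}}f_!A\otimes f_*1\xrightarrow{\lambda^{-1}}f_!(A\otimes f^*f_*1)\xrightarrow{f_!(\mathrm{id}\otimes\epsilon_* )}f_!(A\otimes 1)\cong f_!A$. Groupoids and Kan extensions. A groupoid is essentially finite if it has finitely many isomorphism classes of objects and all its hom-sets are finite. For a groupoid $X$, $\mathcal{C}^X$ is the category of functors $X\to\mathcal{C}$ with pointwise tensor product. For $f\colon X\to Y$, $f^*\colon\mathcal{C}^Y\to\mathcal{C}^X$ is restriction, and $f_!$, $f_*$ are left and right Kan extension. If $p\colon P_y\to X$ is the homotopy fibre of $f$ at $y$, then $f_!V(y)=\operatorname{colim}_{P_y}p^*V$ and $f_*V(y)=\lim_{P_y}p^*V$. If $\mathcal{C}$ has duals and essentially finite colimits (colimits indexed by essentially finite groupoids), both exist for maps of essentially finite groupoids. Nakayama map. On each connected component $\hat P$ of $P_y$, the essentially unique map $\iota\colon\{*\}\to\hat P$ gives an endomorphism $1\xrightarrow{\eta_*}\iota_*\iota^*1\xrightarrow{\gamma_\iota}\iota_!\iota^*1\xrightarrow{\epsilon_!}1$ of the unit of $\mathcal{C}^{\hat P}$. Together these give $\delta_f\colon 1\to 1$ in $\mathcal{C}^{P_y}$ and, by tensoring, a natural endomorphism $\delta_f$ of $p^*V$. When $\delta_f$ is invertible (for all $y$), the Nakayama map is $\nu_f\colon f_*V\xrightarrow{\gamma_f}f_!V\xrightarrow{f_!\delta_f^{-1}}f_!V$, where $f_!\delta_f^{-1}$ is at $y$ the map induced on $\operatorname{colim}_{P_y}p^*V$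 by $\delta_f^{-1}$. Nakayama category. A category $\mathcal{C}$ is a Nakayama category if (i) it has essentially finite colimits; (ii) it is symmetric monoidal; (iii) it has duals; (iv) $\delta_f$ is invertible for every map $f$ of essentially finite groupoids; (v) for all composable $X\xrightarrow{f}Y\xrightarrow{g}Z$ of essentially finite groupoids, up to the canonical identifications $(gf)_*\cong g_*f_*$ and $(gf)_!\cong g_!f_!$, one has $\nu_{gf}=(g_!\nu_f)\circ\nu_g=\nu_g\circ(g_*\nu_f)$ as maps $g_*f_*\to g_!f_!$. *)

theory Defs
  imports "HOL-Library.FuncSet" "HOL-Library.Infinite_Typeclass"
begin

section \<open>Categories and functors\<close>

record ('o, 'a) cat =
  Ob :: "'o set"
  Ar :: "'a set"
  Dom :: "'a \<Rightarrow> 'o"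
  Cod :: "'a \<Rightarrow> 'o"
  Ident :: "'o \<Rightarrow> 'a"
  Comp :: "'a \<Rightarrow> 'a \<Rightarrow> 'a"  (infixl "\<cdot>\<index>" 60)

definition hom :: "('o, 'a, 'e) cat_scheme \<Rightarrow> 'o \<Rightarrow> 'o \<Rightarrow> 'a set" where
  "hom C A B = {f \<in> Ar C. Dom C f = A \<and> Cod C f = B}"

locale category =
  fixes C :: "('o, 'a, 'e) cat_scheme" (structure)
  assumes dom_ob: "f \<in> Ar C \<Longrightarrow> Dom C f \<in> Ob C"
    and cod_ob: "f \<in> Ar C \<Longrightarrow> Cod C f \<in> Ob C"
    and ident_hom: "A \<in> Ob C \<Longrightarrow> Ident C A \<in> hom C A A"
    and comp_hom: "\<lbrakk>f \<in> hom C A B; g \<in> hom C B D\<rbrakk> \<Longrightarrow> g \<cdot> f \<in> hom C A D"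
    and comp_ident_right: "f \<in> hom C A B \<Longrightarrow> f \<cdot> Ident C A = f"
    and comp_ident_left: "f \<in> hom C A B \<Longrightarrow> Ident C B \<cdot> f = f"
    and comp_assoc:
      "\<lbrakk>f \<in> hom C A B; g \<in> hom C B D; h \<in> hom C D E\<rbrakk> \<Longrightarrow> h \<cdot> g \<cdot> f = h \<cdot> (g \<cdot> f)"

definition inverse_arrows :: "('o, 'a, 'e) cat_scheme \<Rightarrow> 'a \<Rightarrow> 'a \<Rightarrow> bool" where
  "inverse_arrows C f g \<longleftrightarrow>
     f \<in> Ar C \<and> g \<in> hom C (Cod C f) (Dom C f) \<and>
     g \<cdot>\<^bsub>C\<^esub> f = Ident C (Dom C f) \<and> f \<cdot>\<^bsub>C\<^esub> g = Ident C (Cod C f)"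

definition is_iso :: "('o, 'a, 'e) cat_scheme \<Rightarrow> 'a \<Rightarrow> bool" where
  "is_iso C f \<longleftrightarrow> (\<exists>g. inverse_arrows C f g)"

definition inv_ar :: "('o, 'a, 'e) cat_scheme \<Rightarrow> 'a \<Rightarrow> 'a" where
  "inv_ar C f = (THE g. inverse_arrows C f g)"

definition isomorphic :: "('o, 'a, 'e) cat_scheme \<Rightarrow> 'o \<Rightarrow> 'o \<Rightarrow> bool" where
  "isomorphic C A B \<longleftrightarrow> (\<exists>f \<in> hom C A B. is_iso C f)"

record ('o1, 'a1, 'o2, 'a2) fct =
  OM :: "'o1 \<Rightarrow> 'o2"
  AM :: "'a1 \<Rightarrow> 'a2"

text \<open>
  Functors are extensional (undefined outside the domain category), so that equality of
  functors is equality of records.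
\<close>

definition is_functor ::
  "('o1, 'a1, 'e1) cat_scheme \<Rightarrow> ('o2, 'a2, 'e2) cat_scheme \<Rightarrow> ('o1, 'a1, 'o2, 'a2) fct \<Rightarrow> bool"
where
  "is_functor A B F \<longleftrightarrow>
     category A \<and> category B \<and>
     OM F \<in> Ob A \<rightarrow>\<^sub>E Ob B \<and> AM F \<in> Ar A \<rightarrow>\<^sub>E Ar B \<and>
     (\<forall>f \<in> Ar A. Dom B (AM F f) = OM F (Dom A f) \<and> Cod B (AM F f) = OM F (Cod A f)) \<and>
     (\<forall>x \<in> Ob A. AM F (Ident A x) = Ident B (OM F x)) \<and>
     (\<forall>f \<in> Ar A. \<forall>g \<in> Ar A. Cod A f = Dom A g \<longrightarrow> AM F (g \<cdot>\<^bsub>A\<^esub> f) = AM F g \<cdot>\<^bsub>B\<^esub> AM F f)"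

definition fct_comp ::
  "('o1, 'a1, 'e1) cat_scheme \<Rightarrow> ('o2, 'a2, 'o3, 'a3) fct \<Rightarrow> ('o1, 'a1, 'o2, 'a2) fct
     \<Rightarrow> ('o1, 'a1, 'o3, 'a3) fct"
where
  "fct_comp A G F =
     \<lparr>OM = (\<lambda>x \<in> Ob A. OM G (OM F x)), AM = (\<lambda>f \<in> Ar A. AM G (AM F f))\<rparr>"

record ('o1, 'a1, 'o2, 'a2) ntr =
  Src :: "('o1, 'a1, 'o2, 'a2) fct"
  Tgt :: "('o1, 'a1, 'o2, 'a2) fct"
  Cmp :: "'o1 \<Rightarrow> 'a2"

definition is_ntr ::
  "('o1, 'a1, 'e1) cat_scheme \<Rightarrow> ('o2, 'a2, 'e2) cat_scheme \<Rightarrow> ('o1, 'a1, 'o2, 'a2) ntr \<Rightarrow> bool"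
where
  "is_ntr A B t \<longleftrightarrow>
     is_functor A B (Src t) \<and> is_functor A B (Tgt t) \<and>
     Cmp t \<in> extensional (Ob A) \<and>
     (\<forall>x \<in> Ob A. Cmp t x \<in> hom B (OM (Src t) x) (OM (Tgt t) x)) \<and>
     (\<forall>f \<in> Ar A. Cmp t (Cod A f) \<cdot>\<^bsub>B\<^esub> AM (Src t) f = AM (Tgt t) f \<cdot>\<^bsub>B\<^esub> Cmp t (Dom A f))"


section \<open>Symmetric monoidal categories\<close>

record ('o, 'a) smcat = "('o, 'a) cat" +
  tens_ob :: "'o \<Rightarrow> 'o \<Rightarrow> 'o"  (infixl "\<otimes>\<index>" 70)
  tens_ar :: "'a \<Rightarrow> 'a \<Rightarrow> 'a"  (infixl "\<boxtimes>\<index>" 70)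
  unit_ob :: 'o  ("\<one>\<index>")
  assoc :: "'o \<Rightarrow> 'o \<Rightarrow> 'o \<Rightarrow> 'a"
  lunit :: "'o \<Rightarrow> 'a"
  runit :: "'o \<Rightarrow> 'a"
  braid :: "'o \<Rightarrow> 'o \<Rightarrow> 'a"

locale symmetric_monoidal_category = category C
  for C :: "('o, 'a, 'e) smcat_scheme" (structure) +
  assumes unit_ob: "\<one> \<in> Ob C"
    and tens_ob: "\<lbrakk>A \<in> Ob C; B \<in> Ob C\<rbrakk> \<Longrightarrow> A \<otimes> B \<in> Ob C"
    and tens_hom:
      "\<lbrakk>f \<in> hom C A A'; g \<in> hom C B B'\<rbrakk> \<Longrightarrow> f \<boxtimes> g \<in> hom C (A \<otimes> B) (A' \<otimes> B')"
    and tens_ident: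
      "\<lbrakk>A \<in> Ob C; B \<in> Ob C\<rbrakk> \<Longrightarrow> Ident C A \<boxtimes> Ident C B = Ident C (A \<otimes> B)"
    and tens_comp:
      "\<lbrakk>f \<in> hom C A A'; f' \<in> hom C A' A''; g \<in> hom C B B'; g' \<in> hom C B' B''\<rbrakk>
        \<Longrightarrow> (f' \<cdot> f) \<boxtimes> (g' \<cdot> g) = (f' \<boxtimes> g') \<cdot> (f \<boxtimes> g)"
    and assoc_hom:
      "\<lbrakk>A \<in> Ob C; B \<in> Ob C; D \<in> Ob C\<rbrakk> \<Longrightarrow> assoc C A B D \<in> hom C (A \<otimes> B \<otimes> D) (A \<otimes> (B \<otimes> D))"
    and assoc_iso: "\<lbrakk>A \<in> Ob C; B \<in> Ob C; D \<in> Ob C\<rbrakk> \<Longrightarrow> is_iso C (assoc C A B D)"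
    and assoc_nat:
      "\<lbrakk>f \<in> hom C A A'; g \<in> hom C B B'; h \<in> hom C D D'\<rbrakk>
        \<Longrightarrow> assoc C A' B' D' \<cdot> (f \<boxtimes> g \<boxtimes> h) = (f \<boxtimes> (g \<boxtimes> h)) \<cdot> assoc C A B D"
    and lunit_hom: "A \<in> Ob C \<Longrightarrow> lunit C A \<in> hom C (\<one> \<otimes> A) A"
    and lunit_iso: "A \<in> Ob C \<Longrightarrow> is_iso C (lunit C A)"
    and lunit_nat: "f \<in> hom C A A' \<Longrightarrow> lunit C A' \<cdot> (Ident C \<one> \<boxtimes> f) = f \<cdot> lunit C A"
    and runit_hom: "A \<in> Ob C \<Longrightarrow> runit C A \<in> hom C (A \<otimes> \<one>) A"
    and runit_iso: "A \<in> Ob C \<Longrightarrow> is_iso C (runit C A)"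
    and runit_nat: "f \<in> hom C A A' \<Longrightarrow> runit C A' \<cdot> (f \<boxtimes> Ident C \<one>) = f \<cdot> runit C A"
    and braid_hom: "\<lbrakk>A \<in> Ob C; B \<in> Ob C\<rbrakk> \<Longrightarrow> braid C A B \<in> hom C (A \<otimes> B) (B \<otimes> A)"
    and braid_nat:
      "\<lbrakk>f \<in> hom C A A'; g \<in> hom C B B'\<rbrakk>
        \<Longrightarrow> braid C A' B' \<cdot> (f \<boxtimes> g) = (g \<boxtimes> f) \<cdot> braid C A B"
    and pentagon:
      "\<lbrakk>A \<in> Ob C; B \<in> Ob C; D \<in> Ob C; E \<in> Ob C\<rbrakk>
        \<Longrightarrow> (Ident C A \<boxtimes> assoc C B D E) \<cdot> assoc C A (B \<otimes> D) E \<cdot> (assoc C A B D \<boxtimes> Ident C E)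
            = assoc C A B (D \<otimes> E) \<cdot> assoc C (A \<otimes> B) D E"
    and triangle:
      "\<lbrakk>A \<in> Ob C; B \<in> Ob C\<rbrakk>
        \<Longrightarrow> (Ident C A \<boxtimes> lunit C B) \<cdot> assoc C A \<one> B = runit C A \<boxtimes> Ident C B"
    and hexagon:
      "\<lbrakk>A \<in> Ob C; B \<in> Ob C; D \<in> Ob C\<rbrakk>
        \<Longrightarrow> assoc C B D A \<cdot> braid C A (B \<otimes> D) \<cdot> assoc C A B D
            = (Ident C B \<boxtimes> braid C A D) \<cdot> assoc C B A D \<cdot> (braid C A B \<boxtimes> Ident C D)"
    and symmetry:
      "\<lbrakk>A \<in> Ob C; B \<in> Ob C\<rbrakk> \<Longrightarrow> braid C B A \<cdot> braid C A B = Ident C (A \<otimes> B)"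

definition is_dual :: "('o, 'a, 'e) smcat_scheme \<Rightarrow> 'o \<Rightarrow> 'o \<Rightarrow> 'a \<Rightarrow> 'a \<Rightarrow> bool" where
  "is_dual C A D coev ev \<longleftrightarrow>
     D \<in> Ob C \<and> coev \<in> hom C \<one>\<^bsub>C\<^esub> (D \<otimes>\<^bsub>C\<^esub> A) \<and> ev \<in> hom C (A \<otimes>\<^bsub>C\<^esub> D) \<one>\<^bsub>C\<^esub> \<and>
     lunit C A \<cdot>\<^bsub>C\<^esub> (ev \<boxtimes>\<^bsub>C\<^esub> Ident C A) \<cdot>\<^bsub>C\<^esub> inv_ar C (assoc C A D A) \<cdot>\<^bsub>C\<^esub> (Ident C A \<boxtimes>\<^bsub>C\<^esub> coev)
       \<cdot>\<^bsub>C\<^esub> inv_ar C (runit C A) = Ident C A \<and>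
     runit C D \<cdot>\<^bsub>C\<^esub> (Ident C D \<boxtimes>\<^bsub>C\<^esub> ev) \<cdot>\<^bsub>C\<^esub> assoc C D A D \<cdot>\<^bsub>C\<^esub> (coev \<boxtimes>\<^bsub>C\<^esub> Ident C D)
       \<cdot>\<^bsub>C\<^esub> inv_ar C (lunit C D) = Ident C D"

definition has_duals :: "('o, 'a, 'e) smcat_scheme \<Rightarrow> bool" where
  "has_duals C \<longleftrightarrow> (\<forall>A \<in> Ob C. \<exists>D coev ev. is_dual C A D coev ev)"


section \<open>Adjunctions and the pre-Nakayama map\<close>

record ('o1, 'a1, 'o2, 'a2) adj =
  Lft :: "('o1, 'a1, 'o2, 'a2) fct"
  Rgt :: "('o2, 'a2, 'o1, 'a1) fct"
  Unit :: "'o1 \<Rightarrow> 'a1"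
  Counit :: "'o2 \<Rightarrow> 'a2"

definition adjunction ::
  "('o1, 'a1, 'e1) cat_scheme \<Rightarrow> ('o2, 'a2, 'e2) cat_scheme \<Rightarrow> ('o1, 'a1, 'o2, 'a2) adj \<Rightarrow> bool"
where
  "adjunction D E J \<longleftrightarrow>
     is_functor D E (Lft J) \<and> is_functor E D (Rgt J) \<and>
     (\<forall>A \<in> Ob D. Unit J A \<in> hom D A (OM (Rgt J) (OM (Lft J) A))) \<and>
     (\<forall>B \<in> Ob E. Counit J B \<in> hom E (OM (Lft J) (OM (Rgt J) B)) B) \<and>
     (\<forall>f \<in> Ar D. Unit J (Cod D f) \<cdot>\<^bsub>D\<^esub> f = AM (Rgt J) (AM (Lft J) f) \<cdot>\<^bsub>D\<^esub> Unit J (Dom D f)) \<and>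
     (\<forall>g \<in> Ar E. Counit J (Cod E g) \<cdot>\<^bsub>E\<^esub> AM (Lft J) (AM (Rgt J) g) = g \<cdot>\<^bsub>E\<^esub> Counit J (Dom E g)) \<and>
     (\<forall>A \<in> Ob D. Counit J (OM (Lft J) A) \<cdot>\<^bsub>E\<^esub> AM (Lft J) (Unit J A) = Ident E (OM (Lft J) A)) \<and>
     (\<forall>B \<in> Ob E. AM (Rgt J) (Counit J B) \<cdot>\<^bsub>D\<^esub> Unit J (OM (Rgt J) B) = Ident D (OM (Rgt J) B))"

text \<open>
  For a monoidal functor \<open>f\<^sup>*\<close> from \<open>A\<close> to \<open>B\<close>, with coherence isomorphisms
  \<open>\<mu> V W\<close> from \<open>f\<^sup>* V \<otimes> f\<^sup>* W\<close> to \<open>f\<^sup>* (V \<otimes> W)\<close>, the adjunction of \<open>f\<^sub>!\<close> and \<open>f\<^sup>*\<close> is an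
  \<open>adj\<close> from \<open>B\<close> to \<open>A\<close> (written \<open>L\<close>), and that of \<open>f\<^sup>*\<close> and \<open>f\<^sub>*\<close> is an \<open>adj\<close> from \<open>A\<close> to \<open>B\<close>
  (written \<open>R\<close>); thus \<open>f\<^sup>* = Rgt L = Lft R\<close>, \<open>f\<^sub>! = Lft L\<close> and \<open>f\<^sub>* = Rgt R\<close>.
\<close>

definition proj_left ::
  "('oa, 'aa, 'ea) smcat_scheme \<Rightarrow> ('ob, 'ab, 'eb) smcat_scheme \<Rightarrow> ('oa \<Rightarrow> 'oa \<Rightarrow> 'ab)
     \<Rightarrow> ('ob, 'ab, 'oa, 'aa) adj \<Rightarrow> 'ob \<Rightarrow> 'oa \<Rightarrow> 'aa"
where
  "proj_left A B \<mu> L V W =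
     Counit L (OM (Lft L) V \<otimes>\<^bsub>A\<^esub> W)
     \<cdot>\<^bsub>A\<^esub> AM (Lft L) (\<mu> (OM (Lft L) V) W)
     \<cdot>\<^bsub>A\<^esub> AM (Lft L) (Unit L V \<boxtimes>\<^bsub>B\<^esub> Ident B (OM (Rgt L) W))"

definition proj_right ::
  "('oa, 'aa, 'ea) smcat_scheme \<Rightarrow> ('ob, 'ab, 'eb) smcat_scheme \<Rightarrow> ('oa \<Rightarrow> 'oa \<Rightarrow> 'ab)
     \<Rightarrow> ('oa, 'aa, 'ob, 'ab) adj \<Rightarrow> 'oa \<Rightarrow> 'ob \<Rightarrow> 'aa"
where
  "proj_right A B \<mu> R V W =
     AM (Rgt R) (Ident B (OM (Lft R) V) \<boxtimes>\<^bsub>B\<^esub> Counit R W)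
     \<cdot>\<^bsub>A\<^esub> AM (Rgt R) (inv_ar B (\<mu> V (OM (Rgt R) W)))
     \<cdot>\<^bsub>A\<^esub> Unit R (V \<otimes>\<^bsub>A\<^esub> OM (Rgt R) W)"

definition pre_nakayama ::
  "('oa, 'aa, 'ea) smcat_scheme \<Rightarrow> ('ob, 'ab, 'eb) smcat_scheme \<Rightarrow> ('oa \<Rightarrow> 'oa \<Rightarrow> 'ab)
     \<Rightarrow> ('ob, 'ab, 'oa, 'aa) adj \<Rightarrow> ('oa, 'aa, 'ob, 'ab) adj \<Rightarrow> 'ob \<Rightarrow> 'aa"
where
  "pre_nakayama A B \<mu> L R V =
     AM (Lft L) (runit B V)
     \<cdot>\<^bsub>A\<^esub> AM (Lft L) (Ident B V \<boxtimes>\<^bsub>B\<^esub> Counit R \<one>\<^bsub>B\<^esub>)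
     \<cdot>\<^bsub>A\<^esub> inv_ar A (proj_left A B \<mu> L V (OM (Rgt R) \<one>\<^bsub>B\<^esub>))
     \<cdot>\<^bsub>A\<^esub> inv_ar A (proj_right A B \<mu> R (OM (Lft L) V) \<one>\<^bsub>B\<^esub>)
     \<cdot>\<^bsub>A\<^esub> AM (Rgt R) (Unit L V \<boxtimes>\<^bsub>B\<^esub> Ident B \<one>\<^bsub>B\<^esub>)
     \<cdot>\<^bsub>A\<^esub> AM (Rgt R) (inv_ar B (runit B V))"

definition adj_comp ::
  "('o1, 'a1, 'e1) cat_scheme \<Rightarrow> ('o3, 'a3, 'e3) cat_scheme \<Rightarrow> ('o2, 'a2, 'o3, 'a3) adj
     \<Rightarrow> ('o1, 'a1, 'o2, 'a2) adj \<Rightarrow> ('o1, 'a1, 'o3, 'a3) adj"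
where
  "adj_comp D H K J =
     \<lparr>Lft = fct_comp D (Lft K) (Lft J),
      Rgt = fct_comp H (Rgt J) (Rgt K),
      Unit = (\<lambda>A. AM (Rgt J) (Unit K (OM (Lft J) A)) \<cdot>\<^bsub>D\<^esub> Unit J A),
      Counit = (\<lambda>B. Counit K B \<cdot>\<^bsub>H\<^esub> AM (Lft K) (Counit J (OM (Rgt K) B)))\<rparr>"

text \<open>
  The canonical isomorphisms between two left (right) adjoints of one functor: here
  \<open>Rgt J = Rgt J'\<close> (respectively \<open>Lft J = Lft J'\<close>).
\<close>

definition left_compare ::
  "('o2, 'a2, 'e2) cat_scheme \<Rightarrow> ('o1, 'a1, 'o2, 'a2) adj \<Rightarrow> ('o1, 'a1, 'o2, 'a2) adj \<Rightarrow> 'o1 \<Rightarrow> 'a2"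
where
  "left_compare E J J' A = Counit J (OM (Lft J') A) \<cdot>\<^bsub>E\<^esub> AM (Lft J) (Unit J' A)"

definition right_compare ::
  "('o1, 'a1, 'e1) cat_scheme \<Rightarrow> ('o1, 'a1, 'o2, 'a2) adj \<Rightarrow> ('o1, 'a1, 'o2, 'a2) adj \<Rightarrow> 'o2 \<Rightarrow> 'a1"
where
  "right_compare D J J' B = AM (Rgt J') (Counit J B) \<cdot>\<^bsub>D\<^esub> Unit J' (OM (Rgt J) B)"


section \<open>Groupoids, functor categories, colimits\<close>

locale groupoid = category G for G :: "('o, 'a, 'e) cat_scheme" (structure) +
  assumes all_iso: "f \<in> Ar G \<Longrightarrow> is_iso G f"

definition ess_finite_groupoid :: "('o, 'a, 'e) cat_scheme \<Rightarrow> bool" where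
  "ess_finite_groupoid G \<longleftrightarrow>
     groupoid G \<and>
     finite (Ob G // {(x, y). x \<in> Ob G \<and> y \<in> Ob G \<and> isomorphic G x y}) \<and>
     (\<forall>x \<in> Ob G. \<forall>y \<in> Ob G. finite (hom G x y))"

definition point_cat :: "(unit, unit) cat" where
  "point_cat = \<lparr>Ob = {()}, Ar = {()}, Dom = (\<lambda>_. ()), Cod = (\<lambda>_. ()),
                Ident = (\<lambda>_. ()), Comp = (\<lambda>_ _. ())\<rparr>"

definition full_sub :: "('o, 'a, 'e) cat_scheme \<Rightarrow> 'o set \<Rightarrow> ('o, 'a, 'e) cat_scheme" where
  "full_sub G S = G\<lparr>Ob := S, Ar := {f \<in> Ar G. Dom G f \<in> S \<and> Cod G f \<in> S}\<rparr>"

definition component :: "('o, 'a, 'e) cat_scheme \<Rightarrow> 'o \<Rightarrow> ('o, 'a, 'e) cat_scheme" where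
  "component G x = full_sub G {y \<in> Ob G. isomorphic G x y}"

definition point_map :: "('o, 'a, 'e) cat_scheme \<Rightarrow> 'o \<Rightarrow> (unit, unit, 'o, 'a) fct" where
  "point_map G x = \<lparr>OM = (\<lambda>_. x), AM = (\<lambda>_. Ident G x)\<rparr>"

text \<open>The homotopy fibre of \<open>f\<close> at \<open>y\<close>; an arrow is recorded together with its source and target.\<close>

definition hfibre ::
  "('x, 'm, 'e1) cat_scheme \<Rightarrow> ('y, 'n, 'e2) cat_scheme \<Rightarrow> ('x, 'm, 'y, 'n) fct \<Rightarrow> 'y
     \<Rightarrow> ('x \<times> 'n, ('x \<times> 'n) \<times> 'm \<times> ('x \<times> 'n)) cat"
where
  "hfibre X Y f y =
     (let P = {(x, \<phi>). x \<in> Ob X \<and> \<phi> \<in> hom Y (OM f x) y} in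
     \<lparr>Ob = P,
      Ar = {(a, m, b). a \<in> P \<and> b \<in> P \<and> m \<in> hom X (fst a) (fst b) \<and> snd b \<cdot>\<^bsub>Y\<^esub> AM f m = snd a},
      Dom = (\<lambda>(a, m, b). a),
      Cod = (\<lambda>(a, m, b). b),
      Ident = (\<lambda>a. (a, Ident X (fst a), a)),
      Comp = (\<lambda>(b', n, c) (a, m, b). (a, n \<cdot>\<^bsub>X\<^esub> m, c))\<rparr>)"

definition hfibre_proj ::
  "('x, 'm, 'e1) cat_scheme \<Rightarrow> ('y, 'n, 'e2) cat_scheme \<Rightarrow> ('x, 'm, 'y, 'n) fct \<Rightarrow> 'y
     \<Rightarrow> ('x \<times> 'n, ('x \<times> 'n) \<times> 'm \<times> ('x \<times> 'n), 'x, 'm) fct"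
where
  "hfibre_proj X Y f y =
     \<lparr>OM = (\<lambda>a \<in> Ob (hfibre X Y f y). fst a),
      AM = (\<lambda>t \<in> Ar (hfibre X Y f y). fst (snd t))\<rparr>"

definition functor_cat ::
  "('x, 'm, 'e) cat_scheme \<Rightarrow> ('o, 'a, 'e2) smcat_scheme
     \<Rightarrow> (('x, 'm, 'o, 'a) fct, ('x, 'm, 'o, 'a) ntr) smcat"
where
  "functor_cat X C =
     (let tens = (\<lambda>F G. \<lparr>OM = (\<lambda>x \<in> Ob X. OM F x \<otimes>\<^bsub>C\<^esub> OM G x), AM = (\<lambda>m \<in> Ar X. AM F m \<boxtimes>\<^bsub>C\<^esub> AM G m)\<rparr>);
          one = \<lparr>OM = (\<lambda>x \<in> Ob X. \<one>\<^bsub>C\<^esub>), AM = (\<lambda>m \<in> Ar X. Ident C \<one>\<^bsub>C\<^esub>)\<rparr>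
      in
     \<lparr>Ob = {F. is_functor X C F},
      Ar = {t. is_ntr X C t},
      Dom = Src,
      Cod = Tgt,
      Ident = (\<lambda>F. \<lparr>Src = F, Tgt = F, Cmp = (\<lambda>x \<in> Ob X. Ident C (OM F x))\<rparr>),
      Comp = (\<lambda>t s. \<lparr>Src = Src s, Tgt = Tgt t, Cmp = (\<lambda>x \<in> Ob X. Cmp t x \<cdot>\<^bsub>C\<^esub> Cmp s x)\<rparr>),
      tens_ob = tens,
      tens_ar = (\<lambda>s t. \<lparr>Src = tens (Src s) (Src t), Tgt = tens (Tgt s) (Tgt t),
                        Cmp = (\<lambda>x \<in> Ob X. Cmp s x \<boxtimes>\<^bsub>C\<^esub> Cmp t x)\<rparr>),
      unit_ob = one,
      assoc = (\<lambda>F G H. \<lparr>Src = tens (tens F G) H, Tgt = tens F (tens G H),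
                        Cmp = (\<lambda>x \<in> Ob X. assoc C (OM F x) (OM G x) (OM H x))\<rparr>),
      lunit = (\<lambda>F. \<lparr>Src = tens one F, Tgt = F, Cmp = (\<lambda>x \<in> Ob X. lunit C (OM F x))\<rparr>),
      runit = (\<lambda>F. \<lparr>Src = tens F one, Tgt = F, Cmp = (\<lambda>x \<in> Ob X. runit C (OM F x))\<rparr>),
      braid = (\<lambda>F G. \<lparr>Src = tens F G, Tgt = tens G F,
                      Cmp = (\<lambda>x \<in> Ob X. braid C (OM F x) (OM G x))\<rparr>)\<rparr>)"

definition is_cocone ::
  "('o, 'a, 'e) cat_scheme \<Rightarrow> ('j, 'm, 'e2) cat_scheme \<Rightarrow> ('j, 'm, 'o, 'a) fct
     \<Rightarrow> 'o \<Rightarrow> ('j \<Rightarrow> 'a) \<Rightarrow> bool"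
where
  "is_cocone C J F v \<kappa> \<longleftrightarrow>
     v \<in> Ob C \<and> (\<forall>j \<in> Ob J. \<kappa> j \<in> hom C (OM F j) v) \<and>
     (\<forall>m \<in> Ar J. \<kappa> (Cod J m) \<cdot>\<^bsub>C\<^esub> AM F m = \<kappa> (Dom J m))"

definition is_colimit ::
  "('o, 'a, 'e) cat_scheme \<Rightarrow> ('j, 'm, 'e2) cat_scheme \<Rightarrow> ('j, 'm, 'o, 'a) fct
     \<Rightarrow> 'o \<Rightarrow> ('j \<Rightarrow> 'a) \<Rightarrow> bool"
where
  "is_colimit C J F v \<kappa> \<longleftrightarrow>
     is_cocone C J F v \<kappa> \<and>
     (\<forall>w \<tau>. is_cocone C J F w \<tau> \<longrightarrow>
        (\<exists>!u. u \<in> hom C v w \<and> (\<forall>j \<in> Ob J. u \<cdot>\<^bsub>C\<^esub> \<kappa> j = \<tau> j)))"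

text \<open>
  The type \<open>'u\<close> plays the role of a universe: the groupoids under consideration are those whose
  objects and arrows are elements of \<open>'u\<close>. As \<open>'u\<close> is infinite, every essentially finite
  groupoid is equivalent to one of these, and (up to isomorphism) they are closed under
  homotopy fibres.
\<close>

definition has_ess_finite_colimits ::
  "'u::infinite itself \<Rightarrow> ('o, 'a, 'e) cat_scheme \<Rightarrow> bool"
where
  "has_ess_finite_colimits U C \<longleftrightarrow>
     (\<forall>(J :: ('u, 'u) cat) F. ess_finite_groupoid J \<and> is_functor J C F \<longrightarrow>
        (\<exists>v \<kappa>. is_colimit C J F v \<kappa>))"


section \<open>Kan extensions\<close>

definition restr ::
  "('o, 'a, 'e) smcat_scheme \<Rightarrow> ('x, 'm, 'e1) cat_scheme \<Rightarrow> ('y, 'n, 'e2) cat_scheme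
     \<Rightarrow> ('x, 'm, 'y, 'n) fct
     \<Rightarrow> (('y, 'n, 'o, 'a) fct, ('y, 'n, 'o, 'a) ntr, ('x, 'm, 'o, 'a) fct, ('x, 'm, 'o, 'a) ntr) fct"
where
  "restr C X Y f =
     \<lparr>OM = (\<lambda>V \<in> Ob (functor_cat Y C). fct_comp X V f),
      AM = (\<lambda>t \<in> Ar (functor_cat Y C).
              \<lparr>Src = fct_comp X (Src t) f, Tgt = fct_comp X (Tgt t) f,
               Cmp = (\<lambda>x \<in> Ob X. Cmp t (OM f x))\<rparr>)\<rparr>"

text \<open>
  As tensor products are pointwise and functors are extensional, \<open>restr C X Y f\<close> preserves
  tensor products and the unit on the nose, so its coherence isomorphisms are identities.
\<close>

definition restr_mu ::
  "('o, 'a, 'e) smcat_scheme \<Rightarrow> ('x, 'm, 'e1) cat_scheme \<Rightarrow> ('y, 'n, 'e2) cat_scheme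
     \<Rightarrow> ('x, 'm, 'y, 'n) fct \<Rightarrow> ('y, 'n, 'o, 'a) fct \<Rightarrow> ('y, 'n, 'o, 'a) fct \<Rightarrow> ('x, 'm, 'o, 'a) ntr"
where
  "restr_mu C X Y f V W =
     Ident (functor_cat X C) (OM (restr C X Y f) (V \<otimes>\<^bsub>functor_cat Y C\<^esub> W))"

text \<open>Chosen left and right adjoints \<open>f\<^sub>!\<close>, \<open>f\<^sub>*\<close> of restriction, with their units and counits.\<close>

definition left_kan ::
  "('o, 'a, 'e) smcat_scheme \<Rightarrow> ('x, 'm, 'e1) cat_scheme \<Rightarrow> ('y, 'n, 'e2) cat_scheme
     \<Rightarrow> ('x, 'm, 'y, 'n) fct
     \<Rightarrow> (('x, 'm, 'o, 'a) fct, ('x, 'm, 'o, 'a) ntr, ('y, 'n, 'o, 'a) fct, ('y, 'n, 'o, 'a) ntr) adj"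
where
  "left_kan C X Y f =
     (SOME J. adjunction (functor_cat X C) (functor_cat Y C) J \<and> Rgt J = restr C X Y f)"

definition right_kan ::
  "('o, 'a, 'e) smcat_scheme \<Rightarrow> ('x, 'm, 'e1) cat_scheme \<Rightarrow> ('y, 'n, 'e2) cat_scheme
     \<Rightarrow> ('x, 'm, 'y, 'n) fct
     \<Rightarrow> (('y, 'n, 'o, 'a) fct, ('y, 'n, 'o, 'a) ntr, ('x, 'm, 'o, 'a) fct, ('x, 'm, 'o, 'a) ntr) adj"
where
  "right_kan C X Y f =
     (SOME J. adjunction (functor_cat Y C) (functor_cat X C) J \<and> Lft J = restr C X Y f)"

text \<open>
  The colimit cocone exhibiting \<open>f\<^sub>! V (y)\<close> as the colimit of \<open>p\<^sup>* V\<close> over the homotopy fibre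
  at \<open>y\<close>: at \<open>(x, \<phi>)\<close> it is \<open>V x \<rightarrow> f\<^sub>! V (f x) \<rightarrow> f\<^sub>! V (y)\<close>, the unit followed by \<open>f\<^sub>! V (\<phi>)\<close>.
\<close>

definition left_kan_cocone ::
  "('o, 'a, 'e) smcat_scheme \<Rightarrow> ('x, 'm, 'e1) cat_scheme \<Rightarrow> ('y, 'n, 'e2) cat_scheme
     \<Rightarrow> ('x, 'm, 'y, 'n) fct \<Rightarrow> ('x, 'm, 'o, 'a) fct \<Rightarrow> 'x \<times> 'n \<Rightarrow> 'a"
where
  "left_kan_cocone C X Y f V =
     (\<lambda>(x, \<phi>). AM (OM (Lft (left_kan C X Y f)) V) \<phi> \<cdot>\<^bsub>C\<^esub> Cmp (Unit (left_kan C X Y f) V) x)"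


section \<open>The Nakayama map\<close>

definition gamma ::
  "('o, 'a, 'e) smcat_scheme \<Rightarrow> ('x, 'm, 'e1) cat_scheme \<Rightarrow> ('y, 'n, 'e2) cat_scheme
     \<Rightarrow> ('x, 'm, 'y, 'n) fct \<Rightarrow> ('x, 'm, 'o, 'a) fct \<Rightarrow> ('y, 'n, 'o, 'a) ntr"
where
  "gamma C X Y f =
     pre_nakayama (functor_cat Y C) (functor_cat X C) (restr_mu C X Y f) (left_kan C X Y f) (right_kan C X Y f)"

text \<open>For connected \<open>P\<close>, the endomorphism of the unit of \<open>C\<^sup>P\<close> given by the point \<open>e\<close> of \<open>P\<close>.\<close>

definition delta_connected ::
  "('o, 'a, 'e) smcat_scheme \<Rightarrow> ('x, 'm, 'e1) cat_scheme \<Rightarrow> 'x \<Rightarrow> ('x, 'm, 'o, 'a) ntr"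
where
  "delta_connected C P e =
     (let \<iota> = point_map P e; one = \<one>\<^bsub>functor_cat P C\<^esub> in
       Counit (left_kan C point_cat P \<iota>) one
       \<cdot>\<^bsub>functor_cat P C\<^esub> gamma C point_cat P \<iota> (OM (restr C point_cat P \<iota>) one)
       \<cdot>\<^bsub>functor_cat P C\<^esub> Unit (right_kan C point_cat P \<iota>) one)"

text \<open>The chosen point depends only on the component, not on the object \<open>c\<close> in it.\<close>

definition delta_unit ::
  "('o, 'a, 'e) smcat_scheme \<Rightarrow> ('x, 'm, 'e1) cat_scheme \<Rightarrow> ('x, 'm, 'o, 'a) ntr"
where
  "delta_unit C P =
     \<lparr>Src = \<one>\<^bsub>functor_cat P C\<^esub>, Tgt = \<one>\<^bsub>functor_cat P C\<^esub>,
      Cmp = (\<lambda>c \<in> Ob P. let Q = component P c in Cmp (delta_connected C Q (SOME e. e \<in> Ob Q)) c)\<rparr>"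

definition delta ::
  "('o, 'a, 'e) smcat_scheme \<Rightarrow> ('x, 'm, 'e1) cat_scheme \<Rightarrow> ('y, 'n, 'e2) cat_scheme
     \<Rightarrow> ('x, 'm, 'y, 'n) fct \<Rightarrow> 'y
     \<Rightarrow> ('x \<times> 'n, ('x \<times> 'n) \<times> 'm \<times> ('x \<times> 'n), 'o, 'a) ntr"
where
  "delta C X Y f y = delta_unit C (hfibre X Y f y)"

definition unit_endo_act :: "('o, 'a, 'e) smcat_scheme \<Rightarrow> 'a \<Rightarrow> 'o \<Rightarrow> 'a" where
  "unit_endo_act C d A = lunit C A \<cdot>\<^bsub>C\<^esub> (d \<boxtimes>\<^bsub>C\<^esub> Ident C A) \<cdot>\<^bsub>C\<^esub> inv_ar C (lunit C A)"

text \<open>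
  The map \<open>f\<^sub>! \<delta>\<inverse>\<close>, which at \<open>y\<close> is the endomorphism of the colimit \<open>f\<^sub>! V (y)\<close> induced by the
  inverse of the endomorphism \<open>\<delta>\<close> of \<open>p\<^sup>* V\<close>.
\<close>

definition left_kan_delta_inv ::
  "('o, 'a, 'e) smcat_scheme \<Rightarrow> ('x, 'm, 'e1) cat_scheme \<Rightarrow> ('y, 'n, 'e2) cat_scheme
     \<Rightarrow> ('x, 'm, 'y, 'n) fct \<Rightarrow> ('x, 'm, 'o, 'a) fct \<Rightarrow> ('y, 'n, 'o, 'a) ntr"
where
  "left_kan_delta_inv C X Y f V =
     (let fV = OM (Lft (left_kan C X Y f)) V; \<kappa> = left_kan_cocone C X Y f V in
     \<lparr>Src = fV, Tgt = fV,
      Cmp = (\<lambda>y \<in> Ob Y.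
        let P = hfibre X Y f y;
            \<delta>_inv = inv_ar (functor_cat P C)
              (unit_endo_act (functor_cat P C) (delta C X Y f y) (fct_comp P V (hfibre_proj X Y f y)))
        in THE u. u \<in> hom C (OM fV y) (OM fV y) \<and>
                  (\<forall>j \<in> Ob P. u \<cdot>\<^bsub>C\<^esub> \<kappa> j = \<kappa> j \<cdot>\<^bsub>C\<^esub> Cmp \<delta>_inv j))\<rparr>)"

definition nakayama ::
  "('o, 'a, 'e) smcat_scheme \<Rightarrow> ('x, 'm, 'e1) cat_scheme \<Rightarrow> ('y, 'n, 'e2) cat_scheme
     \<Rightarrow> ('x, 'm, 'y, 'n) fct \<Rightarrow> ('x, 'm, 'o, 'a) fct \<Rightarrow> ('y, 'n, 'o, 'a) ntr"
where
  "nakayama C X Y f V = left_kan_delta_inv C X Y f V \<cdot>\<^bsub>functor_cat Y C\<^esub> gamma C X Y f V"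

text \<open>
  Compatibility of Nakayama maps with composition. The canonical identifications of \<open>(g f)\<^sub>!\<close> with
  \<open>g\<^sub>! f\<^sub>!\<close> and of \<open>(g f)\<^sub>*\<close> with \<open>g\<^sub>* f\<^sub>*\<close> are the comparisons of adjoints of
  \<open>(g f)\<^sup>* = f\<^sup>* g\<^sup>*\<close>.
\<close>

definition nakayama_compatible ::
  "('o, 'a, 'e) smcat_scheme \<Rightarrow> ('x, 'm, 'e1) cat_scheme \<Rightarrow> ('y, 'n, 'e2) cat_scheme
     \<Rightarrow> ('z, 'k, 'e3) cat_scheme \<Rightarrow> ('x, 'm, 'y, 'n) fct \<Rightarrow> ('y, 'n, 'z, 'k) fct \<Rightarrow> bool"
where
  "nakayama_compatible C X Y Z f g \<longleftrightarrow>
     (let CX = functor_cat X C; CZ = functor_cat Z C;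
          gf = fct_comp X g f;
          \<theta>_left = left_compare CZ (left_kan C X Z gf) (adj_comp CX CZ (left_kan C Y Z g) (left_kan C X Y f));
          \<theta>_right = right_compare CZ (right_kan C X Z gf) (adj_comp CZ CX (right_kan C X Y f) (right_kan C Y Z g))
      in \<forall>V \<in> Ob CX.
        \<theta>_left V \<cdot>\<^bsub>CZ\<^esub> nakayama C X Z gf V
          = AM (Lft (left_kan C Y Z g)) (nakayama C X Y f V)
            \<cdot>\<^bsub>CZ\<^esub> nakayama C Y Z g (OM (Rgt (right_kan C X Y f)) V) \<cdot>\<^bsub>CZ\<^esub> \<theta>_right V \<and>
        \<theta>_left V \<cdot>\<^bsub>CZ\<^esub> nakayama C X Z gf V
          = nakayama C Y Z g (OM (Lft (left_kan C X Y f)) V)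
            \<cdot>\<^bsub>CZ\<^esub> AM (Rgt (right_kan C Y Z g)) (nakayama C X Y f V) \<cdot>\<^bsub>CZ\<^esub> \<theta>_right V)"

definition nakayama_category ::
  "'u::infinite itself \<Rightarrow> ('o, 'a, 'e) smcat_scheme \<Rightarrow> bool"
where
  "nakayama_category U C \<longleftrightarrow>
     has_ess_finite_colimits U C \<and>
     symmetric_monoidal_category C \<and>
     has_duals C \<and>
     (\<forall>(X :: ('u, 'u) cat) (Y :: ('u, 'u) cat) f.
        ess_finite_groupoid X \<and> ess_finite_groupoid Y \<and> is_functor X Y f \<longrightarrow>
        (\<forall>y \<in> Ob Y. is_iso (functor_cat (hfibre X Y f y) C) (delta C X Y f y))) \<and>
     (\<forall>(X :: ('u, 'u) cat) (Y :: ('u, 'u) cat) (Z :: ('u, 'u) cat) f g.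
        ess_finite_groupoid X \<and> ess_finite_groupoid Y \<and> ess_finite_groupoid Z \<and>
        is_functor X Y f \<and> is_functor Y Z g \<longrightarrow>
        nakayama_compatible C X Y Z f g)"

end

theory Submission
  imports Defs
begin

text \<open>
  At an object \<open>y\<close> of \<open>Y\<close> the pre-Nakayama map goes from the limit to the colimit of one functor on the
  homotopy fibre. The proof writes it as a finite sum over the connected components of the fibre and
  recognizes it as the inverse of a norm map, up to the orders of automorphism groups; these
  orders are invertible because \<open>\<delta>\<close> is.

  Finite sums of arrows come from duality. Tensoring with an object of \<open>C\<close> is both a left and a right
  adjoint, so it preserves colimits and limits (\<open>ltens_colimit\<close>, \<open>rtens_limit\<close>). An initial object
  tensored with its dual is then a zero object (\<open>zero_object_ex\<close>), and a finite copower of the unit is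
  also a power of the unit (\<open>copower_limit\<close>). Hence finite families of parallel arrows have a sum
  \<open>Sm\<close>; in particular \<open>mult S A\<close> is multiplication by the cardinality of \<open>S\<close> on \<open>A\<close>.

  Let \<open>V\<close> be a functor on an essentially finite groupoid \<open>P\<close>, with colimit cocone
  \<open>\<kappa> c : V c \<rightarrow> M\<close>. The sums of \<open>V m\<close> over the arrows \<open>m\<close> from \<open>c\<close> to \<open>d\<close> induce norm maps
  \<open>M \<rightarrow> V d\<close>. If the orders of the automorphism groups of \<open>P\<close> are invertible, averaging shows that
  the norm maps make \<open>M\<close> a limit of \<open>V\<close> (\<open>norm_limit\<close>). Applied to the homotopy fibres
  of \<open>f\<close>, this gives both Kan extensions along \<open>f\<close>, pointwise (\<open>lk_lan\<close>, \<open>rk_ran\<close>).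

  The projection maps compare a tensor product with a (co)limit to the (co)limit of the tensor
  products. Unwinding the definition of \<open>\<gamma>\<close> along these comparisons gives, at \<open>y\<close>, the sum of
  \<open>\<kappa> c \<cdot> \<pi> c\<close> over representatives \<open>c\<close> of the components, where \<open>\<pi>\<close> is the limit cone (\<open>gamma\<close>): the
  limit of the constant diagram on the unit is a product of units indexed by the components, and \<open>\<gamma>\<close>
  inserts the corresponding sum of coordinates (\<open>component_sum_eq\<close>). Composed with the norm from the
  colimit to the limit, this sum is multiplication by the order of the automorphism group of \<open>d\<close> on the
  image of \<open>\<kappa> d\<close>, hence \<open>\<gamma>\<close> is invertible (\<open>component_sum_iso\<close>).

  It remains to see that the orders are invertible. The homotopy fibres of the inclusion of a point
  \<open>e\<close> into a connected groupoid are the discrete sets of arrows from \<open>e\<close> to \<open>c\<close>, with trivial automorphism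
  groups, so the formula for \<open>\<gamma>\<close> holds for this inclusion in any case. It shows that \<open>\<delta>\<close> at \<open>c\<close> is the number
  of arrows from \<open>e\<close> to \<open>c\<close>, which is the order of the automorphism group of \<open>c\<close>
  (\<open>delta_connected\<close>, \<open>delta_unit\<close>). So invertibility of \<open>\<delta>\<close> is invertibility of these orders; it also
  makes \<open>f\<^sub>! \<delta>\<inverse>\<close> an automorphism of \<open>f\<^sub>! V\<close> (\<open>left_kan_delta_inv\<close>), and \<open>\<nu>\<close> is the composite of \<open>\<gamma>\<close>
  with it.
\<close>

section \<open>Arrows, isomorphisms and inverses\<close>

context category
begin

lemma hom_iff: "f \<in> hom C A B \<longleftrightarrow> f \<in> Ar C \<and> Dom C f = A \<and> Cod C f = B"
  by (simp add: hom_def)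

text \<open>Typing side conditions are discharged by rewriting. A composite is checked through the single
  predicate \<open>into\<close>, because checking arrow and codomain separately at every composition takes time
  exponential in the length of a chain.\<close>

definition into :: "'a \<Rightarrow> 'o \<Rightarrow> bool" where
  "into f B \<longleftrightarrow> f \<in> Ar C \<and> Cod C f = B"

lemma into_ar: "f \<in> Ar C \<Longrightarrow> into f B \<longleftrightarrow> Cod C f = B"
  by (simp add: into_def)

lemma homD:
  assumes "f \<in> hom C A B"
  shows "f \<in> Ar C" "Dom C f = A" "Cod C f = B" "into f B' \<longleftrightarrow> B = B'"
  using assms by (auto simp: hom_def into_def)

lemma hom_ob:
  assumes "f \<in> hom C A B"
  shows "A \<in> Ob C" "B \<in> Ob C"
  using assms dom_ob cod_ob by (auto simp: hom_def)

lemma ar_hom: "f \<in> Ar C \<Longrightarrow> f \<in> hom C (Dom C f) (Cod C f)"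
  by (simp add: hom_def)

lemma comp_ar [simp]:
  assumes "into f (Dom C g)" "g \<in> Ar C"
  shows "g \<cdot> f \<in> Ar C" "Dom C (g \<cdot> f) = Dom C f" "Cod C (g \<cdot> f) = Cod C g"
    "into (g \<cdot> f) B \<longleftrightarrow> Cod C g = B"
  using comp_hom[of f "Dom C f" "Cod C f" g "Cod C g"] assms by (auto simp: hom_def into_def)

lemma assoc_ar [simp]:
  assumes "into f (Dom C g)" "into g (Dom C h)" "h \<in> Ar C"
  shows "h \<cdot> g \<cdot> f = h \<cdot> (g \<cdot> f)"
  using comp_assoc[of f "Dom C f" "Cod C f" g "Cod C g" h "Cod C h"] assms
  by (auto simp: hom_def into_def)

lemma ident_ar [simp]:
  assumes "A \<in> Ob C"
  shows "Ident C A \<in> Ar C" "Dom C (Ident C A) = A" "Cod C (Ident C A) = A"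
    "into (Ident C A) B \<longleftrightarrow> A = B"
  using ident_hom[OF assms] by (auto simp: hom_def into_def)

lemma dom_cod_ob [simp]:
  assumes "f \<in> Ar C"
  shows "Dom C f \<in> Ob C" "Cod C f \<in> Ob C"
  using assms dom_ob cod_ob by auto

lemma comp_ident_ar [simp]:
  shows "f \<in> Ar C \<Longrightarrow> Dom C f = A \<Longrightarrow> f \<cdot> Ident C A = f"
    and "into f A \<Longrightarrow> Ident C A \<cdot> f = f"
  using comp_ident_right[of f "Dom C f" "Cod C f"] comp_ident_left[of f "Dom C f" "Cod C f"]
  by (auto simp: hom_def into_def)

text \<open>Composites are kept associated to the right; this turns an equation between arrows into one that
  rewrites inside a longer composite.\<close>

lemma reassoc:
  assumes "g \<cdot> f = k" "g \<in> Ar C" "into f (Dom C g)" "into h (Dom C f)"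
  shows "g \<cdot> (f \<cdot> h) = k \<cdot> h"
  using assms assoc_ar[of h f g] by (simp add: into_def)

lemma inverse_arrows_unique:
  assumes "inverse_arrows C f g" "inverse_arrows C f h"
  shows "g = h"
proof -
  note * = assms[unfolded inverse_arrows_def hom_iff]
  have [simp]: "into f (Cod C f)" "into g (Dom C f)" "into h (Dom C f)" using * by (auto simp: into_def)
  have "g = g \<cdot> (f \<cdot> h)" using * by simp
  also have "\<dots> = (g \<cdot> f) \<cdot> h" by (subst assoc_ar) (use * in simp_all)
  also have "\<dots> = h" using * by simp
  finally show ?thesis .
qed

lemma inv_ar_eq: "inverse_arrows C f g \<Longrightarrow> inv_ar C f = g"
  unfolding inv_ar_def using inverse_arrows_unique by blast

lemma inv_ar_inverse: "is_iso C f \<Longrightarrow> inverse_arrows C f (inv_ar C f)"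
  unfolding is_iso_def using inv_ar_eq by auto

lemma is_iso_ar: "is_iso C f \<Longrightarrow> f \<in> Ar C"
  by (auto simp: is_iso_def inverse_arrows_def)

lemma inv_arD [simp]:
  assumes "is_iso C f"
  shows "inv_ar C f \<in> Ar C" "Dom C (inv_ar C f) = Cod C f" "Cod C (inv_ar C f) = Dom C f"
    "into (inv_ar C f) B \<longleftrightarrow> Dom C f = B"
    "inv_ar C f \<cdot> f = Ident C (Dom C f)" "f \<cdot> inv_ar C f = Ident C (Cod C f)"
  using inv_ar_inverse[OF assms] by (auto simp: inverse_arrows_def hom_iff into_def)

lemma inv_ar_cancel [simp]:
  assumes "is_iso C f"
  shows "into h (Dom C f) \<Longrightarrow> inv_ar C f \<cdot> (f \<cdot> h) = h"
    and "into h (Cod C f) \<Longrightarrow> f \<cdot> (inv_ar C f \<cdot> h) = h"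
  using assms is_iso_ar[OF assms] by (simp_all add: into_ar flip: assoc_ar)

lemma inverse_arrows_sym: "inverse_arrows C f g \<Longrightarrow> inverse_arrows C g f"
  by (auto simp: inverse_arrows_def hom_iff)

lemma is_isoI:
  assumes "f \<in> hom C A B" "g \<in> hom C B A" "g \<cdot> f = Ident C A" "f \<cdot> g = Ident C B"
  shows "is_iso C f" "inv_ar C f = g"
proof -
  have "inverse_arrows C f g" using assms by (auto simp: inverse_arrows_def hom_iff)
  then show "is_iso C f" "inv_ar C f = g" using inv_ar_eq by (auto simp: is_iso_def)
qed

lemma is_iso_inv [simp]: "is_iso C f \<Longrightarrow> is_iso C (inv_ar C f)"
  using inverse_arrows_sym inv_ar_inverse is_iso_def by metis

lemma is_iso_ident [simp]: "A \<in> Ob C \<Longrightarrow> is_iso C (Ident C A)"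
  by (rule is_isoI(1)[of _ A A "Ident C A"]) (simp_all add: hom_iff)

lemma is_iso_comp:
  assumes f: "is_iso C f" and g: "is_iso C g" and d: "Cod C f = Dom C g"
  shows "is_iso C (g \<cdot> f)"
proof -
  note [simp] = is_iso_ar[OF f] is_iso_ar[OF g]
  have [simp]: "into f B \<longleftrightarrow> Dom C g = B" "into g B \<longleftrightarrow> Cod C g = B" for B
    using d by (auto simp: into_ar)
  show ?thesis
    by (rule is_isoI(1)[of _ "Dom C f" "Cod C g" "inv_ar C f \<cdot> inv_ar C g"])
      (use assms in \<open>simp_all add: hom_iff\<close>)
qed

lemma iso_epi:
  assumes "f \<cdot> e = g \<cdot> e" "is_iso C e" "f \<in> Ar C" "g \<in> Ar C" "Dom C f = Cod C e" "Dom C g = Cod C e"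
  shows "f = g"
proof -
  note [simp] = is_iso_ar[OF assms(2)] into_ar[OF is_iso_ar[OF assms(2)]]
  have "(f \<cdot> e) \<cdot> inv_ar C e = (g \<cdot> e) \<cdot> inv_ar C e" using assms by simp
  then show ?thesis using assms(2-) by (simp add: into_ar)
qed

lemma iso_mono:
  assumes "e \<cdot> f = e \<cdot> g" "is_iso C e" "into f (Dom C e)" "into g (Dom C e)"
  shows "f = g"
proof -
  have "inv_ar C e \<cdot> (e \<cdot> f) = inv_ar C e \<cdot> (e \<cdot> g)" using assms by simp
  then show ?thesis using assms(2-) by simp
qed

lemma is_iso_cancel_right:
  assumes gf: "is_iso C (g \<cdot> f)" and f: "is_iso C f" and g: "g \<in> Ar C" and d: "Cod C f = Dom C g"
  shows "is_iso C g"
proof -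
  note [simp] = g is_iso_ar[OF f] into_ar[OF is_iso_ar[OF f]] d f
  have "is_iso C ((g \<cdot> f) \<cdot> inv_ar C f)"
    by (rule is_iso_comp) (use gf in simp_all)
  then show ?thesis by simp
qed

end


section \<open>Coherence in a symmetric monoidal category\<close>

context symmetric_monoidal_category
begin


declare unit_ob [simp] tens_ob [simp]

lemma tens_arD [simp]:
  assumes "f \<in> Ar C" "g \<in> Ar C"
  shows "f \<boxtimes> g \<in> Ar C" "Dom C (f \<boxtimes> g) = Dom C f \<otimes> Dom C g" "Cod C (f \<boxtimes> g) = Cod C f \<otimes> Cod C g"
    "into (f \<boxtimes> g) B \<longleftrightarrow> Cod C f \<otimes> Cod C g = B"
  using tens_hom[OF ar_hom ar_hom] assms by (auto simp: hom_iff into_def)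

lemma tens_ident_ar [simp]: "\<lbrakk>A \<in> Ob C; B \<in> Ob C\<rbrakk> \<Longrightarrow> Ident C A \<boxtimes> Ident C B = Ident C (A \<otimes> B)"
  by (rule tens_ident)

lemma interchange:
  assumes "f \<in> Ar C" "f' \<in> Ar C" "g \<in> Ar C" "g' \<in> Ar C" "Cod C f = Dom C f'" "Cod C g = Dom C g'"
  shows "(f' \<boxtimes> g') \<cdot> (f \<boxtimes> g) = (f' \<cdot> f) \<boxtimes> (g' \<cdot> g)"
  using tens_comp[of f "Dom C f" "Cod C f" f' "Cod C f'" g "Dom C g" "Cod C g" g' "Cod C g'"] assms
  by (simp add: hom_iff)

lemma interchange_assoc:
  assumes "f \<in> Ar C" "f' \<in> Ar C" "g \<in> Ar C" "g' \<in> Ar C" "Cod C f = Dom C f'" "Cod C g = Dom C g'"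
    and "into h (Dom C f \<otimes> Dom C g)"
  shows "(f' \<boxtimes> g') \<cdot> ((f \<boxtimes> g) \<cdot> h) = ((f' \<cdot> f) \<boxtimes> (g' \<cdot> g)) \<cdot> h"
  using reassoc[OF interchange] assms by (simp add: into_ar)

lemma coherence_ar [simp]:
  shows "\<lbrakk>A \<in> Ob C; B \<in> Ob C; D \<in> Ob C\<rbrakk> \<Longrightarrow> assoc C A B D \<in> Ar C"
    and "\<lbrakk>A \<in> Ob C; B \<in> Ob C; D \<in> Ob C\<rbrakk> \<Longrightarrow> Dom C (assoc C A B D) = A \<otimes> B \<otimes> D"
    and "\<lbrakk>A \<in> Ob C; B \<in> Ob C; D \<in> Ob C\<rbrakk> \<Longrightarrow> Cod C (assoc C A B D) = A \<otimes> (B \<otimes> D)"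
    and "A \<in> Ob C \<Longrightarrow> lunit C A \<in> Ar C" "A \<in> Ob C \<Longrightarrow> Dom C (lunit C A) = \<one> \<otimes> A"
      "A \<in> Ob C \<Longrightarrow> Cod C (lunit C A) = A"
    and "A \<in> Ob C \<Longrightarrow> runit C A \<in> Ar C" "A \<in> Ob C \<Longrightarrow> Dom C (runit C A) = A \<otimes> \<one>"
      "A \<in> Ob C \<Longrightarrow> Cod C (runit C A) = A"
    and "\<lbrakk>A \<in> Ob C; B \<in> Ob C\<rbrakk> \<Longrightarrow> braid C A B \<in> Ar C"
    and "\<lbrakk>A \<in> Ob C; B \<in> Ob C\<rbrakk> \<Longrightarrow> Dom C (braid C A B) = A \<otimes> B"
    and "\<lbrakk>A \<in> Ob C; B \<in> Ob C\<rbrakk> \<Longrightarrow> Cod C (braid C A B) = B \<otimes> A"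
    and "\<lbrakk>A \<in> Ob C; B \<in> Ob C; D \<in> Ob C\<rbrakk> \<Longrightarrow> into (assoc C A B D) E \<longleftrightarrow> A \<otimes> (B \<otimes> D) = E"
    and "A \<in> Ob C \<Longrightarrow> into (lunit C A) E \<longleftrightarrow> A = E" "A \<in> Ob C \<Longrightarrow> into (runit C A) E \<longleftrightarrow> A = E"
    and "\<lbrakk>A \<in> Ob C; B \<in> Ob C\<rbrakk> \<Longrightarrow> into (braid C A B) E \<longleftrightarrow> B \<otimes> A = E"
  using assoc_hom[of A B D] lunit_hom[of A] runit_hom[of A] braid_hom[of A B] by (auto simp: hom_iff into_def)

declare assoc_iso [simp] lunit_iso [simp] runit_iso [simp] symmetry [simp]

lemma assoc_nat_ar:
  assumes "f \<in> Ar C" "g \<in> Ar C" "h \<in> Ar C" "Cod C f = A" "Cod C g = B" "Cod C h = D"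
  shows "assoc C A B D \<cdot> (f \<boxtimes> g \<boxtimes> h) = (f \<boxtimes> (g \<boxtimes> h)) \<cdot> assoc C (Dom C f) (Dom C g) (Dom C h)"
  using assoc_nat[OF ar_hom ar_hom ar_hom, of f g h] assms by simp

lemma assoc_inv_nat_ar:
  assumes [simp]: "f \<in> Ar C" "g \<in> Ar C" "h \<in> Ar C" and c: "Cod C f = A" "Cod C g = B" "Cod C h = D"
  shows "inv_ar C (assoc C A B D) \<cdot> (f \<boxtimes> (g \<boxtimes> h))
         = (f \<boxtimes> g \<boxtimes> h) \<cdot> inv_ar C (assoc C (Dom C f) (Dom C g) (Dom C h))"
  apply (rule iso_mono[of "assoc C A B D"])
       apply (rule iso_epi[of _ "assoc C (Dom C f) (Dom C g) (Dom C h)"])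
  using c by (auto simp: assoc_nat_ar into_ar)

lemma lunit_nat_ar: "f \<in> Ar C \<Longrightarrow> Cod C f = A \<Longrightarrow> lunit C A \<cdot> (Ident C \<one> \<boxtimes> f) = f \<cdot> lunit C (Dom C f)"
  using lunit_nat[OF ar_hom] by auto

lemma runit_nat_ar: "f \<in> Ar C \<Longrightarrow> Cod C f = A \<Longrightarrow> runit C A \<cdot> (f \<boxtimes> Ident C \<one>) = f \<cdot> runit C (Dom C f)"
  using runit_nat[OF ar_hom] by auto

lemma lunit_inv_nat_ar:
  assumes [simp]: "f \<in> Ar C" and c: "Cod C f = A"
  shows "inv_ar C (lunit C A) \<cdot> f = (Ident C \<one> \<boxtimes> f) \<cdot> inv_ar C (lunit C (Dom C f))"
  apply (rule iso_mono[of "lunit C A"])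
       apply (rule iso_epi[of _ "lunit C (Dom C f)"])
  using c by (auto simp: lunit_nat_ar into_ar)

lemma runit_inv_nat_ar:
  assumes [simp]: "f \<in> Ar C" and c: "Cod C f = A"
  shows "inv_ar C (runit C A) \<cdot> f = (f \<boxtimes> Ident C \<one>) \<cdot> inv_ar C (runit C (Dom C f))"
  apply (rule iso_mono[of "runit C A"])
       apply (rule iso_epi[of _ "runit C (Dom C f)"])
  using c by (auto simp: runit_nat_ar into_ar)

lemma braid_nat_ar:
  assumes "f \<in> Ar C" "g \<in> Ar C" "Cod C f = A" "Cod C g = B"
  shows "braid C A B \<cdot> (f \<boxtimes> g) = (g \<boxtimes> f) \<cdot> braid C (Dom C f) (Dom C g)"
  using braid_nat[OF ar_hom ar_hom, of f g] assms by simp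

lemma braid_iso [simp]: "\<lbrakk>A \<in> Ob C; B \<in> Ob C\<rbrakk> \<Longrightarrow> is_iso C (braid C A B)"
  by (rule is_isoI(1)[of _ "A \<otimes> B" "B \<otimes> A" "braid C B A"]) (simp_all add: hom_iff)

lemma tens_iso [simp]:
  assumes "is_iso C f" "is_iso C g"
  shows "is_iso C (f \<boxtimes> g)" "inv_ar C (f \<boxtimes> g) = inv_ar C f \<boxtimes> inv_ar C g"
  using is_isoI[of "f \<boxtimes> g" "Dom C f \<otimes> Dom C g" "Cod C f \<otimes> Cod C g" "inv_ar C f \<boxtimes> inv_ar C g"]
    is_iso_ar[OF assms(1)] is_iso_ar[OF assms(2)] assms
  by (simp_all add: hom_iff interchange)

text \<open>The unit isomorphisms conjugate \<open>\<one> \<otimes> f\<close> and \<open>f \<otimes> \<one>\<close> into \<open>f\<close>.\<close>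

lemma tens_unit_faithful:
  assumes "f \<in> Ar C" "g \<in> Ar C" "Dom C f = Dom C g" "Cod C f = Cod C g"
  shows "Ident C \<one> \<boxtimes> f = Ident C \<one> \<boxtimes> g \<Longrightarrow> f = g" "f \<boxtimes> Ident C \<one> = g \<boxtimes> Ident C \<one> \<Longrightarrow> f = g"
proof -
  assume "Ident C \<one> \<boxtimes> f = Ident C \<one> \<boxtimes> g"
  then have "f \<cdot> lunit C (Dom C f) = g \<cdot> lunit C (Dom C f)"
    using lunit_nat_ar[of f "Cod C f"] lunit_nat_ar[of g "Cod C f"] assms by simp
  then show "f = g" by (rule iso_epi) (use assms in simp_all)
next
  assume "f \<boxtimes> Ident C \<one> = g \<boxtimes> Ident C \<one>"
  then have "f \<cdot> runit C (Dom C f) = g \<cdot> runit C (Dom C f)"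
    using runit_nat_ar[of f "Cod C f"] runit_nat_ar[of g "Cod C f"] assms by simp
  then show "f = g" by (rule iso_epi) (use assms in simp_all)
qed

lemma pentagon_ar:
  "\<lbrakk>A \<in> Ob C; B \<in> Ob C; D \<in> Ob C; E \<in> Ob C\<rbrakk>
    \<Longrightarrow> (Ident C A \<boxtimes> assoc C B D E) \<cdot> (assoc C A (B \<otimes> D) E \<cdot> (assoc C A B D \<boxtimes> Ident C E))
        = assoc C A B (D \<otimes> E) \<cdot> assoc C (A \<otimes> B) D E"
  using pentagon[of A B D E] by simp

text \<open>Kelly's argument: as tensoring with the unit is faithful, it suffices to compare after tensoring
  with the unit, where the pentagon and the triangle apply.\<close>

lemma assoc_lunit:
  assumes [simp]: "A \<in> Ob C" "B \<in> Ob C"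
  shows "lunit C (A \<otimes> B) \<cdot> assoc C \<one> A B = lunit C A \<boxtimes> Ident C B"
proof -
  let ?I = "Ident C \<one>"
  have "(?I \<boxtimes> (lunit C (A \<otimes> B) \<cdot> assoc C \<one> A B)) \<cdot> (assoc C \<one> (\<one> \<otimes> A) B \<cdot> (assoc C \<one> \<one> A \<boxtimes> Ident C B))
      = (?I \<boxtimes> lunit C (A \<otimes> B)) \<cdot> ((?I \<boxtimes> assoc C \<one> A B) \<cdot> (assoc C \<one> (\<one> \<otimes> A) B \<cdot> (assoc C \<one> \<one> A \<boxtimes> Ident C B)))"
    by (simp add: interchange_assoc)
  also have "\<dots> = (?I \<boxtimes> lunit C (A \<otimes> B)) \<cdot> (assoc C \<one> \<one> (A \<otimes> B) \<cdot> assoc C (\<one> \<otimes> \<one>) A B)"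
    by (simp add: pentagon_ar)
  also have "\<dots> = (runit C \<one> \<boxtimes> Ident C (A \<otimes> B)) \<cdot> assoc C (\<one> \<otimes> \<one>) A B"
    using reassoc[OF triangle[of \<one> "A \<otimes> B"]] by simp
  also have "\<dots> = assoc C \<one> A B \<cdot> (runit C \<one> \<boxtimes> Ident C A \<boxtimes> Ident C B)"
    by (subst assoc_nat_ar) simp_all
  also have "\<dots> = assoc C \<one> A B \<cdot> ((?I \<boxtimes> lunit C A \<boxtimes> Ident C B) \<cdot> (assoc C \<one> \<one> A \<boxtimes> Ident C B))"
    by (simp add: interchange triangle)
  also have "\<dots> = (?I \<boxtimes> (lunit C A \<boxtimes> Ident C B)) \<cdot> (assoc C \<one> (\<one> \<otimes> A) B \<cdot> (assoc C \<one> \<one> A \<boxtimes> Ident C B))"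
    by (subst reassoc[OF assoc_nat_ar]) simp_all
  finally have "?I \<boxtimes> (lunit C (A \<otimes> B) \<cdot> assoc C \<one> A B) = ?I \<boxtimes> (lunit C A \<boxtimes> Ident C B)"
    by (rule iso_epi) (simp_all add: is_iso_comp)
  then show ?thesis by (rule tens_unit_faithful(1)[rotated -1]) simp_all
qed

lemma assoc_runit:
  assumes [simp]: "A \<in> Ob C" "B \<in> Ob C"
  shows "(Ident C A \<boxtimes> runit C B) \<cdot> assoc C A B \<one> = runit C (A \<otimes> B)"
proof -
  let ?I = "Ident C \<one>"
  have "assoc C A B \<one> \<cdot> (((Ident C A \<boxtimes> runit C B) \<cdot> assoc C A B \<one>) \<boxtimes> ?I)
      = assoc C A B \<one> \<cdot> ((Ident C A \<boxtimes> runit C B \<boxtimes> ?I) \<cdot> (assoc C A B \<one> \<boxtimes> ?I))"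
    by (simp add: interchange)
  also have "\<dots> = (Ident C A \<boxtimes> (runit C B \<boxtimes> ?I)) \<cdot> (assoc C A (B \<otimes> \<one>) \<one> \<cdot> (assoc C A B \<one> \<boxtimes> ?I))"
    by (subst reassoc[OF assoc_nat_ar]) simp_all
  also have "\<dots> = (Ident C A \<boxtimes> (Ident C B \<boxtimes> lunit C \<one>)) \<cdot> ((Ident C A \<boxtimes> assoc C B \<one> \<one>)
      \<cdot> (assoc C A (B \<otimes> \<one>) \<one> \<cdot> (assoc C A B \<one> \<boxtimes> ?I)))"
    by (simp add: interchange_assoc triangle)
  also have "\<dots> = (Ident C A \<boxtimes> (Ident C B \<boxtimes> lunit C \<one>)) \<cdot> (assoc C A B (\<one> \<otimes> \<one>) \<cdot> assoc C (A \<otimes> B) \<one> \<one>)"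
    by (simp add: pentagon_ar)
  also have "\<dots> = assoc C A B \<one> \<cdot> ((Ident C (A \<otimes> B) \<boxtimes> lunit C \<one>) \<cdot> assoc C (A \<otimes> B) \<one> \<one>)"
    using assoc_nat_ar[of "Ident C A" "Ident C B" "lunit C \<one>" A B \<one>] by (simp flip: assoc_ar)
  also have "\<dots> = assoc C A B \<one> \<cdot> (runit C (A \<otimes> B) \<boxtimes> ?I)"
    by (simp add: triangle)
  finally have "((Ident C A \<boxtimes> runit C B) \<cdot> assoc C A B \<one>) \<boxtimes> ?I = runit C (A \<otimes> B) \<boxtimes> ?I"
    by (rule iso_mono) simp_all
  then show ?thesis by (rule tens_unit_faithful(2)[rotated -1]) simp_all
qed

lemma lunit_unit: "lunit C \<one> = runit C \<one>"
proof -
  have "lunit C \<one> \<cdot> (Ident C \<one> \<boxtimes> lunit C \<one>) = lunit C \<one> \<cdot> lunit C (\<one> \<otimes> \<one>)"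
    by (simp add: lunit_nat_ar)
  then have "Ident C \<one> \<boxtimes> lunit C \<one> = lunit C (\<one> \<otimes> \<one>)"
    by (rule iso_mono) simp_all
  then have "lunit C \<one> \<boxtimes> Ident C \<one> = runit C \<one> \<boxtimes> Ident C \<one>"
    using triangle[of \<one> \<one>] assoc_lunit[of \<one> \<one>] by simp
  then show ?thesis by (rule tens_unit_faithful(2)[rotated -1]) simp_all
qed

end


section \<open>Opposite categories\<close>

text \<open>Statements about limits and about right adjoints follow by passing to opposite categories.\<close>

definition opc :: "('o, 'a, 'e) cat_scheme \<Rightarrow> ('o, 'a) cat" where
  "opc C = \<lparr>Ob = Ob C, Ar = Ar C, Dom = Cod C, Cod = Dom C, Ident = Ident C, Comp = (\<lambda>g f. f \<cdot>\<^bsub>C\<^esub> g)\<rparr>"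

lemma opc_sel [simp]:
  "Ob (opc C) = Ob C" "Ar (opc C) = Ar C" "Dom (opc C) = Cod C" "Cod (opc C) = Dom C"
  "Ident (opc C) = Ident C" "g \<cdot>\<^bsub>opc C\<^esub> f = f \<cdot>\<^bsub>C\<^esub> g"
  by (simp_all add: opc_def)

lemma hom_opc [simp]: "hom (opc C) A B = hom C B A"
  by (auto simp: hom_def)

lemma category_opc:
  assumes "category C"
  shows "category (opc C)"
proof -
  interpret category C by fact
  show ?thesis
  proof
    fix f g h A B D E
    show "f \<in> Ar (opc C) \<Longrightarrow> Dom (opc C) f \<in> Ob (opc C)" "f \<in> Ar (opc C) \<Longrightarrow> Cod (opc C) f \<in> Ob (opc C)"
      "A \<in> Ob (opc C) \<Longrightarrow> Ident (opc C) A \<in> hom (opc C) A A"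
      using ident_hom by simp_all
    assume f: "f \<in> hom (opc C) A B"
    then show "f \<cdot>\<^bsub>opc C\<^esub> Ident (opc C) A = f" "Ident (opc C) B \<cdot>\<^bsub>opc C\<^esub> f = f"
      by (simp_all add: homD)
    assume g: "g \<in> hom (opc C) B D"
    then show "g \<cdot>\<^bsub>opc C\<^esub> f \<in> hom (opc C) A D" using f comp_hom by simp
    assume "h \<in> hom (opc C) D E"
    then show "h \<cdot>\<^bsub>opc C\<^esub> g \<cdot>\<^bsub>opc C\<^esub> f = h \<cdot>\<^bsub>opc C\<^esub> (g \<cdot>\<^bsub>opc C\<^esub> f)"
      using comp_assoc[of h E D g B f A] f g by simp
  qed
qed

lemma is_iso_opc: "is_iso (opc C) f \<longleftrightarrow> is_iso C f"
  unfolding is_iso_def inverse_arrows_def opc_sel hom_opc by blast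


section \<open>Limits and colimits\<close>

definition is_cone ::
  "('o, 'a, 'e) cat_scheme \<Rightarrow> ('j, 'm, 'e2) cat_scheme \<Rightarrow> ('j, 'm, 'o, 'a) fct
     \<Rightarrow> 'o \<Rightarrow> ('j \<Rightarrow> 'a) \<Rightarrow> bool"
where
  "is_cone C J F v \<pi> \<longleftrightarrow>
     v \<in> Ob C \<and> (\<forall>j \<in> Ob J. \<pi> j \<in> hom C v (OM F j)) \<and>
     (\<forall>m \<in> Ar J. AM F m \<cdot>\<^bsub>C\<^esub> \<pi> (Dom J m) = \<pi> (Cod J m))"

definition is_limit ::
  "('o, 'a, 'e) cat_scheme \<Rightarrow> ('j, 'm, 'e2) cat_scheme \<Rightarrow> ('j, 'm, 'o, 'a) fct
     \<Rightarrow> 'o \<Rightarrow> ('j \<Rightarrow> 'a) \<Rightarrow> bool"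
where
  "is_limit C J F v \<pi> \<longleftrightarrow>
     is_cone C J F v \<pi> \<and>
     (\<forall>w \<tau>. is_cone C J F w \<tau> \<longrightarrow>
        (\<exists>!u. u \<in> hom C w v \<and> (\<forall>j \<in> Ob J. \<pi> j \<cdot>\<^bsub>C\<^esub> u = \<tau> j)))"

lemma is_colimitD:
  assumes "is_colimit C J F v \<kappa>"
  shows "v \<in> Ob C" "\<And>j. j \<in> Ob J \<Longrightarrow> \<kappa> j \<in> hom C (OM F j) v"
    "\<And>m. m \<in> Ar J \<Longrightarrow> \<kappa> (Cod J m) \<cdot>\<^bsub>C\<^esub> AM F m = \<kappa> (Dom J m)"
  using assms by (auto simp: is_colimit_def is_cocone_def)

lemma is_colimit_cocone: "is_colimit C J F v \<kappa> \<Longrightarrow> is_cocone C J F v \<kappa>"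
  by (simp add: is_colimit_def)

lemma is_colimit_ex:
  assumes "is_colimit C J F v \<kappa>" "is_cocone C J F w \<tau>"
  obtains u where "u \<in> hom C v w" "\<And>j. j \<in> Ob J \<Longrightarrow> u \<cdot>\<^bsub>C\<^esub> \<kappa> j = \<tau> j"
proof -
  have "\<exists>!u. u \<in> hom C v w \<and> (\<forall>j \<in> Ob J. u \<cdot>\<^bsub>C\<^esub> \<kappa> j = \<tau> j)"
    using assms by (simp add: is_colimit_def)
  then show ?thesis using that by blast
qed

lemma is_colimit_unique:
  assumes "is_colimit C J F v \<kappa>" "is_cocone C J F w \<tau>"
    and "u \<in> hom C v w" "\<And>j. j \<in> Ob J \<Longrightarrow> u \<cdot>\<^bsub>C\<^esub> \<kappa> j = \<tau> j"
    and "u' \<in> hom C v w" "\<And>j. j \<in> Ob J \<Longrightarrow> u' \<cdot>\<^bsub>C\<^esub> \<kappa> j = \<tau> j"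
  shows "u = u'"
proof -
  have "\<exists>!u. u \<in> hom C v w \<and> (\<forall>j \<in> Ob J. u \<cdot>\<^bsub>C\<^esub> \<kappa> j = \<tau> j)"
    using assms(1,2) by (simp add: is_colimit_def)
  then show ?thesis using assms(3-6) by blast
qed

lemma is_limitD:
  assumes "is_limit C J F v \<pi>"
  shows "v \<in> Ob C" "\<And>j. j \<in> Ob J \<Longrightarrow> \<pi> j \<in> hom C v (OM F j)"
    "\<And>m. m \<in> Ar J \<Longrightarrow> AM F m \<cdot>\<^bsub>C\<^esub> \<pi> (Dom J m) = \<pi> (Cod J m)"
  using assms by (auto simp: is_limit_def is_cone_def)

lemma is_limit_cone: "is_limit C J F v \<pi> \<Longrightarrow> is_cone C J F v \<pi>"
  by (simp add: is_limit_def)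

lemma is_limit_ex:
  assumes "is_limit C J F v \<pi>" "is_cone C J F w \<tau>"
  obtains u where "u \<in> hom C w v" "\<And>j. j \<in> Ob J \<Longrightarrow> \<pi> j \<cdot>\<^bsub>C\<^esub> u = \<tau> j"
proof -
  have "\<exists>!u. u \<in> hom C w v \<and> (\<forall>j \<in> Ob J. \<pi> j \<cdot>\<^bsub>C\<^esub> u = \<tau> j)"
    using assms by (simp add: is_limit_def)
  then show ?thesis using that by blast
qed

lemma is_limit_unique:
  assumes "is_limit C J F v \<pi>" "is_cone C J F w \<tau>"
    and "u \<in> hom C w v" "\<And>j. j \<in> Ob J \<Longrightarrow> \<pi> j \<cdot>\<^bsub>C\<^esub> u = \<tau> j"
    and "u' \<in> hom C w v" "\<And>j. j \<in> Ob J \<Longrightarrow> \<pi> j \<cdot>\<^bsub>C\<^esub> u' = \<tau> j"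
  shows "u = u'"
proof -
  have "\<exists>!u. u \<in> hom C w v \<and> (\<forall>j \<in> Ob J. \<pi> j \<cdot>\<^bsub>C\<^esub> u = \<tau> j)"
    using assms(1,2) by (simp add: is_limit_def)
  then show ?thesis using assms(3-6) by blast
qed

text \<open>Unlike a functor, a diagram need not be extensional; so constant and tensored diagrams can be given
  by plain formulas.\<close>

definition diagram :: "('o, 'a, 'e) cat_scheme \<Rightarrow> ('j, 'm, 'e2) cat_scheme \<Rightarrow> ('j, 'm, 'o, 'a) fct \<Rightarrow> bool"
where
  "diagram C J F \<longleftrightarrow> (\<forall>j \<in> Ob J. OM F j \<in> Ob C) \<and>
     (\<forall>m \<in> Ar J. Dom J m \<in> Ob J \<and> Cod J m \<in> Ob J \<and> AM F m \<in> hom C (OM F (Dom J m)) (OM F (Cod J m)))"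

lemma diagramD:
  assumes "diagram C J F"
  shows "\<And>j. j \<in> Ob J \<Longrightarrow> OM F j \<in> Ob C" "\<And>m. m \<in> Ar J \<Longrightarrow> Dom J m \<in> Ob J"
    "\<And>m. m \<in> Ar J \<Longrightarrow> Cod J m \<in> Ob J"
    "\<And>m. m \<in> Ar J \<Longrightarrow> AM F m \<in> hom C (OM F (Dom J m)) (OM F (Cod J m))"
  using assms by (auto simp: diagram_def)

lemma functor_diagram: "is_functor J C F \<Longrightarrow> diagram C J F"
  unfolding is_functor_def diagram_def
  by (auto simp: hom_def category.dom_ob category.cod_ob dest: PiE_mem)

lemma is_limit_opc: "is_limit C J F v \<pi> \<longleftrightarrow> is_colimit (opc C) (opc J) F v \<pi>"
  by (simp add: is_limit_def is_colimit_def is_cone_def is_cocone_def)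

lemma diagram_opc: "diagram (opc C) (opc J) F \<longleftrightarrow> diagram C J F"
  by (auto simp: diagram_def)

lemma is_limit_cong:
  assumes "\<And>j. j \<in> Ob J \<Longrightarrow> OM F j = OM G j" "\<And>m. m \<in> Ar J \<Longrightarrow> AM F m = AM G m"
    and "\<And>j. j \<in> Ob J \<Longrightarrow> \<pi> j = \<pi>' j"
    and dc: "\<And>m. m \<in> Ar J \<Longrightarrow> Dom J m \<in> Ob J" "\<And>m. m \<in> Ar J \<Longrightarrow> Cod J m \<in> Ob J"
  shows "is_limit C J F v \<pi> \<longleftrightarrow> is_limit C J G v \<pi>'"
proof -
  have "is_cone C J F w \<tau> \<longleftrightarrow> is_cone C J G w \<tau>" for w \<tau> using assms(1,2) by (simp add: is_cone_def)
  moreover have "is_cone C J G v \<pi> \<longleftrightarrow> is_cone C J G v \<pi>'" using assms(3) dc by (simp add: is_cone_def)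
  ultimately show ?thesis using assms(3) by (simp add: is_limit_def)
qed

context category
begin

lemma is_colimit_eq:
  assumes c: "is_colimit C J F v \<kappa>" and u: "u \<in> hom C v w" "u' \<in> hom C v w"
    and e: "\<And>j. j \<in> Ob J \<Longrightarrow> u \<cdot> \<kappa> j = u' \<cdot> \<kappa> j" and F: "diagram C J F"
  shows "u = u'"
proof -
  have "is_cocone C J F w (\<lambda>j. u \<cdot> \<kappa> j)"
    using is_colimitD(3)[OF c] diagramD(2,3)[OF F] homD[OF u(1)] hom_ob[OF u(1)]
      homD[OF is_colimitD(2)[OF c]] homD[OF diagramD(4)[OF F]]
    unfolding is_cocone_def by (simp add: hom_iff)
  from is_colimit_unique[OF c this] show ?thesis using u e by simp
qed

lemma is_limit_eq:
  assumes c: "is_limit C J F v \<pi>" and u: "u \<in> hom C w v" "u' \<in> hom C w v"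
    and e: "\<And>j. j \<in> Ob J \<Longrightarrow> \<pi> j \<cdot> u = \<pi> j \<cdot> u'" and F: "diagram C J F"
  shows "u = u'"
proof -
  have "is_cone C J F w (\<lambda>j. \<pi> j \<cdot> u)"
    using is_limitD(3)[OF c] diagramD(2,3)[OF F] homD[OF u(1)] hom_ob[OF u(1)]
      homD[OF is_limitD(2)[OF c]] homD[OF diagramD(4)[OF F]] reassoc[OF is_limitD(3)[OF c]]
    unfolding is_cone_def by (simp add: hom_iff)
  from is_limit_unique[OF c this] show ?thesis using u e by simp
qed

text \<open>Universal properties enter later proofs mostly through these comparisons.\<close>

lemma colimit_comparison_iso:
  assumes c: "is_colimit C J F v \<kappa>" and d: "is_colimit C J F w \<tau>" and F: "diagram C J F"
    and u: "u \<in> hom C v w" and e: "\<And>j. j \<in> Ob J \<Longrightarrow> u \<cdot> \<kappa> j = \<tau> j"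
  shows "is_iso C u"
proof -
  obtain u' where u': "u' \<in> hom C w v" and e': "\<And>j. j \<in> Ob J \<Longrightarrow> u' \<cdot> \<tau> j = \<kappa> j"
    using is_colimit_ex[OF d is_colimit_cocone[OF c]] by blast
  note [simp] = homD[OF u] homD[OF u'] hom_ob[OF u] homD[OF is_colimitD(2)[OF c]] homD[OF is_colimitD(2)[OF d]]
  have "u' \<cdot> u = Ident C v"
    by (rule is_colimit_eq[OF c _ _ _ F, of _ v]) (simp_all add: e e' hom_iff)
  moreover have "u \<cdot> u' = Ident C w"
    by (rule is_colimit_eq[OF d _ _ _ F, of _ w]) (simp_all add: e e' hom_iff)
  ultimately show ?thesis using is_isoI(1)[OF u u'] by simp
qed

lemma limit_comparison_iso:
  assumes c: "is_limit C J F v \<pi>" and d: "is_limit C J F w \<tau>" and F: "diagram C J F"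
    and u: "u \<in> hom C w v" and e: "\<And>j. j \<in> Ob J \<Longrightarrow> \<pi> j \<cdot> u = \<tau> j"
  shows "is_iso C u"
proof -
  interpret O: category "opc C" by (rule category_opc[OF category_axioms])
  show ?thesis
    using O.colimit_comparison_iso[of "opc J" F v \<pi> w \<tau> u] assms
    by (simp add: is_limit_opc diagram_opc is_iso_opc)
qed

lemma colimit_iso_vertex:
  assumes c: "is_colimit C J F v \<kappa>" and F: "diagram C J F"
    and u: "u \<in> hom C v w" "is_iso C u" and e: "\<And>j. j \<in> Ob J \<Longrightarrow> \<tau> j = u \<cdot> \<kappa> j"
  shows "is_colimit C J F w \<tau>"
  unfolding is_colimit_def
proof (intro conjI allI impI)
  note [simp] = homD[OF u(1)] u(2) hom_ob[OF u(1)] homD[OF is_colimitD(2)[OF c]]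
    homD[OF diagramD(4)[OF F]] diagramD(2,3)[OF F]
  show t: "is_cocone C J F w \<tau>"
    using is_colimitD(3)[OF c] by (simp add: is_cocone_def hom_iff e)
  fix x \<sigma> assume s: "is_cocone C J F x \<sigma>"
  obtain y where y: "y \<in> hom C v x" and ye: "\<And>j. j \<in> Ob J \<Longrightarrow> y \<cdot> \<kappa> j = \<sigma> j"
    using is_colimit_ex[OF c s] by blast
  note [simp] = homD[OF y]
  show "\<exists>!z. z \<in> hom C w x \<and> (\<forall>j \<in> Ob J. z \<cdot> \<tau> j = \<sigma> j)"
  proof (rule ex1I[of _ "y \<cdot> inv_ar C u"])
    show "y \<cdot> inv_ar C u \<in> hom C w x \<and> (\<forall>j \<in> Ob J. y \<cdot> inv_ar C u \<cdot> \<tau> j = \<sigma> j)"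
      by (simp add: hom_iff e ye)
    fix z assume z: "z \<in> hom C w x \<and> (\<forall>j \<in> Ob J. z \<cdot> \<tau> j = \<sigma> j)"
    then have z': "z \<in> hom C w x" by simp
    note [simp] = homD[OF z']
    have "z \<cdot> u = y"
      by (rule is_colimit_eq[OF c _ y _ F]) (use z e ye in \<open>simp_all add: hom_iff\<close>)
    then show "z = y \<cdot> inv_ar C u" by auto
  qed
qed

lemma limit_iso_vertex:
  assumes c: "is_limit C J F v \<pi>" and F: "diagram C J F"
    and u: "u \<in> hom C w v" "is_iso C u" and e: "\<And>j. j \<in> Ob J \<Longrightarrow> \<tau> j = \<pi> j \<cdot> u"
  shows "is_limit C J F w \<tau>"
proof -
  interpret O: category "opc C" by (rule category_opc[OF category_axioms])
  show ?thesis
    using O.colimit_iso_vertex[of "opc J" F v \<pi> u w \<tau>] assms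
    by (simp add: is_limit_opc diagram_opc is_iso_opc)
qed

end


section \<open>Tensoring with a dualizable object\<close>

context symmetric_monoidal_category
begin

lemma is_dualD:
  assumes "is_dual C A D coev ev" "A \<in> Ob C"
  shows "D \<in> Ob C" "coev \<in> hom C \<one> (D \<otimes> A)" "ev \<in> hom C (A \<otimes> D) \<one>"
    "lunit C A \<cdot> ((ev \<boxtimes> Ident C A) \<cdot> (inv_ar C (assoc C A D A) \<cdot> ((Ident C A \<boxtimes> coev)
       \<cdot> inv_ar C (runit C A)))) = Ident C A"
    "runit C D \<cdot> ((Ident C D \<boxtimes> ev) \<cdot> (assoc C D A D \<cdot> ((coev \<boxtimes> Ident C D)
       \<cdot> inv_ar C (lunit C D)))) = Ident C D"
proof -
  show [simp]: "D \<in> Ob C" and c: "coev \<in> hom C \<one> (D \<otimes> A)" and e: "ev \<in> hom C (A \<otimes> D) \<one>"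
    using assms(1) by (simp_all only: is_dual_def)
  note [simp] = homD[OF c] homD[OF e] assms(2)
  have "lunit C A \<cdot> (ev \<boxtimes> Ident C A) \<cdot> inv_ar C (assoc C A D A) \<cdot> (Ident C A \<boxtimes> coev)
      \<cdot> inv_ar C (runit C A) = Ident C A"
    and "runit C D \<cdot> (Ident C D \<boxtimes> ev) \<cdot> assoc C D A D \<cdot> (coev \<boxtimes> Ident C D)
      \<cdot> inv_ar C (lunit C D) = Ident C D"
    using assms(1) unfolding is_dual_def by blast+
  then show "lunit C A \<cdot> ((ev \<boxtimes> Ident C A) \<cdot> (inv_ar C (assoc C A D A) \<cdot> ((Ident C A \<boxtimes> coev)
       \<cdot> inv_ar C (runit C A)))) = Ident C A"
    and "runit C D \<cdot> ((Ident C D \<boxtimes> ev) \<cdot> (assoc C D A D \<cdot> ((coev \<boxtimes> Ident C D)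
       \<cdot> inv_ar C (lunit C D)))) = Ident C D"
    by simp_all
qed

text \<open>For \<open>D\<close> dual to \<open>A\<close>, tensoring with \<open>A\<close> is left adjoint to tensoring with \<open>D\<close>: \<open>lhat\<close> transposes
  \<open>A \<otimes> w \<rightarrow> z\<close> to \<open>w \<rightarrow> D \<otimes> z\<close>, and \<open>lunhat\<close> goes back.\<close>

definition lhat :: "'a \<Rightarrow> 'o \<Rightarrow> 'o \<Rightarrow> 'o \<Rightarrow> 'a \<Rightarrow> 'a" where
  "lhat coev A D w g = (Ident C D \<boxtimes> g) \<cdot> (assoc C D A w \<cdot> ((coev \<boxtimes> Ident C w) \<cdot> inv_ar C (lunit C w)))"

definition lunhat :: "'a \<Rightarrow> 'o \<Rightarrow> 'o \<Rightarrow> 'o \<Rightarrow> 'a \<Rightarrow> 'a" where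
  "lunhat ev A D z k = lunit C z \<cdot> ((ev \<boxtimes> Ident C z) \<cdot> (inv_ar C (assoc C A D z) \<cdot> (Ident C A \<boxtimes> k)))"

text \<open>This is the triangle identity for \<open>A\<close>, tensored with \<open>w\<close>; the rest of the calculation moves the
  evaluation and the coevaluation past associators.\<close>

lemma lunhat_lhat:
  assumes d: "is_dual C A D coev ev" and A[simp]: "A \<in> Ob C" and w[simp]: "w \<in> Ob C"
    and g: "g \<in> hom C (A \<otimes> w) z"
  shows "lunhat ev A D z (lhat coev A D w g) = g"
proof -
  note dd = is_dualD[OF d A]
  note [simp] = dd(1) homD[OF dd(2)] homD[OF dd(3)] homD[OF g] hom_ob[OF g]
  define K where "K = (Ident C A \<boxtimes> assoc C D A w) \<cdot> ((Ident C A \<boxtimes> (coev \<boxtimes> Ident C w)) \<cdot> (Ident C A \<boxtimes> inv_ar C (lunit C w)))"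
  have K1: "K \<in> hom C (A \<otimes> w) (A \<otimes> (D \<otimes> (A \<otimes> w)))" by (simp add: K_def hom_iff)
  note [simp] = homD[OF K1]
  have l: "Ident C A \<boxtimes> inv_ar C (lunit C w) = assoc C A \<one> w \<cdot> (inv_ar C (runit C A) \<boxtimes> Ident C w)"
    by (rule iso_epi[of _ "runit C A \<boxtimes> Ident C w"], subst (1) triangle[symmetric])
      (simp_all add: interchange interchange_assoc)
  have p: "(Ident C A \<boxtimes> assoc C D A w) \<cdot> assoc C A (D \<otimes> A) w
      = assoc C A D (A \<otimes> w) \<cdot> (assoc C (A \<otimes> D) A w \<cdot> (inv_ar C (assoc C A D A) \<boxtimes> Ident C w))"
    by (rule iso_epi[of _ "assoc C A D A \<boxtimes> Ident C w"])
      (simp_all add: interchange pentagon_ar)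
  have K: "K = assoc C A D (A \<otimes> w) \<cdot> (assoc C (A \<otimes> D) A w \<cdot> ((inv_ar C (assoc C A D A) \<boxtimes> Ident C w)
      \<cdot> ((Ident C A \<boxtimes> coev \<boxtimes> Ident C w) \<cdot> (inv_ar C (runit C A) \<boxtimes> Ident C w))))"
  proof -
    have "K = (Ident C A \<boxtimes> assoc C D A w) \<cdot> ((Ident C A \<boxtimes> (coev \<boxtimes> Ident C w)) \<cdot> (assoc C A \<one> w \<cdot> (inv_ar C (runit C A) \<boxtimes> Ident C w)))"
      by (simp add: K_def l)
    also have "\<dots> = (Ident C A \<boxtimes> assoc C D A w) \<cdot> (assoc C A (D \<otimes> A) w \<cdot> ((Ident C A \<boxtimes> coev \<boxtimes> Ident C w) \<cdot> (inv_ar C (runit C A) \<boxtimes> Ident C w)))"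
      using reassoc[OF assoc_nat_ar[of "Ident C A" coev "Ident C w" A "D \<otimes> A" w, symmetric]] by simp
    also have "\<dots> = assoc C A D (A \<otimes> w) \<cdot> (assoc C (A \<otimes> D) A w \<cdot> ((inv_ar C (assoc C A D A) \<boxtimes> Ident C w)
      \<cdot> ((Ident C A \<boxtimes> coev \<boxtimes> Ident C w) \<cdot> (inv_ar C (runit C A) \<boxtimes> Ident C w))))"
      by (subst reassoc[OF p]) simp_all
    finally show ?thesis .
  qed
  have "lunhat ev A D z (lhat coev A D w g)
      = lunit C z \<cdot> ((ev \<boxtimes> Ident C z) \<cdot> (inv_ar C (assoc C A D z) \<cdot> ((Ident C A \<boxtimes> (Ident C D \<boxtimes> g)) \<cdot> K)))"
    by (simp add: lunhat_def lhat_def K_def interchange)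
  also have "\<dots> = lunit C z \<cdot> ((ev \<boxtimes> Ident C z) \<cdot> ((Ident C (A \<otimes> D) \<boxtimes> g) \<cdot> (inv_ar C (assoc C A D (A \<otimes> w)) \<cdot> K)))"
    by (subst reassoc[OF assoc_inv_nat_ar]) simp_all
  also have "\<dots> = lunit C z \<cdot> ((Ident C \<one> \<boxtimes> g) \<cdot> ((ev \<boxtimes> Ident C (A \<otimes> w)) \<cdot> (inv_ar C (assoc C A D (A \<otimes> w)) \<cdot> K)))"
    by (simp add: interchange_assoc)
  also have "\<dots> = g \<cdot> (lunit C (A \<otimes> w) \<cdot> ((ev \<boxtimes> Ident C (A \<otimes> w)) \<cdot> (inv_ar C (assoc C A D (A \<otimes> w)) \<cdot> K)))"
    by (subst reassoc[OF lunit_nat_ar]) simp_all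
  also have "lunit C (A \<otimes> w) \<cdot> ((ev \<boxtimes> Ident C (A \<otimes> w)) \<cdot> (inv_ar C (assoc C A D (A \<otimes> w)) \<cdot> K))
     = lunit C (A \<otimes> w) \<cdot> ((ev \<boxtimes> Ident C (A \<otimes> w)) \<cdot> (assoc C (A \<otimes> D) A w \<cdot> ((inv_ar C (assoc C A D A) \<boxtimes> Ident C w)
      \<cdot> ((Ident C A \<boxtimes> coev \<boxtimes> Ident C w) \<cdot> (inv_ar C (runit C A) \<boxtimes> Ident C w)))))"
    by (simp add: K)
  also have "\<dots> = lunit C (A \<otimes> w) \<cdot> (assoc C \<one> A w \<cdot> ((ev \<boxtimes> Ident C A \<boxtimes> Ident C w) \<cdot> ((inv_ar C (assoc C A D A) \<boxtimes> Ident C w)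
      \<cdot> ((Ident C A \<boxtimes> coev \<boxtimes> Ident C w) \<cdot> (inv_ar C (runit C A) \<boxtimes> Ident C w)))))"
    using reassoc[OF assoc_nat_ar[of ev "Ident C A" "Ident C w" \<one> A w, symmetric]] by simp
  also have "\<dots> = (lunit C A \<boxtimes> Ident C w) \<cdot> ((ev \<boxtimes> Ident C A \<boxtimes> Ident C w) \<cdot> ((inv_ar C (assoc C A D A) \<boxtimes> Ident C w)
      \<cdot> ((Ident C A \<boxtimes> coev \<boxtimes> Ident C w) \<cdot> (inv_ar C (runit C A) \<boxtimes> Ident C w))))"
    by (subst reassoc[OF assoc_lunit]) simp_all
  also have "\<dots> = Ident C (A \<otimes> w)"
    by (simp add: interchange dd(4))
  finally show ?thesis by simp
qed

text \<open>On the other side, tensoring with \<open>A\<close> on the right is right adjoint to tensoring with \<open>D\<close>: \<open>rhat\<close>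
  transposes \<open>w \<rightarrow> z \<otimes> A\<close> to \<open>w \<otimes> D \<rightarrow> z\<close>, and \<open>runhat\<close> goes back.\<close>

definition rhat :: "'a \<Rightarrow> 'o \<Rightarrow> 'o \<Rightarrow> 'o \<Rightarrow> 'a \<Rightarrow> 'a" where
  "rhat ev A D z k = runit C z \<cdot> ((Ident C z \<boxtimes> ev) \<cdot> (assoc C z A D \<cdot> (k \<boxtimes> Ident C D)))"

definition runhat :: "'a \<Rightarrow> 'o \<Rightarrow> 'o \<Rightarrow> 'o \<Rightarrow> 'a \<Rightarrow> 'a" where
  "runhat coev A D w h = (h \<boxtimes> Ident C A) \<cdot> (inv_ar C (assoc C w D A) \<cdot> ((Ident C w \<boxtimes> coev) \<cdot> inv_ar C (runit C w)))"

lemma runhat_rhat: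
  assumes d: "is_dual C A D coev ev" and A[simp]: "A \<in> Ob C" and z[simp]: "z \<in> Ob C"
    and k: "k \<in> hom C w (z \<otimes> A)"
  shows "runhat coev A D w (rhat ev A D z k) = k"
proof -
  note dd = is_dualD[OF d A]
  note [simp] = dd(1) homD[OF dd(2)] homD[OF dd(3)] homD[OF k] hom_ob[OF k]
  let ?r = "\<lambda>x. x \<boxtimes> Ident C A" and ?z = "\<lambda>x. Ident C z \<boxtimes> x" and ?zA = "z \<otimes> A"
  have l: "?r (runit C z) \<cdot> inv_ar C (assoc C z \<one> A) = ?z (lunit C A)"
    by (rule iso_epi[of _ "assoc C z \<one> A"]) (simp_all add: triangle)
  have r: "assoc C z A \<one> \<cdot> inv_ar C (runit C ?zA) = ?z (inv_ar C (runit C A))"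
    by (rule iso_mono[of "?z (runit C A)"], subst reassoc[OF assoc_runit])
      (simp_all add: interchange)
  have p: "?r (assoc C z A D) \<cdot> inv_ar C (assoc C ?zA D A)
      = inv_ar C (assoc C z (A \<otimes> D) A) \<cdot> (?z (inv_ar C (assoc C A D A)) \<cdot> assoc C z A (D \<otimes> A))"
    apply (rule iso_epi[of _ "assoc C ?zA D A"])
    apply (rule iso_mono[of "assoc C z (A \<otimes> D) A"])
    apply (rule iso_mono[of "?z (assoc C A D A)"])
    by (simp_all add: interchange_assoc pentagon_ar)
  define K where "K = inv_ar C (assoc C ?zA D A) \<cdot> ((Ident C ?zA \<boxtimes> coev) \<cdot> inv_ar C (runit C ?zA))"
  have K1: "K \<in> hom C ?zA (?zA \<otimes> D \<otimes> A)" by (simp add: K_def hom_iff)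
  note [simp] = homD[OF K1]
  have rK: "?r (assoc C z A D) \<cdot> K = inv_ar C (assoc C z (A \<otimes> D) A) \<cdot> (?z (inv_ar C (assoc C A D A)) \<cdot>
     (?z (Ident C A \<boxtimes> coev) \<cdot> ?z (inv_ar C (runit C A))))"
  proof -
    have "?r (assoc C z A D) \<cdot> K = inv_ar C (assoc C z (A \<otimes> D) A) \<cdot> (?z (inv_ar C (assoc C A D A)) \<cdot>
      (assoc C z A (D \<otimes> A) \<cdot> ((Ident C ?zA \<boxtimes> coev) \<cdot> inv_ar C (runit C ?zA))))"
      unfolding K_def by (subst reassoc[OF p]) simp_all
    also have "assoc C z A (D \<otimes> A) \<cdot> ((Ident C ?zA \<boxtimes> coev) \<cdot> inv_ar C (runit C ?zA))
       = ?z (Ident C A \<boxtimes> coev) \<cdot> (assoc C z A \<one> \<cdot> inv_ar C (runit C ?zA))"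
      using reassoc[OF assoc_nat_ar[of "Ident C z" "Ident C A" coev z A "D \<otimes> A"]] by simp
    finally show ?thesis by (simp add: r)
  qed
  have "runhat coev A D w (rhat ev A D z k)
      = ?r (runit C z) \<cdot> (?r (?z ev) \<cdot> (?r (assoc C z A D) \<cdot> ((k \<boxtimes> Ident C D \<boxtimes> Ident C A) \<cdot>
        (inv_ar C (assoc C w D A) \<cdot> ((Ident C w \<boxtimes> coev) \<cdot> inv_ar C (runit C w))))))"
    by (simp add: runhat_def rhat_def interchange_assoc)
  also have "(k \<boxtimes> Ident C D \<boxtimes> Ident C A) \<cdot> (inv_ar C (assoc C w D A) \<cdot> ((Ident C w \<boxtimes> coev) \<cdot> inv_ar C (runit C w)))
     = inv_ar C (assoc C ?zA D A) \<cdot> ((k \<boxtimes> Ident C (D \<otimes> A)) \<cdot> ((Ident C w \<boxtimes> coev) \<cdot> inv_ar C (runit C w)))"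
    using reassoc[OF assoc_inv_nat_ar[of k "Ident C D" "Ident C A" ?zA D A, symmetric]] by simp
  also have "(k \<boxtimes> Ident C (D \<otimes> A)) \<cdot> ((Ident C w \<boxtimes> coev) \<cdot> inv_ar C (runit C w))
     = (Ident C ?zA \<boxtimes> coev) \<cdot> ((k \<boxtimes> Ident C \<one>) \<cdot> inv_ar C (runit C w))"
    by (simp add: interchange_assoc)
  also have "(k \<boxtimes> Ident C \<one>) \<cdot> inv_ar C (runit C w) = inv_ar C (runit C ?zA) \<cdot> k"
    by (simp add: runit_inv_nat_ar)
  also have "inv_ar C (assoc C ?zA D A) \<cdot> ((Ident C ?zA \<boxtimes> coev) \<cdot> (inv_ar C (runit C ?zA) \<cdot> k)) = K \<cdot> k"
    by (simp add: K_def)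
  also have "?r (assoc C z A D) \<cdot> (K \<cdot> k) = inv_ar C (assoc C z (A \<otimes> D) A) \<cdot> (?z (inv_ar C (assoc C A D A)) \<cdot>
     (?z (Ident C A \<boxtimes> coev) \<cdot> (?z (inv_ar C (runit C A)) \<cdot> k)))"
    by (subst reassoc[OF rK]) simp_all
  also have "?r (?z ev) \<cdot> (inv_ar C (assoc C z (A \<otimes> D) A) \<cdot> (?z (inv_ar C (assoc C A D A)) \<cdot>
     (?z (Ident C A \<boxtimes> coev) \<cdot> (?z (inv_ar C (runit C A)) \<cdot> k))))
    = inv_ar C (assoc C z \<one> A) \<cdot> (?z (?r ev) \<cdot> (?z (inv_ar C (assoc C A D A)) \<cdot>
     (?z (Ident C A \<boxtimes> coev) \<cdot> (?z (inv_ar C (runit C A)) \<cdot> k))))"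
    using reassoc[OF assoc_inv_nat_ar[of "Ident C z" ev "Ident C A" z \<one> A, symmetric]] by simp
  also have "?r (runit C z) \<cdot> \<dots> = ?z (lunit C A) \<cdot> (?z (?r ev) \<cdot> (?z (inv_ar C (assoc C A D A)) \<cdot>
     (?z (Ident C A \<boxtimes> coev) \<cdot> (?z (inv_ar C (runit C A)) \<cdot> k))))"
    by (subst reassoc[OF l]) simp_all
  also have "\<dots> = k"
    by (simp add: interchange_assoc dd(4))
  finally show ?thesis .
qed

text \<open>The evaluation pairing identifies maps into the dual with maps from the tensor product to the unit.\<close>

lemma ev_injective:
  assumes d: "is_dual C A D coev ev" and A[simp]: "A \<in> Ob C"
    and f: "f \<in> hom C w D" and g: "g \<in> hom C w D"
    and e: "ev \<cdot> (Ident C A \<boxtimes> f) = ev \<cdot> (Ident C A \<boxtimes> g)"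
  shows "f = g"
proof -
  note dd = is_dualD[OF d A]
  note [simp] = dd(1) homD[OF dd(2)] homD[OF dd(3)] hom_ob[OF f]
  have rec: "runit C D \<cdot> ((Ident C D \<boxtimes> (ev \<cdot> (Ident C A \<boxtimes> h))) \<cdot> (assoc C D A w \<cdot> ((coev \<boxtimes> Ident C w) \<cdot> inv_ar C (lunit C w)))) = h"
    if h: "h \<in> hom C w D" for h
  proof -
    note [simp] = homD[OF h]
    have "runit C D \<cdot> ((Ident C D \<boxtimes> (ev \<cdot> (Ident C A \<boxtimes> h))) \<cdot> (assoc C D A w \<cdot> ((coev \<boxtimes> Ident C w) \<cdot> inv_ar C (lunit C w))))
      = runit C D \<cdot> ((Ident C D \<boxtimes> ev) \<cdot> ((Ident C D \<boxtimes> (Ident C A \<boxtimes> h)) \<cdot> (assoc C D A w \<cdot> ((coev \<boxtimes> Ident C w) \<cdot> inv_ar C (lunit C w)))))"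
      by (simp add: interchange_assoc)
    also have "(Ident C D \<boxtimes> (Ident C A \<boxtimes> h)) \<cdot> (assoc C D A w \<cdot> ((coev \<boxtimes> Ident C w) \<cdot> inv_ar C (lunit C w)))
      = assoc C D A D \<cdot> ((Ident C (D \<otimes> A) \<boxtimes> h) \<cdot> ((coev \<boxtimes> Ident C w) \<cdot> inv_ar C (lunit C w)))"
      using reassoc[OF assoc_nat_ar[of "Ident C D" "Ident C A" h D A D, symmetric]] by simp
    also have "(Ident C (D \<otimes> A) \<boxtimes> h) \<cdot> ((coev \<boxtimes> Ident C w) \<cdot> inv_ar C (lunit C w))
      = (coev \<boxtimes> Ident C D) \<cdot> ((Ident C \<one> \<boxtimes> h) \<cdot> inv_ar C (lunit C w))"
      by (simp add: interchange_assoc)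
    also have "(Ident C \<one> \<boxtimes> h) \<cdot> inv_ar C (lunit C w) = inv_ar C (lunit C D) \<cdot> h"
      by (simp add: lunit_inv_nat_ar)
    also have "runit C D \<cdot> ((Ident C D \<boxtimes> ev) \<cdot> (assoc C D A D \<cdot> ((coev \<boxtimes> Ident C D) \<cdot> (inv_ar C (lunit C D) \<cdot> h))))
      = (runit C D \<cdot> ((Ident C D \<boxtimes> ev) \<cdot> (assoc C D A D \<cdot> ((coev \<boxtimes> Ident C D) \<cdot> inv_ar C (lunit C D))))) \<cdot> h"
      by simp
    also have "\<dots> = h" unfolding dd(5) by simp
    finally show ?thesis .
  qed
  show ?thesis by (rule trans[OF rec[OF f, symmetric] rec[OF g, folded e]])
qed

lemma ev_surjective:
  assumes d: "is_dual C A D coev ev" and A[simp]: "A \<in> Ob C" and w[simp]: "w \<in> Ob C"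
    and g: "g \<in> hom C (A \<otimes> w) \<one>"
  obtains f where "f \<in> hom C w D" "ev \<cdot> (Ident C A \<boxtimes> f) = g"
proof
  note dd = is_dualD[OF d A]
  note [simp] = dd(1) homD[OF dd(2)] homD[OF dd(3)] homD[OF g] hom_ob[OF g]
  let ?g = "lhat coev A D w g"
  have G: "?g \<in> hom C w (D \<otimes> \<one>)" by (simp add: lhat_def hom_iff)
  note [simp] = homD[OF G]
  show "runit C D \<cdot> ?g \<in> hom C w D" by (simp add: hom_iff)
  have "ev \<cdot> (Ident C A \<boxtimes> (runit C D \<cdot> ?g)) = ev \<cdot> ((Ident C A \<boxtimes> runit C D) \<cdot> (Ident C A \<boxtimes> ?g))"
    by (simp add: interchange)
  also have "Ident C A \<boxtimes> runit C D = runit C (A \<otimes> D) \<cdot> inv_ar C (assoc C A D \<one>)"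
    by (rule iso_epi[of _ "assoc C A D \<one>"]) (simp_all add: assoc_runit)
  also have "ev \<cdot> (runit C (A \<otimes> D) \<cdot> inv_ar C (assoc C A D \<one>) \<cdot> (Ident C A \<boxtimes> ?g))
     = runit C \<one> \<cdot> ((ev \<boxtimes> Ident C \<one>) \<cdot> (inv_ar C (assoc C A D \<one>) \<cdot> (Ident C A \<boxtimes> ?g)))"
    using reassoc[OF runit_nat_ar[of ev \<one>, symmetric]] by simp
  also have "\<dots> = lunhat ev A D \<one> ?g" by (simp add: lunhat_def lunit_unit)
  also have "\<dots> = g" by (rule lunhat_lhat[OF d A w g])
  finally show "ev \<cdot> (Ident C A \<boxtimes> (runit C D \<cdot> ?g)) = g" .
qed

end


section \<open>Tensor products preserve colimits and limits\<close>

context category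
begin

lemma colimit_iso_diagram:
  assumes c: "is_colimit C J F v \<kappa>" and F: "diagram C J F" and G: "diagram C J G"
    and a: "\<And>j. j \<in> Ob J \<Longrightarrow> \<alpha> j \<in> hom C (OM G j) (OM F j)" "\<And>j. j \<in> Ob J \<Longrightarrow> is_iso C (\<alpha> j)"
    and nat: "\<And>m. m \<in> Ar J \<Longrightarrow> \<alpha> (Cod J m) \<cdot> AM G m = AM F m \<cdot> \<alpha> (Dom J m)"
  shows "is_colimit C J G v (\<lambda>j. \<kappa> j \<cdot> \<alpha> j)"
  unfolding is_colimit_def
proof (intro conjI allI impI)
  note [simp] = is_colimitD(1)[OF c] homD[OF is_colimitD(2)[OF c]] homD[OF a(1)] a(2)
    homD[OF diagramD(4)[OF F]] homD[OF diagramD(4)[OF G]] diagramD(2,3)[OF F]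
  show "is_cocone C J G v (\<lambda>j. \<kappa> j \<cdot> \<alpha> j)"
    using reassoc[OF is_colimitD(3)[OF c]] by (simp add: is_cocone_def hom_iff nat)
  fix w \<tau> assume t: "is_cocone C J G w \<tau>"
  then have th: "\<And>j. j \<in> Ob J \<Longrightarrow> \<tau> j \<in> hom C (OM G j) w" and tn: "\<And>m. m \<in> Ar J \<Longrightarrow> \<tau> (Cod J m) \<cdot> AM G m = \<tau> (Dom J m)"
    and [simp]: "w \<in> Ob C"
    by (auto simp: is_cocone_def)
  note [simp] = homD[OF th]
  have "inv_ar C (\<alpha> (Cod J m)) \<cdot> AM F m = AM G m \<cdot> inv_ar C (\<alpha> (Dom J m))" if m: "m \<in> Ar J" for m
  proof (rule iso_mono[of "\<alpha> (Cod J m)"])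
    show "\<alpha> (Cod J m) \<cdot> (inv_ar C (\<alpha> (Cod J m)) \<cdot> AM F m) = \<alpha> (Cod J m) \<cdot> (AM G m \<cdot> inv_ar C (\<alpha> (Dom J m)))"
      using m reassoc[OF nat[OF m], of "inv_ar C (\<alpha> (Dom J m))"] by simp
  qed (use m in simp_all)
  then have t': "is_cocone C J F w (\<lambda>j. \<tau> j \<cdot> inv_ar C (\<alpha> j))"
    using reassoc[OF tn] by (simp add: is_cocone_def hom_iff)
  obtain u where u: "u \<in> hom C v w" and e: "\<And>j. j \<in> Ob J \<Longrightarrow> u \<cdot> \<kappa> j = \<tau> j \<cdot> inv_ar C (\<alpha> j)"
    using is_colimit_ex[OF c t'] by blast
  show "\<exists>!u. u \<in> hom C v w \<and> (\<forall>j \<in> Ob J. u \<cdot> (\<kappa> j \<cdot> \<alpha> j) = \<tau> j)"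
  proof (rule ex1I[of _ u])
    show "u \<in> hom C v w \<and> (\<forall>j \<in> Ob J. u \<cdot> (\<kappa> j \<cdot> \<alpha> j) = \<tau> j)"
      using u reassoc[OF e] homD[OF u] by simp
    fix y assume y: "y \<in> hom C v w \<and> (\<forall>j \<in> Ob J. y \<cdot> (\<kappa> j \<cdot> \<alpha> j) = \<tau> j)"
    note [simp] = homD[OF conjunct1[OF y]]
    show "y = u"
    proof (rule is_colimit_unique[OF c t'])
      fix j assume j: "j \<in> Ob J"
      show "y \<cdot> \<kappa> j = \<tau> j \<cdot> inv_ar C (\<alpha> j)"
        by (rule iso_epi[of _ "\<alpha> j"]) (use y j in simp_all)
    qed (use y u e in simp_all)
  qed
qed

lemma limit_iso_diagram:
  assumes c: "is_limit C J F v \<pi>" and F: "diagram C J F" and G: "diagram C J G"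
    and a: "\<And>j. j \<in> Ob J \<Longrightarrow> \<alpha> j \<in> hom C (OM F j) (OM G j)" "\<And>j. j \<in> Ob J \<Longrightarrow> is_iso C (\<alpha> j)"
    and nat: "\<And>m. m \<in> Ar J \<Longrightarrow> \<alpha> (Cod J m) \<cdot> AM F m = AM G m \<cdot> \<alpha> (Dom J m)"
  shows "is_limit C J G v (\<lambda>j. \<alpha> j \<cdot> \<pi> j)"
proof -
  interpret O: category "opc C" by (rule category_opc[OF category_axioms])
  show ?thesis
    using O.colimit_iso_diagram[of "opc J" F v \<pi> G \<alpha>] assms
    by (simp add: is_limit_opc diagram_opc is_iso_opc)
qed

end

locale rigid_category = symmetric_monoidal_category C
  for C :: "('o, 'a, 'e) smcat_scheme" (structure) +
  assumes duals: "has_duals C"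
begin

definition ltens :: "'o \<Rightarrow> ('j, 'm, 'o, 'a) fct \<Rightarrow> ('j, 'm, 'o, 'a) fct" where
  "ltens A F = \<lparr>OM = (\<lambda>j. A \<otimes> OM F j), AM = (\<lambda>m. Ident C A \<boxtimes> AM F m)\<rparr>"

definition rtens :: "('j, 'm, 'o, 'a) fct \<Rightarrow> 'o \<Rightarrow> ('j, 'm, 'o, 'a) fct" where
  "rtens F A = \<lparr>OM = (\<lambda>j. OM F j \<otimes> A), AM = (\<lambda>m. AM F m \<boxtimes> Ident C A)\<rparr>"

lemma tens_sel [simp]:
  "OM (ltens A F) j = A \<otimes> OM F j" "AM (ltens A F) m = Ident C A \<boxtimes> AM F m"
  "OM (rtens F A) j = OM F j \<otimes> A" "AM (rtens F A) m = AM F m \<boxtimes> Ident C A"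
  by (simp_all add: ltens_def rtens_def)

lemma diagram_tens:
  assumes "diagram C J F" "A \<in> Ob C"
  shows "diagram C J (ltens A F)" "diagram C J (rtens F A)"
  using assms homD[OF diagramD(4)[OF assms(1)]] by (simp_all add: diagram_def hom_iff)

text \<open>Tensoring with \<open>A\<close> is left adjoint to tensoring with its dual, so it preserves colimits.\<close>

lemma ltens_colimit:
  assumes c: "is_colimit C J F v \<kappa>" and F: "diagram C J F" and A[simp]: "A \<in> Ob C"
  shows "is_colimit C J (ltens A F) (A \<otimes> v) (\<lambda>j. Ident C A \<boxtimes> \<kappa> j)"
  unfolding is_colimit_def
proof (intro conjI allI impI)
  note [simp] = is_colimitD(1)[OF c] homD[OF is_colimitD(2)[OF c]]
    homD[OF diagramD(4)[OF F]] diagramD(1,2,3)[OF F]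
  obtain D coev ev where d: "is_dual C A D coev ev" using duals A unfolding has_duals_def by blast
  note dd = is_dualD[OF d A]
  note [simp] = dd(1) homD[OF dd(2)] homD[OF dd(3)]
  show "is_cocone C J (ltens A F) (A \<otimes> v) (\<lambda>j. Ident C A \<boxtimes> \<kappa> j)"
    using is_colimitD(3)[OF c] by (simp add: is_cocone_def hom_iff interchange)
  have lhat_hom: "lhat coev A D w g \<in> hom C w (D \<otimes> z)" if w: "w \<in> Ob C" and g: "g \<in> hom C (A \<otimes> w) z" for w g z
    using homD[OF g] w by (simp add: lhat_def hom_iff)
  have lhat_nat: "lhat coev A D w g \<cdot> h = lhat coev A D (Dom C h) (g \<cdot> (Ident C A \<boxtimes> h))"
    if g: "g \<in> hom C (A \<otimes> w) z" and h: "h \<in> hom C w' w" for w w' g z h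
  proof -
    note [simp] = homD[OF g] homD[OF h] hom_ob[OF h]
    have "lhat coev A D w g \<cdot> h = (Ident C D \<boxtimes> g) \<cdot> (assoc C D A w \<cdot> ((coev \<boxtimes> Ident C w) \<cdot> ((Ident C \<one> \<boxtimes> h) \<cdot> inv_ar C (lunit C w'))))"
      by (simp add: lhat_def lunit_inv_nat_ar)
    also have "\<dots> = (Ident C D \<boxtimes> g) \<cdot> (assoc C D A w \<cdot> ((Ident C (D \<otimes> A) \<boxtimes> h) \<cdot> ((coev \<boxtimes> Ident C w') \<cdot> inv_ar C (lunit C w'))))"
      by (simp add: interchange_assoc)
    also have "\<dots> = (Ident C D \<boxtimes> g) \<cdot> ((Ident C D \<boxtimes> (Ident C A \<boxtimes> h)) \<cdot> (assoc C D A w' \<cdot> ((coev \<boxtimes> Ident C w') \<cdot> inv_ar C (lunit C w'))))"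
      using reassoc[OF assoc_nat_ar[of "Ident C D" "Ident C A" h D A w]] by simp
    finally show ?thesis by (simp add: lhat_def interchange_assoc)
  qed
  have lunhat_nat: "lunhat ev A D z k \<cdot> (Ident C A \<boxtimes> h) = lunhat ev A D z (k \<cdot> h)"
    if k: "k \<in> hom C w (D \<otimes> z)" and z: "z \<in> Ob C" and h: "h \<in> hom C w' w" for k w z h w'
    using homD[OF k] homD[OF h] hom_ob[OF h] hom_ob[OF k] z by (simp add: lunhat_def interchange)
  have lunhat_hom: "lunhat ev A D z k \<in> hom C (A \<otimes> w) z" if k: "k \<in> hom C w (D \<otimes> z)" and z: "z \<in> Ob C" for w k z
    using homD[OF k] hom_ob[OF k] z by (simp add: lunhat_def hom_iff)
  fix w \<tau> assume t: "is_cocone C J (ltens A F) w \<tau>"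
  then have th: "\<And>j. j \<in> Ob J \<Longrightarrow> \<tau> j \<in> hom C (A \<otimes> OM F j) w"
    and tn: "\<And>m. m \<in> Ar J \<Longrightarrow> \<tau> (Cod J m) \<cdot> (Ident C A \<boxtimes> AM F m) = \<tau> (Dom J m)"
    and [simp]: "w \<in> Ob C"
    by (auto simp: is_cocone_def)
  note [simp] = homD[OF th]
  have t': "is_cocone C J F (D \<otimes> w) (\<lambda>j. lhat coev A D (OM F j) (\<tau> j))"
    unfolding is_cocone_def
  proof (intro conjI ballI)
    fix m assume m: "m \<in> Ar J"
    show "lhat coev A D (OM F (Cod J m)) (\<tau> (Cod J m)) \<cdot> AM F m = lhat coev A D (OM F (Dom J m)) (\<tau> (Dom J m))"
      using m tn[OF m] by (subst lhat_nat[OF th diagramD(4)[OF F]]) simp_all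
  qed (simp_all add: lhat_hom th)
  obtain u where u: "u \<in> hom C v (D \<otimes> w)" and e: "\<And>j. j \<in> Ob J \<Longrightarrow> u \<cdot> \<kappa> j = lhat coev A D (OM F j) (\<tau> j)"
    using is_colimit_ex[OF c t'] by blast
  show "\<exists>!y. y \<in> hom C (A \<otimes> v) w \<and> (\<forall>j \<in> Ob J. y \<cdot> (Ident C A \<boxtimes> \<kappa> j) = \<tau> j)"
  proof (rule ex1I[of _ "lunhat ev A D w u"])
    show "lunhat ev A D w u \<in> hom C (A \<otimes> v) w \<and> (\<forall>j \<in> Ob J. lunhat ev A D w u \<cdot> (Ident C A \<boxtimes> \<kappa> j) = \<tau> j)"
    proof (intro conjI ballI)
      fix j assume j: "j \<in> Ob J"
      show "lunhat ev A D w u \<cdot> (Ident C A \<boxtimes> \<kappa> j) = \<tau> j"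
        using j lunhat_lhat[OF d A _ th[OF j]]
        by (subst lunhat_nat[OF u _ is_colimitD(2)[OF c]]) (simp_all add: e)
    qed (rule lunhat_hom[OF u], simp)
    fix y assume y: "y \<in> hom C (A \<otimes> v) w \<and> (\<forall>j \<in> Ob J. y \<cdot> (Ident C A \<boxtimes> \<kappa> j) = \<tau> j)"
    note y1 = conjunct1[OF y]
    have "lhat coev A D v y = u"
    proof (rule is_colimit_unique[OF c t'])
      fix j assume j: "j \<in> Ob J"
      show "lhat coev A D v y \<cdot> \<kappa> j = lhat coev A D (OM F j) (\<tau> j)"
        using j y by (subst lhat_nat[OF y1 is_colimitD(2)[OF c]]) simp_all
    qed (use u e lhat_hom[OF _ y1] in simp_all)
    then show "y = lunhat ev A D w u" using lunhat_lhat[OF d A _ y1] by simp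
  qed
qed

lemma rtens_colimit:
  assumes c: "is_colimit C J F v \<kappa>" and F: "diagram C J F" and A[simp]: "A \<in> Ob C"
  shows "is_colimit C J (rtens F A) (v \<otimes> A) (\<lambda>j. \<kappa> j \<boxtimes> Ident C A)"
proof -
  note [simp] = is_colimitD(1)[OF c] homD[OF is_colimitD(2)[OF c]]
    homD[OF diagramD(4)[OF F]] diagramD(1,2,3)[OF F]
  have "is_colimit C J (rtens F A) (A \<otimes> v) (\<lambda>j. (Ident C A \<boxtimes> \<kappa> j) \<cdot> braid C (OM F j) A)"
    by (rule colimit_iso_diagram[OF ltens_colimit[OF c F A] diagram_tens[OF F A]])
      (simp_all add: hom_iff braid_nat_ar)
  then show ?thesis
    by (rule colimit_iso_vertex[OF _ diagram_tens(2)[OF F A], of _ _ "braid C A v"])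
      (simp_all add: hom_iff reassoc[OF braid_nat_ar])
qed

text \<open>Tensoring with \<open>A\<close> is also right adjoint to tensoring with its dual, so it preserves limits.\<close>

lemma rtens_limit:
  assumes c: "is_limit C J F v \<pi>" and F: "diagram C J F" and A[simp]: "A \<in> Ob C"
  shows "is_limit C J (rtens F A) (v \<otimes> A) (\<lambda>j. \<pi> j \<boxtimes> Ident C A)"
  unfolding is_limit_def
proof (intro conjI allI impI)
  note [simp] = is_limitD(1)[OF c] homD[OF is_limitD(2)[OF c]]
    homD[OF diagramD(4)[OF F]] diagramD(1,2,3)[OF F]
  obtain D coev ev where d: "is_dual C A D coev ev" using duals A unfolding has_duals_def by blast
  note dd = is_dualD[OF d A]
  note [simp] = dd(1) homD[OF dd(2)] homD[OF dd(3)]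
  show "is_cone C J (rtens F A) (v \<otimes> A) (\<lambda>j. \<pi> j \<boxtimes> Ident C A)"
    using is_limitD(3)[OF c] by (simp add: is_cone_def hom_iff interchange)
  have rhat_hom: "rhat ev A D z k \<in> hom C (w \<otimes> D) z" if z: "z \<in> Ob C" and k: "k \<in> hom C w (z \<otimes> A)" for w k z
    using homD[OF k] hom_ob[OF k] z by (simp add: rhat_def hom_iff)
  have rhat_nat: "h \<cdot> rhat ev A D z k = rhat ev A D (Cod C h) ((h \<boxtimes> Ident C A) \<cdot> k)"
    if k: "k \<in> hom C w (z \<otimes> A)" and h: "h \<in> hom C z z'" for w z z' k h
  proof -
    note [simp] = homD[OF k] homD[OF h] hom_ob[OF h] hom_ob[OF k]
    have "rhat ev A D z' ((h \<boxtimes> Ident C A) \<cdot> k) = runit C z' \<cdot> ((Ident C z' \<boxtimes> ev) \<cdot> (assoc C z' A D \<cdot> ((h \<boxtimes> Ident C A \<boxtimes> Ident C D) \<cdot> (k \<boxtimes> Ident C D))))"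
      by (simp add: rhat_def interchange)
    also have "\<dots> = runit C z' \<cdot> ((Ident C z' \<boxtimes> ev) \<cdot> ((h \<boxtimes> Ident C (A \<otimes> D)) \<cdot> (assoc C z A D \<cdot> (k \<boxtimes> Ident C D))))"
      using reassoc[OF assoc_nat_ar[of h "Ident C A" "Ident C D" z' A D]] by simp
    also have "\<dots> = runit C z' \<cdot> ((h \<boxtimes> Ident C \<one>) \<cdot> ((Ident C z \<boxtimes> ev) \<cdot> (assoc C z A D \<cdot> (k \<boxtimes> Ident C D))))"
      by (simp add: interchange_assoc)
    also have "\<dots> = h \<cdot> rhat ev A D z k"
      using reassoc[OF runit_nat_ar[of h z']] by (simp add: rhat_def)
    finally show ?thesis by simp
  qed
  have runhat_nat: "(h \<boxtimes> Ident C A) \<cdot> runhat coev A D w k = runhat coev A D w (h \<cdot> k)"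
    if k: "k \<in> hom C (w \<otimes> D) z" and w: "w \<in> Ob C" and h: "h \<in> hom C z z'" for k w z h z'
    using homD[OF k] homD[OF h] hom_ob[OF h] hom_ob[OF k] w by (simp add: runhat_def interchange_assoc)
  have runhat_hom: "runhat coev A D w k \<in> hom C w (z \<otimes> A)" if k: "k \<in> hom C (w \<otimes> D) z" and w: "w \<in> Ob C" for w k z
    using homD[OF k] hom_ob[OF k] w by (simp add: runhat_def hom_iff)
  fix w \<tau> assume t: "is_cone C J (rtens F A) w \<tau>"
  then have th: "\<And>j. j \<in> Ob J \<Longrightarrow> \<tau> j \<in> hom C w (OM F j \<otimes> A)"
    and tn: "\<And>m. m \<in> Ar J \<Longrightarrow> (AM F m \<boxtimes> Ident C A) \<cdot> \<tau> (Dom J m) = \<tau> (Cod J m)"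
    and [simp]: "w \<in> Ob C"
    by (auto simp: is_cone_def)
  note [simp] = homD[OF th]
  have t': "is_cone C J F (w \<otimes> D) (\<lambda>j. rhat ev A D (OM F j) (\<tau> j))"
    unfolding is_cone_def
  proof (intro conjI ballI)
    fix m assume m: "m \<in> Ar J"
    show "AM F m \<cdot> rhat ev A D (OM F (Dom J m)) (\<tau> (Dom J m)) = rhat ev A D (OM F (Cod J m)) (\<tau> (Cod J m))"
      using m tn[OF m] by (subst rhat_nat[OF th diagramD(4)[OF F]]) simp_all
  qed (simp_all add: rhat_hom th)
  obtain u where u: "u \<in> hom C (w \<otimes> D) v" and e: "\<And>j. j \<in> Ob J \<Longrightarrow> \<pi> j \<cdot> u = rhat ev A D (OM F j) (\<tau> j)"
    using is_limit_ex[OF c t'] by blast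
  show "\<exists>!y. y \<in> hom C w (v \<otimes> A) \<and> (\<forall>j \<in> Ob J. (\<pi> j \<boxtimes> Ident C A) \<cdot> y = \<tau> j)"
  proof (rule ex1I[of _ "runhat coev A D w u"])
    show "runhat coev A D w u \<in> hom C w (v \<otimes> A) \<and> (\<forall>j \<in> Ob J. (\<pi> j \<boxtimes> Ident C A) \<cdot> runhat coev A D w u = \<tau> j)"
    proof (intro conjI ballI)
      fix j assume j: "j \<in> Ob J"
      show "(\<pi> j \<boxtimes> Ident C A) \<cdot> runhat coev A D w u = \<tau> j"
        using j runhat_rhat[OF d A _ th[OF j]]
        by (subst runhat_nat[OF u _ is_limitD(2)[OF c]]) (simp_all add: e)
    qed (rule runhat_hom[OF u], simp)
    fix y assume y: "y \<in> hom C w (v \<otimes> A) \<and> (\<forall>j \<in> Ob J. (\<pi> j \<boxtimes> Ident C A) \<cdot> y = \<tau> j)"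
    note y1 = conjunct1[OF y]
    have "rhat ev A D v y = u"
    proof (rule is_limit_unique[OF c t'])
      fix j assume j: "j \<in> Ob J"
      show "\<pi> j \<cdot> rhat ev A D v y = rhat ev A D (OM F j) (\<tau> j)"
        using j y by (subst rhat_nat[OF y1 is_limitD(2)[OF c]]) simp_all
    qed (use u e rhat_hom[OF _ y1] in simp_all)
    then show "y = runhat coev A D w u" using runhat_rhat[OF d A _ y1] by simp
  qed
qed

lemma ltens_limit:
  assumes c: "is_limit C J F v \<pi>" and F: "diagram C J F" and A[simp]: "A \<in> Ob C"
  shows "is_limit C J (ltens A F) (A \<otimes> v) (\<lambda>j. Ident C A \<boxtimes> \<pi> j)"
proof -
  note [simp] = is_limitD(1)[OF c] homD[OF is_limitD(2)[OF c]]
    homD[OF diagramD(4)[OF F]] diagramD(1,2,3)[OF F]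
  have "is_limit C J (ltens A F) (v \<otimes> A) (\<lambda>j. braid C (OM F j) A \<cdot> (\<pi> j \<boxtimes> Ident C A))"
    by (rule limit_iso_diagram[OF rtens_limit[OF c F A] diagram_tens(2,1)[OF F A]])
      (simp_all add: hom_iff braid_nat_ar)
  then show ?thesis
    by (rule limit_iso_vertex[OF _ diagram_tens(1)[OF F A], of _ _ "braid C A v"])
      (simp_all add: hom_iff braid_nat_ar)
qed

end


section \<open>Zero object\<close>

text \<open>The discrete category: an object also serves as its identity arrow.\<close>

definition disc :: "'i set \<Rightarrow> ('i, 'i) cat" where
  "disc S = \<lparr>Ob = S, Ar = S, Dom = (\<lambda>s. s), Cod = (\<lambda>s. s), Ident = (\<lambda>s. s), Comp = (\<lambda>s t. t)\<rparr>"

definition cst :: "('o, 'a, 'e) cat_scheme \<Rightarrow> 'o \<Rightarrow> ('j, 'm, 'o, 'a) fct" where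
  "cst C A = \<lparr>OM = (\<lambda>_. A), AM = (\<lambda>_. Ident C A)\<rparr>"

lemma disc_sel [simp]: "Ob (disc S) = S" "Ar (disc S) = S" "Dom (disc S) s = s" "Cod (disc S) s = s"
  and cst_sel [simp]: "OM (cst C A) j = A" "AM (cst C A) m = Ident C A"
  by (simp_all add: disc_def cst_def)

lemma hom_disc: "hom (disc S) s t = (if s \<in> S \<and> s = t then {s} else {})"
  by (auto simp: hom_def)

lemma groupoid_disc: "groupoid (disc S)"
proof
  show "is_iso (disc S) f" if "f \<in> Ar (disc S)" for f
    using that by (auto simp: is_iso_def inverse_arrows_def hom_def disc_def)
qed (auto simp: hom_def disc_def)

lemma ess_finite_disc: "finite S \<Longrightarrow> ess_finite_groupoid (disc S)"
  unfolding ess_finite_groupoid_def using groupoid_disc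
  by (auto simp: hom_disc intro!: finite_quotient)

context category
begin

lemma diagram_cst: "A \<in> Ob C \<Longrightarrow> diagram C (disc S) (cst C A)"
  by (simp add: diagram_def hom_iff)

lemma disc_cocone:
  assumes "A \<in> Ob C"
  shows "is_cocone C (disc S) (cst C A) v \<kappa> \<longleftrightarrow> v \<in> Ob C \<and> (\<forall>s \<in> S. \<kappa> s \<in> hom C A v)"
  using assms by (auto simp: is_cocone_def homD)

lemma disc_cone:
  assumes "A \<in> Ob C"
  shows "is_cone C (disc S) (cst C A) v \<pi> \<longleftrightarrow> v \<in> Ob C \<and> (\<forall>s \<in> S. \<pi> s \<in> hom C v A)"
  using assms by (auto simp: is_cone_def homD)

end

locale fin_cocomplete_rigid = rigid_category C
  for C :: "('o, 'a, 'e) smcat_scheme" (structure) and U :: "'u::infinite itself" +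
  assumes colimits: "has_ess_finite_colimits U C"
begin

lemma finite_inj_ex:
  assumes "finite S"
  shows "\<exists>e :: 'i \<Rightarrow> 'u. inj_on e S"
proof -
  obtain T :: "'u set" where T: "finite T" "card T = card S"
    using infinite_arbitrarily_large[OF infinite_UNIV, of "card S"] by metis
  then show ?thesis using finite_same_card_bij[OF assms T(1)] by (auto simp: bij_betw_def)
qed

text \<open>The index set is transported along an embedding into the infinite type \<open>'u\<close>, whose groupoids
  have colimits.\<close>

lemma copower_ex:
  assumes A: "A \<in> Ob C" and S: "finite (S :: 'i set)"
  shows "\<exists>v \<kappa>. is_colimit C (disc S) (cst C A) v \<kappa>"
proof -
  obtain e :: "'i \<Rightarrow> 'u" where e: "inj_on e S" using finite_inj_ex[OF S] by blast
  let ?F = "\<lparr>OM = (\<lambda>x \<in> e ` S. A), AM = (\<lambda>x \<in> e ` S. Ident C A)\<rparr> :: ('u, 'u, 'o, 'a) fct"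
  have "is_functor (disc (e ` S)) C ?F"
    using A groupoid_disc[of "e ` S"] category_axioms
    by (auto simp: is_functor_def groupoid_def disc_def)
  then obtain v \<kappa> where c: "is_colimit C (disc (e ` S)) ?F v \<kappa>"
    using colimits ess_finite_disc[of "e ` S"] S unfolding has_ess_finite_colimits_def by blast
  have co: "is_cocone C (disc (e ` S)) ?F w \<tau> \<longleftrightarrow> is_cocone C (disc S) (cst C A) w (\<lambda>s. \<tau> (e s))" for w \<tau>
    by (auto simp: is_cocone_def)
  have "is_colimit C (disc S) (cst C A) v (\<lambda>s. \<kappa> (e s))"
    unfolding is_colimit_def
  proof (intro conjI allI impI)
    show "is_cocone C (disc S) (cst C A) v (\<lambda>s. \<kappa> (e s))" using is_colimit_cocone[OF c] co by simp
    fix w \<tau> assume t: "is_cocone C (disc S) (cst C A) w \<tau>"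
    have "is_cocone C (disc S) (cst C A) w (\<lambda>s. \<tau> (the_inv_into S e (e s)))"
      using t the_inv_into_f_f[OF e] by (auto simp: is_cocone_def)
    then have "is_cocone C (disc (e ` S)) ?F w (\<lambda>x. \<tau> (the_inv_into S e x))" using co by simp
    then have "\<exists>!u. u \<in> hom C v w \<and> (\<forall>j \<in> e ` S. u \<cdot> \<kappa> j = \<tau> (the_inv_into S e j))"
      using c[unfolded is_colimit_def, THEN conjunct2, rule_format] by simp
    then show "\<exists>!u. u \<in> hom C v w \<and> (\<forall>j \<in> Ob (disc S). u \<cdot> \<kappa> (e j) = \<tau> j)"
      using the_inv_into_f_f[OF e] by simp
  qed
  then show ?thesis by blast
qed

definition initial :: "'o \<Rightarrow> bool" where
  "initial K \<longleftrightarrow> K \<in> Ob C \<and> (\<forall>w \<in> Ob C. \<exists>!u. u \<in> hom C K w)"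

definition terminal :: "'o \<Rightarrow> bool" where
  "terminal K \<longleftrightarrow> K \<in> Ob C \<and> (\<forall>w \<in> Ob C. \<exists>!u. u \<in> hom C w K)"

lemma initial_colimit: "initial v \<longleftrightarrow> is_colimit C (disc ({} :: unit set)) F v \<kappa>"
  by (auto simp: initial_def is_colimit_def is_cocone_def)

lemma terminal_limit: "terminal v \<longleftrightarrow> is_limit C (disc ({} :: unit set)) F v \<pi>"
  by (auto simp: terminal_def is_limit_def is_cone_def)

lemma initial_tens: "\<lbrakk>initial K; A \<in> Ob C\<rbrakk> \<Longrightarrow> initial (A \<otimes> K)" "\<lbrakk>initial K; A \<in> Ob C\<rbrakk> \<Longrightarrow> initial (K \<otimes> A)"
  using ltens_colimit[of "disc ({} :: unit set)" "cst C \<one>" K undefined A]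
    rtens_colimit[of "disc ({} :: unit set)" "cst C \<one>" K undefined A] diagram_cst[of \<one>]
  by (auto simp flip: initial_colimit)

lemma terminal_tens: "\<lbrakk>terminal K; A \<in> Ob C\<rbrakk> \<Longrightarrow> terminal (A \<otimes> K)"
  using ltens_limit[of "disc ({} :: unit set)" "cst C \<one>" K undefined A] diagram_cst[of \<one>]
  by (auto simp flip: terminal_limit)

text \<open>Let \<open>N\<close> be initial with dual \<open>D\<close>. Maps from \<open>w\<close> to \<open>D\<close> correspond to maps from \<open>N \<otimes> w\<close> to the unit, and
  \<open>N \<otimes> w\<close> is initial, so \<open>D\<close> is terminal. Tensoring preserves both properties, so \<open>N \<otimes> D\<close> is a zero object.\<close>

lemma zero_object_ex: "\<exists>Z. initial Z \<and> terminal Z"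
proof -
  obtain N where N: "initial N"
    using copower_ex[OF unit_ob, of "{} :: unit set"] initial_colimit by blast
  then have [simp]: "N \<in> Ob C" by (simp add: initial_def)
  obtain D coev ev where d: "is_dual C N D coev ev"
    using duals \<open>N \<in> Ob C\<close> unfolding has_duals_def by blast
  note dd = is_dualD[OF d \<open>N \<in> Ob C\<close>]
  have "terminal D"
    unfolding terminal_def
  proof (intro conjI ballI)
    fix w assume [simp]: "w \<in> Ob C"
    have i: "initial (N \<otimes> w)" using initial_tens(2)[OF N] by simp
    then obtain g where "g \<in> hom C (N \<otimes> w) \<one>" unfolding initial_def using unit_ob by blast
    then obtain f where f: "f \<in> hom C w D" using ev_surjective[OF d] by (metis \<open>N \<in> Ob C\<close> \<open>w \<in> Ob C\<close>)
    show "\<exists>!u. u \<in> hom C w D"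
    proof (rule ex1I)
      show "f \<in> hom C w D" by (rule f)
      fix h assume h: "h \<in> hom C w D"
      note [simp] = homD[OF f] homD[OF h] homD[OF dd(3)]
      have "ev \<cdot> (Ident C N \<boxtimes> h) \<in> hom C (N \<otimes> w) \<one>" "ev \<cdot> (Ident C N \<boxtimes> f) \<in> hom C (N \<otimes> w) \<one>"
        by (simp_all add: hom_iff)
      then have "ev \<cdot> (Ident C N \<boxtimes> h) = ev \<cdot> (Ident C N \<boxtimes> f)"
        using i unit_ob unfolding initial_def by blast
      then show "h = f" by (rule ev_injective[OF d _ h f, rotated]) simp
    qed
  qed (rule dd(1))
  then have "initial (N \<otimes> D) \<and> terminal (N \<otimes> D)"
    using initial_tens(2)[OF N dd(1)] terminal_tens by simp
  then show ?thesis by blast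
qed

definition zero_ob :: 'o where "zero_ob = (SOME Z. initial Z \<and> terminal Z)"

lemma zero_ob: "initial zero_ob" "terminal zero_ob"
  using someI_ex[OF zero_object_ex] by (simp_all add: zero_ob_def)

definition zer :: "'o \<Rightarrow> 'o \<Rightarrow> 'a" where
  "zer A B = (THE v. v \<in> hom C zero_ob B) \<cdot> (THE u. u \<in> hom C A zero_ob)"

text \<open>An arrow that factors through any initial object is zero, since that object is isomorphic to the
  chosen zero object.\<close>

lemma zer_eqI:
  assumes u: "u \<in> hom C A K" and v: "v \<in> hom C K B" and K: "initial K"
  shows "v \<cdot> u = zer A B"
proof -
  have A: "A \<in> Ob C" and B: "B \<in> Ob C" and K': "K \<in> Ob C" using hom_ob[OF u] hom_ob[OF v] by auto
  have ex: "\<exists>!v. v \<in> hom C zero_ob B" "\<exists>!u. u \<in> hom C A zero_ob" "\<exists>!u. u \<in> hom C K zero_ob"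
    using zero_ob A B K' by (auto simp: initial_def terminal_def)
  obtain k where k: "k \<in> hom C K zero_ob" using ex(3) by blast
  let ?v = "THE v. v \<in> hom C zero_ob B" and ?u = "THE u. u \<in> hom C A zero_ob"
  have v': "?v \<in> hom C zero_ob B" and u': "?u \<in> hom C A zero_ob" using theI'[OF ex(1)] theI'[OF ex(2)] by auto
  note [simp] = homD[OF u] homD[OF v] homD[OF k] homD[OF v'] homD[OF u']
  have "?v \<cdot> k \<in> hom C K B" by (rule comp_hom[OF k v'])
  then have "v = ?v \<cdot> k" using v K B unfolding initial_def by blast
  moreover have "k \<cdot> u \<in> hom C A zero_ob" by (rule comp_hom[OF u k])
  then have "k \<cdot> u = ?u" using u' ex(2) by blast
  ultimately show ?thesis by (simp add: zer_def)
qed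

lemma zer_factor:
  assumes "A \<in> Ob C" "B \<in> Ob C"
  obtains u v where "u \<in> hom C A zero_ob" "v \<in> hom C zero_ob B" "v \<cdot> u = zer A B"
proof -
  obtain u v where u: "u \<in> hom C A zero_ob" and v: "v \<in> hom C zero_ob B"
    using zero_ob assms unfolding initial_def terminal_def by blast
  then show thesis using that zer_eqI[OF u v zero_ob(1)] by blast
qed

lemma zer_hom [intro]: "\<lbrakk>A \<in> Ob C; B \<in> Ob C\<rbrakk> \<Longrightarrow> zer A B \<in> hom C A B"
  using zer_factor comp_hom by metis

lemma zer_ar [simp]:
  assumes "A \<in> Ob C" "B \<in> Ob C"
  shows "zer A B \<in> Ar C" "Dom C (zer A B) = A" "Cod C (zer A B) = B" "into (zer A B) D \<longleftrightarrow> B = D"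
  using homD[OF zer_hom[OF assms]] by auto

lemma zer_comp [simp]:
  assumes A: "A \<in> Ob C" and B: "B \<in> Ob C"
  shows "\<lbrakk>g \<in> Ar C; Dom C g = B\<rbrakk> \<Longrightarrow> g \<cdot> zer A B = zer A (Cod C g)"
    and "into f A \<Longrightarrow> zer A B \<cdot> f = zer (Dom C f) B"
proof -
  obtain u v where u: "u \<in> hom C A zero_ob" and v: "v \<in> hom C zero_ob B" and e: "v \<cdot> u = zer A B"
    using zer_factor[OF A B] by blast
  note [simp] = homD[OF u] homD[OF v]
  show "g \<cdot> zer A B = zer A (Cod C g)" if [simp]: "g \<in> Ar C" "Dom C g = B"
    using zer_eqI[OF u _ zero_ob(1), of "g \<cdot> v" "Cod C g"] by (simp add: hom_iff flip: e)
  show "zer A B \<cdot> f = zer (Dom C f) B" if f: "into f A"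
    using zer_eqI[OF _ v zero_ob(1), of "u \<cdot> f" "Dom C f"] f by (simp add: hom_iff into_def flip: e)
qed

lemma tens_zer [simp]:
  assumes f[simp]: "f \<in> Ar C" and [simp]: "A \<in> Ob C" "B \<in> Ob C"
  shows "f \<boxtimes> zer A B = zer (Dom C f \<otimes> A) (Cod C f \<otimes> B)" "zer A B \<boxtimes> f = zer (A \<otimes> Dom C f) (B \<otimes> Cod C f)"
proof -
  obtain u v where u: "u \<in> hom C A zero_ob" and v: "v \<in> hom C zero_ob B" and e: "v \<cdot> u = zer A B"
    using zer_factor[of A B] by auto
  note [simp] = homD[OF u] homD[OF v] zero_ob(1) hom_ob[OF u]
  have "f \<boxtimes> zer A B = (f \<boxtimes> v) \<cdot> (Ident C (Dom C f) \<boxtimes> u)" by (simp add: interchange e)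
  also have "\<dots> = zer (Dom C f \<otimes> A) (Cod C f \<otimes> B)"
    by (rule zer_eqI[of _ _ "Dom C f \<otimes> zero_ob"]) (simp_all add: hom_iff initial_tens)
  finally show "f \<boxtimes> zer A B = zer (Dom C f \<otimes> A) (Cod C f \<otimes> B)" .
  have "zer A B \<boxtimes> f = (v \<boxtimes> f) \<cdot> (u \<boxtimes> Ident C (Dom C f))" by (simp add: interchange e)
  also have "\<dots> = zer (A \<otimes> Dom C f) (B \<otimes> Cod C f)"
    by (rule zer_eqI[of _ _ "zero_ob \<otimes> Dom C f"]) (simp_all add: hom_iff initial_tens)
  finally show "zer A B \<boxtimes> f = zer (A \<otimes> Dom C f) (B \<otimes> Cod C f)" .
qed


section \<open>Copowers of the unit are biproducts\<close>

definition copower :: "'i set \<Rightarrow> 'o \<times> ('i \<Rightarrow> 'a)" where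
  "copower S = (SOME p. is_colimit C (disc S) (cst C \<one>) (fst p) (snd p))"

definition cop :: "'i set \<Rightarrow> 'o" where "cop S = fst (copower S)"
definition cinj :: "'i set \<Rightarrow> 'i \<Rightarrow> 'a" where "cinj S = snd (copower S)"

lemma copower:
  assumes "finite S"
  shows "is_colimit C (disc S) (cst C \<one>) (cop S) (cinj S)"
proof -
  have "\<exists>p. is_colimit C (disc S) (cst C \<one>) (fst p) (snd p)"
    using copower_ex[OF unit_ob assms] by auto
  from someI_ex[OF this] show ?thesis by (simp add: copower_def cop_def cinj_def)
qed

lemma copower_ar [simp]:
  assumes "finite S"
  shows "cop S \<in> Ob C" "s \<in> S \<Longrightarrow> cinj S s \<in> Ar C" "s \<in> S \<Longrightarrow> Dom C (cinj S s) = \<one>"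
    "s \<in> S \<Longrightarrow> Cod C (cinj S s) = cop S" "s \<in> S \<Longrightarrow> into (cinj S s) A \<longleftrightarrow> cop S = A"
  using is_colimitD(1,2)[OF copower[OF assms]] by (auto simp: hom_iff into_def)

lemma copower_eqI:
  assumes "finite S" "f \<in> hom C (cop S) w" "g \<in> hom C (cop S) w" "\<And>s. s \<in> S \<Longrightarrow> f \<cdot> cinj S s = g \<cdot> cinj S s"
  shows "f = g"
  using is_colimit_eq[OF copower[OF assms(1)] assms(2,3) _ diagram_cst] assms(4) by simp

lemma copower_induced:
  assumes "finite S" "w \<in> Ob C" "\<And>s. s \<in> S \<Longrightarrow> \<tau> s \<in> hom C \<one> w"
  obtains u where "u \<in> hom C (cop S) w" "\<And>s. s \<in> S \<Longrightarrow> u \<cdot> cinj S s = \<tau> s"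
  using is_colimit_ex[OF copower[OF assms(1)], of w \<tau>] assms(2,3) by (auto simp: disc_cocone)

text \<open>The coordinates of the copower and its codiagonal.\<close>

definition prj :: "'i set \<Rightarrow> 'i \<Rightarrow> 'a" where
  "prj S t = (SOME u. u \<in> hom C (cop S) \<one> \<and> (\<forall>s \<in> S. u \<cdot> cinj S s = (if s = t then Ident C \<one> else zer \<one> \<one>)))"

definition aug :: "'i set \<Rightarrow> 'a" where
  "aug S = (SOME u. u \<in> hom C (cop S) \<one> \<and> (\<forall>s \<in> S. u \<cdot> cinj S s = Ident C \<one>))"

lemma prj:
  assumes "finite S"
  shows "prj S t \<in> hom C (cop S) \<one>" "s \<in> S \<Longrightarrow> prj S t \<cdot> cinj S s = (if s = t then Ident C \<one> else zer \<one> \<one>)"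
proof -
  have "\<exists>u. u \<in> hom C (cop S) \<one> \<and> (\<forall>s \<in> S. u \<cdot> cinj S s = (if s = t then Ident C \<one> else zer \<one> \<one>))"
    using copower_induced[OF assms unit_ob, of "\<lambda>s. if s = t then Ident C \<one> else zer \<one> \<one>"]
    by (metis ident_hom unit_ob zer_hom)
  from someI_ex[OF this] show "prj S t \<in> hom C (cop S) \<one>"
    "s \<in> S \<Longrightarrow> prj S t \<cdot> cinj S s = (if s = t then Ident C \<one> else zer \<one> \<one>)"
    unfolding prj_def by blast+
qed

lemma aug:
  assumes "finite S"
  shows "aug S \<in> hom C (cop S) \<one>" "s \<in> S \<Longrightarrow> aug S \<cdot> cinj S s = Ident C \<one>"
proof -
  have "\<exists>u. u \<in> hom C (cop S) \<one> \<and> (\<forall>s \<in> S. u \<cdot> cinj S s = Ident C \<one>)"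
    using copower_induced[OF assms unit_ob, of "\<lambda>s. Ident C \<one>"] by (metis ident_hom unit_ob)
  from someI_ex[OF this] show "aug S \<in> hom C (cop S) \<one>" "s \<in> S \<Longrightarrow> aug S \<cdot> cinj S s = Ident C \<one>"
    unfolding aug_def by blast+
qed

lemmas prj_ar [simp] = homD[OF prj(1)]
lemmas aug_ar [simp] = homD[OF aug(1)]

text \<open>Maps from \<open>w\<close> to the dual \<open>D\<close> correspond to maps from \<open>cop S \<otimes> w\<close> to the unit, and \<open>cop S \<otimes> w\<close> is a copower
  of \<open>w\<close>; so a map to \<open>D\<close> is a family of maps to the unit.\<close>

lemma dual_copower_limit:
  assumes S[simp]: "finite S" and d: "is_dual C (cop S) D coev ev"
  shows "is_limit C (disc S) (cst C \<one>) D (\<lambda>s. ev \<cdot> ((cinj S s \<boxtimes> Ident C D) \<cdot> inv_ar C (lunit C D)))"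
    (is "is_limit _ _ _ _ ?p")
  unfolding is_limit_def
proof (intro conjI allI impI)
  have [simp]: "cop S \<in> Ob C" by simp
  note dd = is_dualD[OF d \<open>cop S \<in> Ob C\<close>]
  note [simp] = dd(1) homD[OF dd(3)]
  show "is_cone C (disc S) (cst C \<one>) D ?p" by (simp add: disc_cone hom_iff)
  fix w \<tau> assume t: "is_cone C (disc S) (cst C \<one>) w \<tau>"
  then have [simp]: "w \<in> Ob C" and th: "\<And>s. s \<in> S \<Longrightarrow> \<tau> s \<in> hom C w \<one>" by (auto simp: disc_cone)
  note [simp] = homD[OF th]
  have c: "is_colimit C (disc S) (cst C (\<one> \<otimes> w)) (cop S \<otimes> w) (\<lambda>s. cinj S s \<boxtimes> Ident C w)"
    using rtens_colimit[OF copower[OF S] diagram_cst[OF unit_ob], of w] by (simp add: rtens_def cst_def)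
  have key: "ev \<cdot> (Ident C (cop S) \<boxtimes> u) \<cdot> (cinj S s \<boxtimes> Ident C w) = ?p s \<cdot> u \<cdot> lunit C w"
    if s: "s \<in> S" and u: "u \<in> hom C w D" for s u
    using s homD[OF u] by (simp add: interchange lunit_inv_nat_ar interchange_assoc)
  obtain g where g: "g \<in> hom C (cop S \<otimes> w) \<one>" and ge: "\<And>s. s \<in> S \<Longrightarrow> g \<cdot> (cinj S s \<boxtimes> Ident C w) = \<tau> s \<cdot> lunit C w"
    using is_colimit_ex[OF c, of \<one> "\<lambda>s. \<tau> s \<cdot> lunit C w"] by (auto simp: disc_cocone hom_iff)
  obtain u where u: "u \<in> hom C w D" and ue: "ev \<cdot> (Ident C (cop S) \<boxtimes> u) = g"
    using ev_surjective[OF d _ _ g] by (metis \<open>cop S \<in> Ob C\<close> \<open>w \<in> Ob C\<close>)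
  show "\<exists>!u. u \<in> hom C w D \<and> (\<forall>j \<in> Ob (disc S). ?p j \<cdot> u = \<tau> j)"
  proof (rule ex1I[of _ u])
    show "u \<in> hom C w D \<and> (\<forall>j \<in> Ob (disc S). ?p j \<cdot> u = \<tau> j)"
    proof (intro conjI ballI u)
      fix s assume "s \<in> Ob (disc S)"
      then have s: "s \<in> S" by simp
      show "?p s \<cdot> u = \<tau> s"
        by (rule iso_epi[of _ "lunit C w"]) (use s homD[OF u] key[OF s u] ge[OF s] ue in simp_all)
    qed
    fix y assume "y \<in> hom C w D \<and> (\<forall>j \<in> Ob (disc S). ?p j \<cdot> y = \<tau> j)"
    then have y: "y \<in> hom C w D" and ye: "\<And>s. s \<in> S \<Longrightarrow> ?p s \<cdot> y = \<tau> s" by simp_all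
    have "ev \<cdot> (Ident C (cop S) \<boxtimes> y) = g"
    proof (rule is_colimit_unique[OF c])
      show "is_cocone C (disc S) (cst C (\<one> \<otimes> w)) \<one> (\<lambda>s. \<tau> s \<cdot> lunit C w)"
        by (simp add: disc_cocone hom_iff)
      show "ev \<cdot> (Ident C (cop S) \<boxtimes> y) \<cdot> (cinj S s \<boxtimes> Ident C w) = \<tau> s \<cdot> lunit C w"
        if "s \<in> Ob (disc S)" for s using that key[OF _ y, of s] ye[of s] by simp
    qed (use g ge homD[OF y] in \<open>simp_all add: hom_iff\<close>)
    then show "y = u" using ev_injective[OF d _ y u] ue by simp
  qed
qed

text \<open>Let \<open>U\<close> be the copower and \<open>D\<close> its dual, which is a power of the unit. They are compared by the identity
  matrix \<open>I\<close>. The object \<open>U \<otimes> D\<close> is a copower of \<open>D\<close> and a power of \<open>U\<close> at once, so an arrow into it can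
  be given by components and an arrow out of it by restrictions. Writing the would-be inverse, the sum
  of \<open>cinj S s \<cdot> p s\<close>, as a composite \<open>D \<rightarrow> U \<otimes> D \<rightarrow> U\<close> of such arrows makes sense of it before addition is
  available.\<close>

lemma copower_limit:
  fixes S :: "'i set"
  assumes S[simp]: "finite S"
  shows "is_limit C (disc S) (cst C \<one>) (cop S) (prj S)"
proof -
  let ?U = "cop S"
  have U[simp]: "?U \<in> Ob C" by simp
  obtain D coev ev where d: "is_dual C ?U D coev ev" using duals U unfolding has_duals_def by blast
  define p where "p = (\<lambda>s. ev \<cdot> ((cinj S s \<boxtimes> Ident C D) \<cdot> inv_ar C (lunit C D)))"
  have l: "is_limit C (disc S) (cst C \<one>) D p" unfolding p_def by (rule dual_copower_limit[OF S d])
  have p: "\<And>s. s \<in> S \<Longrightarrow> p s \<in> hom C D \<one>" using is_limitD(2)[OF l] by simp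
  have D[simp]: "D \<in> Ob C" using is_limitD(1)[OF l] .
  note [simp] = homD[OF p]
  define \<delta> where "\<delta> = (\<lambda>(s :: 'i) t. if s = t then Ident C \<one> else zer \<one> \<one>)"
  have \<delta>[simp]: "\<delta> s t \<in> Ar C" "Dom C (\<delta> s t) = \<one>" "Cod C (\<delta> s t) = \<one>" "into (\<delta> s t) A \<longleftrightarrow> \<one> = A" for s t A
    by (simp_all add: \<delta>_def)
  have qi: "prj S t \<cdot> cinj S s = \<delta> s t" if "s \<in> S" for s t using prj(2)[OF S that] by (simp add: \<delta>_def)
  \<comment> \<open>the comparison map from the copower to the power, given by the identity matrix\<close>
  obtain I where I: "I \<in> hom C ?U D" and pI: "\<And>s. s \<in> S \<Longrightarrow> p s \<cdot> I = prj S s"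
    using is_limit_ex[OF l, of ?U "prj S"] prj(1)[OF S] by (auto simp: disc_cone)
  note [simp] = homD[OF I]
  \<comment> \<open>tensoring with \<open>D\<close> preserves the copower, tensoring with the copower preserves the power\<close>
  have c2: "is_colimit C (disc S) (cst C (\<one> \<otimes> D)) (?U \<otimes> D) (\<lambda>s. cinj S s \<boxtimes> Ident C D)"
    using rtens_colimit[OF copower[OF S] diagram_cst[OF unit_ob] D] by (simp add: rtens_def cst_def)
  have l2: "is_limit C (disc S) (cst C (?U \<otimes> \<one>)) (?U \<otimes> D) (\<lambda>s. Ident C ?U \<boxtimes> p s)"
    using ltens_limit[OF l diagram_cst[OF unit_ob] U] by (simp add: ltens_def cst_def)
  obtain e where e: "e \<in> hom C D (?U \<otimes> D)"
    and pe: "\<And>s. s \<in> S \<Longrightarrow> (Ident C ?U \<boxtimes> p s) \<cdot> e = inv_ar C (runit C ?U) \<cdot> (cinj S s \<cdot> p s)"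
    using is_limit_ex[OF l2, of D "\<lambda>s. inv_ar C (runit C ?U) \<cdot> (cinj S s \<cdot> p s)"]
    by (auto simp: disc_cone hom_iff)
  obtain \<tau> where \<tau>: "\<tau> \<in> hom C (?U \<otimes> D) ?U"
    and \<tau>i: "\<And>s. s \<in> S \<Longrightarrow> \<tau> \<cdot> (cinj S s \<boxtimes> Ident C D) = cinj S s \<cdot> (p s \<cdot> lunit C D)"
    using is_colimit_ex[OF c2, of ?U "\<lambda>s. cinj S s \<cdot> (p s \<cdot> lunit C D)"]
    by (auto simp: disc_cocone hom_iff)
  note [simp] = homD[OF e] homD[OF \<tau>]
  have "(\<tau> \<cdot> e) \<cdot> I = Ident C ?U"
  proof (rule copower_eqI[OF S])
    fix s assume s[simp]: "s \<in> S"
    \<comment> \<open>the inclusion of the summand \<open>s\<close> into the power, given by column \<open>s\<close> of the identity matrix\<close>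
    obtain j where j: "j \<in> hom C \<one> D" and pj: "\<And>t. t \<in> S \<Longrightarrow> p t \<cdot> j = \<delta> s t"
      using is_limit_ex[OF l, of \<one> "\<delta> s"] by (auto simp: disc_cone hom_iff)
    note [simp] = homD[OF j]
    have "e \<cdot> (I \<cdot> cinj S s) = (cinj S s \<boxtimes> j) \<cdot> inv_ar C (lunit C \<one>)"
    proof (rule is_limit_eq[OF l2])
      fix t assume "t \<in> Ob (disc S)"
      then have [simp]: "t \<in> S" by simp
      have "(Ident C ?U \<boxtimes> p t) \<cdot> (e \<cdot> (I \<cdot> cinj S s)) = inv_ar C (runit C ?U) \<cdot> (cinj S t \<cdot> \<delta> s t)"
        by (simp add: reassoc[OF pe] reassoc[OF pI] qi)
      also have "\<dots> = (cinj S s \<boxtimes> \<delta> s t) \<cdot> inv_ar C (lunit C \<one>)"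
        by (cases "s = t") (simp_all add: \<delta>_def runit_inv_nat_ar lunit_unit)
      also have "\<dots> = (Ident C ?U \<boxtimes> p t) \<cdot> ((cinj S s \<boxtimes> j) \<cdot> inv_ar C (lunit C \<one>))"
        by (simp add: interchange_assoc pj)
      finally show "(Ident C ?U \<boxtimes> p t) \<cdot> (e \<cdot> (I \<cdot> cinj S s)) = (Ident C ?U \<boxtimes> p t) \<cdot> ((cinj S s \<boxtimes> j) \<cdot> inv_ar C (lunit C \<one>))" .
    qed (simp_all add: hom_iff diagram_cst)
    then have "(\<tau> \<cdot> e) \<cdot> I \<cdot> cinj S s = \<tau> \<cdot> ((cinj S s \<boxtimes> j) \<cdot> inv_ar C (lunit C \<one>))" by simp
    also have "\<dots> = \<tau> \<cdot> ((cinj S s \<boxtimes> Ident C D) \<cdot> ((Ident C \<one> \<boxtimes> j) \<cdot> inv_ar C (lunit C \<one>)))"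
      by (simp add: interchange_assoc)
    also have "\<dots> = cinj S s \<cdot> (p s \<cdot> (lunit C D \<cdot> ((Ident C \<one> \<boxtimes> j) \<cdot> inv_ar C (lunit C \<one>))))"
      by (simp add: reassoc[OF \<tau>i])
    also have "\<dots> = cinj S s"
      by (simp add: reassoc[OF lunit_nat_ar] pj \<delta>_def)
    finally show "(\<tau> \<cdot> e) \<cdot> I \<cdot> cinj S s = Ident C ?U \<cdot> cinj S s" by simp
  qed (simp_all add: hom_iff)
  moreover have "I \<cdot> (\<tau> \<cdot> e) = Ident C D"
  proof (rule is_limit_eq[OF l])
    fix t assume "t \<in> Ob (disc S)"
    then have t[simp]: "t \<in> S" by simp
    have "prj S t \<cdot> \<tau> = runit C \<one> \<cdot> (prj S t \<boxtimes> p t)"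
    proof (rule is_colimit_eq[OF c2])
      fix s assume "s \<in> Ob (disc S)"
      then have [simp]: "s \<in> S" by simp
      have "prj S t \<cdot> \<tau> \<cdot> (cinj S s \<boxtimes> Ident C D) = \<delta> s t \<cdot> (p s \<cdot> lunit C D)"
        by (simp add: \<tau>i reassoc[OF qi])
      also have "\<dots> = lunit C \<one> \<cdot> (\<delta> s t \<boxtimes> p t)"
        by (cases "s = t") (simp_all add: \<delta>_def lunit_nat_ar)
      also have "\<dots> = runit C \<one> \<cdot> (prj S t \<boxtimes> p t) \<cdot> (cinj S s \<boxtimes> Ident C D)"
        by (simp add: interchange qi lunit_unit)
      finally show "prj S t \<cdot> \<tau> \<cdot> (cinj S s \<boxtimes> Ident C D) = runit C \<one> \<cdot> (prj S t \<boxtimes> p t) \<cdot> (cinj S s \<boxtimes> Ident C D)" .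
    qed (simp_all add: hom_iff diagram_cst)
    then have "p t \<cdot> (I \<cdot> (\<tau> \<cdot> e)) = runit C \<one> \<cdot> ((prj S t \<boxtimes> Ident C \<one>) \<cdot> ((Ident C ?U \<boxtimes> p t) \<cdot> e))"
      by (simp add: reassoc[OF pI] interchange_assoc) (simp flip: assoc_ar)
    also have "\<dots> = p t"
      by (simp add: pe reassoc[OF runit_nat_ar] reassoc[OF qi] \<delta>_def)
    finally show "p t \<cdot> (I \<cdot> (\<tau> \<cdot> e)) = p t \<cdot> Ident C D" by simp
  qed (simp_all add: hom_iff diagram_cst)
  ultimately have "is_iso C I" by (intro is_isoI(1)[OF I, of "\<tau> \<cdot> e"]) (simp_all add: hom_iff)
  then show ?thesis
    by (rule limit_iso_vertex[OF l diagram_cst[OF unit_ob] I]) (simp add: pI)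
qed

lemma copower_limit_tens:
  assumes S: "finite S" and B[simp]: "B \<in> Ob C"
  shows "is_limit C (disc S) (cst C B) (B \<otimes> cop S) (\<lambda>s. runit C B \<cdot> (Ident C B \<boxtimes> prj S s))"
proof -
  have "is_limit C (disc S) (cst C (B \<otimes> \<one>)) (B \<otimes> cop S) (\<lambda>s. Ident C B \<boxtimes> prj S s)"
    using ltens_limit[OF copower_limit[OF S] diagram_cst[OF unit_ob] B] by (simp add: ltens_def cst_def)
  from limit_iso_diagram[OF this, of "cst C B" "\<lambda>_. runit C B"]
  show ?thesis by (simp add: diagram_cst hom_iff)
qed


section \<open>Finite sums of arrows\<close>

text \<open>The family \<open>f\<close> defines an arrow into the biproduct of copies of \<open>B\<close>, realized as the tensor
  product of \<open>B\<close> with a copower of the unit; the sum is its composite with the codiagonal.\<close>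

definition tuple :: "'i set \<Rightarrow> 'o \<Rightarrow> 'o \<Rightarrow> ('i \<Rightarrow> 'a) \<Rightarrow> 'a" where
  "tuple S A B f = (THE u. u \<in> hom C A (B \<otimes> cop S) \<and> (\<forall>s \<in> S. runit C B \<cdot> ((Ident C B \<boxtimes> prj S s) \<cdot> u) = f s))"

definition Sm :: "'i set \<Rightarrow> 'o \<Rightarrow> 'o \<Rightarrow> ('i \<Rightarrow> 'a) \<Rightarrow> 'a" where
  "Sm S A B f = runit C B \<cdot> ((Ident C B \<boxtimes> aug S) \<cdot> tuple S A B f)"

lemma tuple_ex1:
  assumes S: "finite S" and [simp]: "A \<in> Ob C" "B \<in> Ob C" and f: "\<And>s. s \<in> S \<Longrightarrow> f s \<in> hom C A B"
  shows "\<exists>!u. u \<in> hom C A (B \<otimes> cop S) \<and> (\<forall>s \<in> S. runit C B \<cdot> ((Ident C B \<boxtimes> prj S s) \<cdot> u) = f s)"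
proof -
  have "is_cone C (disc S) (cst C B) A f" using f by (simp add: disc_cone)
  then have "\<exists>!u. u \<in> hom C A (B \<otimes> cop S) \<and> (\<forall>s \<in> S. runit C B \<cdot> (Ident C B \<boxtimes> prj S s) \<cdot> u = f s)"
    using copower_limit_tens[OF S, of B] unfolding is_limit_def by simp
  moreover have "runit C B \<cdot> (Ident C B \<boxtimes> prj S s) \<cdot> u = runit C B \<cdot> ((Ident C B \<boxtimes> prj S s) \<cdot> u)"
    if "u \<in> hom C A (B \<otimes> cop S)" for u s using homD[OF that] S by simp
  ultimately show ?thesis by (metis (no_types, lifting))
qed

lemma tuple:
  assumes "finite S" "A \<in> Ob C" "B \<in> Ob C" "\<And>s. s \<in> S \<Longrightarrow> f s \<in> hom C A B"
  shows "tuple S A B f \<in> hom C A (B \<otimes> cop S)"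
    "s \<in> S \<Longrightarrow> runit C B \<cdot> ((Ident C B \<boxtimes> prj S s) \<cdot> tuple S A B f) = f s"
  using theI'[OF tuple_ex1[OF assms]] by (auto simp: tuple_def)

lemma tuple_eqI:
  assumes "finite S" "A \<in> Ob C" "B \<in> Ob C" and u: "u \<in> hom C A (B \<otimes> cop S)"
    and e: "\<And>s. s \<in> S \<Longrightarrow> runit C B \<cdot> ((Ident C B \<boxtimes> prj S s) \<cdot> u) = f s"
  shows "tuple S A B f = u"
proof -
  have "f s \<in> hom C A B" if "s \<in> S" for s
    using homD[OF u] assms(1,2,3) that by (simp add: hom_iff flip: e)
  from tuple_ex1[OF assms(1-3) this] show ?thesis
    unfolding tuple_def using u e by (intro the1_equality) auto
qed

lemma Sm_hom:
  assumes "finite S" "A \<in> Ob C" "B \<in> Ob C" "\<And>s. s \<in> S \<Longrightarrow> f s \<in> hom C A B"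
  shows "Sm S A B f \<in> hom C A B"
  using homD[OF tuple(1)[OF assms]] assms(1-3) by (simp add: Sm_def hom_iff)

lemma Sm_cong: "(\<And>s. s \<in> S \<Longrightarrow> f s = g s) \<Longrightarrow> Sm S A B f = Sm S A B g"
  unfolding Sm_def tuple_def by (metis (mono_tags, lifting))

lemma Sm_comp_left:
  assumes S[simp]: "finite S" and A[simp]: "A \<in> Ob C" and f: "\<And>s. s \<in> S \<Longrightarrow> f s \<in> hom C A B" and g: "g \<in> hom C B B'"
  shows "g \<cdot> Sm S A B f = Sm S A B' (\<lambda>s. g \<cdot> f s)"
proof -
  note [simp] = homD[OF g] hom_ob[OF g]
  note [simp] = homD[OF tuple(1)[OF S A _ f]]
  have "tuple S A B' (\<lambda>s. g \<cdot> f s) = (g \<boxtimes> Ident C (cop S)) \<cdot> tuple S A B f"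
  proof (rule tuple_eqI)
    fix s assume s[simp]: "s \<in> S"
    have "runit C B' \<cdot> ((Ident C B' \<boxtimes> prj S s) \<cdot> ((g \<boxtimes> Ident C (cop S)) \<cdot> tuple S A B f))
      = runit C B' \<cdot> ((g \<boxtimes> Ident C \<one>) \<cdot> ((Ident C B \<boxtimes> prj S s) \<cdot> tuple S A B f))"
      by (simp add: interchange_assoc)
    also have "\<dots> = g \<cdot> (runit C B \<cdot> ((Ident C B \<boxtimes> prj S s) \<cdot> tuple S A B f))"
      by (subst reassoc[OF runit_nat_ar]) simp_all
    finally show "runit C B' \<cdot> ((Ident C B' \<boxtimes> prj S s) \<cdot> ((g \<boxtimes> Ident C (cop S)) \<cdot> tuple S A B f)) = g \<cdot> f s"
      using tuple(2)[OF S A _ f s] by simp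
  qed (simp_all add: hom_iff)
  then have "Sm S A B' (\<lambda>s. g \<cdot> f s) = runit C B' \<cdot> ((g \<boxtimes> Ident C \<one>) \<cdot> ((Ident C B \<boxtimes> aug S) \<cdot> tuple S A B f))"
    by (simp add: Sm_def interchange_assoc)
  also have "\<dots> = g \<cdot> Sm S A B f"
    unfolding Sm_def by (subst reassoc[OF runit_nat_ar]) simp_all
  finally show ?thesis by simp
qed

lemma Sm_comp_right:
  assumes S[simp]: "finite S" and B[simp]: "B \<in> Ob C" and f: "\<And>s. s \<in> S \<Longrightarrow> f s \<in> hom C A B" and g: "g \<in> hom C A' A"
  shows "Sm S A B f \<cdot> g = Sm S A' B (\<lambda>s. f s \<cdot> g)"
proof -
  note [simp] = homD[OF g] hom_ob[OF g]
  note [simp] = homD[OF tuple(1)[OF S _ B f]]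
  have "tuple S A' B (\<lambda>s. f s \<cdot> g) = tuple S A B f \<cdot> g"
  proof (rule tuple_eqI)
    fix s assume s: "s \<in> S"
    have "runit C B \<cdot> ((Ident C B \<boxtimes> prj S s) \<cdot> (tuple S A B f \<cdot> g))
      = (runit C B \<cdot> ((Ident C B \<boxtimes> prj S s) \<cdot> tuple S A B f)) \<cdot> g" by simp
    then show "runit C B \<cdot> ((Ident C B \<boxtimes> prj S s) \<cdot> (tuple S A B f \<cdot> g)) = f s \<cdot> g"
      using tuple(2)[OF S _ B f s] by simp
  qed (simp_all add: hom_iff)
  then show ?thesis by (simp add: Sm_def)
qed

lemma tens_runit_inv_zer:
  assumes S[simp]: "finite S" and B[simp]: "B \<in> Ob C" and t: "t \<in> S"
  shows "runit C B \<cdot> ((Ident C B \<boxtimes> prj S s) \<cdot> ((Ident C B \<boxtimes> cinj S t) \<cdot> inv_ar C (runit C B)))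
    = (if s = t then Ident C B else zer B B)"
  using t by (simp add: interchange_assoc prj(2))

lemma Sm_single:
  assumes S[simp]: "finite S" and t: "t \<in> S" and f: "f t \<in> hom C A B"
    and z: "\<And>s. s \<in> S \<Longrightarrow> s \<noteq> t \<Longrightarrow> f s = zer A B"
  shows "Sm S A B f = f t"
proof -
  note [simp] = homD[OF f] hom_ob[OF f] t
  have "tuple S A B f = (Ident C B \<boxtimes> cinj S t) \<cdot> (inv_ar C (runit C B) \<cdot> f t)"
  proof (rule tuple_eqI)
    fix s assume s: "s \<in> S"
    have "runit C B \<cdot> ((Ident C B \<boxtimes> prj S s) \<cdot> ((Ident C B \<boxtimes> cinj S t) \<cdot> (inv_ar C (runit C B) \<cdot> f t)))
      = (runit C B \<cdot> ((Ident C B \<boxtimes> prj S s) \<cdot> ((Ident C B \<boxtimes> cinj S t) \<cdot> inv_ar C (runit C B)))) \<cdot> f t"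
      by (simp add: interchange_assoc)
    also have "\<dots> = f s" unfolding tens_runit_inv_zer[OF S hom_ob(2)[OF f] t] using z[OF s] by simp
    finally show "runit C B \<cdot> ((Ident C B \<boxtimes> prj S s) \<cdot> ((Ident C B \<boxtimes> cinj S t) \<cdot> (inv_ar C (runit C B) \<cdot> f t))) = f s" .
  qed (simp_all add: hom_iff)
  then show ?thesis by (simp add: Sm_def interchange_assoc aug(2))
qed

lemma Sm_zero:
  assumes S[simp]: "finite S" and [simp]: "A \<in> Ob C" "B \<in> Ob C" and z: "\<And>s. s \<in> S \<Longrightarrow> f s = zer A B"
  shows "Sm S A B f = zer A B"
proof -
  have "tuple S A B f = zer A (B \<otimes> cop S)"
    by (rule tuple_eqI) (simp_all add: zer_hom z)
  then show ?thesis by (simp add: Sm_def)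
qed

lemma Sm_reindex:
  assumes S[simp]: "finite S" and bij: "bij_betw \<sigma> S S'" and A[simp]: "A \<in> Ob C" and B[simp]: "B \<in> Ob C"
    and f: "\<And>s. s \<in> S' \<Longrightarrow> f s \<in> hom C A B"
  shows "Sm S' A B f = Sm S A B (\<lambda>s. f (\<sigma> s))"
proof -
  have S'[simp]: "finite S'" using bij_betw_finite[OF bij] S by simp
  have \<sigma>: "\<And>s. s \<in> S \<Longrightarrow> \<sigma> s \<in> S'" using bij by (auto simp: bij_betw_def)
  obtain h where h: "h \<in> hom C (cop S) (cop S')" and hi: "\<And>s. s \<in> S \<Longrightarrow> h \<cdot> cinj S s = cinj S' (\<sigma> s)"
    using copower_induced[OF S, of "cop S'" "\<lambda>s. cinj S' (\<sigma> s)"] \<sigma> by (auto simp: hom_iff)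
  have f': "\<And>s. s \<in> S \<Longrightarrow> f (\<sigma> s) \<in> hom C A B" using f \<sigma> by auto
  note [simp] = homD[OF h] \<sigma> homD[OF tuple(1)[OF S A B f']]
  have a: "aug S' \<cdot> h = aug S"
    by (rule copower_eqI[OF S]) (simp_all add: hom_iff hi aug(2))
  have p: "prj S' (\<sigma> t) \<cdot> h = prj S t" if "t \<in> S" for t
    by (rule copower_eqI[OF S])
      (use that in \<open>simp_all add: hom_iff hi prj(2) inj_on_eq_iff[OF bij_betw_imp_inj_on[OF bij]]\<close>)
  have "tuple S' A B f = (Ident C B \<boxtimes> h) \<cdot> tuple S A B (\<lambda>s. f (\<sigma> s))"
  proof (rule tuple_eqI)
    fix s' assume "s' \<in> S'"
    then obtain s where s: "s \<in> S" and [simp]: "s' = \<sigma> s" using bij by (auto simp: bij_betw_def)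
    show "runit C B \<cdot> ((Ident C B \<boxtimes> prj S' s') \<cdot> ((Ident C B \<boxtimes> h) \<cdot> tuple S A B (\<lambda>s. f (\<sigma> s)))) = f s'"
      using s tuple(2)[OF S A B f' s] by (simp add: interchange_assoc p)
  qed (simp_all add: hom_iff)
  then show ?thesis by (simp add: Sm_def interchange_assoc a)
qed

text \<open>The multiple of an identity by the cardinality of \<open>S\<close> is the action of a scalar, hence is
  invertible as soon as it is on the unit.\<close>

abbreviation mult :: "'i set \<Rightarrow> 'o \<Rightarrow> 'a" where "mult S A \<equiv> Sm S A A (\<lambda>_. Ident C A)"

lemma mult_hom: "\<lbrakk>finite S; A \<in> Ob C\<rbrakk> \<Longrightarrow> mult S A \<in> hom C A A"
  by (rule Sm_hom) (simp_all add: hom_iff)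

lemmas mult_ar [simp] = homD[OF mult_hom]

lemma mult_natural:
  assumes S[simp]: "finite S" and f: "f \<in> hom C A B"
  shows "f \<cdot> mult S A = Sm S A B (\<lambda>_. f)" "mult S B \<cdot> f = Sm S A B (\<lambda>_. f)"
proof -
  note [simp] = homD[OF f] hom_ob[OF f]
  show "f \<cdot> mult S A = Sm S A B (\<lambda>_. f)" by (subst Sm_comp_left[OF S _ _ f]) (simp_all add: hom_iff)
  show "mult S B \<cdot> f = Sm S A B (\<lambda>_. f)" by (subst Sm_comp_right[OF S _ _ f]) (simp_all add: hom_iff)
qed

lemma mult_iso:
  assumes S[simp]: "finite S" and i: "is_iso C (mult S \<one>)" and A[simp]: "A \<in> Ob C"
  shows "is_iso C (mult S A)"
proof -
  have i1: "\<And>A. A \<in> Ob C \<Longrightarrow> Ident C A \<in> hom C A A" by (simp add: hom_iff)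
  \<comment> \<open>the diagonal of the unit; composed with the codiagonal it is the scalar \<open>card S\<close>\<close>
  define \<sigma> where "\<sigma> = lunit C (cop S) \<cdot> tuple S \<one> \<one> (\<lambda>_. Ident C \<one>)"
  note [simp] = homD[OF tuple(1)[OF S unit_ob unit_ob i1[OF unit_ob]]]
  have sh: "\<sigma> \<in> hom C \<one> (cop S)" by (simp add: \<sigma>_def hom_iff)
  note [simp] = homD[OF sh]
  have q: "prj S s \<cdot> \<sigma> = Ident C \<one>" if s: "s \<in> S" for s
  proof -
    have "prj S s \<cdot> lunit C (cop S) = runit C \<one> \<cdot> (Ident C \<one> \<boxtimes> prj S s)"
      using lunit_nat_ar[of "prj S s" \<one>] by (simp add: lunit_unit)
    from reassoc[OF this] show ?thesis
      using tuple(2)[OF S unit_ob unit_ob i1[OF unit_ob] s] by (simp add: \<sigma>_def)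
  qed
  have t: "tuple S B B (\<lambda>_. Ident C B) = (Ident C B \<boxtimes> \<sigma>) \<cdot> inv_ar C (runit C B)" if [simp]: "B \<in> Ob C" for B
    by (rule tuple_eqI) (simp_all add: hom_iff interchange_assoc q)
  have m: "mult S B = runit C B \<cdot> ((Ident C B \<boxtimes> (aug S \<cdot> \<sigma>)) \<cdot> inv_ar C (runit C B))" if [simp]: "B \<in> Ob C" for B
    by (simp add: Sm_def t interchange_assoc)
  have "mult S \<one> = lunit C \<one> \<cdot> ((Ident C \<one> \<boxtimes> (aug S \<cdot> \<sigma>)) \<cdot> inv_ar C (lunit C \<one>))"
    by (simp add: m lunit_unit)
  also have "\<dots> = aug S \<cdot> \<sigma>" by (subst reassoc[OF lunit_nat_ar]) simp_all
  finally have "is_iso C (aug S \<cdot> \<sigma>)" using i by simp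
  then have "is_iso C (Ident C A \<boxtimes> (aug S \<cdot> \<sigma>))" by simp
  from is_iso_comp[OF is_iso_comp[OF _ this]] show ?thesis unfolding m[OF A] by simp
qed

end


section \<open>Groupoids with finitely many components and finite hom-sets\<close>

lemma is_functorD:
  assumes "is_functor A B F"
  shows "category A" "category B" "\<And>x. x \<in> Ob A \<Longrightarrow> OM F x \<in> Ob B"
    "\<And>m. m \<in> hom A x y \<Longrightarrow> AM F m \<in> hom B (OM F x) (OM F y)"
    "\<And>x. x \<in> Ob A \<Longrightarrow> AM F (Ident A x) = Ident B (OM F x)"
    "\<And>m n. m \<in> hom A x y \<Longrightarrow> n \<in> hom A y z \<Longrightarrow> AM F (n \<cdot>\<^bsub>A\<^esub> m) = AM F n \<cdot>\<^bsub>B\<^esub> AM F m"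
  using assms by (auto simp: is_functor_def hom_def Pi_def PiE_def)

context groupoid
begin

lemma inv_hom: "m \<in> hom G c d \<Longrightarrow> inv_ar G m \<in> hom G d c"
  using all_iso[of m] by (simp add: hom_iff)

lemma inv_comp: "m \<in> hom G c d \<Longrightarrow> inv_ar G m \<cdot>\<^bsub>G\<^esub> m = Ident G c" "m \<in> hom G c d \<Longrightarrow> m \<cdot>\<^bsub>G\<^esub> inv_ar G m = Ident G d"
  using all_iso[of m] by (simp_all add: hom_iff)

lemma isomorphic_iff: "isomorphic G x y \<longleftrightarrow> hom G x y \<noteq> {}"
  using all_iso by (auto simp: isomorphic_def hom_iff)

lemma connected_sym:
  assumes "hom G c d \<noteq> {}"
  shows "hom G d c \<noteq> {}"
proof -
  from assms obtain m where "m \<in> hom G c d" by blast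
  from inv_hom[OF this] show ?thesis by blast
qed

lemma connected_trans:
  assumes "hom G c d \<noteq> {}" "hom G d e \<noteq> {}"
  shows "hom G c e \<noteq> {}"
proof -
  from assms obtain m n where "m \<in> hom G c d" "n \<in> hom G d e" by blast
  from comp_hom[OF this] show ?thesis by blast
qed

end

text \<open>\<open>R\<close> selects one object in each connected component.\<close>

locale finite_groupoid = groupoid P for P :: "('p, 'q, 'e) cat_scheme" +
  fixes R :: "'p set"
  assumes fin_hom: "\<lbrakk>c \<in> Ob P; d \<in> Ob P\<rbrakk> \<Longrightarrow> finite (hom P c d)"
    and reps_ob: "R \<subseteq> Ob P" and fin_reps: "finite R"
    and rep_ex1: "c \<in> Ob P \<Longrightarrow> \<exists>!r. r \<in> R \<and> hom P r c \<noteq> {}"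
begin

lemma bij_precompose:
  assumes k: "k \<in> hom P c' c"
  shows "bij_betw (\<lambda>m. m \<cdot>\<^bsub>P\<^esub> k) (hom P c d) (hom P c' d)"
  by (rule bij_betw_byWitness[where f' = "\<lambda>m. m \<cdot>\<^bsub>P\<^esub> inv_ar P k"])
    (use homD[OF k] homD[OF inv_hom[OF k]] inv_comp[OF k] in \<open>auto simp: hom_iff into_ar\<close>)

lemma bij_postcompose:
  assumes k: "k \<in> hom P d d'"
  shows "bij_betw (\<lambda>m. k \<cdot>\<^bsub>P\<^esub> m) (hom P c d) (hom P c d')"
  by (rule bij_betw_byWitness[where f' = "\<lambda>m. inv_ar P k \<cdot>\<^bsub>P\<^esub> m"])
    (use homD[OF k] all_iso[of k] in \<open>auto simp: hom_iff into_ar\<close>)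

definition rep :: "'p \<Rightarrow> 'p" where "rep c = (THE r. r \<in> R \<and> hom P r c \<noteq> {})"

lemma rep:
  assumes "c \<in> Ob P"
  shows "rep c \<in> R" "rep c \<in> Ob P" "hom P (rep c) c \<noteq> {}" "\<lbrakk>r \<in> R; r \<noteq> rep c\<rbrakk> \<Longrightarrow> hom P r c = {}"
    "\<lbrakk>r \<in> R; r \<noteq> rep c\<rbrakk> \<Longrightarrow> hom P c r = {}"
proof -
  note * = theI'[OF rep_ex1[OF assms], folded rep_def]
  show "rep c \<in> R" "rep c \<in> Ob P" "hom P (rep c) c \<noteq> {}" using * reps_ob by auto
  show n: "\<lbrakk>r \<in> R; r \<noteq> rep c\<rbrakk> \<Longrightarrow> hom P r c = {}" using * rep_ex1[OF assms] by blast
  show "\<lbrakk>r \<in> R; r \<noteq> rep c\<rbrakk> \<Longrightarrow> hom P c r = {}" using n connected_sym by blast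
qed

end

lemma ess_finite_reps:
  assumes "ess_finite_groupoid P"
  obtains R where "finite_groupoid P R"
proof -
  interpret groupoid P using assms by (simp add: ess_finite_groupoid_def)
  let ?r = "{(x, y). x \<in> Ob P \<and> y \<in> Ob P \<and> isomorphic P x y}"
  note iso = isomorphic_iff and s = connected_sym and t = connected_trans
  have eq: "equiv (Ob P) ?r"
  proof (rule equivI)
    have "hom P x x \<noteq> {}" if "x \<in> Ob P" for x using ident_hom[OF that] by blast
    then show "refl_on (Ob P) ?r" by (auto simp: refl_on_def iso)
    show "sym ?r" unfolding sym_def iso using s by blast
    show "trans ?r" unfolding trans_def iso using t by blast
  qed auto
  have fin: "finite (Ob P // ?r)" using assms by (simp add: ess_finite_groupoid_def)
  define R where "R = (\<lambda>A. SOME x. x \<in> A) ` (Ob P // ?r)"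
  have some: "(SOME x. x \<in> A) \<in> A" if "A \<in> Ob P // ?r" for A
    using in_quotient_imp_non_empty[OF eq that] some_in_eq by blast
  have "finite_groupoid P R"
  proof
    show "finite (hom P c d)" if "c \<in> Ob P" "d \<in> Ob P" for c d
      using assms that by (simp add: ess_finite_groupoid_def)
    show "R \<subseteq> Ob P" using some in_quotient_imp_subset[OF eq] by (auto simp: R_def)
    show "finite R" using fin by (simp add: R_def)
    fix c assume c: "c \<in> Ob P"
    then have q: "?r `` {c} \<in> Ob P // ?r" by (rule quotientI)
    let ?x = "SOME x. x \<in> ?r `` {c}"
    show "\<exists>!r. r \<in> R \<and> hom P r c \<noteq> {}"
    proof (rule ex1I)
      show "?x \<in> R \<and> hom P ?x c \<noteq> {}"
      proof
        show "?x \<in> R" unfolding R_def by (rule imageI[OF q])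
        have "hom P c ?x \<noteq> {}" using some[OF q] unfolding iso by blast
        then show "hom P ?x c \<noteq> {}" by (rule s)
      qed
      fix r assume r: "r \<in> R \<and> hom P r c \<noteq> {}"
      then obtain A where A: "A \<in> Ob P // ?r" and rA: "r = (SOME x. x \<in> A)" by (auto simp: R_def)
      have "r \<in> A" using some[OF A] rA by simp
      moreover have "r \<in> ?r `` {c}"
        using s[OF conjunct2[OF r]] c in_quotient_imp_subset[OF eq A] \<open>r \<in> A\<close> by (auto simp: iso)
      ultimately have "A = ?r `` {c}" using quotient_disj[OF eq A q] by blast
      then show "r = ?x" using rA by simp
    qed
  qed
  then show thesis by (rule that)
qed

lemma ess_finiteI:
  assumes "groupoid P" "\<And>c d. \<lbrakk>c \<in> Ob P; d \<in> Ob P\<rbrakk> \<Longrightarrow> finite (hom P c d)"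
    and R: "finite R" "R \<subseteq> Ob P" "\<And>c. c \<in> Ob P \<Longrightarrow> \<exists>r \<in> R. hom P c r \<noteq> {}"
  shows "ess_finite_groupoid P"
proof -
  interpret groupoid P by fact
  let ?r = "{(x, y). x \<in> Ob P \<and> y \<in> Ob P \<and> isomorphic P x y}"
  note iso = isomorphic_iff and s = connected_sym and t = connected_trans
  have "Ob P // ?r \<subseteq> (\<lambda>r. ?r `` {r}) ` R"
  proof
    fix A assume "A \<in> Ob P // ?r"
    then obtain c where c: "c \<in> Ob P" and A: "A = ?r `` {c}" by (auto elim: quotientE)
    obtain r where r: "r \<in> R" "hom P c r \<noteq> {}" using R(3)[OF c] by blast
    then have "A = ?r `` {r}" unfolding A iso using c R(2) s t by blast
    then show "A \<in> (\<lambda>r. ?r `` {r}) ` R" using r(1) by blast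
  qed
  then have "finite (Ob P // ?r)" using R(1) finite_subset by blast
  then show ?thesis using assms(1,2) by (simp add: ess_finite_groupoid_def)
qed


section \<open>Limits over a groupoid from colimits\<close>

locale groupoid_diagrams = fin_cocomplete_rigid C U + P: finite_groupoid P R
  for C :: "('o, 'a, 'e) smcat_scheme" (structure) and U :: "'u::infinite itself"
    and P :: "('p, 'q, 'e2) cat_scheme" and R :: "'p set"
begin

lemmas fin_homs [simp] = P.fin_hom P.fin_reps

text \<open>Division by the order of the automorphism group of \<open>c\<close>.\<close>

definition card_inv :: "'p \<Rightarrow> 'o \<Rightarrow> 'a" where
  "card_inv c A = inv_ar C (mult (hom P c c) A)"

abbreviation orders_iso :: bool where
  "orders_iso \<equiv> \<forall>c \<in> Ob P. is_iso C (mult (hom P c c) \<one>)"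

text \<open>A nonempty set of arrows from \<open>c\<close> to \<open>d\<close> is a torsor under the automorphism group of \<open>c\<close>.\<close>

lemma Sm_hom_const:
  assumes "c \<in> Ob P" "d \<in> Ob P" "f \<in> hom C A B"
  shows "hom P c d \<noteq> {} \<Longrightarrow> Sm (hom P c d) A B (\<lambda>_. f) = Sm (hom P c c) A B (\<lambda>_. f)"
    and "hom P d c \<noteq> {} \<Longrightarrow> Sm (hom P d c) A B (\<lambda>_. f) = Sm (hom P c c) A B (\<lambda>_. f)"
proof -
  note [simp] = assms(1,2) hom_ob[OF assms(3)]
  show "Sm (hom P c d) A B (\<lambda>_. f) = Sm (hom P c c) A B (\<lambda>_. f)" if "hom P c d \<noteq> {}"
  proof -
    from that obtain k where k: "k \<in> hom P c d" by blast
    show ?thesis by (rule Sm_reindex[OF _ P.bij_postcompose[OF k]]) (simp_all add: assms(3))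
  qed
  show "Sm (hom P d c) A B (\<lambda>_. f) = Sm (hom P c c) A B (\<lambda>_. f)" if "hom P d c \<noteq> {}"
  proof -
    from that obtain k where k: "k \<in> hom P d c" by blast
    show ?thesis by (rule Sm_reindex[OF _ P.bij_precompose[OF k]]) (simp_all add: assms(3))
  qed
qed

lemma mult_connected:
  assumes "c \<in> Ob P" "d \<in> Ob P" "hom P c d \<noteq> {}" "A \<in> Ob C"
  shows "mult (hom P c c) A = mult (hom P d d) A"
  using Sm_hom_const(1)[OF assms(1,2) ident_hom[OF assms(4)] assms(3)]
    Sm_hom_const(2)[OF assms(2,1) ident_hom[OF assms(4)] assms(3)] by simp

context
  assumes orders_iso: orders_iso
begin

lemma mult_iso_hom [simp]: "\<lbrakk>c \<in> Ob P; A \<in> Ob C\<rbrakk> \<Longrightarrow> is_iso C (mult (hom P c c) A)"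
  by (rule mult_iso) (use orders_iso in simp_all)

lemma card_inv_hom: "\<lbrakk>c \<in> Ob P; A \<in> Ob C\<rbrakk> \<Longrightarrow> card_inv c A \<in> hom C A A"
  by (simp add: card_inv_def hom_iff)

lemmas card_inv_ar [simp] = homD[OF card_inv_hom]

lemma card_inv_natural:
  assumes c[simp]: "c \<in> Ob P" and f: "f \<in> hom C A B"
  shows "f \<cdot> card_inv c A = card_inv c B \<cdot> f"
proof -
  note [simp] = homD[OF f] hom_ob[OF f]
  have n: "mult (hom P c c) B \<cdot> f = f \<cdot> mult (hom P c c) A" using mult_natural[OF _ f, of "hom P c c"] by simp
  show ?thesis
    by (rule iso_mono[of "mult (hom P c c) B"])
      (simp_all add: card_inv_def reassoc[OF n])
qed

lemma card_inv_mult: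
  assumes [simp]: "c \<in> Ob P" "A \<in> Ob C"
  shows "mult (hom P c c) A \<cdot> card_inv c A = Ident C A"
  by (simp add: card_inv_def)

end

lemma functor_cone_connected:
  assumes V: "is_functor P C V" and c: "is_cone C P V w p" and k: "is_cocone C P V v \<kappa>" and m: "m \<in> hom P a b"
  shows "\<kappa> b \<cdot> p b = \<kappa> a \<cdot> p a"
proof -
  have ab: "a \<in> Ob P" "b \<in> Ob P" "m \<in> Ar P" "Dom P m = a" "Cod P m = b"
    using P.hom_ob[OF m] P.homD[OF m] by auto
  have p: "p a \<in> hom C w (OM V a)" and kb: "\<kappa> b \<in> hom C (OM V b) v" and e: "AM V m \<cdot> p a = p b" "\<kappa> b \<cdot> AM V m = \<kappa> a"
    using c k ab by (auto simp: is_cone_def is_cocone_def)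
  have Vm: "AM V m \<in> hom C (OM V a) (OM V b)" by (rule is_functorD(4)[OF V m])
  show ?thesis using e homD[OF p] homD[OF kb] homD[OF Vm] reassoc[OF e(2), of "p a"] by simp
qed

text \<open>The norm at \<open>d\<close> adds up the actions of all arrows into \<open>d\<close>. Translating the set of these arrows by an arrow of
  \<open>P\<close> permutes the summands; so the sums are compatible with the cocone, and the norms form a cone.\<close>

definition norm_map :: "('p, 'q, 'o, 'a) fct \<Rightarrow> 'o \<Rightarrow> ('p \<Rightarrow> 'a) \<Rightarrow> 'p \<Rightarrow> 'a" where
  "norm_map V M \<kappa> d = (SOME u. u \<in> hom C M (OM V d) \<and>
     (\<forall>c \<in> Ob P. u \<cdot> \<kappa> c = Sm (hom P c d) (OM V c) (OM V d) (AM V)))"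

lemma norm_map:
  assumes V: "is_functor P C V" and k: "is_colimit C P V M \<kappa>" and d[simp]: "d \<in> Ob P"
  shows "norm_map V M \<kappa> d \<in> hom C M (OM V d)"
    "c \<in> Ob P \<Longrightarrow> norm_map V M \<kappa> d \<cdot> \<kappa> c = Sm (hom P c d) (OM V c) (OM V d) (AM V)"
proof -
  note Vs = is_functorD[OF V]
  note [simp] = Vs(3)
  have "is_cocone C P V (OM V d) (\<lambda>c. Sm (hom P c d) (OM V c) (OM V d) (AM V))"
    unfolding is_cocone_def
  proof (intro conjI ballI)
    show "Sm (hom P c d) (OM V c) (OM V d) (AM V) \<in> hom C (OM V c) (OM V d)" if "c \<in> Ob P" for c
      using that by (intro Sm_hom Vs(4)) simp_all
    fix m assume "m \<in> Ar P"
    then have m: "m \<in> hom P (Dom P m) (Cod P m)" and [simp]: "Dom P m \<in> Ob P" "Cod P m \<in> Ob P"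
      by (simp_all add: P.hom_iff)
    have "Sm (hom P (Cod P m) d) (OM V (Cod P m)) (OM V d) (AM V) \<cdot> AM V m
        = Sm (hom P (Cod P m) d) (OM V (Dom P m)) (OM V d) (\<lambda>n. AM V n \<cdot> AM V m)"
      by (rule Sm_comp_right) (simp_all add: Vs(4) m)
    also have "\<dots> = Sm (hom P (Cod P m) d) (OM V (Dom P m)) (OM V d) (\<lambda>n. AM V (n \<cdot>\<^bsub>P\<^esub> m))"
      by (rule Sm_cong) (simp add: Vs(6)[OF m])
    also have "\<dots> = Sm (hom P (Dom P m) d) (OM V (Dom P m)) (OM V d) (AM V)"
      by (rule Sm_reindex[OF _ P.bij_precompose[OF m], symmetric]) (simp_all add: Vs(4))
    finally show "Sm (hom P (Cod P m) d) (OM V (Cod P m)) (OM V d) (AM V) \<cdot> AM V m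
      = Sm (hom P (Dom P m) d) (OM V (Dom P m)) (OM V d) (AM V)" .
  qed simp
  then obtain u where "u \<in> hom C M (OM V d)"
    and "\<And>c. c \<in> Ob P \<Longrightarrow> u \<cdot> \<kappa> c = Sm (hom P c d) (OM V c) (OM V d) (AM V)"
    using is_colimit_ex[OF k] by blast
  then have "\<exists>u. u \<in> hom C M (OM V d) \<and>
     (\<forall>c \<in> Ob P. u \<cdot> \<kappa> c = Sm (hom P c d) (OM V c) (OM V d) (AM V))" by blast
  from someI_ex[OF this, folded norm_map_def]
  show "norm_map V M \<kappa> d \<in> hom C M (OM V d)"
    "c \<in> Ob P \<Longrightarrow> norm_map V M \<kappa> d \<cdot> \<kappa> c = Sm (hom P c d) (OM V c) (OM V d) (AM V)" by blast+
qed

lemma norm_cone: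
  assumes V: "is_functor P C V" and k: "is_colimit C P V M \<kappa>"
  shows "is_cone C P V M (norm_map V M \<kappa>)"
  unfolding is_cone_def
proof (intro conjI ballI)
  note Vs = is_functorD[OF V]
  note [simp] = Vs(3)
  fix l assume "l \<in> Ar P"
  then have l: "l \<in> hom P (Dom P l) (Cod P l)" and [simp]: "Dom P l \<in> Ob P" "Cod P l \<in> Ob P"
    by (simp_all add: P.hom_iff)
  note n1 = norm_map(1)[OF V k, of "Dom P l"] and n2 = norm_map(1)[OF V k, of "Cod P l"]
  note [simp] = homD[OF n1] homD[OF n2] homD[OF Vs(4)[OF l]] homD[OF is_colimitD(2)[OF k]]
  show "AM V l \<cdot> norm_map V M \<kappa> (Dom P l) = norm_map V M \<kappa> (Cod P l)"
  proof (rule is_colimit_eq[OF k _ _ _ functor_diagram[OF V]])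
    fix c assume [simp]: "c \<in> Ob P"
    have "AM V l \<cdot> norm_map V M \<kappa> (Dom P l) \<cdot> \<kappa> c = AM V l \<cdot> Sm (hom P c (Dom P l)) (OM V c) (OM V (Dom P l)) (AM V)"
      by (simp add: norm_map(2)[OF V k])
    also have "\<dots> = Sm (hom P c (Dom P l)) (OM V c) (OM V (Cod P l)) (\<lambda>n. AM V l \<cdot> AM V n)"
      by (rule Sm_comp_left) (simp_all add: Vs(4) l)
    also have "\<dots> = Sm (hom P c (Dom P l)) (OM V c) (OM V (Cod P l)) (\<lambda>n. AM V (l \<cdot>\<^bsub>P\<^esub> n))"
      by (rule Sm_cong) (simp add: Vs(6)[OF _ l])
    also have "\<dots> = Sm (hom P c (Cod P l)) (OM V c) (OM V (Cod P l)) (AM V)"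
      by (rule Sm_reindex[OF _ P.bij_postcompose[OF l], symmetric]) (simp_all add: Vs(4))
    finally show "AM V l \<cdot> norm_map V M \<kappa> (Dom P l) \<cdot> \<kappa> c = norm_map V M \<kappa> (Cod P l) \<cdot> \<kappa> c"
      by (simp add: norm_map(2)[OF V k])
  qed (simp_all add: hom_iff)
qed (rule is_colimitD(1)[OF k], erule norm_map(1)[OF V k])

text \<open>This reads off one coordinate of a sum over all components.\<close>

lemma Sm_rep:
  assumes c: "c \<in> Ob P" and f: "f (P.rep c) \<in> hom C A B"
    and z: "\<And>r. \<lbrakk>r \<in> R; r \<in> Ob P; hom P r c = {}; hom P c r = {}\<rbrakk> \<Longrightarrow> f r = zer A B"
  shows "Sm R A B f = f (P.rep c)"
  by (rule Sm_single) (use P.rep[OF c] P.reps_ob f z in auto)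

lemma norm_disconnected:
  assumes V: "is_functor P C V" and k: "is_colimit C P V M \<kappa>" and "c \<in> Ob P" "d \<in> Ob P" "hom P c d = {}"
  shows "norm_map V M \<kappa> d \<cdot> \<kappa> c = zer (OM V c) (OM V d)"
proof -
  have "Sm {} (OM V c) (OM V d) (AM V) = zer (OM V c) (OM V d)"
    by (rule Sm_zero) (simp_all add: is_functorD(3)[OF V] assms(3,4))
  then show ?thesis using norm_map(2)[OF V k assms(4,3)] assms(5) by simp
qed

text \<open>Each summand of the norm becomes \<open>\<kappa> c\<close> when followed by \<open>\<kappa> d\<close>, and becomes \<open>\<tau> d\<close> when preceded by \<open>\<tau> c\<close>
  for a cone \<open>\<tau>\<close>; so only the number of summands remains.\<close>

lemma cocone_norm:
  assumes V: "is_functor P C V" and k: "is_colimit C P V M \<kappa>" and [simp]: "c \<in> Ob P" "d \<in> Ob P" and cd: "hom P c d \<noteq> {}"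
  shows "\<kappa> d \<cdot> (norm_map V M \<kappa> d \<cdot> \<kappa> c) = \<kappa> c \<cdot> mult (hom P c c) (OM V c)"
proof -
  note Vs = is_functorD[OF V]
  note [simp] = Vs(3)
  have kc: "\<kappa> c \<in> hom C (OM V c) M" and kd: "\<kappa> d \<in> hom C (OM V d) M" using is_colimitD(2)[OF k] by auto
  have "\<kappa> d \<cdot> (norm_map V M \<kappa> d \<cdot> \<kappa> c) = Sm (hom P c d) (OM V c) M (\<lambda>m. \<kappa> d \<cdot> AM V m)"
    by (simp add: norm_map(2)[OF V k]) (rule Sm_comp_left[OF _ _ _ kd], simp_all add: Vs(4))
  also have "\<dots> = Sm (hom P c d) (OM V c) M (\<lambda>_. \<kappa> c)"
    using is_colimitD(3)[OF k] by (intro Sm_cong) (auto simp: P.hom_iff)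
  also have "\<dots> = \<kappa> c \<cdot> mult (hom P c c) (OM V c)"
    using Sm_hom_const(1)[OF _ _ kc cd] mult_natural(1)[OF _ kc, of "hom P c c"] by simp
  finally show ?thesis .
qed

lemma norm_cocone_cone:
  assumes V: "is_functor P C V" and k: "is_colimit C P V M \<kappa>" and t: "is_cone C P V w \<tau>"
    and [simp]: "c \<in> Ob P" "d \<in> Ob P" and cd: "hom P c d \<noteq> {}"
  shows "norm_map V M \<kappa> d \<cdot> \<kappa> c \<cdot> \<tau> c = mult (hom P c c) (OM V d) \<cdot> \<tau> d"
proof -
  note Vs = is_functorD[OF V]
  note [simp] = Vs(3)
  have tc: "\<tau> c \<in> hom C w (OM V c)" and td: "\<tau> d \<in> hom C w (OM V d)" using t by (auto simp: is_cone_def)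
  have "norm_map V M \<kappa> d \<cdot> \<kappa> c \<cdot> \<tau> c = Sm (hom P c d) w (OM V d) (\<lambda>m. AM V m \<cdot> \<tau> c)"
    by (simp add: norm_map(2)[OF V k]) (rule Sm_comp_right[OF _ _ _ tc], simp_all add: Vs(4))
  also have "\<dots> = Sm (hom P c d) w (OM V d) (\<lambda>_. \<tau> d)"
    using t by (intro Sm_cong) (auto simp: P.hom_iff is_cone_def)
  also have "\<dots> = mult (hom P c c) (OM V d) \<cdot> \<tau> d"
    using Sm_hom_const(1)[OF _ _ td cd] mult_natural(2)[OF _ td, of "hom P c c"] by simp
  finally show ?thesis .
qed

text \<open>Averaging a cone over the automorphism groups gives a map to the colimit, and the norm undoes the
  averaging.\<close>

lemma norm_limit:
  assumes orders_iso: orders_iso and V: "is_functor P C V" and k: "is_colimit C P V M \<kappa>"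
  shows "is_limit C P V M (norm_map V M \<kappa>)"
  unfolding is_limit_def
proof (intro conjI allI impI norm_cone[OF V k])
  note Vs = is_functorD[OF V]
  note [simp] = Vs(3) is_colimitD(1)[OF k]
  let ?N = "norm_map V M \<kappa>"
  note nh = norm_map(1)[OF V k] and kh = is_colimitD(2)[OF k]
  note [simp] = homD[OF nh] homD[OF kh] card_inv_ar[OF orders_iso]
  fix w \<tau> assume t: "is_cone C P V w \<tau>"
  then have th: "\<And>c. c \<in> Ob P \<Longrightarrow> \<tau> c \<in> hom C w (OM V c)" and [simp]: "w \<in> Ob C" by (auto simp: is_cone_def)
  note [simp] = homD[OF th]
  have RO [simp]: "c \<in> R \<Longrightarrow> c \<in> Ob P" for c using P.reps_ob by blast
  \<comment> \<open>the average of the cone \<open>\<tau>\<close>, one term for each component\<close>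
  let ?u = "Sm R w M (\<lambda>c. \<kappa> c \<cdot> (card_inv c (OM V c) \<cdot> \<tau> c))"
  have uh: "?u \<in> hom C w M" by (rule Sm_hom) (simp_all add: hom_iff)
  have "?N d \<cdot> ?u = \<tau> d" if d[simp]: "d \<in> Ob P" for d
  proof -
    let ?c = "P.rep d"
    note [simp] = P.rep(2)[OF d]
    have nz: "?N d \<cdot> (\<kappa> c \<cdot> (card_inv c (OM V c) \<cdot> \<tau> c)) = zer w (OM V d)"
      if [simp]: "c \<in> Ob P" and "hom P c d = {}" for c
    proof -
      have "?N d \<cdot> (\<kappa> c \<cdot> (card_inv c (OM V c) \<cdot> \<tau> c)) = ?N d \<cdot> \<kappa> c \<cdot> (card_inv c (OM V c) \<cdot> \<tau> c)" by simp
      then show ?thesis using norm_disconnected[OF V k \<open>c \<in> Ob P\<close> d] that by simp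
    qed
    have "?N d \<cdot> ?u = Sm R w (OM V d) (\<lambda>c. ?N d \<cdot> (\<kappa> c \<cdot> (card_inv c (OM V c) \<cdot> \<tau> c)))"
      by (rule Sm_comp_left[OF _ _ _ nh]) (simp_all add: hom_iff)
    also have "\<dots> = ?N d \<cdot> (\<kappa> ?c \<cdot> (card_inv ?c (OM V ?c) \<cdot> \<tau> ?c))"
      by (rule Sm_rep[OF d]) (simp_all add: hom_iff nz)
    also have "\<dots> = ?N d \<cdot> \<kappa> ?c \<cdot> \<tau> ?c \<cdot> card_inv ?c w"
      using card_inv_natural[OF orders_iso _ th, of ?c ?c] by simp
    also have "\<dots> = mult (hom P ?c ?c) (OM V d) \<cdot> \<tau> d \<cdot> card_inv ?c w"
      using norm_cocone_cone[OF V k t _ d P.rep(3)[OF d]] by (simp del: assoc_ar)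
    also have "\<dots> = \<tau> d"
      using card_inv_natural[OF orders_iso _ th[OF d], of ?c] reassoc[OF card_inv_mult[OF orders_iso]] by simp
    finally show ?thesis .
  qed
  moreover have "y = ?u" if y: "y \<in> hom C w M" and e: "\<And>d. d \<in> Ob P \<Longrightarrow> ?N d \<cdot> y = \<tau> d" for y
  proof -
    note [simp] = homD[OF y]
    \<comment> \<open>for the uniqueness, the identity of the colimit is itself such an average of the norms\<close>
    let ?f = "\<lambda>c. \<kappa> c \<cdot> (card_inv c (OM V c) \<cdot> ?N c)"
    have fh: "?f c \<in> hom C M M" if "c \<in> R" for c using that by (simp add: hom_iff)
    have Sh: "Sm R M M ?f \<in> hom C M M" by (rule Sm_hom) (simp_all add: fh)
    have "Sm R M M ?f = Ident C M"
    proof (rule is_colimit_eq[OF k Sh ident_hom _ functor_diagram[OF V]])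
      fix d assume d[simp]: "d \<in> Ob P"
      let ?c = "P.rep d"
      note [simp] = P.rep(2)[OF d]
      have dc: "hom P d ?c \<noteq> {}" using P.rep(3)[OF d] P.connected_sym by blast
      have "Sm R M M ?f \<cdot> \<kappa> d = Sm R (OM V d) M (\<lambda>c. ?f c \<cdot> \<kappa> d)"
        by (rule Sm_comp_right[OF _ _ _ kh]) (simp_all add: fh)
      also have "\<dots> = ?f ?c \<cdot> \<kappa> d"
        by (rule Sm_rep[OF d]) (simp_all add: hom_iff norm_disconnected[OF V k])
      also have "\<dots> = \<kappa> ?c \<cdot> (?N ?c \<cdot> \<kappa> d) \<cdot> card_inv ?c (OM V d)"
        using card_inv_natural[OF orders_iso _ kh[OF d], of ?c, symmetric]
          reassoc[OF card_inv_natural[OF orders_iso _ norm_map(1)[OF V k], of ?c ?c, symmetric]] by simp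
      also have "\<dots> = \<kappa> d \<cdot> (mult (hom P d d) (OM V d) \<cdot> card_inv ?c (OM V d))"
        by (simp add: cocone_norm[OF V k d _ dc] del: assoc_ar) simp
      also have "\<dots> = \<kappa> d"
        using mult_connected[OF d _ dc, of "OM V d"] card_inv_mult[OF orders_iso] by simp
      finally show "Sm R M M ?f \<cdot> \<kappa> d = Ident C M \<cdot> \<kappa> d" by simp
    qed simp
    then have "y = Sm R M M ?f \<cdot> y" by simp
    also have "\<dots> = Sm R w M (\<lambda>c. ?f c \<cdot> y)"
      by (rule Sm_comp_right[OF _ _ _ y]) (simp_all add: fh)
    also have "\<dots> = ?u" by (rule Sm_cong) (simp add: e)
    finally show ?thesis .
  qed
  ultimately show "\<exists>!u. u \<in> hom C w M \<and> (\<forall>j \<in> Ob P. ?N j \<cdot> u = \<tau> j)"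
    using uh by (intro ex1I[of _ ?u]) blast+
qed

text \<open>The sum over the components of the composites through the vertices inverts the norm up to the
  orders of the automorphism groups.\<close>

lemma component_sum_iso:
  assumes orders_iso: orders_iso and V: "is_functor P C V" and k: "is_colimit C P V M \<kappa>" and p: "is_limit C P V L p"
  shows "is_iso C (Sm R L M (\<lambda>c. \<kappa> c \<cdot> p c))"
proof -
  note Vs = is_functorD[OF V]
  note [simp] = Vs(3) is_colimitD(1)[OF k] is_limitD(1)[OF p]
  let ?N = "norm_map V M \<kappa>" and ?G = "Sm R L M (\<lambda>c. \<kappa> c \<cdot> p c)"
  note nh = norm_map(1)[OF V k] and kh = is_colimitD(2)[OF k] and ph = is_limitD(2)[OF p]
  note [simp] = homD[OF nh] homD[OF kh] homD[OF ph] card_inv_ar[OF orders_iso]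
  have RO [simp]: "c \<in> R \<Longrightarrow> c \<in> Ob P" for c using P.reps_ob by blast
  have Gh: "?G \<in> hom C L M" by (rule Sm_hom) (simp_all add: hom_iff)
  obtain N where N: "N \<in> hom C M L" and pN: "\<And>c. c \<in> Ob P \<Longrightarrow> p c \<cdot> N = ?N c"
    using is_limit_ex[OF p norm_cone[OF V k]] by blast
  have Ni: "is_iso C N"
    by (rule limit_comparison_iso[OF p norm_limit[OF orders_iso V k] functor_diagram[OF V] N pN])
  note [simp] = homD[OF Gh] homD[OF N]
  have GN: "?G \<cdot> N \<cdot> \<kappa> d = \<kappa> d \<cdot> mult (hom P d d) (OM V d)" if d[simp]: "d \<in> Ob P" for d
  proof -
    let ?c = "P.rep d"
    note [simp] = P.rep(2)[OF d]
    have dc: "hom P d ?c \<noteq> {}" using P.rep(3)[OF d] P.connected_sym by blast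
    have "N \<cdot> \<kappa> d \<in> hom C (OM V d) L" by (simp add: hom_iff)
    then have "?G \<cdot> (N \<cdot> \<kappa> d) = Sm R (OM V d) M (\<lambda>c. \<kappa> c \<cdot> p c \<cdot> (N \<cdot> \<kappa> d))"
      by (intro Sm_comp_right) (simp_all add: hom_iff)
    also have "\<dots> = Sm R (OM V d) M (\<lambda>c. \<kappa> c \<cdot> (?N c \<cdot> \<kappa> d))"
      by (rule Sm_cong) (simp add: reassoc[OF pN])
    also have "\<dots> = \<kappa> ?c \<cdot> (?N ?c \<cdot> \<kappa> d)"
      by (rule Sm_rep[OF d]) (simp_all add: hom_iff norm_disconnected[OF V k])
    also have "\<dots> = \<kappa> d \<cdot> mult (hom P d d) (OM V d)"
      by (rule cocone_norm[OF V k d _ dc]) simp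
    finally show ?thesis by simp
  qed
  have "is_cocone C P V M (\<lambda>d. \<kappa> d \<cdot> card_inv d (OM V d))"
    unfolding is_cocone_def
  proof (intro conjI ballI)
    fix m assume "m \<in> Ar P"
    then have m: "m \<in> hom P (Dom P m) (Cod P m)" and [simp]: "m \<in> Ar P" "Dom P m \<in> Ob P" "Cod P m \<in> Ob P"
      by (simp_all add: P.hom_iff)
    note Vm = Vs(4)[OF m]
    note [simp] = homD[OF Vm]
    have "hom P (Dom P m) (Cod P m) \<noteq> {}" using m by blast
    then have "card_inv (Cod P m) (OM V (Cod P m)) = card_inv (Dom P m) (OM V (Cod P m))"
      using mult_connected[OF _ _ _ Vs(3), of "Dom P m" "Cod P m" "Cod P m"] by (simp add: card_inv_def)
    then show "\<kappa> (Cod P m) \<cdot> card_inv (Cod P m) (OM V (Cod P m)) \<cdot> AM V m = \<kappa> (Dom P m) \<cdot> card_inv (Dom P m) (OM V (Dom P m))"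
      using card_inv_natural[OF orders_iso _ Vm, of "Dom P m"] reassoc[OF is_colimitD(3)[OF k \<open>m \<in> Ar P\<close>], of "card_inv (Dom P m) (OM V (Dom P m))"]
      by simp
  qed (simp_all add: hom_iff)
  \<comment> \<open>division of the colimit by the orders, component by component\<close>
  then obtain T where T: "T \<in> hom C M M" and Tk: "\<And>d. d \<in> Ob P \<Longrightarrow> T \<cdot> \<kappa> d = \<kappa> d \<cdot> card_inv d (OM V d)"
    using is_colimit_ex[OF k] by blast
  note [simp] = homD[OF T]
  have "?G \<cdot> N \<cdot> T = Ident C M"
  proof (rule is_colimit_eq[OF k _ _ _ functor_diagram[OF V]])
    fix d assume d[simp]: "d \<in> Ob P"
    have "?G \<cdot> N \<cdot> T \<cdot> \<kappa> d = ?G \<cdot> N \<cdot> \<kappa> d \<cdot> card_inv d (OM V d)" by (simp add: Tk)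
    also have "\<dots> = \<kappa> d" by (simp add: GN card_inv_mult[OF orders_iso] del: assoc_ar) (simp add: card_inv_mult[OF orders_iso])
    finally show "?G \<cdot> N \<cdot> T \<cdot> \<kappa> d = Ident C M \<cdot> \<kappa> d" by simp
  qed (simp_all add: hom_iff)
  moreover have "T \<cdot> (?G \<cdot> N) = Ident C M"
  proof (rule is_colimit_eq[OF k _ _ _ functor_diagram[OF V]])
    fix d assume d[simp]: "d \<in> Ob P"
    have "T \<cdot> (?G \<cdot> N) \<cdot> \<kappa> d = T \<cdot> (?G \<cdot> N \<cdot> \<kappa> d)" by simp
    also have "\<dots> = T \<cdot> \<kappa> d \<cdot> mult (hom P d d) (OM V d)" unfolding GN[OF d] by simp
    also have "\<dots> = \<kappa> d" unfolding Tk[OF d] using mult_iso_hom[OF orders_iso d, of "OM V d"] by (simp add: card_inv_def)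
    finally show "T \<cdot> (?G \<cdot> N) \<cdot> \<kappa> d = Ident C M \<cdot> \<kappa> d" by simp
  qed (simp_all add: hom_iff)
  ultimately have "is_iso C (?G \<cdot> N)" by (intro is_isoI(1)[OF _ T]) (simp_all add: hom_iff)
  then show ?thesis by (rule is_iso_cancel_right[OF _ Ni]) simp_all
qed

text \<open>Here \<open>\<tau>\<close> and \<open>e\<close> are the two halves of the pre-Nakayama map at one object, characterized by their
  behaviour on \<open>V c\<close>. The limit \<open>B\<close> of the constant diagram on the unit is a product of units indexed by the
  components, so \<open>e\<close> decomposes as a sum over the components, and \<open>\<tau>\<close> sends the summand of \<open>c\<close>
  to \<open>\<kappa> c \<cdot> p c\<close>.\<close>

lemma component_sum_eq:
  assumes V: "is_functor P C V" and k: "is_colimit C P V M \<kappa>" and p: "is_limit C P V L p"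
    and b: "is_limit C P (cst C \<one>) B b"
    and e: "e \<in> hom C L (M \<otimes> B)" "\<And>c. c \<in> Ob P \<Longrightarrow> (Ident C M \<boxtimes> b c) \<cdot> e = inv_ar C (runit C M) \<cdot> (\<kappa> c \<cdot> p c)"
    and t: "\<tau> \<in> hom C (M \<otimes> B) M"
      "\<And>c. c \<in> Ob P \<Longrightarrow> \<tau> \<cdot> (\<kappa> c \<boxtimes> Ident C B) = \<kappa> c \<cdot> (runit C (OM V c) \<cdot> (Ident C (OM V c) \<boxtimes> b c))"
  shows "\<tau> \<cdot> e = Sm R L M (\<lambda>c. \<kappa> c \<cdot> p c)"
proof -
  note Vs = is_functorD[OF V]
  note [simp] = Vs(3) is_colimitD(1)[OF k] is_limitD(1)[OF p] is_limitD(1)[OF b]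
  note kh = is_colimitD(2)[OF k] and ph = is_limitD(2)[OF p]
  have bh: "c \<in> Ob P \<Longrightarrow> b c \<in> hom C B \<one>" for c using is_limitD(2)[OF b] by simp
  note [simp] = homD[OF kh] homD[OF ph] homD[OF bh] homD[OF e(1)] homD[OF t(1)]
  have RO [simp]: "c \<in> R \<Longrightarrow> c \<in> Ob P" for c using P.reps_ob by blast
  have dg: "diagram C P (cst C \<one>)" by (simp add: diagram_def hom_iff)
  \<comment> \<open>the inclusion \<open>j\<close> of the component of \<open>c\<close> into \<open>B\<close>: its coordinate at \<open>d\<close> is the identity or zero\<close>
  have "\<exists>j. j \<in> hom C \<one> B \<and> (\<forall>d \<in> Ob P. b d \<cdot> j = (if hom P c d = {} then zer \<one> \<one> else Ident C \<one>))" if c: "c \<in> Ob P" for c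
  proof -
    have "hom P c (Dom P m) = {} \<longleftrightarrow> hom P c (Cod P m) = {}" if m: "m \<in> Ar P" for m
      using P.ar_hom[OF m] P.connected_trans[of c "Dom P m" "Cod P m"] P.connected_trans[of c "Cod P m" "Dom P m"]
        P.connected_sym[of "Dom P m" "Cod P m"] by blast
    then have "is_cone C P (cst C \<one>) \<one> (\<lambda>d. if hom P c d = {} then zer \<one> \<one> else Ident C \<one>)"
      by (auto simp: is_cone_def hom_iff)
    from is_limit_ex[OF b this] show ?thesis by metis
  qed
  then obtain j where jh: "\<And>c. c \<in> Ob P \<Longrightarrow> j c \<in> hom C \<one> B"
    and bj: "\<And>c d. \<lbrakk>c \<in> Ob P; d \<in> Ob P\<rbrakk> \<Longrightarrow> b d \<cdot> j c = (if hom P c d = {} then zer \<one> \<one> else Ident C \<one>)"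
    by metis
  note [simp] = homD[OF jh]
  let ?f = "\<lambda>c. (Ident C M \<boxtimes> j c) \<cdot> (inv_ar C (runit C M) \<cdot> (\<kappa> c \<cdot> p c))"
  have fh: "?f c \<in> hom C L (M \<otimes> B)" if "c \<in> R" for c using that by (simp add: hom_iff)
  have "e = Sm R L (M \<otimes> B) ?f"
  proof (rule is_limit_eq[OF ltens_limit[OF b dg, of M]])
    show "Sm R L (M \<otimes> B) ?f \<in> hom C L (M \<otimes> B)" by (rule Sm_hom) (simp_all add: fh)
    fix d assume d[simp]: "d \<in> Ob P"
    let ?c = "P.rep d"
    note [simp] = P.rep(2)[OF d]
    obtain m where m: "m \<in> hom P ?c d" using P.rep(3)[OF d] by blast
    have "Ident C M \<boxtimes> b d \<in> hom C (M \<otimes> B) (M \<otimes> \<one>)" by (simp add: hom_iff)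
    then have "(Ident C M \<boxtimes> b d) \<cdot> Sm R L (M \<otimes> B) ?f = Sm R L (M \<otimes> \<one>) (\<lambda>c. (Ident C M \<boxtimes> b d) \<cdot> ?f c)"
      by (intro Sm_comp_left) (simp_all add: fh)
    also have "\<dots> = (Ident C M \<boxtimes> b d) \<cdot> ?f ?c"
      by (rule Sm_rep[OF d]) (simp_all add: hom_iff interchange_assoc bj)
    also have "\<dots> = inv_ar C (runit C M) \<cdot> (\<kappa> ?c \<cdot> p ?c)"
      using P.rep(3)[OF d] by (simp add: interchange_assoc bj)
    also have "\<dots> = inv_ar C (runit C M) \<cdot> (\<kappa> d \<cdot> p d)"
      using functor_cone_connected[OF V is_limit_cone[OF p] is_colimit_cocone[OF k] m] by simp
    finally show "(Ident C M \<boxtimes> b d) \<cdot> e = (Ident C M \<boxtimes> b d) \<cdot> Sm R L (M \<otimes> B) ?f" using e(2) by simp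
  qed (use e(1) diagram_tens[OF dg] in simp_all)
  then have "\<tau> \<cdot> e = \<tau> \<cdot> Sm R L (M \<otimes> B) ?f" by simp
  also have "\<dots> = Sm R L M (\<lambda>c. \<tau> \<cdot> ?f c)"
    by (rule Sm_comp_left[OF _ _ _ t(1)]) (simp_all add: fh)
  also have "\<dots> = Sm R L M (\<lambda>c. \<kappa> c \<cdot> p c)"
  proof (rule Sm_cong)
    fix c assume c: "c \<in> R"
    then have [simp]: "c \<in> Ob P" by simp
    have "hom P c c \<noteq> {}" using P.ident_hom[of c] by auto
    then have [simp]: "b c \<cdot> j c = Ident C \<one>" by (simp add: bj)
    have "\<tau> \<cdot> ?f c = \<tau> \<cdot> ((Ident C M \<boxtimes> j c) \<cdot> ((\<kappa> c \<boxtimes> Ident C \<one>) \<cdot> (inv_ar C (runit C (OM V c)) \<cdot> p c)))"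
      using reassoc[OF runit_inv_nat_ar[of "\<kappa> c" M]] by simp
    also have "\<dots> = \<tau> \<cdot> ((\<kappa> c \<boxtimes> Ident C B) \<cdot> ((Ident C (OM V c) \<boxtimes> j c) \<cdot> (inv_ar C (runit C (OM V c)) \<cdot> p c)))"
      by (simp add: interchange_assoc)
    also have "\<dots> = \<kappa> c \<cdot> p c"
      by (subst reassoc[OF t(2)]) (simp_all add: interchange_assoc)
    finally show "\<tau> \<cdot> ?f c = \<kappa> c \<cdot> p c" .
  qed
  finally show ?thesis .
qed

end


section \<open>Functor categories\<close>

lemma functor_cat_sel [simp]:
  "Ob (functor_cat X C) = {F. is_functor X C F}" "Ar (functor_cat X C) = {t. is_ntr X C t}"
  "Dom (functor_cat X C) = Src" "Cod (functor_cat X C) = Tgt"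
  by (simp_all add: functor_cat_def Let_def)

lemma functor_cat_cmp [simp]:
  "Src (t \<cdot>\<^bsub>functor_cat X C\<^esub> s) = Src s" "Tgt (t \<cdot>\<^bsub>functor_cat X C\<^esub> s) = Tgt t"
  "x \<in> Ob X \<Longrightarrow> Cmp (t \<cdot>\<^bsub>functor_cat X C\<^esub> s) x = Cmp t x \<cdot>\<^bsub>C\<^esub> Cmp s x"
  "Src (Ident (functor_cat X C) F) = F" "Tgt (Ident (functor_cat X C) F) = F"
  "x \<in> Ob X \<Longrightarrow> Cmp (Ident (functor_cat X C) F) x = Ident C (OM F x)"
  "x \<in> Ob X \<Longrightarrow> Cmp (s \<boxtimes>\<^bsub>functor_cat X C\<^esub> t) x = Cmp s x \<boxtimes>\<^bsub>C\<^esub> Cmp t x"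
  "Src (s \<boxtimes>\<^bsub>functor_cat X C\<^esub> t) = Src s \<otimes>\<^bsub>functor_cat X C\<^esub> Src t"
  "Tgt (s \<boxtimes>\<^bsub>functor_cat X C\<^esub> t) = Tgt s \<otimes>\<^bsub>functor_cat X C\<^esub> Tgt t"
  "x \<in> Ob X \<Longrightarrow> OM (F \<otimes>\<^bsub>functor_cat X C\<^esub> G) x = OM F x \<otimes>\<^bsub>C\<^esub> OM G x"
  "m \<in> Ar X \<Longrightarrow> AM (F \<otimes>\<^bsub>functor_cat X C\<^esub> G) m = AM F m \<boxtimes>\<^bsub>C\<^esub> AM G m"
  "x \<in> Ob X \<Longrightarrow> OM \<one>\<^bsub>functor_cat X C\<^esub> x = \<one>\<^bsub>C\<^esub>"
  "m \<in> Ar X \<Longrightarrow> AM \<one>\<^bsub>functor_cat X C\<^esub> m = Ident C \<one>\<^bsub>C\<^esub>"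
  "Src (runit (functor_cat X C) F) = F \<otimes>\<^bsub>functor_cat X C\<^esub> \<one>\<^bsub>functor_cat X C\<^esub>"
  "Tgt (runit (functor_cat X C) F) = F"
  "x \<in> Ob X \<Longrightarrow> Cmp (runit (functor_cat X C) F) x = runit C (OM F x)"
  "Src (lunit (functor_cat X C) F) = \<one>\<^bsub>functor_cat X C\<^esub> \<otimes>\<^bsub>functor_cat X C\<^esub> F"
  "Tgt (lunit (functor_cat X C) F) = F"
  "x \<in> Ob X \<Longrightarrow> Cmp (lunit (functor_cat X C) F) x = lunit C (OM F x)"
  by (simp_all add: functor_cat_def Let_def)

lemma functor_cat_ext:
  "Cmp (t \<cdot>\<^bsub>functor_cat X C\<^esub> s) \<in> extensional (Ob X)"
  "Cmp (Ident (functor_cat X C) F) \<in> extensional (Ob X)"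
  "Cmp (s \<boxtimes>\<^bsub>functor_cat X C\<^esub> t) \<in> extensional (Ob X)"
  "Cmp (runit (functor_cat X C) F) \<in> extensional (Ob X)"
  "Cmp (lunit (functor_cat X C) F) \<in> extensional (Ob X)"
  "OM (F \<otimes>\<^bsub>functor_cat X C\<^esub> G) \<in> extensional (Ob X)" "AM (F \<otimes>\<^bsub>functor_cat X C\<^esub> G) \<in> extensional (Ar X)"
  "OM \<one>\<^bsub>functor_cat X C\<^esub> \<in> extensional (Ob X)" "AM \<one>\<^bsub>functor_cat X C\<^esub> \<in> extensional (Ar X)"
  by (simp_all add: functor_cat_def Let_def)

lemma is_functorI:
  assumes "category A" "category B" "OM F \<in> extensional (Ob A)" "AM F \<in> extensional (Ar A)"
    and "\<And>x. x \<in> Ob A \<Longrightarrow> OM F x \<in> Ob B"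
    and "\<And>m x y. m \<in> hom A x y \<Longrightarrow> AM F m \<in> hom B (OM F x) (OM F y)"
    and "\<And>x. x \<in> Ob A \<Longrightarrow> AM F (Ident A x) = Ident B (OM F x)"
    and "\<And>m n x y z. m \<in> hom A x y \<Longrightarrow> n \<in> hom A y z \<Longrightarrow> AM F (n \<cdot>\<^bsub>A\<^esub> m) = AM F n \<cdot>\<^bsub>B\<^esub> AM F m"
  shows "is_functor A B F"
proof -
  have "AM F m \<in> hom B (OM F (Dom A m)) (OM F (Cod A m))" if "m \<in> Ar A" for m
    using assms(6)[of m "Dom A m" "Cod A m"] that by (simp add: hom_def)
  then show ?thesis using assms(1-5,7,8) unfolding is_functor_def
    by (simp add: PiE_def Pi_def hom_def)
qed

lemma is_functor_ext: "is_functor A B F \<Longrightarrow> OM F \<in> extensional (Ob A)" "is_functor A B F \<Longrightarrow> AM F \<in> extensional (Ar A)"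
  by (auto simp: is_functor_def PiE_def)

lemma fct_eqI:
  fixes F G :: "('x, 'm, 'o, 'a) fct"
  assumes "OM F \<in> extensional (Ob X)" "AM F \<in> extensional (Ar X)" "OM G \<in> extensional (Ob X)" "AM G \<in> extensional (Ar X)"
    and "\<And>x. x \<in> Ob X \<Longrightarrow> OM F x = OM G x" "\<And>m. m \<in> Ar X \<Longrightarrow> AM F m = AM G m"
  shows "F = G"
  using extensionalityI[OF assms(1,3,5)] extensionalityI[OF assms(2,4,6)] by simp

lemma is_ntrD:
  assumes "is_ntr A B t"
  shows "is_functor A B (Src t)" "is_functor A B (Tgt t)" "Cmp t \<in> extensional (Ob A)"
    "\<And>x. x \<in> Ob A \<Longrightarrow> Cmp t x \<in> hom B (OM (Src t) x) (OM (Tgt t) x)"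
    "\<And>m x y. m \<in> hom A x y \<Longrightarrow> Cmp t y \<cdot>\<^bsub>B\<^esub> AM (Src t) m = AM (Tgt t) m \<cdot>\<^bsub>B\<^esub> Cmp t x"
  using assms by (auto simp: is_ntr_def hom_def)

lemma is_ntrI:
  assumes "is_functor A B (Src t)" "is_functor A B (Tgt t)" "Cmp t \<in> extensional (Ob A)"
    "\<And>x. x \<in> Ob A \<Longrightarrow> Cmp t x \<in> hom B (OM (Src t) x) (OM (Tgt t) x)"
    "\<And>m x y. m \<in> hom A x y \<Longrightarrow> Cmp t y \<cdot>\<^bsub>B\<^esub> AM (Src t) m = AM (Tgt t) m \<cdot>\<^bsub>B\<^esub> Cmp t x"
  shows "is_ntr A B t"
  using assms by (auto simp: is_ntr_def hom_def)

lemma hom_functor_cat: "t \<in> hom (functor_cat X C) F G \<longleftrightarrow> is_ntr X C t \<and> Src t = F \<and> Tgt t = G"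
  by (simp add: hom_def)

lemma hom_functor_catD:
  assumes "t \<in> hom (functor_cat X C) F G"
  shows "is_functor X C F" "is_functor X C G" "Src t = F" "Tgt t = G" "is_ntr X C t"
    "\<And>x. x \<in> Ob X \<Longrightarrow> Cmp t x \<in> hom C (OM F x) (OM G x)"
    "\<And>m x y. m \<in> hom X x y \<Longrightarrow> Cmp t y \<cdot>\<^bsub>C\<^esub> AM F m = AM G m \<cdot>\<^bsub>C\<^esub> Cmp t x"
  using assms is_ntrD[of X C t] by (auto simp: hom_functor_cat)

lemma ntr_eqI:
  assumes "t \<in> hom (functor_cat X C) F G" "s \<in> hom (functor_cat X C) F G"
    and "\<And>x. x \<in> Ob X \<Longrightarrow> Cmp t x = Cmp s x"
  shows "t = s"
proof -
  have "Cmp t = Cmp s"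
    by (rule extensionalityI[of _ "Ob X"]) (use assms is_ntrD(3) in \<open>auto simp: hom_functor_cat\<close>)
  then show ?thesis using assms(1,2) by (simp add: hom_functor_cat)
qed

lemma hom_functor_catI:
  assumes "is_functor X C F" "is_functor X C G" "Cmp t \<in> extensional (Ob X)" "Src t = F" "Tgt t = G"
    "\<And>x. x \<in> Ob X \<Longrightarrow> Cmp t x \<in> hom C (OM F x) (OM G x)"
    "\<And>m x y. m \<in> hom X x y \<Longrightarrow> Cmp t y \<cdot>\<^bsub>C\<^esub> AM F m = AM G m \<cdot>\<^bsub>C\<^esub> Cmp t x"
  shows "t \<in> hom (functor_cat X C) F G"
  unfolding hom_functor_cat using assms by (auto intro!: is_ntrI)

context symmetric_monoidal_category
begin

lemma ident_ntr:
  assumes F: "is_functor X C F"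
  shows "Ident (functor_cat X C) F \<in> hom (functor_cat X C) F F"
proof (rule hom_functor_catI)
  note Fs = is_functorD[OF F]
  interpret X: category X by (rule Fs(1))
  fix m x y assume m: "m \<in> hom X x y"
  note [simp] = X.hom_ob[OF m] homD[OF Fs(4)[OF m]]
  show "Cmp (Ident (functor_cat X C) F) y \<cdot> AM F m = AM F m \<cdot> Cmp (Ident (functor_cat X C) F) x" by simp
qed (use F is_functorD(3)[OF F] in \<open>simp_all add: functor_cat_ext hom_iff\<close>)

lemma comp_ntr:
  assumes t: "t \<in> hom (functor_cat X C) F G" and s: "s \<in> hom (functor_cat X C) G H"
  shows "s \<cdot>\<^bsub>functor_cat X C\<^esub> t \<in> hom (functor_cat X C) F H"
proof (rule hom_functor_catI)
  note T = hom_functor_catD[OF t] and S = hom_functor_catD[OF s]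
  interpret X: category X by (rule is_functorD(1)[OF T(1)])
  note [simp] = homD[OF T(6)] homD[OF S(6)]
  show "Cmp (s \<cdot>\<^bsub>functor_cat X C\<^esub> t) x \<in> hom C (OM F x) (OM H x)" if "x \<in> Ob X" for x
    using that by (simp add: hom_iff)
  fix m x y assume m: "m \<in> hom X x y"
  note [simp] = X.hom_ob[OF m] homD[OF is_functorD(4)[OF T(1) m]] homD[OF is_functorD(4)[OF T(2) m]]
    homD[OF is_functorD(4)[OF S(2) m]]
  show "Cmp (s \<cdot>\<^bsub>functor_cat X C\<^esub> t) y \<cdot> AM F m = AM H m \<cdot> Cmp (s \<cdot>\<^bsub>functor_cat X C\<^esub> t) x"
    using T(7)[OF m] reassoc[OF S(7)[OF m], of "Cmp t x"] by simp
qed (use hom_functor_catD[OF t] hom_functor_catD[OF s] in \<open>auto simp: functor_cat_ext\<close>)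

lemma category_functor_cat:
  assumes X: "category X"
  shows "category (functor_cat X C)"
proof
  interpret X: category X by fact
  fix f g h A B D E
  show "f \<in> Ar (functor_cat X C) \<Longrightarrow> Dom (functor_cat X C) f \<in> Ob (functor_cat X C)"
    "f \<in> Ar (functor_cat X C) \<Longrightarrow> Cod (functor_cat X C) f \<in> Ob (functor_cat X C)"
    using is_ntrD by auto
  show "A \<in> Ob (functor_cat X C) \<Longrightarrow> Ident (functor_cat X C) A \<in> hom (functor_cat X C) A A"
    using ident_ntr by simp
  assume f: "f \<in> hom (functor_cat X C) A B"
  note F = hom_functor_catD[OF f]
  note [simp] = homD[OF F(6)] is_functorD(3)[OF F(1)] is_functorD(3)[OF F(2)]
  show "f \<cdot>\<^bsub>functor_cat X C\<^esub> Ident (functor_cat X C) A = f"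
    by (rule ntr_eqI[OF comp_ntr[OF ident_ntr f] f]) (simp_all add: F)
  show "Ident (functor_cat X C) B \<cdot>\<^bsub>functor_cat X C\<^esub> f = f"
    by (rule ntr_eqI[OF comp_ntr[OF f ident_ntr] f]) (simp_all add: F)
  assume g: "g \<in> hom (functor_cat X C) B D"
  note G = hom_functor_catD[OF g]
  note [simp] = homD[OF G(6)]
  show "g \<cdot>\<^bsub>functor_cat X C\<^esub> f \<in> hom (functor_cat X C) A D" by (rule comp_ntr[OF f g])
  assume h: "h \<in> hom (functor_cat X C) D E"
  note [simp] = homD[OF hom_functor_catD(6)[OF h]]
  show "h \<cdot>\<^bsub>functor_cat X C\<^esub> g \<cdot>\<^bsub>functor_cat X C\<^esub> f = h \<cdot>\<^bsub>functor_cat X C\<^esub> (g \<cdot>\<^bsub>functor_cat X C\<^esub> f)"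
    by (rule ntr_eqI[OF comp_ntr[OF f comp_ntr[OF g h]] comp_ntr[OF comp_ntr[OF f g] h]]) simp
qed

lemma ntr_iso:
  assumes t: "t \<in> hom (functor_cat X C) F G" and i: "\<And>x. x \<in> Ob X \<Longrightarrow> is_iso C (Cmp t x)"
  shows "is_iso (functor_cat X C) t" "x \<in> Ob X \<Longrightarrow> Cmp (inv_ar (functor_cat X C) t) x = inv_ar C (Cmp t x)"
    "inv_ar (functor_cat X C) t \<in> hom (functor_cat X C) G F"
proof -
  note T = hom_functor_catD[OF t]
  interpret X: category X by (rule is_functorD(1)[OF T(1)])
  interpret FX: category "functor_cat X C" by (rule category_functor_cat[OF X.category_axioms])
  note [simp] = homD[OF T(6)] i is_functorD(3)[OF T(1)] is_functorD(3)[OF T(2)]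
  let ?s = "\<lparr>Src = G, Tgt = F, Cmp = (\<lambda>x \<in> Ob X. inv_ar C (Cmp t x))\<rparr>"
  have s: "?s \<in> hom (functor_cat X C) G F"
  proof (rule hom_functor_catI)
    fix m x y assume m: "m \<in> hom X x y"
    note [simp] = X.hom_ob[OF m] homD[OF is_functorD(4)[OF T(1) m]] homD[OF is_functorD(4)[OF T(2) m]]
    have "inv_ar C (Cmp t y) \<cdot> AM G m = AM F m \<cdot> inv_ar C (Cmp t x)"
      by (rule iso_mono[of "Cmp t y"]) (simp_all add: reassoc[OF T(7)[OF m]])
    then show "Cmp ?s y \<cdot> AM G m = AM F m \<cdot> Cmp ?s x" by simp
  qed (use T in \<open>simp_all add: hom_iff\<close>)
  have "?s \<cdot>\<^bsub>functor_cat X C\<^esub> t = Ident (functor_cat X C) F"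
    by (rule ntr_eqI[OF comp_ntr[OF t s] ident_ntr[OF T(1)]]) simp
  moreover have "t \<cdot>\<^bsub>functor_cat X C\<^esub> ?s = Ident (functor_cat X C) G"
    by (rule ntr_eqI[OF comp_ntr[OF s t] ident_ntr[OF T(2)]]) simp
  ultimately have *: "is_iso (functor_cat X C) t" "inv_ar (functor_cat X C) t = ?s"
    using FX.is_isoI[OF t s] by auto
  then show "is_iso (functor_cat X C) t" "x \<in> Ob X \<Longrightarrow> Cmp (inv_ar (functor_cat X C) t) x = inv_ar C (Cmp t x)"
    "inv_ar (functor_cat X C) t \<in> hom (functor_cat X C) G F"
    using s by simp_all
qed

lemma ntr_iso_cmp:
  assumes X: "category X" and t: "t \<in> hom (functor_cat X C) F G" and i: "is_iso (functor_cat X C) t" and x: "x \<in> Ob X"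
  shows "is_iso C (Cmp t x)"
proof -
  interpret FX: category "functor_cat X C" by (rule category_functor_cat[OF X])
  note T = hom_functor_catD[OF t]
  let ?s = "inv_ar (functor_cat X C) t"
  have s: "?s \<in> hom (functor_cat X C) G F" using FX.inv_arD[OF i] FX.homD[OF t] by (simp add: FX.hom_iff)
  have "Cmp (?s \<cdot>\<^bsub>functor_cat X C\<^esub> t) x = Ident C (OM F x)" "Cmp (t \<cdot>\<^bsub>functor_cat X C\<^esub> ?s) x = Ident C (OM G x)"
    using FX.inv_arD(5,6)[OF i] T(3,4) x by simp_all
  then show ?thesis
    using is_isoI(1)[OF T(6)[OF x] hom_functor_catD(6)[OF s x]] x by simp
qed

end

lemma functor_comp:
  assumes f: "is_functor X Y f" and V: "is_functor Y C V"
  shows "is_functor X C (fct_comp X V f)"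
proof (rule is_functorI)
  interpret X: category X by (rule is_functorD(1)[OF f])
  note [simp] = is_functorD(3)[OF f]
  show "AM (fct_comp X V f) m \<in> hom C (OM (fct_comp X V f) x) (OM (fct_comp X V f) y)" if m: "m \<in> hom X x y" for m x y
    using is_functorD(4)[OF V is_functorD(4)[OF f m]] X.homD[OF m] X.hom_ob[OF m] by (simp add: fct_comp_def)
  show "AM (fct_comp X V f) (Ident X x) = Ident C (OM (fct_comp X V f) x)" if "x \<in> Ob X" for x
    using that is_functorD(5)[OF f that] is_functorD(5)[OF V] by (simp add: fct_comp_def)
  show "AM (fct_comp X V f) (n \<cdot>\<^bsub>X\<^esub> m) = AM (fct_comp X V f) n \<cdot>\<^bsub>C\<^esub> AM (fct_comp X V f) m"
    if m: "m \<in> hom X x y" and n: "n \<in> hom X y z" for m n x y z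
    using is_functorD(6)[OF f m n] is_functorD(6)[OF V is_functorD(4)[OF f m] is_functorD(4)[OF f n]]
      X.homD[OF m] X.homD[OF n] by (simp add: fct_comp_def)
qed (use is_functorD[OF f] is_functorD[OF V] in \<open>auto simp: fct_comp_def\<close>)

lemma fct_comp_sel [simp]:
  "x \<in> Ob X \<Longrightarrow> OM (fct_comp X V f) x = OM V (OM f x)" "m \<in> Ar X \<Longrightarrow> AM (fct_comp X V f) m = AM V (AM f m)"
  by (simp_all add: fct_comp_def)

lemma restr_sel:
  "is_functor Y C V \<Longrightarrow> OM (restr C X Y f) V = fct_comp X V f"
  "is_ntr Y C t \<Longrightarrow> Src (AM (restr C X Y f) t) = fct_comp X (Src t) f"
  "is_ntr Y C t \<Longrightarrow> Tgt (AM (restr C X Y f) t) = fct_comp X (Tgt t) f"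
  "\<lbrakk>is_ntr Y C t; x \<in> Ob X\<rbrakk> \<Longrightarrow> Cmp (AM (restr C X Y f) t) x = Cmp t (OM f x)"
  by (simp_all add: restr_def)

lemma restr_ntr:
  assumes f: "is_functor X Y f" and t: "t \<in> hom (functor_cat Y C) F G"
  shows "AM (restr C X Y f) t \<in> hom (functor_cat X C) (fct_comp X F f) (fct_comp X G f)"
proof (rule hom_functor_catI)
  note T = hom_functor_catD[OF t] and fs = is_functorD[OF f]
  interpret X: category X by (rule fs(1))
  note [simp] = restr_sel(2,3,4)[OF T(5)] fs(3)
  show "is_functor X C (fct_comp X F f)" "is_functor X C (fct_comp X G f)" using functor_comp[OF f] T(1,2) by auto
  show "Cmp (AM (restr C X Y f) t) \<in> extensional (Ob X)" using T(5) by (simp add: restr_def)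
  show "Src (AM (restr C X Y f) t) = fct_comp X F f" "Tgt (AM (restr C X Y f) t) = fct_comp X G f" using T by simp_all
  show "Cmp (AM (restr C X Y f) t) x \<in> hom C (OM (fct_comp X F f) x) (OM (fct_comp X G f) x)" if "x \<in> Ob X" for x
    using that T(6)[OF fs(3)[OF that]] by simp
  show "Cmp (AM (restr C X Y f) t) y \<cdot>\<^bsub>C\<^esub> AM (fct_comp X F f) m = AM (fct_comp X G f) m \<cdot>\<^bsub>C\<^esub> Cmp (AM (restr C X Y f) t) x"
    if m: "m \<in> hom X x y" for m x y
    using T(7)[OF fs(4)[OF m]] X.homD[OF m] X.hom_ob[OF m] by simp
qed

lemma restr_functor:
  assumes f: "is_functor X Y f" and C: "symmetric_monoidal_category C"
  shows "is_functor (functor_cat Y C) (functor_cat X C) (restr C X Y f)"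
proof (rule is_functorI)
  interpret C: symmetric_monoidal_category C by (rule C)
  note fs = is_functorD[OF f]
  note [simp] = fs(3)
  show "category (functor_cat Y C)" "category (functor_cat X C)" using C.category_functor_cat fs by auto
  show "OM (restr C X Y f) \<in> extensional (Ob (functor_cat Y C))" "AM (restr C X Y f) \<in> extensional (Ar (functor_cat Y C))"
    by (simp_all add: restr_def)
  show "OM (restr C X Y f) V \<in> Ob (functor_cat X C)" if "V \<in> Ob (functor_cat Y C)" for V
    using that functor_comp[OF f] by (simp add: restr_sel)
  show "AM (restr C X Y f) m \<in> hom (functor_cat X C) (OM (restr C X Y f) F) (OM (restr C X Y f) G)"
    if m: "m \<in> hom (functor_cat Y C) F G" for m F G
    using restr_ntr[OF f m] hom_functor_catD(1,2)[OF m] by (simp add: restr_sel)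
  show "AM (restr C X Y f) (Ident (functor_cat Y C) V) = Ident (functor_cat X C) (OM (restr C X Y f) V)"
    if V: "V \<in> Ob (functor_cat Y C)" for V
  proof -
    have V': "is_functor Y C V" using V by simp
    note i = C.ident_ntr[OF V']
    show ?thesis unfolding restr_sel(1)[OF V']
      by (rule ntr_eqI[OF restr_ntr[OF f i] C.ident_ntr[OF functor_comp[OF f V']]])
        (simp add: restr_sel(4)[OF hom_functor_catD(5)[OF i]])
  qed
  show "AM (restr C X Y f) (n \<cdot>\<^bsub>functor_cat Y C\<^esub> m) = AM (restr C X Y f) n \<cdot>\<^bsub>functor_cat X C\<^esub> AM (restr C X Y f) m"
    if m: "m \<in> hom (functor_cat Y C) F G" and n: "n \<in> hom (functor_cat Y C) G H" for m n F G H
    by (rule ntr_eqI[OF restr_ntr[OF f C.comp_ntr[OF m n]] C.comp_ntr[OF restr_ntr[OF f m] restr_ntr[OF f n]]])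
      (simp add: restr_sel(4) hom_functor_catD(5)[OF m] hom_functor_catD(5)[OF n] hom_functor_catD(5)[OF C.comp_ntr[OF m n]])
qed

context symmetric_monoidal_category
begin

lemma tens_functor:
  assumes F: "is_functor X C F" and G: "is_functor X C G"
  shows "is_functor X C (F \<otimes>\<^bsub>functor_cat X C\<^esub> G)"
proof (rule is_functorI)
  note Fs = is_functorD[OF F] and Gs = is_functorD[OF G]
  interpret X: category X by (rule Fs(1))
  show "category X" "category C" by (rule Fs)+
  show "AM (F \<otimes>\<^bsub>functor_cat X C\<^esub> G) m \<in> hom C (OM (F \<otimes>\<^bsub>functor_cat X C\<^esub> G) x) (OM (F \<otimes>\<^bsub>functor_cat X C\<^esub> G) y)"
    if m: "m \<in> hom X x y" for m x y
    using tens_hom[OF Fs(4)[OF m] Gs(4)[OF m]] X.homD[OF m] X.hom_ob[OF m] by simp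
  show "AM (F \<otimes>\<^bsub>functor_cat X C\<^esub> G) (n \<cdot>\<^bsub>X\<^esub> m) = AM (F \<otimes>\<^bsub>functor_cat X C\<^esub> G) n \<cdot> AM (F \<otimes>\<^bsub>functor_cat X C\<^esub> G) m"
    if m: "m \<in> hom X x y" and n: "n \<in> hom X y z" for m n x y z
    using tens_comp[OF Fs(4)[OF m] Fs(4)[OF n] Gs(4)[OF m] Gs(4)[OF n]] X.homD[OF m] X.homD[OF n]
    by (simp add: Fs(6)[OF m n] Gs(6)[OF m n])
qed (use is_functorD(3,5)[OF F] is_functorD(3,5)[OF G] category.ident_ar[OF is_functorD(1)[OF F]] in
    \<open>simp_all add: functor_cat_ext\<close>)

lemma one_functor:
  assumes "category X"
  shows "is_functor X C \<one>\<^bsub>functor_cat X C\<^esub>"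
proof (rule is_functorI)
  interpret X: category X by fact
  show "AM \<one>\<^bsub>functor_cat X C\<^esub> m \<in> hom C (OM \<one>\<^bsub>functor_cat X C\<^esub> x) (OM \<one>\<^bsub>functor_cat X C\<^esub> y)"
    if m: "m \<in> hom X x y" for m x y using X.homD[OF m] X.hom_ob[OF m] by (simp add: hom_iff)
  show "AM \<one>\<^bsub>functor_cat X C\<^esub> (n \<cdot>\<^bsub>X\<^esub> m) = AM \<one>\<^bsub>functor_cat X C\<^esub> n \<cdot> AM \<one>\<^bsub>functor_cat X C\<^esub> m"
    if m: "m \<in> hom X x y" and n: "n \<in> hom X y z" for m n x y z
    using X.homD[OF m] X.homD[OF n] by simp
qed (use assms category_axioms category.ident_ar[OF assms] in \<open>simp_all add: functor_cat_ext\<close>)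

lemma tens_ntr:
  assumes s: "s \<in> hom (functor_cat X C) F F'" and t: "t \<in> hom (functor_cat X C) G G'"
  shows "s \<boxtimes>\<^bsub>functor_cat X C\<^esub> t \<in> hom (functor_cat X C) (F \<otimes>\<^bsub>functor_cat X C\<^esub> G) (F' \<otimes>\<^bsub>functor_cat X C\<^esub> G')"
proof (rule hom_functor_catI)
  note S = hom_functor_catD[OF s] and T = hom_functor_catD[OF t]
  interpret X: category X by (rule is_functorD(1)[OF S(1)])
  note [simp] = homD[OF S(6)] homD[OF T(6)]
  show "is_functor X C (F \<otimes>\<^bsub>functor_cat X C\<^esub> G)" "is_functor X C (F' \<otimes>\<^bsub>functor_cat X C\<^esub> G')"
    using tens_functor S T by auto
  show "Cmp (s \<boxtimes>\<^bsub>functor_cat X C\<^esub> t) x \<in> hom C (OM (F \<otimes>\<^bsub>functor_cat X C\<^esub> G) x) (OM (F' \<otimes>\<^bsub>functor_cat X C\<^esub> G') x)"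
    if "x \<in> Ob X" for x using that by (simp add: hom_iff)
  fix m x y assume m: "m \<in> hom X x y"
  note [simp] = X.homD[OF m] X.hom_ob[OF m] homD[OF is_functorD(4)[OF S(1) m]] homD[OF is_functorD(4)[OF S(2) m]]
    homD[OF is_functorD(4)[OF T(1) m]] homD[OF is_functorD(4)[OF T(2) m]]
  show "Cmp (s \<boxtimes>\<^bsub>functor_cat X C\<^esub> t) y \<cdot> AM (F \<otimes>\<^bsub>functor_cat X C\<^esub> G) m
      = AM (F' \<otimes>\<^bsub>functor_cat X C\<^esub> G') m \<cdot> Cmp (s \<boxtimes>\<^bsub>functor_cat X C\<^esub> t) x"
    using S(7)[OF m] T(7)[OF m] by (simp add: interchange)
qed (use hom_functor_catD[OF s] hom_functor_catD[OF t] in \<open>simp_all add: functor_cat_ext\<close>)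

lemma runit_ntr:
  assumes F: "is_functor X C F"
  shows "runit (functor_cat X C) F \<in> hom (functor_cat X C) (F \<otimes>\<^bsub>functor_cat X C\<^esub> \<one>\<^bsub>functor_cat X C\<^esub>) F"
proof (rule hom_functor_catI)
  note Fs = is_functorD[OF F]
  interpret X: category X by (rule Fs(1))
  note [simp] = Fs(3)
  show "is_functor X C (F \<otimes>\<^bsub>functor_cat X C\<^esub> \<one>\<^bsub>functor_cat X C\<^esub>)"
    by (rule tens_functor[OF F one_functor[OF Fs(1)]])
  fix m x y assume m: "m \<in> hom X x y"
  note [simp] = X.homD[OF m] X.hom_ob[OF m] homD[OF Fs(4)[OF m]]
  show "Cmp (runit (functor_cat X C) F) y \<cdot> AM (F \<otimes>\<^bsub>functor_cat X C\<^esub> \<one>\<^bsub>functor_cat X C\<^esub>) m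
     = AM F m \<cdot> Cmp (runit (functor_cat X C) F) x"
    by (simp add: runit_nat_ar)
qed (use F is_functorD(3)[OF F] in \<open>simp_all add: functor_cat_ext hom_iff\<close>)

lemma lunit_ntr:
  assumes F: "is_functor X C F"
  shows "lunit (functor_cat X C) F \<in> hom (functor_cat X C) (\<one>\<^bsub>functor_cat X C\<^esub> \<otimes>\<^bsub>functor_cat X C\<^esub> F) F"
proof (rule hom_functor_catI)
  note Fs = is_functorD[OF F]
  interpret X: category X by (rule Fs(1))
  note [simp] = Fs(3)
  show "is_functor X C (\<one>\<^bsub>functor_cat X C\<^esub> \<otimes>\<^bsub>functor_cat X C\<^esub> F)"
    by (rule tens_functor[OF one_functor[OF Fs(1)] F])
  fix m x y assume m: "m \<in> hom X x y"
  note [simp] = X.homD[OF m] X.hom_ob[OF m] homD[OF Fs(4)[OF m]]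
  show "Cmp (lunit (functor_cat X C) F) y \<cdot> AM (\<one>\<^bsub>functor_cat X C\<^esub> \<otimes>\<^bsub>functor_cat X C\<^esub> F) m
     = AM F m \<cdot> Cmp (lunit (functor_cat X C) F) x"
    by (simp add: lunit_nat_ar)
qed (use F is_functorD(3)[OF F] in \<open>simp_all add: functor_cat_ext hom_iff\<close>)

lemma comp_tens:
  assumes f: "is_functor X Y f" and F: "is_functor Y C F" and G: "is_functor Y C G"
  shows "fct_comp X (F \<otimes>\<^bsub>functor_cat Y C\<^esub> G) f = fct_comp X F f \<otimes>\<^bsub>functor_cat X C\<^esub> fct_comp X G f"
proof (rule fct_eqI)
  note fs = is_functorD[OF f]
  interpret X: category X by (rule fs(1))
  interpret Y: category Y by (rule fs(2))
  show "AM (fct_comp X (F \<otimes>\<^bsub>functor_cat Y C\<^esub> G) f) m = AM (fct_comp X F f \<otimes>\<^bsub>functor_cat X C\<^esub> fct_comp X G f) m"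
    if "m \<in> Ar X" for m
    using that Y.homD[OF fs(4)[OF X.ar_hom[OF that]]] by simp
qed (use is_functorD(3)[OF f] in \<open>auto simp: fct_comp_def functor_cat_ext functor_cat_def Let_def\<close>)

end


section \<open>Adjunctions from universal arrows\<close>

definition universal ::
  "('o1, 'a1, 'e1) cat_scheme \<Rightarrow> ('o2, 'a2, 'e2) cat_scheme \<Rightarrow> ('o2, 'a2, 'o1, 'a1) fct
     \<Rightarrow> 'o1 \<Rightarrow> 'o2 \<Rightarrow> 'a1 \<Rightarrow> bool"
where
  "universal D E G A L \<eta> \<longleftrightarrow> L \<in> Ob E \<and> \<eta> \<in> hom D A (OM G L) \<and>
     (\<forall>B \<in> Ob E. \<forall>t \<in> hom D A (OM G B). \<exists>!u. u \<in> hom E L B \<and> AM G u \<cdot>\<^bsub>D\<^esub> \<eta> = t)"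

definition couniversal ::
  "('o1, 'a1, 'e1) cat_scheme \<Rightarrow> ('o2, 'a2, 'e2) cat_scheme \<Rightarrow> ('o1, 'a1, 'o2, 'a2) fct
     \<Rightarrow> 'o2 \<Rightarrow> 'o1 \<Rightarrow> 'a2 \<Rightarrow> bool"
where
  "couniversal D E G B K \<epsilon> \<longleftrightarrow> K \<in> Ob D \<and> \<epsilon> \<in> hom E (OM G K) B \<and>
     (\<forall>A \<in> Ob D. \<forall>t \<in> hom E (OM G A) B. \<exists>!u. u \<in> hom D A K \<and> \<epsilon> \<cdot>\<^bsub>E\<^esub> AM G u = t)"

lemma universalD:
  assumes "universal D E G A L \<eta>"
  shows "L \<in> Ob E" "\<eta> \<in> hom D A (OM G L)"
  using assms by (auto simp: universal_def)

lemma universal_ex: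
  assumes "universal D E G A L \<eta>" "B \<in> Ob E" "t \<in> hom D A (OM G B)"
  obtains u where "u \<in> hom E L B" "AM G u \<cdot>\<^bsub>D\<^esub> \<eta> = t"
proof -
  have "\<exists>!u. u \<in> hom E L B \<and> AM G u \<cdot>\<^bsub>D\<^esub> \<eta> = t" using assms by (simp add: universal_def)
  then show thesis using that by blast
qed

lemma ex1_eqI: "\<lbrakk>\<exists>!x. P x; P a; P b\<rbrakk> \<Longrightarrow> a = b"
  by blast

lemma universal_eq:
  assumes "universal D E G A L \<eta>" "B \<in> Ob E" "AM G u \<cdot>\<^bsub>D\<^esub> \<eta> \<in> hom D A (OM G B)"
    and "u \<in> hom E L B" "v \<in> hom E L B" "AM G u \<cdot>\<^bsub>D\<^esub> \<eta> = AM G v \<cdot>\<^bsub>D\<^esub> \<eta>"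
  shows "u = v"
proof -
  have "\<exists>!w. w \<in> hom E L B \<and> AM G w \<cdot>\<^bsub>D\<^esub> \<eta> = AM G u \<cdot>\<^bsub>D\<^esub> \<eta>"
    using assms(1-3) by (simp add: universal_def)
  then show ?thesis by (rule ex1_eqI) (simp_all add: assms(4-6))
qed

lemma universal_iso:
  assumes G: "is_functor E D G" and u: "universal D E G A L \<eta>" and u': "universal D E G A L' \<eta>'"
  obtains v where "v \<in> hom E L L'" "is_iso E v" "AM G v \<cdot>\<^bsub>D\<^esub> \<eta> = \<eta>'"
proof -
  interpret E: category E by (rule is_functorD(1)[OF G])
  interpret D: category D by (rule is_functorD(2)[OF G])
  note U = universalD[OF u] and U' = universalD[OF u']
  obtain v where v: "v \<in> hom E L L'" and ve: "AM G v \<cdot>\<^bsub>D\<^esub> \<eta> = \<eta>'" using universal_ex[OF u U'] by blast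
  obtain w where w: "w \<in> hom E L' L" and we: "AM G w \<cdot>\<^bsub>D\<^esub> \<eta>' = \<eta>" using universal_ex[OF u' U] by blast
  note Gv = is_functorD(4)[OF G v] and Gw = is_functorD(4)[OF G w]
  note [simp] = D.homD[OF U(2)] D.homD[OF U'(2)] D.homD[OF Gv] D.homD[OF Gw] U(1) U'(1)
    is_functorD(3,5)[OF G]
  have "w \<cdot>\<^bsub>E\<^esub> v = Ident E L"
    by (rule universal_eq[OF u U(1) _ E.comp_hom[OF v w] E.ident_hom[OF U(1)]])
      (simp_all add: is_functorD(6)[OF G v w] ve we D.hom_iff)
  moreover have "v \<cdot>\<^bsub>E\<^esub> w = Ident E L'"
    by (rule universal_eq[OF u' U'(1) _ E.comp_hom[OF w v] E.ident_hom[OF U'(1)]])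
      (simp_all add: is_functorD(6)[OF G w v] ve we D.hom_iff)
  ultimately show thesis using that[OF v E.is_isoI(1)[OF v w] ve] by simp
qed

lemma left_adjoint_ex:
  fixes D :: "('o1, 'a1, 'e1) cat_scheme" and E :: "('o2, 'a2, 'e2) cat_scheme"
  assumes G: "is_functor E D G" and ex: "\<And>A. A \<in> Ob D \<Longrightarrow> \<exists>L \<eta>. universal D E G A L \<eta>"
  shows "\<exists>J. adjunction D E J \<and> Rgt J = G"
proof -
  interpret E: category E by (rule is_functorD(1)[OF G])
  interpret D: category D by (rule is_functorD(2)[OF G])
  obtain L \<eta> where u: "\<And>A. A \<in> Ob D \<Longrightarrow> universal D E G A (L A) (\<eta> A)" using ex by metis
  note LO = universalD(1)[OF u] and \<eta> = universalD(2)[OF u]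
  note Gs = is_functorD[OF G]
  note [simp] = LO D.homD[OF \<eta>] Gs(3,5)
  define tr where "tr = (\<lambda>A B t. SOME v. v \<in> hom E (L A) B \<and> AM G v \<cdot>\<^bsub>D\<^esub> \<eta> A = t)"
  have tr: "tr A B t \<in> hom E (L A) B \<and> AM G (tr A B t) \<cdot>\<^bsub>D\<^esub> \<eta> A = t"
    if A: "A \<in> Ob D" and B: "B \<in> Ob E" and t: "t \<in> hom D A (OM G B)" for A B t
  proof -
    obtain v where "v \<in> hom E (L A) B" "AM G v \<cdot>\<^bsub>D\<^esub> \<eta> A = t"
      using universal_ex[OF u[OF A] B t] by blast
    then have "\<exists>v. v \<in> hom E (L A) B \<and> AM G v \<cdot>\<^bsub>D\<^esub> \<eta> A = t" by blast
    from someI_ex[OF this] show ?thesis by (simp add: tr_def)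
  qed
  have uq: "v = w" if A: "A \<in> Ob D" and v: "v \<in> hom E (L A) B" and w: "w \<in> hom E (L A) B"
    and e: "AM G v \<cdot>\<^bsub>D\<^esub> \<eta> A = AM G w \<cdot>\<^bsub>D\<^esub> \<eta> A" for A B v w
    by (rule universal_eq[OF u[OF A] E.hom_ob(2)[OF v] _ v w e]) (rule D.comp_hom[OF \<eta>[OF A] Gs(4)[OF v]])
  define F where "F = \<lparr>OM = (\<lambda>A \<in> Ob D. L A), AM = (\<lambda>f \<in> Ar D. tr (Dom D f) (L (Cod D f)) (\<eta> (Cod D f) \<cdot>\<^bsub>D\<^esub> f))\<rparr>"
  define \<epsilon> where "\<epsilon> = (\<lambda>B. tr (OM G B) B (Ident D (OM G B)))"
  have FO [simp]: "OM F A = L A" if "A \<in> Ob D" for A using that by (simp add: F_def)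
  have Fh: "AM F f \<in> hom E (L A) (L B)" and Fe: "AM G (AM F f) \<cdot>\<^bsub>D\<^esub> \<eta> A = \<eta> B \<cdot>\<^bsub>D\<^esub> f"
    if f: "f \<in> hom D A B" for f A B
    using tr[of A "L B" "\<eta> B \<cdot>\<^bsub>D\<^esub> f"] D.homD[OF f] D.hom_ob[OF f] by (auto simp: F_def D.hom_iff)
  have \<epsilon>h: "\<epsilon> B \<in> hom E (L (OM G B)) B" and \<epsilon>e: "AM G (\<epsilon> B) \<cdot>\<^bsub>D\<^esub> \<eta> (OM G B) = Ident D (OM G B)"
    if B: "B \<in> Ob E" for B
    using tr[of "OM G B" B "Ident D (OM G B)"] B by (auto simp: \<epsilon>_def D.hom_iff)
  have F: "is_functor D E F"
  proof (rule is_functorI)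
    show "AM F (Ident D A) = Ident E (OM F A)" if A[simp]: "A \<in> Ob D" for A
    proof -
      note i = D.ident_hom[OF A]
      have "AM F (Ident D A) = Ident E (L A)"
        by (rule uq[OF A Fh[OF i] E.ident_hom[OF LO[OF A]]]) (simp add: Fe[OF i])
      then show ?thesis by simp
    qed
    show "AM F (g \<cdot>\<^bsub>D\<^esub> f) = AM F g \<cdot>\<^bsub>E\<^esub> AM F f" if f: "f \<in> hom D A B" and g: "g \<in> hom D B K" for f g A B K
    proof (rule uq[OF D.hom_ob(1)[OF f] Fh[OF D.comp_hom[OF f g]] E.comp_hom[OF Fh[OF f] Fh[OF g]]])
      note [simp] = D.homD[OF f] D.homD[OF g] D.hom_ob[OF f] D.hom_ob[OF g]
        D.homD[OF Gs(4)[OF Fh[OF f]]] D.homD[OF Gs(4)[OF Fh[OF g]]]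
      show "AM G (AM F (g \<cdot>\<^bsub>D\<^esub> f)) \<cdot>\<^bsub>D\<^esub> \<eta> A = AM G (AM F g \<cdot>\<^bsub>E\<^esub> AM F f) \<cdot>\<^bsub>D\<^esub> \<eta> A"
        by (simp add: Fe[OF D.comp_hom[OF f g]] Gs(6)[OF Fh[OF f] Fh[OF g]] Fe[OF f] D.reassoc[OF Fe[OF g]])
    qed
    show "AM F m \<in> hom E (OM F x) (OM F y)" if m: "m \<in> hom D x y" for m x y
      using Fh[OF m] D.hom_ob[OF m] by simp
  qed (simp_all add: F_def D.category_axioms E.category_axioms)
  have "adjunction D E \<lparr>Lft = F, Rgt = G, Unit = \<eta>, Counit = \<epsilon>\<rparr>"
    unfolding adjunction_def adj.simps
  proof (intro conjI ballI F G)
    show "\<eta> A \<in> hom D A (OM G (OM F A))" if "A \<in> Ob D" for A using that \<eta> by simp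
    show "\<epsilon> B \<in> hom E (OM F (OM G B)) B" if "B \<in> Ob E" for B using that \<epsilon>h by simp
    show "\<eta> (Cod D f) \<cdot>\<^bsub>D\<^esub> f = AM G (AM F f) \<cdot>\<^bsub>D\<^esub> \<eta> (Dom D f)" if "f \<in> Ar D" for f
      using Fe[OF D.ar_hom[OF that]] by simp
    show "AM G (\<epsilon> B) \<cdot>\<^bsub>D\<^esub> \<eta> (OM G B) = Ident D (OM G B)" if "B \<in> Ob E" for B by (rule \<epsilon>e[OF that])
    show "\<epsilon> (Cod E g) \<cdot>\<^bsub>E\<^esub> AM F (AM G g) = g \<cdot>\<^bsub>E\<^esub> \<epsilon> (Dom E g)" if "g \<in> Ar E" for g
    proof -
      note g = E.ar_hom[OF that]
      note Gg = Gs(4)[OF g] and b = E.hom_ob[OF g]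
      note h1 = \<epsilon>h[OF b(1)] and h2 = \<epsilon>h[OF b(2)] and F1 = Fh[OF Gg]
      note [simp] = b D.homD[OF Gg] D.homD[OF Gs(4)[OF h1]] D.homD[OF Gs(4)[OF h2]] D.homD[OF Gs(4)[OF F1]]
      show ?thesis
        by (rule uq[OF Gs(3)[OF b(1)] E.comp_hom[OF F1 h2] E.comp_hom[OF h1 g]])
          (simp add: Gs(6)[OF F1 h2] Gs(6)[OF h1 g] Fe[OF Gg] \<epsilon>e D.reassoc[OF \<epsilon>e[OF b(2)]])
    qed
    show "\<epsilon> (OM F A) \<cdot>\<^bsub>E\<^esub> AM F (\<eta> A) = Ident E (OM F A)" if A[simp]: "A \<in> Ob D" for A
    proof -
      note h = \<epsilon>h[OF LO[OF A]] and F1 = Fh[OF \<eta>[OF A]]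
      note [simp] = D.homD[OF Gs(4)[OF h]] D.homD[OF Gs(4)[OF F1]]
      have "\<epsilon> (L A) \<cdot>\<^bsub>E\<^esub> AM F (\<eta> A) = Ident E (L A)"
        by (rule uq[OF A E.comp_hom[OF F1 h] E.ident_hom[OF LO[OF A]]])
          (simp add: Gs(6)[OF F1 h] Fe[OF \<eta>[OF A]] D.reassoc[OF \<epsilon>e[OF LO[OF A]]])
      then show ?thesis by simp
    qed
  qed
  then show ?thesis by (intro exI[of _ "\<lparr>Lft = F, Rgt = G, Unit = \<eta>, Counit = \<epsilon>\<rparr>"]) simp
qed

lemma functor_opc:
  assumes "category A" "category B"
  shows "is_functor (opc A) (opc B) F \<longleftrightarrow> is_functor A B F"
proof
  assume F: "is_functor (opc A) (opc B) F"
  show "is_functor A B F"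
    by (rule is_functorI) (use assms is_functorD(3-6)[OF F] is_functor_ext[OF F] in simp_all)
next
  assume F: "is_functor A B F"
  show "is_functor (opc A) (opc B) F"
    by (rule is_functorI) (use assms category_opc is_functorD(3-6)[OF F] is_functor_ext[OF F] in simp_all)
qed

lemma universal_opc: "universal (opc E) (opc D) G B K \<epsilon> \<longleftrightarrow> couniversal D E G B K \<epsilon>"
  by (simp add: universal_def couniversal_def)

lemma adjunctionD:
  assumes "adjunction D E J"
  shows "is_functor D E (Lft J)" "is_functor E D (Rgt J)"
    "\<And>A. A \<in> Ob D \<Longrightarrow> Unit J A \<in> hom D A (OM (Rgt J) (OM (Lft J) A))"
    "\<And>B. B \<in> Ob E \<Longrightarrow> Counit J B \<in> hom E (OM (Lft J) (OM (Rgt J) B)) B"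
    "\<And>f A B. f \<in> hom D A B \<Longrightarrow> Unit J B \<cdot>\<^bsub>D\<^esub> f = AM (Rgt J) (AM (Lft J) f) \<cdot>\<^bsub>D\<^esub> Unit J A"
    "\<And>g A B. g \<in> hom E A B \<Longrightarrow> Counit J B \<cdot>\<^bsub>E\<^esub> AM (Lft J) (AM (Rgt J) g) = g \<cdot>\<^bsub>E\<^esub> Counit J A"
    "\<And>A. A \<in> Ob D \<Longrightarrow> Counit J (OM (Lft J) A) \<cdot>\<^bsub>E\<^esub> AM (Lft J) (Unit J A) = Ident E (OM (Lft J) A)"
    "\<And>B. B \<in> Ob E \<Longrightarrow> AM (Rgt J) (Counit J B) \<cdot>\<^bsub>D\<^esub> Unit J (OM (Rgt J) B) = Ident D (OM (Rgt J) B)"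
  using assms unfolding adjunction_def hom_def by auto

lemma adjunctionI:
  assumes "is_functor D E (Lft J)" "is_functor E D (Rgt J)"
    "\<And>A. A \<in> Ob D \<Longrightarrow> Unit J A \<in> hom D A (OM (Rgt J) (OM (Lft J) A))"
    "\<And>B. B \<in> Ob E \<Longrightarrow> Counit J B \<in> hom E (OM (Lft J) (OM (Rgt J) B)) B"
    "\<And>f A B. f \<in> hom D A B \<Longrightarrow> Unit J B \<cdot>\<^bsub>D\<^esub> f = AM (Rgt J) (AM (Lft J) f) \<cdot>\<^bsub>D\<^esub> Unit J A"
    "\<And>g A B. g \<in> hom E A B \<Longrightarrow> Counit J B \<cdot>\<^bsub>E\<^esub> AM (Lft J) (AM (Rgt J) g) = g \<cdot>\<^bsub>E\<^esub> Counit J A"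
    "\<And>A. A \<in> Ob D \<Longrightarrow> Counit J (OM (Lft J) A) \<cdot>\<^bsub>E\<^esub> AM (Lft J) (Unit J A) = Ident E (OM (Lft J) A)"
    "\<And>B. B \<in> Ob E \<Longrightarrow> AM (Rgt J) (Counit J B) \<cdot>\<^bsub>D\<^esub> Unit J (OM (Rgt J) B) = Ident D (OM (Rgt J) B)"
  shows "adjunction D E J"
  using assms(1-4,7,8) assms(5,6)[unfolded hom_def] unfolding adjunction_def by simp

definition adj_opc :: "('o1, 'a1, 'o2, 'a2) adj \<Rightarrow> ('o2, 'a2, 'o1, 'a1) adj" where
  "adj_opc J = \<lparr>Lft = Rgt J, Rgt = Lft J, Unit = Counit J, Counit = Unit J\<rparr>"

lemma adj_opc_sel [simp]:
  "Lft (adj_opc J) = Rgt J" "Rgt (adj_opc J) = Lft J" "Unit (adj_opc J) = Counit J" "Counit (adj_opc J) = Unit J"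
  by (simp_all add: adj_opc_def)

text \<open>Passing to opposite categories exchanges the two adjoints and the unit with the counit.\<close>

lemma adjunction_of_opc:
  assumes cs: "category D" "category E" and a: "adjunction (opc E) (opc D) J"
  shows "adjunction D E (adj_opc J)"
proof (rule adjunctionI)
  note J = adjunctionD[OF a, simplified]
  show "is_functor D E (Lft (adj_opc J))" "is_functor E D (Rgt (adj_opc J))"
    using J(1,2) functor_opc[OF cs] functor_opc[OF cs(2,1)] by simp_all
qed (use adjunctionD[OF a] in \<open>simp_all\<close>)

lemma adjunction_opc:
  assumes a: "adjunction D E J"
  shows "adjunction (opc E) (opc D) (adj_opc J)"
proof (rule adjunctionI)
  note J = adjunctionD[OF a]
  note cs = is_functorD(1,2)[OF J(1)]
  show "is_functor (opc E) (opc D) (Lft (adj_opc J))" "is_functor (opc D) (opc E) (Rgt (adj_opc J))"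
    using J(1,2) functor_opc[OF cs] functor_opc[OF cs(2,1)] by simp_all
qed (use adjunctionD[OF a] in \<open>simp_all\<close>)

lemma right_adjoint_ex:
  assumes G: "is_functor D E G" and ex: "\<And>B. B \<in> Ob E \<Longrightarrow> \<exists>K \<epsilon>. couniversal D E G B K \<epsilon>"
  shows "\<exists>J. adjunction D E J \<and> Lft J = G"
proof -
  note cs = is_functorD(1,2)[OF G]
  have G': "is_functor (opc D) (opc E) G" using G functor_opc[OF cs] by simp
  have "\<exists>L \<eta>. universal (opc E) (opc D) G A L \<eta>" if "A \<in> Ob (opc E)" for A
    using ex that by (simp add: universal_opc)
  from left_adjoint_ex[OF G' this]
  obtain J where J: "adjunction (opc E) (opc D) J" "Rgt J = G" by blast
  show ?thesis
    by (rule exI[of _ "adj_opc J"]) (simp add: adjunction_of_opc[OF cs J(1)] J(2))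
qed

lemma couniversal_iso:
  assumes G: "is_functor D E G" and u: "couniversal D E G B K \<epsilon>" and u': "couniversal D E G B K' \<epsilon>'"
  obtains v where "v \<in> hom D K' K" "is_iso D v" "\<epsilon> \<cdot>\<^bsub>E\<^esub> AM G v = \<epsilon>'"
proof -
  note cs = is_functorD(1,2)[OF G]
  have G': "is_functor (opc D) (opc E) G" using G functor_opc[OF cs] by simp
  obtain v where "v \<in> hom (opc D) K K'" "is_iso (opc D) v" "AM G v \<cdot>\<^bsub>opc E\<^esub> \<epsilon> = \<epsilon>'"
    using universal_iso[OF G' u[folded universal_opc] u'[folded universal_opc]] by blast
  then show thesis using that by (simp add: is_iso_opc)
qed

lemma adjunction_transpose:
  assumes J: "adjunction D E J" and A: "A \<in> Ob D" and t: "t \<in> hom D A (OM (Rgt J) B)" and B: "B \<in> Ob E"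
  shows "AM (Rgt J) (Counit J B \<cdot>\<^bsub>E\<^esub> AM (Lft J) t) \<cdot>\<^bsub>D\<^esub> Unit J A = t"
proof -
  note Js = adjunctionD[OF J]
  interpret D: category D by (rule is_functorD(1)[OF Js(1)])
  note Rs = is_functorD[OF Js(2)] and Ls = is_functorD[OF Js(1)]
  note [simp] = D.homD[OF Rs(4)[OF Js(4)[OF B]]] D.homD[OF Rs(4)[OF Ls(4)[OF t]]] D.homD[OF Js(3)[OF A]] D.homD[OF t]
    D.homD[OF Js(3)[OF Rs(3)[OF B]]] Rs(3)[OF B]
  show ?thesis using Js(5)[OF t, symmetric]
    by (simp add: Rs(6)[OF Ls(4)[OF t] Js(4)[OF B]] D.reassoc[OF Js(8)[OF B]])
qed

lemma adjunction_universal: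
  assumes J: "adjunction D E J" and A: "A \<in> Ob D"
  shows "universal D E (Rgt J) A (OM (Lft J) A) (Unit J A)"
  unfolding universal_def
proof (intro conjI ballI)
  note Js = adjunctionD[OF J]
  interpret D: category D by (rule is_functorD(1)[OF Js(1)])
  interpret E: category E by (rule is_functorD(2)[OF Js(1)])
  note Rs = is_functorD[OF Js(2)] and Ls = is_functorD[OF Js(1)]
  show "OM (Lft J) A \<in> Ob E" "Unit J A \<in> hom D A (OM (Rgt J) (OM (Lft J) A))" using Ls(3)[OF A] Js(3)[OF A] by auto
  fix B t assume B: "B \<in> Ob E" and t: "t \<in> hom D A (OM (Rgt J) B)"
  show "\<exists>!u. u \<in> hom E (OM (Lft J) A) B \<and> AM (Rgt J) u \<cdot>\<^bsub>D\<^esub> Unit J A = t"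
  proof (rule ex1I[of _ "Counit J B \<cdot>\<^bsub>E\<^esub> AM (Lft J) t"])
    show "Counit J B \<cdot>\<^bsub>E\<^esub> AM (Lft J) t \<in> hom E (OM (Lft J) A) B \<and> AM (Rgt J) (Counit J B \<cdot>\<^bsub>E\<^esub> AM (Lft J) t) \<cdot>\<^bsub>D\<^esub> Unit J A = t"
      using E.comp_hom[OF Ls(4)[OF t] Js(4)[OF B]] adjunction_transpose[OF J A t B] by simp
    fix u assume u: "u \<in> hom E (OM (Lft J) A) B \<and> AM (Rgt J) u \<cdot>\<^bsub>D\<^esub> Unit J A = t"
    note uh = conjunct1[OF u]
    note [simp] = E.homD[OF uh] E.homD[OF Ls(4)[OF Js(3)[OF A]]] E.homD[OF Ls(4)[OF Rs(4)[OF uh]]] E.homD[OF Js(4)[OF B]]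
      E.homD[OF Js(4)[OF Ls(3)[OF A]]]
    have "Counit J B \<cdot>\<^bsub>E\<^esub> AM (Lft J) t = Counit J B \<cdot>\<^bsub>E\<^esub> (AM (Lft J) (AM (Rgt J) u) \<cdot>\<^bsub>E\<^esub> AM (Lft J) (Unit J A))"
      using Ls(6)[OF Js(3)[OF A] Rs(4)[OF uh]] u by simp
    also have "\<dots> = u"
      by (simp add: E.reassoc[OF Js(6)[OF uh]] Js(7)[OF A])
    finally show "u = Counit J B \<cdot>\<^bsub>E\<^esub> AM (Lft J) t" by simp
  qed
qed

lemma adjunction_couniversal:
  assumes "adjunction D E J" "B \<in> Ob E"
  shows "couniversal D E (Lft J) B (OM (Rgt J) B) (Counit J B)"
  using adjunction_universal[OF adjunction_opc[OF assms(1)], of B] assms(2) by (simp add: universal_opc)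

lemma adjunction_cotranspose:
  assumes J: "adjunction D E J" and A: "A \<in> Ob D" and t: "t \<in> hom E (OM (Lft J) A) B" and B: "B \<in> Ob E"
  shows "Counit J B \<cdot>\<^bsub>E\<^esub> AM (Lft J) (AM (Rgt J) t \<cdot>\<^bsub>D\<^esub> Unit J A) = t"
  using adjunction_transpose[OF adjunction_opc[OF J], of B t A] assms by simp


section \<open>Homotopy fibres\<close>

locale groupoid_map = X: groupoid X + Y: groupoid Y
  for X :: "('x, 'm, 'e1) cat_scheme" and Y :: "('y, 'n, 'e2) cat_scheme" +
  fixes f :: "('x, 'm, 'y, 'n) fct"
  assumes f: "is_functor X Y f"
begin

abbreviation P :: "'y \<Rightarrow> ('x \<times> 'n, ('x \<times> 'n) \<times> 'm \<times> ('x \<times> 'n)) cat" where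
  "P y \<equiv> hfibre X Y f y"

lemmas fs = is_functorD[OF f]

lemma ob_P [simp]: "(x, \<phi>) \<in> Ob (P y) \<longleftrightarrow> x \<in> Ob X \<and> \<phi> \<in> hom Y (OM f x) y"
  by (simp add: hfibre_def Let_def)

lemma ob_PD: "c \<in> Ob (P y) \<Longrightarrow> fst c \<in> Ob X \<and> snd c \<in> hom Y (OM f (fst c)) y"
  by (cases c) simp

lemma ar_P: "(a, m, b) \<in> Ar (P y) \<longleftrightarrow> a \<in> Ob (P y) \<and> b \<in> Ob (P y) \<and> m \<in> hom X (fst a) (fst b) \<and>
    snd b \<cdot>\<^bsub>Y\<^esub> AM f m = snd a"
  by (simp add: hfibre_def Let_def)

lemma sel_P [simp]:
  "Dom (P y) (a, m, b) = a" "Cod (P y) (a, m, b) = b" "Ident (P y) a = (a, Ident X (fst a), a)"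
  "(b', n, c) \<cdot>\<^bsub>P y\<^esub> (a, m, b) = (a, n \<cdot>\<^bsub>X\<^esub> m, c)"
  by (simp_all add: hfibre_def Let_def)

lemma hom_P: "t \<in> hom (P y) a b \<longleftrightarrow> (\<exists>m. t = (a, m, b) \<and> a \<in> Ob (P y) \<and> b \<in> Ob (P y) \<and>
    m \<in> hom X (fst a) (fst b) \<and> snd b \<cdot>\<^bsub>Y\<^esub> AM f m = snd a)"
  by (cases t) (auto simp: hom_def[of "P y"] ar_P)

lemma category_P: "category (P y)"
proof
  fix g h k a b c d
  show "g \<in> Ar (P y) \<Longrightarrow> Dom (P y) g \<in> Ob (P y)" "g \<in> Ar (P y) \<Longrightarrow> Cod (P y) g \<in> Ob (P y)"
    by (cases g, simp add: ar_P)+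
  show "Ident (P y) a \<in> hom (P y) a a" if "a \<in> Ob (P y)"
    using ob_PD[OF that] that X.ident_hom fs(5) Y.comp_ident_right by (auto simp: hom_P)
  assume g: "g \<in> hom (P y) a b"
  then obtain m where m: "g = (a, m, b)" "a \<in> Ob (P y)" "b \<in> Ob (P y)" "m \<in> hom X (fst a) (fst b)"
    "snd b \<cdot>\<^bsub>Y\<^esub> AM f m = snd a" by (auto simp: hom_P)
  show "g \<cdot>\<^bsub>P y\<^esub> Ident (P y) a = g" "Ident (P y) b \<cdot>\<^bsub>P y\<^esub> g = g"
    using m X.comp_ident_right[OF m(4)] X.comp_ident_left[OF m(4)] by simp_all
  assume h: "h \<in> hom (P y) b c"
  then obtain n where n: "h = (b, n, c)" "c \<in> Ob (P y)" "n \<in> hom X (fst b) (fst c)"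
    "snd c \<cdot>\<^bsub>Y\<^esub> AM f n = snd b" by (auto simp: hom_P)
  have "snd c \<cdot>\<^bsub>Y\<^esub> AM f (n \<cdot>\<^bsub>X\<^esub> m) = snd c \<cdot>\<^bsub>Y\<^esub> AM f n \<cdot>\<^bsub>Y\<^esub> AM f m"
    using Y.comp_assoc[OF fs(4)[OF m(4)] fs(4)[OF n(3)]] ob_PD[OF n(2)] fs(6)[OF m(4) n(3)] by auto
  then show "h \<cdot>\<^bsub>P y\<^esub> g \<in> hom (P y) a c"
    using m n X.comp_hom[OF m(4) n(3)] by (simp add: hom_P)
  assume "k \<in> hom (P y) c d"
  then obtain l where l: "k = (c, l, d)" "l \<in> hom X (fst c) (fst d)" by (auto simp: hom_P)
  show "k \<cdot>\<^bsub>P y\<^esub> h \<cdot>\<^bsub>P y\<^esub> g = k \<cdot>\<^bsub>P y\<^esub> (h \<cdot>\<^bsub>P y\<^esub> g)"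
    using m(1) n(1) l(1) X.comp_assoc[OF m(4) n(3) l(2)] by simp
qed

lemma groupoid_P: "groupoid (P y)"
proof -
  interpret P: category "P y" by (rule category_P)
  show ?thesis
  proof
    fix g assume "g \<in> Ar (P y)"
    then have g: "g \<in> hom (P y) (Dom (P y) g) (Cod (P y) g)" by (rule P.ar_hom)
    then obtain m where m: "g = (Dom (P y) g, m, Cod (P y) g)" "Dom (P y) g \<in> Ob (P y)" "Cod (P y) g \<in> Ob (P y)"
      "m \<in> hom X (fst (Dom (P y) g)) (fst (Cod (P y) g))" "snd (Cod (P y) g) \<cdot>\<^bsub>Y\<^esub> AM f m = snd (Dom (P y) g)"
      unfolding hom_P by blast
    let ?a = "Dom (P y) g" and ?b = "Cod (P y) g"
    let ?n = "inv_ar X m"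
    note n = X.inv_hom[OF m(4)]
    note [simp] = Y.homD[OF fs(4)[OF m(4)]] Y.homD[OF fs(4)[OF n]] Y.homD[OF conjunct2[OF ob_PD[OF m(3)]]]
      Y.homD[OF conjunct2[OF ob_PD[OF m(2)]]]
    have "snd ?a \<cdot>\<^bsub>Y\<^esub> AM f ?n = snd ?b \<cdot>\<^bsub>Y\<^esub> AM f (m \<cdot>\<^bsub>X\<^esub> ?n)"
      unfolding m(5)[symmetric] fs(6)[OF n m(4)] by simp
    also have "\<dots> = snd ?b" using X.inv_comp(2)[OF m(4)] ob_PD[OF m(3)] fs(5) by simp
    finally have n': "(?b, ?n, ?a) \<in> hom (P y) ?b ?a" using m n by (simp add: hom_P)
    have "(?b, ?n, ?a) \<cdot>\<^bsub>P y\<^esub> (?a, m, ?b) = Ident (P y) ?a" "(?a, m, ?b) \<cdot>\<^bsub>P y\<^esub> (?b, ?n, ?a) = Ident (P y) ?b"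
      using X.inv_comp[OF m(4)] by simp_all
    then show "is_iso (P y) g" using P.is_isoI(1)[OF g n'] m(1) by simp
  qed
qed

text \<open>Composition with \<open>n\<close> identifies the homotopy fibres at its two ends; this makes the pointwise
  constructions natural in \<open>y\<close>.\<close>

definition sh :: "'n \<Rightarrow> 'x \<times> 'n \<Rightarrow> 'x \<times> 'n" where "sh n c = (fst c, n \<cdot>\<^bsub>Y\<^esub> snd c)"

lemma sh_ob: "\<lbrakk>n \<in> hom Y y y'; c \<in> Ob (P y)\<rbrakk> \<Longrightarrow> sh n c \<in> Ob (P y')"
  using ob_PD[of c y] Y.comp_hom[of "snd c" _ y n y'] by (simp add: sh_def)

lemma sh_hom:
  assumes n: "n \<in> hom Y y y'" and a: "a \<in> Ob (P y)" and b: "b \<in> Ob (P y)"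
  shows "(sh n a, m, sh n b) \<in> hom (P y') (sh n a) (sh n b) \<longleftrightarrow> (a, m, b) \<in> hom (P y) a b"
proof -
  have "(n \<cdot>\<^bsub>Y\<^esub> snd b) \<cdot>\<^bsub>Y\<^esub> AM f m = n \<cdot>\<^bsub>Y\<^esub> snd a \<longleftrightarrow> snd b \<cdot>\<^bsub>Y\<^esub> AM f m = snd a" if m: "m \<in> hom X (fst a) (fst b)"
  proof -
    note [simp] = Y.homD[OF n] Y.homD[OF conjunct2[OF ob_PD[OF a]]] Y.homD[OF conjunct2[OF ob_PD[OF b]]]
      Y.homD[OF fs(4)[OF m]] Y.all_iso[of n]
    show ?thesis using Y.iso_mono[of n "snd b \<cdot>\<^bsub>Y\<^esub> AM f m" "snd a"] by auto
  qed
  then show ?thesis using sh_ob[OF n a] sh_ob[OF n b] a b by (auto simp: hom_P) (auto simp: sh_def)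
qed

lemma sh_bij:
  assumes n: "n \<in> hom Y y y'" and a: "a \<in> Ob (P y)" and b: "b \<in> Ob (P y)"
  shows "bij_betw (\<lambda>(_, m, _). (sh n a, m, sh n b)) (hom (P y) a b) (hom (P y') (sh n a) (sh n b))"
proof -
  have 1: "\<exists>m. t = (a, m, b)" if "t \<in> hom (P z) a b" for t z a b using that by (auto simp: hom_P)
  show ?thesis
  proof (rule bij_betwI[where g = "\<lambda>(_, m, _). (a, m, b)"])
    show "(\<lambda>(_, m, _). (sh n a, m, sh n b)) \<in> hom (P y) a b \<rightarrow> hom (P y') (sh n a) (sh n b)"
    proof
      fix t assume t: "t \<in> hom (P y) a b"
      obtain m where m: "t = (a, m, b)" using 1[OF t] by blast
      show "(case t of (_, m, _) \<Rightarrow> (sh n a, m, sh n b)) \<in> hom (P y') (sh n a) (sh n b)"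
        using t sh_hom[OF assms, of m] by (simp add: m)
    qed
    show "(\<lambda>(_, m, _). (a, m, b)) \<in> hom (P y') (sh n a) (sh n b) \<rightarrow> hom (P y) a b"
    proof
      fix t assume t: "t \<in> hom (P y') (sh n a) (sh n b)"
      obtain m where m: "t = (sh n a, m, sh n b)" using 1[OF t] by blast
      show "(case t of (_, m, _) \<Rightarrow> (a, m, b)) \<in> hom (P y) a b"
        using t sh_hom[OF assms, of m] by (simp add: m)
    qed
    show "(case (case t of (_, m, _) \<Rightarrow> (sh n a, m, sh n b)) of (_, m, _) \<Rightarrow> (a, m, b)) = t"
      if "t \<in> hom (P y) a b" for t using 1[OF that] by auto
    show "(case (case t of (_, m, _) \<Rightarrow> (a, m, b)) of (_, m, _) \<Rightarrow> (sh n a, m, sh n b)) = t"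
      if "t \<in> hom (P y') (sh n a) (sh n b)" for t using 1[OF that] by auto
  qed
qed

lemma inv_fibre:
  assumes m: "m \<in> hom X x x'" and \<phi>: "\<phi> \<in> hom Y (OM f x) y" and \<phi>': "\<phi>' \<in> hom Y (OM f x') y"
    and e: "\<phi>' \<cdot>\<^bsub>Y\<^esub> AM f m = \<phi>"
  shows "AM f m \<cdot>\<^bsub>Y\<^esub> inv_ar Y \<phi> = inv_ar Y \<phi>'"
proof (rule Y.iso_mono[of \<phi>'])
  note i = Y.inv_hom[OF \<phi>] and i' = Y.inv_hom[OF \<phi>']
  note [simp] = Y.homD[OF \<phi>'] Y.homD[OF \<phi>] Y.homD[OF fs(4)[OF m]] Y.homD[OF i] Y.homD[OF i']
  have "\<phi>' \<cdot>\<^bsub>Y\<^esub> (AM f m \<cdot>\<^bsub>Y\<^esub> inv_ar Y \<phi>) = \<phi> \<cdot>\<^bsub>Y\<^esub> inv_ar Y \<phi>" by (rule Y.reassoc[OF e]) simp_all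
  then show "\<phi>' \<cdot>\<^bsub>Y\<^esub> (AM f m \<cdot>\<^bsub>Y\<^esub> inv_ar Y \<phi>) = \<phi>' \<cdot>\<^bsub>Y\<^esub> inv_ar Y \<phi>'"
    using Y.inv_comp(2)[OF \<phi>] Y.inv_comp(2)[OF \<phi>'] by simp
  show "is_iso Y \<phi>'" by (rule Y.all_iso) simp
  show "Y.into (AM f m \<cdot>\<^bsub>Y\<^esub> inv_ar Y \<phi>) (Dom Y \<phi>')" "Y.into (inv_ar Y \<phi>') (Dom Y \<phi>')" by simp_all
qed

lemma functor_iso:
  assumes F: "is_functor Y C F" and n: "n \<in> hom Y y y'"
  shows "is_iso C (AM F n)"
proof -
  interpret C: category C by (rule is_functorD(2)[OF F])
  note Fs = is_functorD[OF F] and i = Y.inv_hom[OF n]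
  show ?thesis
    by (rule C.is_isoI(1)[OF Fs(4)[OF n] Fs(4)[OF i]])
      (use Fs(6)[OF n i] Fs(6)[OF i n] Y.inv_comp[OF n] Fs(5) Y.hom_ob[OF n] in simp_all)
qed

lemma proj_functor: "is_functor (P y) X (hfibre_proj X Y f y)"
proof (rule is_functorI)
  interpret P: category "P y" by (rule category_P)
  show "category (P y)" "category X" by (rule category_P, rule X.category_axioms)
  show "OM (hfibre_proj X Y f y) c \<in> Ob X" if "c \<in> Ob (P y)" for c
    using that ob_PD[OF that] by (simp add: hfibre_proj_def)
  show "AM (hfibre_proj X Y f y) m \<in> hom X (OM (hfibre_proj X Y f y) a) (OM (hfibre_proj X Y f y) b)"
    if m: "m \<in> hom (P y) a b" for m a b
  proof -
    obtain k where "m = (a, k, b)" "k \<in> hom X (fst a) (fst b)" using m by (auto simp: hom_P)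
    then show ?thesis using P.homD(1)[OF m] P.hom_ob[OF m] by (simp add: hfibre_proj_def)
  qed
  show "AM (hfibre_proj X Y f y) (Ident (P y) c) = Ident X (OM (hfibre_proj X Y f y) c)" if "c \<in> Ob (P y)" for c
    using that P.ident_ar(1)[OF that] by (simp add: hfibre_proj_def)
  show "AM (hfibre_proj X Y f y) (n \<cdot>\<^bsub>P y\<^esub> m) = AM (hfibre_proj X Y f y) n \<cdot>\<^bsub>X\<^esub> AM (hfibre_proj X Y f y) m"
    if m: "m \<in> hom (P y) a b" and n: "n \<in> hom (P y) b c" for m n a b c
  proof -
    obtain k l where "m = (a, k, b)" "n = (b, l, c)" using m n by (auto simp: hom_P)
    then show ?thesis using P.homD(1)[OF m] P.homD(1)[OF n] P.homD(1)[OF P.comp_hom[OF m n]]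
      by (simp add: hfibre_proj_def)
  qed
qed (simp_all add: hfibre_proj_def)

text \<open>The restriction \<open>p\<^sup>* V\<close> along the projection \<open>p\<close> of the homotopy fibre.\<close>

definition pb :: "('x, 'm, 'o, 'a) fct \<Rightarrow> 'y \<Rightarrow> ('x \<times> 'n, ('x \<times> 'n) \<times> 'm \<times> ('x \<times> 'n), 'o, 'a) fct" where
  "pb V y = fct_comp (P y) V (hfibre_proj X Y f y)"

lemma pb_functor: "is_functor X C V \<Longrightarrow> is_functor (P y) C (pb V y)"
  unfolding pb_def by (rule functor_comp[OF proj_functor])

lemma pb_sel:
  "c \<in> Ob (P y) \<Longrightarrow> OM (pb V y) c = OM V (fst c)" "(a, m, b) \<in> Ar (P y) \<Longrightarrow> AM (pb V y) (a, m, b) = AM V m"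
  by (simp_all add: pb_def hfibre_proj_def)

end


section \<open>Pointwise Kan extensions\<close>

text \<open>Colimits over the homotopy fibres are a separate hypothesis, because objects and arrows of a homotopy
  fibre are tuples and not elements of the universe \<open>'u\<close>. This also lets \<open>X\<close> be the one-point groupoid
  and \<open>Y\<close> a component of a homotopy fibre.\<close>

locale kan = fin_cocomplete_rigid C U + groupoid_map X Y f
  for C :: "('o, 'a, 'e) smcat_scheme" (structure) and U :: "'u::infinite itself"
    and X :: "('x, 'm, 'e1) cat_scheme" and Y :: "('y, 'n, 'e2) cat_scheme" and f :: "('x, 'm, 'y, 'n) fct" +
  fixes R :: "'y \<Rightarrow> ('x \<times> 'n) set"
  assumes fib: "y \<in> Ob Y \<Longrightarrow> finite_groupoid (hfibre X Y f y) (R y)"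
    and colim: "\<lbrakk>y \<in> Ob Y; is_functor (hfibre X Y f y) C F\<rbrakk> \<Longrightarrow> \<exists>v \<kappa>. is_colimit C (hfibre X Y f y) F v \<kappa>"
    and orders_iso: "\<lbrakk>y \<in> Ob Y; c \<in> Ob (hfibre X Y f y)\<rbrakk> \<Longrightarrow> is_iso C (mult (hom (hfibre X Y f y) c c) \<one>)"
begin

abbreviation CX where "CX \<equiv> functor_cat X C"
abbreviation CY where "CY \<equiv> functor_cat Y C"
abbreviation rs where "rs \<equiv> restr C X Y f"

lemma category_CX: "category CX" and category_CY: "category CY"
  using category_functor_cat X.category_axioms Y.category_axioms by auto

sublocale CX: category CX by (rule category_CX)
sublocale CY: category CY by (rule category_CY)

lemma fibre_diagrams: "y \<in> Ob Y \<Longrightarrow> groupoid_diagrams C U (P y) (R y)"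
  using fib fin_cocomplete_rigid_axioms by (simp add: groupoid_diagrams_def)

lemmas rs_functor = restr_functor[OF f symmetric_monoidal_category_axioms]

definition lan_cocone :: "('y, 'n, 'o, 'a) fct \<Rightarrow> ('x, 'm, 'o, 'a) ntr \<Rightarrow> 'x \<times> 'n \<Rightarrow> 'a" where
  "lan_cocone W \<eta> = (\<lambda>(x, \<phi>). AM W \<phi> \<cdot> Cmp \<eta> x)"

text \<open>A cone over the fibre at \<open>y\<close> starts at \<open>W y\<close>, so it moves along the inverse of \<open>\<phi>\<close>.\<close>

definition ran_cone :: "('y, 'n, 'o, 'a) fct \<Rightarrow> ('x, 'm, 'o, 'a) ntr \<Rightarrow> 'x \<times> 'n \<Rightarrow> 'a" where
  "ran_cone W \<epsilon> = (\<lambda>(x, \<phi>). Cmp \<epsilon> x \<cdot> AM W (inv_ar Y \<phi>))"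

text \<open>Pointwise Kan extensions: the values are colimits, respectively limits, over the homotopy fibres.\<close>

definition is_lan :: "('x, 'm, 'o, 'a) fct \<Rightarrow> ('y, 'n, 'o, 'a) fct \<Rightarrow> ('x, 'm, 'o, 'a) ntr \<Rightarrow> bool" where
  "is_lan V W \<eta> \<longleftrightarrow> is_functor X C V \<and> is_functor Y C W \<and> \<eta> \<in> hom CX V (fct_comp X W f) \<and>
     (\<forall>y \<in> Ob Y. is_colimit C (P y) (pb V y) (OM W y) (lan_cocone W \<eta>))"

definition is_ran :: "('x, 'm, 'o, 'a) fct \<Rightarrow> ('y, 'n, 'o, 'a) fct \<Rightarrow> ('x, 'm, 'o, 'a) ntr \<Rightarrow> bool" where
  "is_ran V W \<epsilon> \<longleftrightarrow> is_functor X C V \<and> is_functor Y C W \<and> \<epsilon> \<in> hom CX (fct_comp X W f) V \<and>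
     (\<forall>y \<in> Ob Y. is_limit C (P y) (pb V y) (OM W y) (ran_cone W \<epsilon>))"

lemma is_lanD:
  assumes "is_lan V W \<eta>"
  shows "is_functor X C V" "is_functor Y C W" "\<eta> \<in> hom CX V (fct_comp X W f)"
    "\<And>y. y \<in> Ob Y \<Longrightarrow> is_colimit C (P y) (pb V y) (OM W y) (lan_cocone W \<eta>)"
    "\<And>x. x \<in> Ob X \<Longrightarrow> Cmp \<eta> x \<in> hom C (OM V x) (OM W (OM f x))"
    "\<And>m x x'. m \<in> hom X x x' \<Longrightarrow> Cmp \<eta> x' \<cdot> AM V m = AM W (AM f m) \<cdot> Cmp \<eta> x"
proof -
  show *: "is_functor X C V" "is_functor Y C W" and \<eta>: "\<eta> \<in> hom CX V (fct_comp X W f)"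
    "\<And>y. y \<in> Ob Y \<Longrightarrow> is_colimit C (P y) (pb V y) (OM W y) (lan_cocone W \<eta>)"
    using assms by (auto simp: is_lan_def)
  show "Cmp \<eta> x \<in> hom C (OM V x) (OM W (OM f x))" if "x \<in> Ob X" for x
    using hom_functor_catD(6)[OF \<eta>(1) that] that by simp
  show "Cmp \<eta> x' \<cdot> AM V m = AM W (AM f m) \<cdot> Cmp \<eta> x" if "m \<in> hom X x x'" for m x x'
    using hom_functor_catD(7)[OF \<eta>(1) that] X.homD[OF that] by simp
qed

lemma is_ranD:
  assumes "is_ran V W \<epsilon>"
  shows "is_functor X C V" "is_functor Y C W" "\<epsilon> \<in> hom CX (fct_comp X W f) V"
    "\<And>y. y \<in> Ob Y \<Longrightarrow> is_limit C (P y) (pb V y) (OM W y) (ran_cone W \<epsilon>)"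
    "\<And>x. x \<in> Ob X \<Longrightarrow> Cmp \<epsilon> x \<in> hom C (OM W (OM f x)) (OM V x)"
    "\<And>m x x'. m \<in> hom X x x' \<Longrightarrow> Cmp \<epsilon> x' \<cdot> AM W (AM f m) = AM V m \<cdot> Cmp \<epsilon> x"
proof -
  show *: "is_functor X C V" "is_functor Y C W" and \<epsilon>: "\<epsilon> \<in> hom CX (fct_comp X W f) V"
    "\<And>y. y \<in> Ob Y \<Longrightarrow> is_limit C (P y) (pb V y) (OM W y) (ran_cone W \<epsilon>)"
    using assms by (auto simp: is_ran_def)
  show "Cmp \<epsilon> x \<in> hom C (OM W (OM f x)) (OM V x)" if "x \<in> Ob X" for x
    using hom_functor_catD(6)[OF \<epsilon>(1) that] that by simp
  show "Cmp \<epsilon> x' \<cdot> AM W (AM f m) = AM V m \<cdot> Cmp \<epsilon> x" if "m \<in> hom X x x'" for m x x'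
    using hom_functor_catD(7)[OF \<epsilon>(1) that] X.homD[OF that] by simp
qed

lemma lan_cocone_unit:
  assumes l: "is_lan V W \<eta>" and x: "x \<in> Ob X"
  shows "lan_cocone W \<eta> (x, Ident Y (OM f x)) = Cmp \<eta> x"
  using is_functorD(5)[OF is_lanD(2)[OF l]] fs(3)[OF x] homD[OF is_lanD(5)[OF l x]] by (simp add: lan_cocone_def)

lemma ident_inv: "y \<in> Ob Y \<Longrightarrow> inv_ar Y (Ident Y y) = Ident Y y"
  using Y.is_isoI(2)[of "Ident Y y" y y "Ident Y y"] by (simp add: Y.hom_iff)

lemma ran_cone_counit:
  assumes r: "is_ran V W \<epsilon>" and x: "x \<in> Ob X"
  shows "ran_cone W \<epsilon> (x, Ident Y (OM f x)) = Cmp \<epsilon> x"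
  using is_functorD(5)[OF is_ranD(2)[OF r]] fs(3)[OF x] homD[OF is_ranD(5)[OF r x]]
  by (simp add: ran_cone_def ident_inv)

lemma lan_cocone_shift:
  assumes l: "is_lan V W \<eta>" and n: "n \<in> hom Y y y'" and c: "c \<in> Ob (P y)"
  shows "AM W n \<cdot> lan_cocone W \<eta> c = lan_cocone W \<eta> (sh n c)"
proof -
  obtain x \<phi> where cc: "c = (x, \<phi>)" by (cases c)
  have x: "x \<in> Ob X" and \<phi>: "\<phi> \<in> hom Y (OM f x) y" using c cc by auto
  note Ws = is_functorD[OF is_lanD(2)[OF l]]
  show ?thesis
    using homD[OF Ws(4)[OF n]] homD[OF Ws(4)[OF \<phi>]] homD[OF is_lanD(5)[OF l x]]
    by (simp add: cc lan_cocone_def sh_def Ws(6)[OF \<phi> n])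
qed

text \<open>The value at \<open>y\<close> is a chosen colimit over the fibre; an arrow \<open>n\<close> acts by the map of colimits that \<open>sh n\<close>
  induces.\<close>

lemma lan_ex:
  assumes V: "is_functor X C V"
  shows "\<exists>W \<eta>. is_lan V W \<eta>"
proof -
  note Vs = is_functorD[OF V]
  have "\<forall>y \<in> Ob Y. \<exists>v \<kappa>. is_colimit C (P y) (pb V y) v \<kappa>" using colim pb_functor[OF V] by blast
  then obtain v \<kappa> where c: "\<And>y. y \<in> Ob Y \<Longrightarrow> is_colimit C (P y) (pb V y) (v y) (\<kappa> y)" by metis
  note cD = is_colimitD[OF c]
  have dg: "diagram C (P y) (pb V y)" for y by (rule functor_diagram[OF pb_functor[OF V]])
  have \<kappa>h: "\<kappa> y d \<in> hom C (OM V (fst d)) (v y)" if "y \<in> Ob Y" "d \<in> Ob (P y)" for y d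
    using cD(2)[OF that] that by (simp add: pb_sel)
  note [simp] = homD[OF \<kappa>h] cD(1)
  define w where "w = (\<lambda>n. SOME u. u \<in> hom C (v (Dom Y n)) (v (Cod Y n)) \<and>
    (\<forall>d \<in> Ob (P (Dom Y n)). u \<cdot> \<kappa> (Dom Y n) d = \<kappa> (Cod Y n) (sh n d)))"
  have wh: "w n \<in> hom C (v y) (v y')" and w\<kappa>: "d \<in> Ob (P y) \<Longrightarrow> w n \<cdot> \<kappa> y d = \<kappa> y' (sh n d)"
    if n: "n \<in> hom Y y y'" for n y y' d
  proof -
    note y = Y.hom_ob[OF n] and nD = Y.homD[OF n]
    have "is_cocone C (P y) (pb V y) (v y') (\<lambda>d. \<kappa> y' (sh n d))"
      unfolding is_cocone_def
    proof (intro conjI ballI)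
      show "v y' \<in> Ob C" using y by simp
      show "\<kappa> y' (sh n d) \<in> hom C (OM (pb V y) d) (v y')" if "d \<in> Ob (P y)" for d
        using \<kappa>h[OF y(2) sh_ob[OF n that]] that by (simp add: pb_sel sh_def)
      fix t assume t: "t \<in> Ar (P y)"
      obtain a m b where tt: "t = (a, m, b)" by (cases t)
      have ab: "a \<in> Ob (P y)" "b \<in> Ob (P y)" using t unfolding tt ar_P by auto
      have "(a, m, b) \<in> hom (P y) a b" using t tt by (simp add: hom_def)
      then have t': "(sh n a, m, sh n b) \<in> Ar (P y')" using sh_hom[OF n ab, of m] by (simp add: hom_def)
      show "\<kappa> y' (sh n (Cod (P y) t)) \<cdot> AM (pb V y) t = \<kappa> y' (sh n (Dom (P y) t))"
        using cD(3)[OF y(2) t'] t t' by (simp add: tt pb_sel)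
    qed
    then obtain u where "u \<in> hom C (v y) (v y')" "\<And>d. d \<in> Ob (P y) \<Longrightarrow> u \<cdot> \<kappa> y d = \<kappa> y' (sh n d)"
      using is_colimit_ex[OF c[OF y(1)]] by blast
    then have "\<exists>u. u \<in> hom C (v (Dom Y n)) (v (Cod Y n)) \<and>
      (\<forall>d \<in> Ob (P (Dom Y n)). u \<cdot> \<kappa> (Dom Y n) d = \<kappa> (Cod Y n) (sh n d))" using nD by auto
    then have "w n \<in> hom C (v (Dom Y n)) (v (Cod Y n)) \<and>
      (\<forall>d \<in> Ob (P (Dom Y n)). w n \<cdot> \<kappa> (Dom Y n) d = \<kappa> (Cod Y n) (sh n d))"
      unfolding w_def by (rule someI_ex)
    then show "w n \<in> hom C (v y) (v y')" "d \<in> Ob (P y) \<Longrightarrow> w n \<cdot> \<kappa> y d = \<kappa> y' (sh n d)" using nD by auto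
  qed
  define W where "W = \<lparr>OM = (\<lambda>y \<in> Ob Y. v y), AM = (\<lambda>n \<in> Ar Y. w n)\<rparr>"
  have WO [simp]: "OM W y = v y" if "y \<in> Ob Y" for y using that by (simp add: W_def)
  have WA [simp]: "AM W n = w n" if "n \<in> Ar Y" for n using that by (simp add: W_def)
  have W: "is_functor Y C W"
  proof (rule is_functorI)
    show "AM W n \<in> hom C (OM W y) (OM W y')" if "n \<in> hom Y y y'" for n y y'
      using wh[OF that] Y.homD[OF that] Y.hom_ob[OF that] by simp
    show "AM W (Ident Y y) = Ident C (OM W y)" if y: "y \<in> Ob Y" for y
    proof -
      note i = Y.ident_hom[OF y]
      have "w (Ident Y y) = Ident C (v y)"
      proof (rule is_colimit_eq[OF c[OF y] wh[OF i] ident_hom[OF cD(1)[OF y]] _ dg])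
        fix d assume d: "d \<in> Ob (P y)"
        have "sh (Ident Y y) d = d" using ob_PD[OF d] Y.homD[OF conjunct2[OF ob_PD[OF d]]] by (simp add: sh_def)
        then show "w (Ident Y y) \<cdot> \<kappa> y d = Ident C (v y) \<cdot> \<kappa> y d" using w\<kappa>[OF i d] d y by simp
      qed
      then show ?thesis using y by simp
    qed
    show "AM W (n' \<cdot>\<^bsub>Y\<^esub> n) = AM W n' \<cdot> AM W n" if n: "n \<in> hom Y y y'" and n': "n' \<in> hom Y y' y''" for n n' y y' y''
    proof -
      note nn = Y.comp_hom[OF n n'] and y = Y.hom_ob[OF n]
      note [simp] = y homD[OF wh[OF n]] homD[OF wh[OF n']]
      have "w (n' \<cdot>\<^bsub>Y\<^esub> n) = w n' \<cdot> w n"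
      proof (rule is_colimit_eq[OF c[OF y(1)] wh[OF nn] comp_hom[OF wh[OF n] wh[OF n']] _ dg])
        fix d assume d: "d \<in> Ob (P y)"
        have "sh n' (sh n d) = sh (n' \<cdot>\<^bsub>Y\<^esub> n) d"
          using Y.homD[OF n] Y.homD[OF n'] Y.homD[OF conjunct2[OF ob_PD[OF d]]] by (simp add: sh_def)
        then show "w (n' \<cdot>\<^bsub>Y\<^esub> n) \<cdot> \<kappa> y d = w n' \<cdot> w n \<cdot> \<kappa> y d"
          using w\<kappa>[OF nn d] w\<kappa>[OF n' sh_ob[OF n d]] w\<kappa>[OF n d] d by simp
      qed
      then show ?thesis using Y.homD[OF n] Y.homD[OF n'] by simp
    qed
  qed (simp_all add: W_def Y.category_axioms category_axioms)
  define \<eta> where "\<eta> = \<lparr>Src = V, Tgt = fct_comp X W f, Cmp = (\<lambda>x \<in> Ob X. \<kappa> (OM f x) (x, Ident Y (OM f x)))\<rparr>"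
  have i: "(x, Ident Y (OM f x)) \<in> Ob (P (OM f x))" if "x \<in> Ob X" for x
    using that Y.ident_hom[OF fs(3)[OF that]] by simp
  have \<eta>: "\<eta> \<in> hom CX V (fct_comp X W f)"
  proof (rule hom_functor_catI)
    show "Cmp \<eta> x \<in> hom C (OM V x) (OM (fct_comp X W f) x)" if "x \<in> Ob X" for x
      using \<kappa>h[OF fs(3) i, OF that that] that fs(3) by (simp add: \<eta>_def)
    fix m x x' assume m: "m \<in> hom X x x'"
    note xx = X.hom_ob[OF m] and fm = fs(4)[OF m] and mD = X.homD[OF m]
    note y = fs(3)[OF xx(1)] fs(3)[OF xx(2)]
    have s: "sh (AM f m) (x, Ident Y (OM f x)) = (x, AM f m)"
      using Y.homD[OF fm] y by (simp add: sh_def)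
    have t: "((x, AM f m), m, (x', Ident Y (OM f x'))) \<in> Ar (P (OM f x'))"
      unfolding ar_P using m fm xx Y.homD[OF fm] i[OF xx(2)] by simp
    show "Cmp \<eta> x' \<cdot> AM V m = AM (fct_comp X W f) m \<cdot> Cmp \<eta> x"
      using cD(3)[OF y(2) t] w\<kappa>[OF fm i[OF xx(1)]] xx mD Y.homD[OF fm] t by (simp add: \<eta>_def s pb_sel)
  qed (use V functor_comp[OF f W] in \<open>simp_all add: \<eta>_def\<close>)
  have "lan_cocone W \<eta> d = \<kappa> y d" if y: "y \<in> Ob Y" and d: "d \<in> Ob (P y)" for y d
  proof -
    obtain x \<phi> where dd: "d = (x, \<phi>)" by (cases d)
    have x: "x \<in> Ob X" and \<phi>: "\<phi> \<in> hom Y (OM f x) y" using d dd by auto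
    show ?thesis using w\<kappa>[OF \<phi> i[OF x]] x Y.homD[OF \<phi>] by (simp add: dd lan_cocone_def \<eta>_def sh_def)
  qed
  then have "is_colimit C (P y) (pb V y) (OM W y) (lan_cocone W \<eta>)" if "y \<in> Ob Y" for y
    using colimit_iso_vertex[OF c[OF that] dg ident_hom[OF cD(1)[OF that]], of "lan_cocone W \<eta>"] that by simp
  then have "is_lan V W \<eta>" using V W \<eta> by (simp add: is_lan_def)
  then show ?thesis by blast
qed

text \<open>A transformation from \<open>V\<close> to the restriction of \<open>Z\<close> is the same as a family of cocones \<open>\<sigma>\<close> over the fibres,
  natural in \<open>y\<close>, whose vertices are the values of \<open>Z\<close>.\<close>

lemma lan_universal:
  assumes l: "is_lan V W \<eta>"
  shows "universal CX CY rs V W \<eta>"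
  unfolding universal_def
proof (intro conjI ballI)
  note L = is_lanD[OF l]
  note Vs = is_functorD[OF L(1)] and Ws = is_functorD[OF L(2)]
  have dg: "diagram C (P y) (pb V y)" for y by (rule functor_diagram[OF pb_functor[OF L(1)]])
  have kh: "lan_cocone W \<eta> d \<in> hom C (OM V (fst d)) (OM W y)" if "y \<in> Ob Y" "d \<in> Ob (P y)" for y d
    using is_colimitD(2)[OF L(4)[OF that(1)] that(2)] that by (simp add: pb_sel)
  show "W \<in> Ob CY" using L(2) by simp
  show "\<eta> \<in> hom CX V (OM rs W)" using L(3) by (simp add: restr_sel(1)[OF L(2)])
  fix Z t assume "Z \<in> Ob CY"
  then have Z: "is_functor Y C Z" by simp
  note Zs = is_functorD[OF Z]
  assume "t \<in> hom CX V (OM rs Z)"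
  then have t: "t \<in> hom CX V (fct_comp X Z f)" by (simp add: restr_sel(1)[OF Z])
  have th: "Cmp t x \<in> hom C (OM V x) (OM Z (OM f x))" if "x \<in> Ob X" for x
    using hom_functor_catD(6)[OF t that] that by simp
  have tn: "Cmp t x' \<cdot> AM V m = AM Z (AM f m) \<cdot> Cmp t x" if "m \<in> hom X x x'" for m x x'
    using hom_functor_catD(7)[OF t that] X.homD[OF that] by simp
  have key: "(u \<in> hom CY W Z \<and> AM rs u \<cdot>\<^bsub>CX\<^esub> \<eta> = t) \<longleftrightarrow> (u \<in> hom CY W Z \<and> (\<forall>x \<in> Ob X. Cmp u (OM f x) \<cdot> Cmp \<eta> x = Cmp t x))" for u
  proof (intro iffI conjI ballI)
    assume a: "u \<in> hom CY W Z \<and> AM rs u \<cdot>\<^bsub>CX\<^esub> \<eta> = t"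
    then show "u \<in> hom CY W Z" by simp
    fix x assume x: "x \<in> Ob X"
    have "Cmp t x = Cmp (AM rs u \<cdot>\<^bsub>CX\<^esub> \<eta>) x" using a by simp
    then show "Cmp u (OM f x) \<cdot> Cmp \<eta> x = Cmp t x"
      using restr_sel(4)[OF hom_functor_catD(5)[OF conjunct1[OF a]] x, of f] x by simp
  next
    assume a: "u \<in> hom CY W Z \<and> (\<forall>x \<in> Ob X. Cmp u (OM f x) \<cdot> Cmp \<eta> x = Cmp t x)"
    then show u: "u \<in> hom CY W Z" by simp
    show "AM rs u \<cdot>\<^bsub>CX\<^esub> \<eta> = t"
      by (rule ntr_eqI[OF comp_ntr[OF L(3) restr_ntr[OF f u]] t])
        (use a in \<open>simp add: restr_sel(4)[OF hom_functor_catD(5)[OF u]]\<close>)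
  qed
  define \<sigma> where "\<sigma> = (\<lambda>(x, \<phi>). AM Z \<phi> \<cdot> Cmp t x)"
  have sc: "is_cocone C (P y) (pb V y) (OM Z y) \<sigma>" if y: "y \<in> Ob Y" for y
    unfolding is_cocone_def
  proof (intro conjI ballI)
    show "OM Z y \<in> Ob C" using Zs(3)[OF y] .
    show "\<sigma> d \<in> hom C (OM (pb V y) d) (OM Z y)" if d: "d \<in> Ob (P y)" for d
      using d ob_PD[OF d] comp_hom[OF th Zs(4), of "fst d" "snd d" y] by (cases d) (simp add: \<sigma>_def pb_sel)
    fix s assume s: "s \<in> Ar (P y)"
    obtain x \<phi> m x' \<phi>' where ss: "s = ((x, \<phi>), m, (x', \<phi>'))" by (metis surj_pair)
    have m: "m \<in> hom X x x'" and \<phi>: "\<phi> \<in> hom Y (OM f x) y" and \<phi>': "\<phi>' \<in> hom Y (OM f x') y"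
      and e: "\<phi>' \<cdot>\<^bsub>Y\<^esub> AM f m = \<phi>" using s unfolding ss ar_P by auto
    note xx = X.hom_ob[OF m]
    note [simp] = homD[OF th[OF xx(1)]] homD[OF th[OF xx(2)]] homD[OF Zs(4)[OF \<phi>']] homD[OF Zs(4)[OF fs(4)[OF m]]]
      homD[OF Vs(4)[OF m]]
    have "AM Z \<phi>' \<cdot> Cmp t x' \<cdot> AM V m = AM Z \<phi> \<cdot> Cmp t x"
      using tn[OF m] Zs(6)[OF fs(4)[OF m] \<phi>'] by (simp add: e)
    then show "\<sigma> (Cod (P y) s) \<cdot> AM (pb V y) s = \<sigma> (Dom (P y) s)" using s by (simp add: ss \<sigma>_def pb_sel)
  qed
  have "\<forall>y \<in> Ob Y. \<exists>u. u \<in> hom C (OM W y) (OM Z y) \<and> (\<forall>d \<in> Ob (P y). u \<cdot> lan_cocone W \<eta> d = \<sigma> d)"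
    using is_colimit_ex[OF L(4) sc] by metis
  then obtain u where uh: "\<And>y. y \<in> Ob Y \<Longrightarrow> u y \<in> hom C (OM W y) (OM Z y)"
    and ue: "\<And>y d. y \<in> Ob Y \<Longrightarrow> d \<in> Ob (P y) \<Longrightarrow> u y \<cdot> lan_cocone W \<eta> d = \<sigma> d" by metis
  define v where "v = \<lparr>Src = W, Tgt = Z, Cmp = (\<lambda>y \<in> Ob Y. u y)\<rparr>"
  have vh: "v \<in> hom CY W Z"
  proof (rule hom_functor_catI[OF L(2) Z])
    fix n y y' assume n: "n \<in> hom Y y y'"
    note y = Y.hom_ob[OF n]
    note [simp] = homD[OF uh[OF y(1)]] homD[OF uh[OF y(2)]] homD[OF Ws(4)[OF n]] homD[OF Zs(4)[OF n]] homD[OF kh[OF y(1)]]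
    have "u y' \<cdot> AM W n = AM Z n \<cdot> u y"
    proof (rule is_colimit_eq[OF L(4)[OF y(1)] _ _ _ dg])
      fix d assume d: "d \<in> Ob (P y)"
      obtain x \<phi> where dd: "d = (x, \<phi>)" by (cases d)
      have x: "x \<in> Ob X" and \<phi>: "\<phi> \<in> hom Y (OM f x) y" using d dd by auto
      have "\<sigma> (sh n d) = AM Z n \<cdot> \<sigma> d"
        using homD[OF Zs(4)[OF \<phi>]] homD[OF th[OF x]] Zs(6)[OF \<phi> n] by (simp add: \<sigma>_def dd sh_def)
      then show "u y' \<cdot> AM W n \<cdot> lan_cocone W \<eta> d = AM Z n \<cdot> u y \<cdot> lan_cocone W \<eta> d"
        using d lan_cocone_shift[OF l n d] ue[OF y(2) sh_ob[OF n d]] ue[OF y(1) d] by simp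
    qed (simp_all add: hom_iff)
    then show "Cmp v y' \<cdot> AM W n = AM Z n \<cdot> Cmp v y" using y by (simp add: v_def)
  qed (simp_all add: v_def uh)
  have i: "(x, Ident Y (OM f x)) \<in> Ob (P (OM f x))" if "x \<in> Ob X" for x
    using that Y.ident_hom[OF fs(3)[OF that]] by simp
  have ve: "Cmp v (OM f x) \<cdot> Cmp \<eta> x = Cmp t x" if x: "x \<in> Ob X" for x
    using ue[OF fs(3)[OF x] i[OF x]] fs(3)[OF x] homD[OF th[OF x]] Zs(5)[OF fs(3)[OF x]]
    by (simp add: v_def lan_cocone_unit[OF l x] \<sigma>_def)
  show "\<exists>!u. u \<in> hom CY W Z \<and> AM rs u \<cdot>\<^bsub>CX\<^esub> \<eta> = t"
    unfolding key
  proof (rule ex1I[of _ v])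
    show "v \<in> hom CY W Z \<and> (\<forall>x \<in> Ob X. Cmp v (OM f x) \<cdot> Cmp \<eta> x = Cmp t x)" using vh ve by simp
    fix z assume z: "z \<in> hom CY W Z \<and> (\<forall>x \<in> Ob X. Cmp z (OM f x) \<cdot> Cmp \<eta> x = Cmp t x)"
    note zD = hom_functor_catD[OF conjunct1[OF z]]
    show "z = v"
    proof (rule ntr_eqI[OF conjunct1[OF z] vh])
      fix y assume y: "y \<in> Ob Y"
      show "Cmp z y = Cmp v y"
      proof (rule is_colimit_unique[OF L(4)[OF y] sc[OF y] zD(6)[OF y]])
        fix d assume d: "d \<in> Ob (P y)"
        obtain x \<phi> where dd: "d = (x, \<phi>)" by (cases d)
        have x: "x \<in> Ob X" and \<phi>: "\<phi> \<in> hom Y (OM f x) y" using d dd by auto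
        note [simp] = homD[OF Ws(4)[OF \<phi>]] homD[OF L(5)[OF x]] homD[OF zD(6)[OF y]] homD[OF zD(6)[OF fs(3)[OF x]]] homD[OF Zs(4)[OF \<phi>]]
        show "Cmp z y \<cdot> lan_cocone W \<eta> d = \<sigma> d"
          using z x by (simp add: dd lan_cocone_def \<sigma>_def reassoc[OF zD(7)[OF \<phi>]])
      next
        show "Cmp v y \<in> hom C (OM W y) (OM Z y)" using uh[OF y] y by (simp add: v_def)
        show "Cmp v y \<cdot> lan_cocone W \<eta> d = \<sigma> d" if "d \<in> Ob (P y)" for d using ue[OF y that] y by (simp add: v_def)
      qed
    qed
  qed
qed

text \<open>Because limits over the homotopy fibres are computed by the colimits and the norm, the left
  Kan extension is also a right Kan extension; its counit is the norm at the identity.\<close>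

lemma ran_of_lan:
  assumes l: "is_lan V W \<eta>"
  shows "\<exists>\<epsilon>. is_ran V W \<epsilon>"
proof -
  note L = is_lanD[OF l]
  note Vs = is_functorD[OF L(1)] and Ws = is_functorD[OF L(2)]
  note pbV = pb_functor[OF L(1)]
  define N where "N = (\<lambda>y. groupoid_diagrams.norm_map C (P y) (pb V y) (OM W y) (lan_cocone W \<eta>))"
  have lim: "is_limit C (P y) (pb V y) (OM W y) (N y)" if y: "y \<in> Ob Y" for y
    unfolding N_def
    by (rule groupoid_diagrams.norm_limit[OF fibre_diagrams[OF y] _ pbV L(4)[OF y]]) (use orders_iso y in blast)
  have Nh: "N y d \<in> hom C (OM W y) (OM V (fst d))" if "y \<in> Ob Y" "d \<in> Ob (P y)" for y d
    using is_limitD(2)[OF lim[OF that(1)] that(2)] that by (simp add: pb_sel)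
  have kh: "lan_cocone W \<eta> d \<in> hom C (OM V (fst d)) (OM W y)" if "y \<in> Ob Y" "d \<in> Ob (P y)" for y d
    using is_colimitD(2)[OF L(4)[OF that(1)] that(2)] that by (simp add: pb_sel)
  have Nk: "N y d \<cdot> lan_cocone W \<eta> c = Sm (hom (P y) c d) (OM V (fst c)) (OM V (fst d)) (AM (pb V y))"
    if "y \<in> Ob Y" "d \<in> Ob (P y)" "c \<in> Ob (P y)" for y c d
    using groupoid_diagrams.norm_map(2)[OF fibre_diagrams[OF that(1)] pbV L(4)[OF that(1)] that(2,3)] that(2,3)
    by (simp add: N_def pb_sel)
  have shift: "N y' (sh n d) \<cdot> AM W n = N y d" if n: "n \<in> hom Y y y'" and d: "d \<in> Ob (P y)" for n y y' d
  proof -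
    note y = Y.hom_ob[OF n]
    note sd = sh_ob[OF n d]
    have Nsd: "N y' (sh n d) \<in> hom C (OM W y') (OM V (fst d))" using Nh[OF y(2) sd] by (simp add: sh_def)
    note [simp] = homD[OF Nsd] homD[OF Ws(4)[OF n]] homD[OF kh[OF y(1)]]
    show ?thesis
    proof (rule is_colimit_eq[OF L(4)[OF y(1)] _ Nh[OF y(1) d] _ functor_diagram[OF pbV]])
      fix c assume c: "c \<in> Ob (P y)"
      note sc = sh_ob[OF n c]
      interpret G: groupoid_diagrams C U "P y" "R y" by (rule fibre_diagrams[OF y(1)])
      have Vc: "OM V (fst c) \<in> Ob C" and Vd: "OM V (fst d) \<in> Ob C" using Vs(3) ob_PD[OF c] ob_PD[OF d] by auto
      have "N y' (sh n d) \<cdot> AM W n \<cdot> lan_cocone W \<eta> c = N y' (sh n d) \<cdot> lan_cocone W \<eta> (sh n c)"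
        using c lan_cocone_shift[OF l n c] by simp
      also have "\<dots> = Sm (hom (P y') (sh n c) (sh n d)) (OM V (fst c)) (OM V (fst d)) (AM (pb V y'))"
        using Nk[OF y(2) sd sc] by (simp add: sh_def)
      also have "\<dots> = Sm (hom (P y) c d) (OM V (fst c)) (OM V (fst d)) (\<lambda>t. AM (pb V y') (case t of (_, m, _) \<Rightarrow> (sh n c, m, sh n d)))"
      proof (rule Sm_reindex[OF G.P.fin_hom[OF c d] sh_bij[OF n c d] Vc Vd])
        fix s assume "s \<in> hom (P y') (sh n c) (sh n d)"
        from is_functorD(4)[OF pbV this] show "AM (pb V y') s \<in> hom C (OM V (fst c)) (OM V (fst d))"
          using sc sd by (simp add: pb_sel) (simp add: sh_def)
      qed
      also have "\<dots> = Sm (hom (P y) c d) (OM V (fst c)) (OM V (fst d)) (AM (pb V y))"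
      proof (rule Sm_cong)
        fix t assume t: "t \<in> hom (P y) c d"
        then obtain m where m: "t = (c, m, d)" by (auto simp: hom_P)
        have "(c, m, d) \<in> Ar (P y)" "(sh n c, m, sh n d) \<in> Ar (P y')"
          using t sh_hom[OF n c d, of m] unfolding m by (simp_all add: hom_def)
        then show "AM (pb V y') (case t of (_, m, _) \<Rightarrow> (sh n c, m, sh n d)) = AM (pb V y) t"
          by (simp add: m pb_sel)
      qed
      finally show "N y' (sh n d) \<cdot> AM W n \<cdot> lan_cocone W \<eta> c = N y d \<cdot> lan_cocone W \<eta> c"
        using Nk[OF y(1) d c] by simp
    qed (simp_all add: hom_iff)
  qed
  define \<epsilon> where "\<epsilon> = \<lparr>Src = fct_comp X W f, Tgt = V, Cmp = (\<lambda>x \<in> Ob X. N (OM f x) (x, Ident Y (OM f x)))\<rparr>"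
  have i: "(x, Ident Y (OM f x)) \<in> Ob (P (OM f x))" if "x \<in> Ob X" for x
    using that Y.ident_hom[OF fs(3)[OF that]] by simp
  have \<epsilon>: "\<epsilon> \<in> hom CX (fct_comp X W f) V"
  proof (rule hom_functor_catI)
    show "Cmp \<epsilon> x \<in> hom C (OM (fct_comp X W f) x) (OM V x)" if "x \<in> Ob X" for x
      using Nh[OF fs(3) i, OF that that] that by (simp add: \<epsilon>_def)
    fix m x x' assume m: "m \<in> hom X x x'"
    note xx = X.hom_ob[OF m] and fm = fs(4)[OF m]
    note y = fs(3)[OF xx(1)] fs(3)[OF xx(2)] and inv = Y.inv_hom[OF fm]
    let ?d = "(x', inv_ar Y (AM f m))"
    have d: "?d \<in> Ob (P (OM f x))" using xx inv by simp
    have s: "sh (AM f m) ?d = (x', Ident Y (OM f x'))" using Y.inv_comp(2)[OF fm] by (simp add: sh_def)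
    have t: "((x, Ident Y (OM f x)), m, ?d) \<in> Ar (P (OM f x))"
      unfolding ar_P using i[OF xx(1)] d m Y.inv_comp(1)[OF fm] by simp
    show "Cmp \<epsilon> x' \<cdot> AM (fct_comp X W f) m = AM V m \<cdot> Cmp \<epsilon> x"
      using shift[OF fm d] is_limitD(3)[OF lim[OF y(1)] t] xx X.homD[OF m] t by (simp add: \<epsilon>_def s pb_sel)
  qed (use L functor_comp[OF f L(2)] in \<open>simp_all add: \<epsilon>_def\<close>)
  have "ran_cone W \<epsilon> d = N y d" if y: "y \<in> Ob Y" and d: "d \<in> Ob (P y)" for y d
  proof -
    obtain x \<phi> where dd: "d = (x, \<phi>)" by (cases d)
    have x: "x \<in> Ob X" and \<phi>: "\<phi> \<in> hom Y (OM f x) y" using d dd by auto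
    show ?thesis using shift[OF Y.inv_hom[OF \<phi>] d] x Y.inv_comp(1)[OF \<phi>] by (simp add: dd ran_cone_def \<epsilon>_def sh_def)
  qed
  then have "is_limit C (P y) (pb V y) (OM W y) (ran_cone W \<epsilon>)" if "y \<in> Ob Y" for y
    using limit_iso_vertex[OF lim[OF that] functor_diagram[OF pbV] ident_hom[OF Ws(3)[OF that]], of "ran_cone W \<epsilon>"]
      homD[OF Nh[OF that]] that is_iso_ident[OF Ws(3)[OF that]] by simp
  then have "is_ran V W \<epsilon>" using L \<epsilon> by (simp add: is_ran_def)
  then show ?thesis by blast
qed

lemma ran_couniversal:
  assumes r: "is_ran V W \<epsilon>"
  shows "couniversal CY CX rs V W \<epsilon>"
  unfolding couniversal_def
proof (intro conjI ballI)
  note L = is_ranD[OF r]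
  note Vs = is_functorD[OF L(1)] and Ws = is_functorD[OF L(2)]
  have dg: "diagram C (P y) (pb V y)" for y by (rule functor_diagram[OF pb_functor[OF L(1)]])
  have ph: "ran_cone W \<epsilon> d \<in> hom C (OM W y) (OM V (fst d))" if "y \<in> Ob Y" "d \<in> Ob (P y)" for y d
    using is_limitD(2)[OF L(4)[OF that(1)] that(2)] that by (simp add: pb_sel)
  show "W \<in> Ob CY" using L(2) by simp
  show "\<epsilon> \<in> hom CX (OM rs W) V" using L(3) by (simp add: restr_sel(1)[OF L(2)])
  fix Z t assume "Z \<in> Ob CY"
  then have Z: "is_functor Y C Z" by simp
  note Zs = is_functorD[OF Z]
  assume "t \<in> hom CX (OM rs Z) V"
  then have t: "t \<in> hom CX (fct_comp X Z f) V" by (simp add: restr_sel(1)[OF Z])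
  have th: "Cmp t x \<in> hom C (OM Z (OM f x)) (OM V x)" if "x \<in> Ob X" for x
    using hom_functor_catD(6)[OF t that] that by simp
  have tn: "Cmp t x' \<cdot> AM Z (AM f m) = AM V m \<cdot> Cmp t x" if "m \<in> hom X x x'" for m x x'
    using hom_functor_catD(7)[OF t that] X.homD[OF that] by simp
  have key: "(u \<in> hom CY Z W \<and> \<epsilon> \<cdot>\<^bsub>CX\<^esub> AM rs u = t) \<longleftrightarrow> (u \<in> hom CY Z W \<and> (\<forall>x \<in> Ob X. Cmp \<epsilon> x \<cdot> Cmp u (OM f x) = Cmp t x))" for u
  proof (intro iffI conjI ballI)
    assume a: "u \<in> hom CY Z W \<and> \<epsilon> \<cdot>\<^bsub>CX\<^esub> AM rs u = t"
    then show "u \<in> hom CY Z W" by simp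
    fix x assume x: "x \<in> Ob X"
    have "Cmp t x = Cmp (\<epsilon> \<cdot>\<^bsub>CX\<^esub> AM rs u) x" using a by simp
    then show "Cmp \<epsilon> x \<cdot> Cmp u (OM f x) = Cmp t x"
      using x by (simp add: restr_sel(4)[OF hom_functor_catD(5)[OF conjunct1[OF a]]])
  next
    assume a: "u \<in> hom CY Z W \<and> (\<forall>x \<in> Ob X. Cmp \<epsilon> x \<cdot> Cmp u (OM f x) = Cmp t x)"
    then show u: "u \<in> hom CY Z W" by simp
    show "\<epsilon> \<cdot>\<^bsub>CX\<^esub> AM rs u = t"
      by (rule ntr_eqI[OF comp_ntr[OF restr_ntr[OF f u] L(3)] t])
        (use a in \<open>simp add: restr_sel(4)[OF hom_functor_catD(5)[OF u]]\<close>)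
  qed
  define \<sigma> where "\<sigma> = (\<lambda>(x, \<phi>). Cmp t x \<cdot> AM Z (inv_ar Y \<phi>))"
  have sc: "is_cone C (P y) (pb V y) (OM Z y) \<sigma>" if y: "y \<in> Ob Y" for y
    unfolding is_cone_def
  proof (intro conjI ballI)
    show "OM Z y \<in> Ob C" using Zs(3)[OF y] .
    show "\<sigma> d \<in> hom C (OM Z y) (OM (pb V y) d)" if d: "d \<in> Ob (P y)" for d
    proof -
      have x: "fst d \<in> Ob X" and \<phi>: "snd d \<in> hom Y (OM f (fst d)) y" using ob_PD[OF d] by auto
      show ?thesis using comp_hom[OF Zs(4)[OF Y.inv_hom[OF \<phi>]] th[OF x]] d by (simp add: \<sigma>_def pb_sel split_beta)
    qed
    fix s assume s: "s \<in> Ar (P y)"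
    obtain x \<phi> m x' \<phi>' where ss: "s = ((x, \<phi>), m, (x', \<phi>'))" by (metis surj_pair)
    have m: "m \<in> hom X x x'" and \<phi>: "\<phi> \<in> hom Y (OM f x) y" and \<phi>': "\<phi>' \<in> hom Y (OM f x') y"
      and e: "\<phi>' \<cdot>\<^bsub>Y\<^esub> AM f m = \<phi>" using s unfolding ss ar_P by auto
    note xx = X.hom_ob[OF m]
    note i = Y.inv_hom[OF \<phi>] and i' = Y.inv_hom[OF \<phi>'] and fm = fs(4)[OF m]
    note e' = inv_fibre[OF m \<phi> \<phi>' e]
    note [simp] = homD[OF th[OF xx(1)]] homD[OF th[OF xx(2)]] homD[OF Zs(4)[OF i]] homD[OF Zs(4)[OF i']] homD[OF Zs(4)[OF fm]]
      homD[OF Vs(4)[OF m]]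
    have "AM V m \<cdot> (Cmp t x \<cdot> AM Z (inv_ar Y \<phi>)) = Cmp t x' \<cdot> AM Z (inv_ar Y \<phi>')"
      using reassoc[OF tn[OF m, symmetric], of "AM Z (inv_ar Y \<phi>)"] Zs(6)[OF i fm] by (simp add: e')
    then show "AM (pb V y) s \<cdot> \<sigma> (Dom (P y) s) = \<sigma> (Cod (P y) s)" using s by (simp add: ss \<sigma>_def pb_sel)
  qed
  have "\<forall>y \<in> Ob Y. \<exists>u. u \<in> hom C (OM Z y) (OM W y) \<and> (\<forall>d \<in> Ob (P y). ran_cone W \<epsilon> d \<cdot> u = \<sigma> d)"
    using is_limit_ex[OF L(4) sc] by metis
  then obtain u where uh: "\<And>y. y \<in> Ob Y \<Longrightarrow> u y \<in> hom C (OM Z y) (OM W y)"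
    and ue: "\<And>y d. y \<in> Ob Y \<Longrightarrow> d \<in> Ob (P y) \<Longrightarrow> ran_cone W \<epsilon> d \<cdot> u y = \<sigma> d" by metis
  define v where "v = \<lparr>Src = Z, Tgt = W, Cmp = (\<lambda>y \<in> Ob Y. u y)\<rparr>"
  have vh: "v \<in> hom CY Z W"
  proof (rule hom_functor_catI[OF Z L(2)])
    fix n y y' assume n: "n \<in> hom Y y y'"
    note y = Y.hom_ob[OF n]
    note [simp] = homD[OF uh[OF y(1)]] homD[OF uh[OF y(2)]] homD[OF Ws(4)[OF n]] homD[OF Zs(4)[OF n]] homD[OF ph[OF y(2)]]
    have "u y' \<cdot> AM Z n = AM W n \<cdot> u y"
    proof (rule is_limit_eq[OF L(4)[OF y(2)] _ _ _ dg])
      fix d assume d: "d \<in> Ob (P y')"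
      obtain x \<phi> where dd: "d = (x, \<phi>)" by (cases d)
      have x: "x \<in> Ob X" and \<phi>: "\<phi> \<in> hom Y (OM f x) y'" using d dd by auto
      note i = Y.inv_hom[OF \<phi>] and ni = Y.inv_hom[OF n]
      have c: "(x, inv_ar Y n \<cdot>\<^bsub>Y\<^esub> \<phi>) \<in> Ob (P y)" using x Y.comp_hom[OF \<phi> ni] by simp
      have e: "inv_ar Y (inv_ar Y n \<cdot>\<^bsub>Y\<^esub> \<phi>) = inv_ar Y \<phi> \<cdot>\<^bsub>Y\<^esub> n"
      proof -
        note [simp] = Y.homD[OF n] Y.homD[OF \<phi>] Y.homD[OF i] Y.homD[OF ni] Y.all_iso[of n] Y.all_iso[of \<phi>]
        show ?thesis by (rule Y.is_isoI(2)[of _ "OM f x" y]) (simp_all add: Y.hom_iff)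
      qed
      note [simp] = homD[OF Zs(4)[OF i]] homD[OF Ws(4)[OF i]] homD[OF th[OF x]] homD[OF L(5)[OF x]]
      have "ran_cone W \<epsilon> d \<cdot> AM W n = ran_cone W \<epsilon> (x, inv_ar Y n \<cdot>\<^bsub>Y\<^esub> \<phi>)"
        using Ws(6)[OF n i] by (simp add: dd ran_cone_def e)
      moreover have "\<sigma> (x, inv_ar Y n \<cdot>\<^bsub>Y\<^esub> \<phi>) = \<sigma> d \<cdot> AM Z n" using Zs(6)[OF n i] by (simp add: dd \<sigma>_def e)
      ultimately have "ran_cone W \<epsilon> d \<cdot> (AM W n \<cdot> u y) = \<sigma> d \<cdot> AM Z n"
        using ue[OF y(1) c] d reassoc[OF refl, of "ran_cone W \<epsilon> d" "AM W n" "u y"] by simp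
      then show "ran_cone W \<epsilon> d \<cdot> (u y' \<cdot> AM Z n) = ran_cone W \<epsilon> d \<cdot> (AM W n \<cdot> u y)"
        using d reassoc[OF ue[OF y(2) d], of "AM Z n"] by simp
    qed (simp_all add: hom_iff)
    then show "Cmp v y' \<cdot> AM Z n = AM W n \<cdot> Cmp v y" using y by (simp add: v_def)
  qed (simp_all add: v_def uh)
  have i: "(x, Ident Y (OM f x)) \<in> Ob (P (OM f x))" if "x \<in> Ob X" for x
    using that Y.ident_hom[OF fs(3)[OF that]] by simp
  have ve: "Cmp \<epsilon> x \<cdot> Cmp v (OM f x) = Cmp t x" if x: "x \<in> Ob X" for x
    using ue[OF fs(3)[OF x] i[OF x]] fs(3)[OF x] homD[OF th[OF x]] Zs(5)[OF fs(3)[OF x]]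
    by (simp add: v_def ran_cone_counit[OF r x] \<sigma>_def ident_inv)
  show "\<exists>!u. u \<in> hom CY Z W \<and> \<epsilon> \<cdot>\<^bsub>CX\<^esub> AM rs u = t"
    unfolding key
  proof (rule ex1I[of _ v])
    show "v \<in> hom CY Z W \<and> (\<forall>x \<in> Ob X. Cmp \<epsilon> x \<cdot> Cmp v (OM f x) = Cmp t x)" using vh ve by simp
    fix z assume z: "z \<in> hom CY Z W \<and> (\<forall>x \<in> Ob X. Cmp \<epsilon> x \<cdot> Cmp z (OM f x) = Cmp t x)"
    note zD = hom_functor_catD[OF conjunct1[OF z]]
    show "z = v"
    proof (rule ntr_eqI[OF conjunct1[OF z] vh])
      fix y assume y: "y \<in> Ob Y"
      show "Cmp z y = Cmp v y"
      proof (rule is_limit_unique[OF L(4)[OF y] sc[OF y] zD(6)[OF y]])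
        fix d assume d: "d \<in> Ob (P y)"
        obtain x \<phi> where dd: "d = (x, \<phi>)" by (cases d)
        have x: "x \<in> Ob X" and \<phi>: "\<phi> \<in> hom Y (OM f x) y" using d dd by auto
        note i = Y.inv_hom[OF \<phi>]
        note [simp] = homD[OF Ws(4)[OF i]] homD[OF L(5)[OF x]] homD[OF zD(6)[OF y]] homD[OF zD(6)[OF fs(3)[OF x]]] homD[OF Zs(4)[OF i]]
        have "Cmp \<epsilon> x \<cdot> (AM W (inv_ar Y \<phi>) \<cdot> Cmp z y) = Cmp \<epsilon> x \<cdot> (Cmp z (OM f x) \<cdot> AM Z (inv_ar Y \<phi>))"
          using zD(7)[OF i] by simp
        also have "\<dots> = Cmp t x \<cdot> AM Z (inv_ar Y \<phi>)"
          by (rule reassoc) (use z x in simp_all)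
        finally show "ran_cone W \<epsilon> d \<cdot> Cmp z y = \<sigma> d" by (simp add: dd ran_cone_def \<sigma>_def)
      next
        show "Cmp v y \<in> hom C (OM Z y) (OM W y)" using uh[OF y] y by (simp add: v_def)
        show "ran_cone W \<epsilon> d \<cdot> Cmp v y = \<sigma> d" if "d \<in> Ob (P y)" for d using ue[OF y that] y by (simp add: v_def)
      qed
    qed
  qed
qed

abbreviation lk where "lk \<equiv> left_kan C X Y f"
abbreviation rk where "rk \<equiv> right_kan C X Y f"

lemma lk: "adjunction CX CY lk" "Rgt lk = rs"
proof -
  have "\<exists>J. adjunction CX CY J \<and> Rgt J = rs"
    using left_adjoint_ex[OF rs_functor] lan_ex lan_universal by (metis (no_types, lifting) functor_cat_sel(1) mem_Collect_eq)
  from someI_ex[OF this] show "adjunction CX CY lk" "Rgt lk = rs" by (simp_all add: left_kan_def)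
qed

lemma rk: "adjunction CY CX rk" "Lft rk = rs"
proof -
  have "\<exists>J. adjunction CY CX J \<and> Lft J = rs"
    using right_adjoint_ex[OF rs_functor] lan_ex ran_of_lan ran_couniversal by (metis (no_types, lifting) functor_cat_sel(1) mem_Collect_eq)
  from someI_ex[OF this] show "adjunction CY CX rk" "Lft rk = rs" by (simp_all add: right_kan_def)
qed

text \<open>The chosen adjoints are arbitrary, but universal arrows are unique up to isomorphism, so they are
  pointwise Kan extensions.\<close>

lemma lk_lan:
  assumes V: "is_functor X C V"
  shows "is_lan V (OM (Lft lk) V) (Unit lk V)"
proof -
  obtain W \<eta> where l: "is_lan V W \<eta>" using lan_ex[OF V] by blast
  note L = is_lanD[OF l]
  let ?L = "OM (Lft lk) V"
  have u: "universal CX CY rs V ?L (Unit lk V)" using adjunction_universal[OF lk(1), of V] V lk(2) by simp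
  obtain v where v: "v \<in> hom CY W ?L" "is_iso CY v" "AM rs v \<cdot>\<^bsub>CX\<^esub> \<eta> = Unit lk V"
    using universal_iso[OF rs_functor lan_universal[OF l] u] by blast
  note vD = hom_functor_catD[OF v(1)]
  note Ws = is_functorD[OF L(2)] and Ls = is_functorD[OF vD(2)]
  have un: "Unit lk V \<in> hom CX V (fct_comp X ?L f)"
    using universalD(2)[OF u] by (simp add: restr_sel(1)[OF vD(2)])
  have ux: "Cmp (Unit lk V) x = Cmp v (OM f x) \<cdot> Cmp \<eta> x" if "x \<in> Ob X" for x
    using that by (simp add: v(3)[symmetric] restr_sel(4)[OF vD(5)])
  have "is_colimit C (P y) (pb V y) (OM ?L y) (lan_cocone ?L (Unit lk V))" if y: "y \<in> Ob Y" for y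
  proof (rule colimit_iso_vertex[OF L(4)[OF y] functor_diagram[OF pb_functor[OF V]] vD(6)[OF y] ntr_iso_cmp[OF Y.category_axioms v(1,2) y]])
    fix d assume d: "d \<in> Ob (P y)"
    obtain x \<phi> where dd: "d = (x, \<phi>)" by (cases d)
    have x: "x \<in> Ob X" and \<phi>: "\<phi> \<in> hom Y (OM f x) y" using d dd by auto
    note [simp] = homD[OF Ws(4)[OF \<phi>]] homD[OF L(5)[OF x]] homD[OF vD(6)[OF y]] homD[OF vD(6)[OF fs(3)[OF x]]] homD[OF Ls(4)[OF \<phi>]]
    show "lan_cocone ?L (Unit lk V) d = Cmp v y \<cdot> lan_cocone W \<eta> d"
      using x by (simp add: dd lan_cocone_def ux reassoc[OF vD(7)[OF \<phi>]])
  qed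
  then show ?thesis using V vD(2) un by (simp add: is_lan_def)
qed

lemma rk_ran:
  assumes V: "is_functor X C V"
  shows "is_ran V (OM (Rgt rk) V) (Counit rk V)"
proof -
  obtain W \<eta> where l: "is_lan V W \<eta>" using lan_ex[OF V] by blast
  obtain \<epsilon> where r: "is_ran V W \<epsilon>" using ran_of_lan[OF l] by blast
  note L = is_ranD[OF r]
  let ?L = "OM (Rgt rk) V"
  have u: "couniversal CY CX rs V ?L (Counit rk V)" using adjunction_couniversal[OF rk(1), of V] V rk(2) by simp
  obtain v where v: "v \<in> hom CY ?L W" "is_iso CY v" "\<epsilon> \<cdot>\<^bsub>CX\<^esub> AM rs v = Counit rk V"
    using couniversal_iso[OF rs_functor ran_couniversal[OF r] u] by blast
  note vD = hom_functor_catD[OF v(1)]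
  note Ws = is_functorD[OF L(2)] and Ls = is_functorD[OF vD(1)]
  have un: "Counit rk V \<in> hom CX (fct_comp X ?L f) V"
    using u by (simp add: couniversal_def restr_sel(1)[OF vD(1)])
  have ux: "Cmp (Counit rk V) x = Cmp \<epsilon> x \<cdot> Cmp v (OM f x)" if "x \<in> Ob X" for x
    using that by (simp add: v(3)[symmetric] restr_sel(4)[OF vD(5)])
  have "is_limit C (P y) (pb V y) (OM ?L y) (ran_cone ?L (Counit rk V))" if y: "y \<in> Ob Y" for y
  proof (rule limit_iso_vertex[OF L(4)[OF y] functor_diagram[OF pb_functor[OF V]] vD(6)[OF y] ntr_iso_cmp[OF Y.category_axioms v(1,2) y]])
    fix d assume d: "d \<in> Ob (P y)"
    obtain x \<phi> where dd: "d = (x, \<phi>)" by (cases d)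
    have x: "x \<in> Ob X" and \<phi>: "\<phi> \<in> hom Y (OM f x) y" using d dd by auto
    note i = Y.inv_hom[OF \<phi>]
    note [simp] = homD[OF Ws(4)[OF i]] homD[OF L(5)[OF x]] homD[OF vD(6)[OF y]] homD[OF vD(6)[OF fs(3)[OF x]]] homD[OF Ls(4)[OF i]]
    show "ran_cone ?L (Counit rk V) d = ran_cone W \<epsilon> d \<cdot> Cmp v y"
      using x by (simp add: dd ran_cone_def ux vD(7)[OF i])
  qed
  then show ?thesis using V vD(1) un by (simp add: is_ran_def)
qed

section \<open>Projection maps and the pre-Nakayama map\<close>

abbreviation Lo where "Lo V \<equiv> OM (Lft lk) V"
abbreviation Ro where "Ro V \<equiv> OM (Rgt rk) V"
abbreviation lc where "lc V \<equiv> lan_cocone (Lo V) (Unit lk V)"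
abbreviation rc where "rc V \<equiv> ran_cone (Ro V) (Counit rk V)"
abbreviation oneX where "oneX \<equiv> \<one>\<^bsub>CX\<^esub>"

lemmas lkD = adjunctionD[OF lk(1), unfolded lk(2)]
lemmas rkD = adjunctionD[OF rk(1), unfolded rk(2)]

lemma lc_hom: "\<lbrakk>is_functor X C V; y \<in> Ob Y; d \<in> Ob (P y)\<rbrakk> \<Longrightarrow> lc V d \<in> hom C (OM V (fst d)) (OM (Lo V) y)"
  using is_colimitD(2)[OF is_lanD(4)[OF lk_lan]] by (simp add: pb_sel)

lemma rc_hom: "\<lbrakk>is_functor X C V; y \<in> Ob Y; d \<in> Ob (P y)\<rbrakk> \<Longrightarrow> rc V d \<in> hom C (OM (Ro V) y) (OM V (fst d))"
  using is_limitD(2)[OF is_ranD(4)[OF rk_ran]] by (simp add: pb_sel)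

text \<open>A map out of a colimit is determined by the cocone and a map into a limit by the cone; these lemmas
  give the values of the Kan extensions on transformations in this form.\<close>

lemma Lft_cmp:
  assumes h: "h \<in> hom CX V V'" and y: "y \<in> Ob Y" and d: "d \<in> Ob (P y)"
  shows "AM (Lft lk) h \<in> hom CY (Lo V) (Lo V')"
    "Cmp (AM (Lft lk) h) y \<cdot> lc V d = lc V' d \<cdot> Cmp h (fst d)"
proof -
  note hD = hom_functor_catD[OF h]
  show L: "AM (Lft lk) h \<in> hom CY (Lo V) (Lo V')" by (rule is_functorD(4)[OF lkD(1) h])
  note LD = hom_functor_catD[OF L]
  obtain x \<phi> where dd: "d = (x, \<phi>)" by (cases d)
  have x: "x \<in> Ob X" and \<phi>: "\<phi> \<in> hom Y (OM f x) y" using d dd by auto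
  note l1 = is_lanD[OF lk_lan[OF hD(1)]] and l2 = is_lanD[OF lk_lan[OF hD(2)]]
  note [simp] = homD[OF LD(6)[OF y]] homD[OF LD(6)[OF fs(3)[OF x]]] homD[OF is_functorD(4)[OF l1(2) \<phi>]]
    homD[OF is_functorD(4)[OF l2(2) \<phi>]] homD[OF l1(5)[OF x]] homD[OF l2(5)[OF x]] homD[OF hD(6)[OF x]]
  have "Cmp (Unit lk V' \<cdot>\<^bsub>CX\<^esub> h) x = Cmp (AM rs (AM (Lft lk) h) \<cdot>\<^bsub>CX\<^esub> Unit lk V) x"
    using lkD(5)[OF h] by simp
  then have "Cmp (AM (Lft lk) h) (OM f x) \<cdot> Cmp (Unit lk V) x = Cmp (Unit lk V') x \<cdot> Cmp h x"
    using x by (simp add: restr_sel(4)[OF LD(5)])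
  then show "Cmp (AM (Lft lk) h) y \<cdot> lc V d = lc V' d \<cdot> Cmp h (fst d)"
    by (simp add: dd lan_cocone_def reassoc[OF LD(7)[OF \<phi>]])
qed

lemma Rgt_cmp:
  assumes h: "h \<in> hom CX V V'" and y: "y \<in> Ob Y" and d: "d \<in> Ob (P y)"
  shows "AM (Rgt rk) h \<in> hom CY (Ro V) (Ro V')"
    "rc V' d \<cdot> Cmp (AM (Rgt rk) h) y = Cmp h (fst d) \<cdot> rc V d"
proof -
  note hD = hom_functor_catD[OF h]
  show L: "AM (Rgt rk) h \<in> hom CY (Ro V) (Ro V')" by (rule is_functorD(4)[OF rkD(2) h])
  note LD = hom_functor_catD[OF L]
  obtain x \<phi> where dd: "d = (x, \<phi>)" by (cases d)
  have x: "x \<in> Ob X" and \<phi>: "\<phi> \<in> hom Y (OM f x) y" using d dd by auto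
  note i = Y.inv_hom[OF \<phi>]
  note l1 = is_ranD[OF rk_ran[OF hD(1)]] and l2 = is_ranD[OF rk_ran[OF hD(2)]]
  note [simp] = homD[OF LD(6)[OF y]] homD[OF LD(6)[OF fs(3)[OF x]]] homD[OF is_functorD(4)[OF l1(2) i]]
    homD[OF is_functorD(4)[OF l2(2) i]] homD[OF l1(5)[OF x]] homD[OF l2(5)[OF x]] homD[OF hD(6)[OF x]]
  have "Cmp (Counit rk V' \<cdot>\<^bsub>CX\<^esub> AM rs (AM (Rgt rk) h)) x = Cmp (h \<cdot>\<^bsub>CX\<^esub> Counit rk V) x"
    using rkD(6)[OF h] by simp
  then have e: "Cmp (Counit rk V') x \<cdot> Cmp (AM (Rgt rk) h) (OM f x) = Cmp h x \<cdot> Cmp (Counit rk V) x"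
    using x by (simp add: restr_sel(4)[OF LD(5)])
  have "rc V' d \<cdot> Cmp (AM (Rgt rk) h) y = Cmp (Counit rk V') x \<cdot> (Cmp (AM (Rgt rk) h) (OM f x) \<cdot> AM (Ro V) (inv_ar Y \<phi>))"
    using LD(7)[OF i] by (simp add: dd ran_cone_def)
  also have "\<dots> = Cmp h x \<cdot> Cmp (Counit rk V) x \<cdot> AM (Ro V) (inv_ar Y \<phi>)"
    by (rule reassoc[OF e]) simp_all
  finally show "rc V' d \<cdot> Cmp (AM (Rgt rk) h) y = Cmp h (fst d) \<cdot> rc V d" by (simp add: dd ran_cone_def)
qed

lemma rs_tens: "\<lbrakk>is_functor Y C F; is_functor Y C G\<rbrakk> \<Longrightarrow> OM rs (F \<otimes>\<^bsub>CY\<^esub> G) = fct_comp X F f \<otimes>\<^bsub>CX\<^esub> fct_comp X G f"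
  by (simp add: restr_sel(1)[OF tens_functor] comp_tens[OF f])

text \<open>On the colimit over a homotopy fibre, the left projection map is the comparison with the tensor
  product of the colimit with \<open>W y\<close>, which is again a colimit.\<close>

lemma proj_left:
  assumes V: "is_functor X C V" and W: "is_functor Y C W"
  defines "\<mu> \<equiv> restr_mu C X Y f" and "T \<equiv> V \<otimes>\<^bsub>CX\<^esub> fct_comp X W f"
  shows "proj_left CY CX \<mu> lk V W \<in> hom CY (Lo T) (Lo V \<otimes>\<^bsub>CY\<^esub> W)"
    "\<lbrakk>y \<in> Ob Y; d \<in> Ob (P y)\<rbrakk> \<Longrightarrow> Cmp (proj_left CY CX \<mu> lk V W) y \<cdot> lc T d = lc V d \<boxtimes> AM W (snd d)"
    "y \<in> Ob Y \<Longrightarrow> is_iso C (Cmp (proj_left CY CX \<mu> lk V W) y)"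
proof -
  note L = is_lanD[OF lk_lan[OF V]]
  note Ls = is_functorD[OF L(2)] and Ws = is_functorD[OF W] and Vs = is_functorD[OF V]
  have fW: "is_functor X C (fct_comp X W f)" by (rule functor_comp[OF f W])
  have T: "is_functor X C T" unfolding T_def by (rule tens_functor[OF V fW])
  have M: "is_functor Y C (Lo V \<otimes>\<^bsub>CY\<^esub> W)" by (rule tens_functor[OF L(2) W])
  have rM: "OM rs (Lo V \<otimes>\<^bsub>CY\<^esub> W) = fct_comp X (Lo V) f \<otimes>\<^bsub>CX\<^esub> fct_comp X W f" by (rule rs_tens[OF L(2) W])
  define g where "g = Unit lk V \<boxtimes>\<^bsub>CX\<^esub> Ident CX (fct_comp X W f)"
  have g: "g \<in> hom CX T (OM rs (Lo V \<otimes>\<^bsub>CY\<^esub> W))"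
    unfolding g_def T_def rM by (rule tens_ntr[OF L(3) ident_ntr[OF fW]])
  let ?l = "proj_left CY CX \<mu> lk V W"
  note Lg = is_functorD(4)[OF lkD(1) g]
  have rsM: "OM rs (Lo V \<otimes>\<^bsub>CY\<^esub> W) \<in> Ob CX" using hom_functor_catD(2)[OF g] by simp
  have cou: "Counit lk (Lo V \<otimes>\<^bsub>CY\<^esub> W) \<in> hom CY (OM (Lft lk) (OM rs (Lo V \<otimes>\<^bsub>CY\<^esub> W))) (Lo V \<otimes>\<^bsub>CY\<^esub> W)"
    using lkD(4) M by simp
  have leq: "?l = Counit lk (Lo V \<otimes>\<^bsub>CY\<^esub> W) \<cdot>\<^bsub>CY\<^esub> AM (Lft lk) g"
    using CY.homD[OF cou] is_functorD(5)[OF lkD(1) rsM] is_functorD(3)[OF lkD(1) rsM]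
    by (simp add: proj_left_def \<mu>_def restr_mu_def g_def lk(2) restr_sel(1)[OF W])
  show lh: "?l \<in> hom CY (Lo T) (Lo V \<otimes>\<^bsub>CY\<^esub> W)" unfolding leq by (rule CY.comp_hom[OF Lg cou])
  note lD = hom_functor_catD[OF lh]
  have lu: "AM rs ?l \<cdot>\<^bsub>CX\<^esub> Unit lk T = g"
    using adjunction_transpose[OF lk(1) _ _ _, of T g "Lo V \<otimes>\<^bsub>CY\<^esub> W"] T g M by (simp add: leq lk(2))
  note LT = is_lanD[OF lk_lan[OF T]]
  have lx: "Cmp ?l (OM f x) \<cdot> Cmp (Unit lk T) x = Cmp (Unit lk V) x \<boxtimes> Ident C (OM W (OM f x))" if x: "x \<in> Ob X" for x
  proof -
    have "Cmp (AM rs ?l \<cdot>\<^bsub>CX\<^esub> Unit lk T) x = Cmp g x" by (simp add: lu)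
    then show ?thesis using x by (simp add: g_def restr_sel(4)[OF lD(5)])
  qed
  show lc: "Cmp ?l y \<cdot> lc T d = lc V d \<boxtimes> AM W (snd d)" if y: "y \<in> Ob Y" and d: "d \<in> Ob (P y)" for y d
  proof -
    obtain x \<phi> where dd: "d = (x, \<phi>)" by (cases d)
    have x: "x \<in> Ob X" and \<phi>: "\<phi> \<in> hom Y (OM f x) y" using d dd by auto
    note [simp] = homD[OF lD(6)[OF y]] homD[OF lD(6)[OF fs(3)[OF x]]] homD[OF is_functorD(4)[OF LT(2) \<phi>]]
      homD[OF is_functorD(4)[OF M \<phi>]] homD[OF LT(5)[OF x]] homD[OF L(5)[OF x]] homD[OF Ls(4)[OF \<phi>]] homD[OF Ws(4)[OF \<phi>]]
      Ws(3)[OF fs(3)[OF x]] fs(3)[OF x] y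
    show ?thesis using Y.homD[OF \<phi>]
      by (simp add: dd lan_cocone_def reassoc[OF lD(7)[OF \<phi>]] lx[OF x] interchange)
  qed
  show "is_iso C (Cmp ?l y)" if y: "y \<in> Ob Y"
  proof (rule colimit_comparison_iso[OF LT(4)[OF y] _ functor_diagram[OF pb_functor[OF T]]])
    note cl = L(4)[OF y]
    note dV = functor_diagram[OF pb_functor[OF V]]
    have Wy: "OM W y \<in> Ob C" by (rule Ws(3)[OF y])
    note lch = lc_hom[OF V y]
    have "is_colimit C (P y) (pb T y) (OM (Lo V) y \<otimes> OM W y)
        (\<lambda>d. (lc V d \<boxtimes> Ident C (OM W y)) \<cdot> (Ident C (OM V (fst d)) \<boxtimes> AM W (snd d)))"
    proof (rule colimit_iso_diagram[OF rtens_colimit[OF cl dV Wy] diagram_tens(2)[OF dV Wy] functor_diagram[OF pb_functor[OF T]]])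
      fix d assume d: "d \<in> Ob (P y)"
      note x = conjunct1[OF ob_PD[OF d]] and \<phi> = conjunct2[OF ob_PD[OF d]]
      note [simp] = homD[OF Ws(4)[OF \<phi>]] Vs(3)[OF x]
      show "Ident C (OM V (fst d)) \<boxtimes> AM W (snd d) \<in> hom C (OM (pb T y) d) (OM (rtens (pb V y) (OM W y)) d)"
        using d x by (simp add: hom_iff pb_sel T_def)
      have "is_iso C (AM W (snd d))"
        using functor_iso[OF W \<phi>] .
      then show "is_iso C (Ident C (OM V (fst d)) \<boxtimes> AM W (snd d))" by simp
    next
      fix s assume s: "s \<in> Ar (P y)"
      obtain a m b where ss: "s = (a, m, b)" by (metis surj_pair)
      have m: "m \<in> hom X (fst a) (fst b)" and ab: "a \<in> Ob (P y)" "b \<in> Ob (P y)" and e: "snd b \<cdot>\<^bsub>Y\<^esub> AM f m = snd a"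
        using s unfolding ss ar_P by auto
      note fm = fs(4)[OF m] and \<phi>b = conjunct2[OF ob_PD[OF ab(2)]] and \<phi>a = conjunct2[OF ob_PD[OF ab(1)]]
      note [simp] = homD[OF Ws(4)[OF fm]] homD[OF Ws(4)[OF \<phi>a]] homD[OF Ws(4)[OF \<phi>b]] homD[OF Vs(4)[OF m]] Wy
        Vs(3)[OF conjunct1[OF ob_PD[OF ab(1)]]] Vs(3)[OF conjunct1[OF ob_PD[OF ab(2)]]]
      show "(Ident C (OM V (fst (Cod (P y) s))) \<boxtimes> AM W (snd (Cod (P y) s))) \<cdot> AM (pb T y) s
         = AM (rtens (pb V y) (OM W y)) s \<cdot> (Ident C (OM V (fst (Dom (P y) s))) \<boxtimes> AM W (snd (Dom (P y) s)))"
        using s Ws(6)[OF fm \<phi>b] X.homD[OF m] by (simp add: ss pb_sel T_def interchange e)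
    qed
    then show "is_colimit C (P y) (pb T y) (OM (Lo V \<otimes>\<^bsub>CY\<^esub> W) y) (\<lambda>d. Cmp ?l y \<cdot> lc T d)"
    proof (rule colimit_iso_vertex[OF _ functor_diagram[OF pb_functor[OF T]], where u = "Ident C (OM (Lo V) y \<otimes> OM W y)"])
      have o[simp]: "OM (Lo V) y \<in> Ob C" "OM W y \<in> Ob C" using Ls(3)[OF y] Wy by auto
      show "Ident C (OM (Lo V) y \<otimes> OM W y) \<in> hom C (OM (Lo V) y \<otimes> OM W y) (OM (Lo V \<otimes>\<^bsub>CY\<^esub> W) y)"
        using y by (simp add: hom_iff)
      show "is_iso C (Ident C (OM (Lo V) y \<otimes> OM W y))" by simp
      fix d assume d: "d \<in> Ob (P y)"
      note x = conjunct1[OF ob_PD[OF d]] and \<phi> = conjunct2[OF ob_PD[OF d]]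
      note [simp] = homD[OF Ws(4)[OF \<phi>]] Vs(3)[OF x] homD[OF lch[OF d]]
      show "Cmp ?l y \<cdot> lc T d = Ident C (OM (Lo V) y \<otimes> OM W y) \<cdot> ((lc V d \<boxtimes> Ident C (OM W y)) \<cdot> (Ident C (OM V (fst d)) \<boxtimes> AM W (snd d)))"
        by (simp add: lc[OF y d] interchange)
    qed
    show "Cmp ?l y \<in> hom C (OM (Lo T) y) (OM (Lo V \<otimes>\<^bsub>CY\<^esub> W) y)" by (rule lD(6)[OF y])
  qed simp
qed

text \<open>Dually, tensoring with \<open>M y\<close> preserves the limit over the homotopy fibre.\<close>

lemma proj_right:
  assumes M: "is_functor Y C M" and Z: "is_functor X C Z"
  defines "\<mu> \<equiv> restr_mu C X Y f" and "T \<equiv> fct_comp X M f \<otimes>\<^bsub>CX\<^esub> Z"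
  shows "proj_right CY CX \<mu> rk M Z \<in> hom CY (M \<otimes>\<^bsub>CY\<^esub> Ro Z) (Ro T)"
    "\<lbrakk>y \<in> Ob Y; d \<in> Ob (P y)\<rbrakk> \<Longrightarrow> rc T d \<cdot> Cmp (proj_right CY CX \<mu> rk M Z) y = AM M (inv_ar Y (snd d)) \<boxtimes> rc Z d"
    "y \<in> Ob Y \<Longrightarrow> is_iso C (Cmp (proj_right CY CX \<mu> rk M Z) y)"
proof -
  note L = is_ranD[OF rk_ran[OF Z]]
  note Ls = is_functorD[OF L(2)] and Ms = is_functorD[OF M] and Zs = is_functorD[OF Z]
  have fM: "is_functor X C (fct_comp X M f)" by (rule functor_comp[OF f M])
  have T: "is_functor X C T" unfolding T_def by (rule tens_functor[OF fM Z])
  have N: "is_functor Y C (M \<otimes>\<^bsub>CY\<^esub> Ro Z)" by (rule tens_functor[OF M L(2)])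
  have rN: "OM rs (M \<otimes>\<^bsub>CY\<^esub> Ro Z) = fct_comp X M f \<otimes>\<^bsub>CX\<^esub> fct_comp X (Ro Z) f" by (rule rs_tens[OF M L(2)])
  define g where "g = Ident CX (fct_comp X M f) \<boxtimes>\<^bsub>CX\<^esub> Counit rk Z"
  have g: "g \<in> hom CX (OM rs (M \<otimes>\<^bsub>CY\<^esub> Ro Z)) T"
    unfolding g_def T_def rN by (rule tens_ntr[OF ident_ntr[OF fM] L(3)])
  let ?l = "proj_right CY CX \<mu> rk M Z"
  note Rg = is_functorD(4)[OF rkD(2) g]
  have rsN: "OM rs (M \<otimes>\<^bsub>CY\<^esub> Ro Z) \<in> Ob CX" using hom_functor_catD(1)[OF g] by simp
  have un: "Unit rk (M \<otimes>\<^bsub>CY\<^esub> Ro Z) \<in> hom CY (M \<otimes>\<^bsub>CY\<^esub> Ro Z) (OM (Rgt rk) (OM rs (M \<otimes>\<^bsub>CY\<^esub> Ro Z)))"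
    using rkD(3) N by simp
  have iI: "inv_ar CX (Ident CX F) = Ident CX F" if "F \<in> Ob CX" for F
    by (rule CX.is_isoI(2)[of _ F F]) (use that CX.ident_ar[OF that] in \<open>simp_all add: CX.hom_iff del: functor_cat_sel functor_cat_cmp\<close>)
  have leq: "?l = AM (Rgt rk) g \<cdot>\<^bsub>CY\<^esub> Unit rk (M \<otimes>\<^bsub>CY\<^esub> Ro Z)"
  proof -
    have "?l = AM (Rgt rk) g \<cdot>\<^bsub>CY\<^esub> Ident CY (OM (Rgt rk) (OM rs (M \<otimes>\<^bsub>CY\<^esub> Ro Z))) \<cdot>\<^bsub>CY\<^esub> Unit rk (M \<otimes>\<^bsub>CY\<^esub> Ro Z)"
      by (simp add: proj_right_def \<mu>_def restr_mu_def g_def rk(2) restr_sel(1)[OF M] iI[OF rsN] is_functorD(5)[OF rkD(2) rsN])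
    also have "\<dots> = AM (Rgt rk) g \<cdot>\<^bsub>CY\<^esub> Unit rk (M \<otimes>\<^bsub>CY\<^esub> Ro Z)"
      using CY.comp_ident_right[OF Rg] by simp
    finally show ?thesis .
  qed
  show lh: "?l \<in> hom CY (M \<otimes>\<^bsub>CY\<^esub> Ro Z) (Ro T)" unfolding leq by (rule CY.comp_hom[OF un Rg])
  note lD = hom_functor_catD[OF lh]
  have lu: "Counit rk T \<cdot>\<^bsub>CX\<^esub> AM rs ?l = g"
    using adjunction_cotranspose[OF rk(1) _ _ _, of "M \<otimes>\<^bsub>CY\<^esub> Ro Z" g T] T g N by (simp add: leq rk(2))
  note RT = is_ranD[OF rk_ran[OF T]]
  have lx: "Cmp (Counit rk T) x \<cdot> Cmp ?l (OM f x) = Ident C (OM M (OM f x)) \<boxtimes> Cmp (Counit rk Z) x" if x: "x \<in> Ob X" for x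
  proof -
    have "Cmp (Counit rk T \<cdot>\<^bsub>CX\<^esub> AM rs ?l) x = Cmp g x" by (simp add: lu)
    then show ?thesis using x by (simp add: g_def restr_sel(4)[OF lD(5)])
  qed
  show lc: "rc T d \<cdot> Cmp ?l y = AM M (inv_ar Y (snd d)) \<boxtimes> rc Z d" if y: "y \<in> Ob Y" and d: "d \<in> Ob (P y)" for y d
  proof -
    obtain x \<phi> where dd: "d = (x, \<phi>)" by (cases d)
    have x: "x \<in> Ob X" and \<phi>: "\<phi> \<in> hom Y (OM f x) y" using d dd by auto
    note i = Y.inv_hom[OF \<phi>]
    note [simp] = homD[OF lD(6)[OF y]] homD[OF lD(6)[OF fs(3)[OF x]]] homD[OF is_functorD(4)[OF RT(2) i]]
      homD[OF is_functorD(4)[OF N i]] homD[OF RT(5)[OF x]] homD[OF L(5)[OF x]] homD[OF Ls(4)[OF i]] homD[OF Ms(4)[OF i]]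
      Ms(3)[OF fs(3)[OF x]] fs(3)[OF x] y
    have "rc T d \<cdot> Cmp ?l y = Cmp (Counit rk T) x \<cdot> (Cmp ?l (OM f x) \<cdot> AM (M \<otimes>\<^bsub>CY\<^esub> Ro Z) (inv_ar Y \<phi>))"
      using lD(7)[OF i] by (simp add: dd ran_cone_def)
    also have "\<dots> = (Ident C (OM M (OM f x)) \<boxtimes> Cmp (Counit rk Z) x) \<cdot> AM (M \<otimes>\<^bsub>CY\<^esub> Ro Z) (inv_ar Y \<phi>)"
      by (rule reassoc[OF lx[OF x]]) simp_all
    also have "\<dots> = AM M (inv_ar Y (snd d)) \<boxtimes> rc Z d"
      using Y.homD[OF i] by (simp add: dd ran_cone_def interchange)
    finally show ?thesis .
  qed
  show "is_iso C (Cmp ?l y)" if y: "y \<in> Ob Y"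
  proof (rule limit_comparison_iso[OF RT(4)[OF y] _ functor_diagram[OF pb_functor[OF T]]])
    note cl = L(4)[OF y]
    note dZ = functor_diagram[OF pb_functor[OF Z]]
    have My: "OM M y \<in> Ob C" by (rule Ms(3)[OF y])
    note rch = rc_hom[OF Z y]
    have "is_limit C (P y) (pb T y) (OM M y \<otimes> OM (Ro Z) y)
        (\<lambda>d. (AM M (inv_ar Y (snd d)) \<boxtimes> Ident C (OM Z (fst d))) \<cdot> (Ident C (OM M y) \<boxtimes> rc Z d))"
    proof (rule limit_iso_diagram[OF ltens_limit[OF cl dZ My] diagram_tens(1)[OF dZ My] functor_diagram[OF pb_functor[OF T]]])
      fix d assume d: "d \<in> Ob (P y)"
      note x = conjunct1[OF ob_PD[OF d]] and \<phi> = conjunct2[OF ob_PD[OF d]]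
      note i = Y.inv_hom[OF \<phi>]
      note [simp] = homD[OF Ms(4)[OF i]] Zs(3)[OF x]
      show "AM M (inv_ar Y (snd d)) \<boxtimes> Ident C (OM Z (fst d)) \<in> hom C (OM (ltens (OM M y) (pb Z y)) d) (OM (pb T y) d)"
        using d x by (simp add: hom_iff pb_sel T_def)
      have "is_iso C (AM M (inv_ar Y (snd d)))"
        using functor_iso[OF M i] .
      then show "is_iso C (AM M (inv_ar Y (snd d)) \<boxtimes> Ident C (OM Z (fst d)))" by simp
    next
      fix s assume s: "s \<in> Ar (P y)"
      obtain a m b where ss: "s = (a, m, b)" by (metis surj_pair)
      have m: "m \<in> hom X (fst a) (fst b)" and ab: "a \<in> Ob (P y)" "b \<in> Ob (P y)" and e: "snd b \<cdot>\<^bsub>Y\<^esub> AM f m = snd a"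
        using s unfolding ss ar_P by auto
      note fm = fs(4)[OF m] and \<phi>b = conjunct2[OF ob_PD[OF ab(2)]] and \<phi>a = conjunct2[OF ob_PD[OF ab(1)]]
      note ia = Y.inv_hom[OF \<phi>a] and ib = Y.inv_hom[OF \<phi>b]
      have e': "AM f m \<cdot>\<^bsub>Y\<^esub> inv_ar Y (snd a) = inv_ar Y (snd b)"
        by (rule inv_fibre[OF m \<phi>a \<phi>b e])
      note [simp] = homD[OF Ms(4)[OF fm]] homD[OF Ms(4)[OF ia]] homD[OF Ms(4)[OF ib]] homD[OF Zs(4)[OF m]] My
        Zs(3)[OF conjunct1[OF ob_PD[OF ab(1)]]] Zs(3)[OF conjunct1[OF ob_PD[OF ab(2)]]]
      show "(AM M (inv_ar Y (snd (Cod (P y) s))) \<boxtimes> Ident C (OM Z (fst (Cod (P y) s)))) \<cdot> AM (ltens (OM M y) (pb Z y)) s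
         = AM (pb T y) s \<cdot> (AM M (inv_ar Y (snd (Dom (P y) s))) \<boxtimes> Ident C (OM Z (fst (Dom (P y) s))))"
        using s Ms(6)[OF ia fm] X.homD[OF m] by (simp add: ss pb_sel T_def interchange e')
    qed
    then show "is_limit C (P y) (pb T y) (OM (M \<otimes>\<^bsub>CY\<^esub> Ro Z) y) (\<lambda>d. rc T d \<cdot> Cmp ?l y)"
    proof (rule limit_iso_vertex[OF _ functor_diagram[OF pb_functor[OF T]], where u = "Ident C (OM M y \<otimes> OM (Ro Z) y)"])
      have o[simp]: "OM (Ro Z) y \<in> Ob C" "OM M y \<in> Ob C" using Ls(3)[OF y] My by auto
      show "Ident C (OM M y \<otimes> OM (Ro Z) y) \<in> hom C (OM (M \<otimes>\<^bsub>CY\<^esub> Ro Z) y) (OM M y \<otimes> OM (Ro Z) y)"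
        using y by (simp add: hom_iff)
      show "is_iso C (Ident C (OM M y \<otimes> OM (Ro Z) y))" by simp
      fix d assume d: "d \<in> Ob (P y)"
      note x = conjunct1[OF ob_PD[OF d]] and \<phi> = conjunct2[OF ob_PD[OF d]]
      note i = Y.inv_hom[OF \<phi>]
      note [simp] = homD[OF Ms(4)[OF i]] Zs(3)[OF x] homD[OF rch[OF d]]
      show "rc T d \<cdot> Cmp ?l y = (AM M (inv_ar Y (snd d)) \<boxtimes> Ident C (OM Z (fst d))) \<cdot> (Ident C (OM M y) \<boxtimes> rc Z d) \<cdot> Ident C (OM M y \<otimes> OM (Ro Z) y)"
        by (simp add: lc[OF y d] interchange)
    qed
    show "Cmp ?l y \<in> hom C (OM (M \<otimes>\<^bsub>CY\<^esub> Ro Z) y) (OM (Ro T) y)" by (rule lD(6)[OF y])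
  qed simp
qed

text \<open>The pre-Nakayama map factors as \<open>\<tau> \<cdot> e\<close> through \<open>f\<^sub>! V \<otimes> f\<^sub>* 1\<close>, where \<open>e\<close> ends with the inverse of the right
  projection map and \<open>\<tau>\<close> starts with the inverse of the left one. The formulas for the projection maps on
  cones and cocones say that \<open>e\<close> and \<open>\<tau>\<close> satisfy the hypotheses of \<open>component_sum_eq\<close>.\<close>

lemma gamma:
  assumes V: "is_functor X C V"
  shows "gamma C X Y f V \<in> hom CY (Ro V) (Lo V)"
    "y \<in> Ob Y \<Longrightarrow> Cmp (gamma C X Y f V) y = Sm (R y) (OM (Ro V) y) (OM (Lo V) y) (\<lambda>c. lc V c \<cdot> rc V c)"
proof -
  have o: "is_functor X C oneX" by (rule one_functor[OF X.category_axioms])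
  note L = is_lanD[OF lk_lan[OF V]] and Rn = is_ranD[OF rk_ran[OF V]] and B = is_ranD[OF rk_ran[OF o]]
  let ?M = "Lo V" and ?B = "Ro oneX" and ?\<mu> = "restr_mu C X Y f"
  let ?fM = "fct_comp X ?M f" and ?fB = "fct_comp X ?B f"
  have fM: "is_functor X C ?fM" by (rule functor_comp[OF f L(2)])
  define l where "l = proj_left CY CX ?\<mu> lk V ?B"
  define r where "r = proj_right CY CX ?\<mu> rk ?M oneX"
  note pl = proj_left[OF V B(2), folded l_def]
  note pr = proj_right[OF L(2) o, folded r_def]
  define h1 where "h1 = Ident CX V \<boxtimes>\<^bsub>CX\<^esub> Counit rk oneX"
  define h2 where "h2 = Unit lk V \<boxtimes>\<^bsub>CX\<^esub> Ident CX oneX"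
  define r1 where "r1 = runit CX V"
  have Vs: "x \<in> Ob X \<Longrightarrow> OM V x \<in> Ob C" for x by (rule is_functorD(3)[OF V])
  have h1: "h1 \<in> hom CX (V \<otimes>\<^bsub>CX\<^esub> ?fB) (V \<otimes>\<^bsub>CX\<^esub> oneX)" unfolding h1_def by (rule tens_ntr[OF ident_ntr[OF V] B(3)])
  have h2: "h2 \<in> hom CX (V \<otimes>\<^bsub>CX\<^esub> oneX) (?fM \<otimes>\<^bsub>CX\<^esub> oneX)" unfolding h2_def by (rule tens_ntr[OF L(3) ident_ntr[OF o]])
  have r1: "r1 \<in> hom CX (V \<otimes>\<^bsub>CX\<^esub> oneX) V" unfolding r1_def by (rule runit_ntr[OF V])
  have r1x: "x \<in> Ob X \<Longrightarrow> Cmp r1 x = runit C (OM V x)" for x by (simp add: r1_def)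
  have r1i: "inv_ar CX r1 \<in> hom CX V (V \<otimes>\<^bsub>CX\<^esub> oneX)" and r1ix: "x \<in> Ob X \<Longrightarrow> Cmp (inv_ar CX r1) x = inv_ar C (runit C (OM V x))" for x
    using ntr_iso[OF r1] r1x Vs by auto
  have li: "inv_ar CY l \<in> hom CY (?M \<otimes>\<^bsub>CY\<^esub> ?B) (Lo (V \<otimes>\<^bsub>CX\<^esub> ?fB))"
      "x \<in> Ob Y \<Longrightarrow> Cmp (inv_ar CY l) x = inv_ar C (Cmp l x)" for x
    using ntr_iso[OF pl(1)] pl(3) by auto
  have ri: "inv_ar CY r \<in> hom CY (Ro (?fM \<otimes>\<^bsub>CX\<^esub> oneX)) (?M \<otimes>\<^bsub>CY\<^esub> ?B)"
      "x \<in> Ob Y \<Longrightarrow> Cmp (inv_ar CY r) x = inv_ar C (Cmp r x)" for x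
    using ntr_iso[OF pr(1)] pr(3) by auto
  note g1 = is_functorD(4)[OF lkD(1) r1] and g2 = is_functorD(4)[OF lkD(1) h1]
    and g5 = is_functorD(4)[OF rkD(2) h2] and g6 = is_functorD(4)[OF rkD(2) r1i]
  define \<tau> where "\<tau> = AM (Lft lk) r1 \<cdot>\<^bsub>CY\<^esub> (AM (Lft lk) h1 \<cdot>\<^bsub>CY\<^esub> inv_ar CY l)"
  define e where "e = inv_ar CY r \<cdot>\<^bsub>CY\<^esub> (AM (Rgt rk) h2 \<cdot>\<^bsub>CY\<^esub> AM (Rgt rk) (inv_ar CX r1))"
  have \<tau>: "\<tau> \<in> hom CY (?M \<otimes>\<^bsub>CY\<^esub> ?B) ?M" unfolding \<tau>_def by (rule CY.comp_hom[OF CY.comp_hom[OF li(1) g2] g1])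
  have e: "e \<in> hom CY (Ro V) (?M \<otimes>\<^bsub>CY\<^esub> ?B)" unfolding e_def by (rule CY.comp_hom[OF CY.comp_hom[OF g6 g5] ri(1)])
  have ge: "gamma C X Y f V = \<tau> \<cdot>\<^bsub>CY\<^esub> e"
  proof -
    have "gamma C X Y f V = AM (Lft lk) r1 \<cdot>\<^bsub>CY\<^esub> AM (Lft lk) h1 \<cdot>\<^bsub>CY\<^esub> inv_ar CY l \<cdot>\<^bsub>CY\<^esub> inv_ar CY r
      \<cdot>\<^bsub>CY\<^esub> AM (Rgt rk) h2 \<cdot>\<^bsub>CY\<^esub> AM (Rgt rk) (inv_ar CX r1)"
      by (simp only: gamma_def pre_nakayama_def l_def r_def h1_def h2_def r1_def)
    also have "\<dots> = \<tau> \<cdot>\<^bsub>CY\<^esub> e"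
      unfolding \<tau>_def e_def
      using CY.homD[OF g1] CY.homD[OF g2] CY.homD[OF li(1)] CY.homD[OF ri(1)] CY.homD[OF g5] CY.homD[OF g6]
      by (simp del: functor_cat_sel functor_cat_cmp)
    finally show ?thesis .
  qed
  show gh: "gamma C X Y f V \<in> hom CY (Ro V) (Lo V)" unfolding ge by (rule CY.comp_hom[OF e \<tau>])
  assume y: "y \<in> Ob Y"
  interpret G: groupoid_diagrams C U "P y" "R y" by (rule fibre_diagrams[OF y])
  note \<tau>D = hom_functor_catD[OF \<tau>] and eD = hom_functor_catD[OF e]
  have Ms: "OM ?M y \<in> Ob C" and Bs: "OM ?B y \<in> Ob C" using is_functorD(3)[OF L(2) y] is_functorD(3)[OF B(2) y] by auto
  have \<tau>y: "Cmp \<tau> y \<in> hom C (OM ?M y \<otimes> OM ?B y) (OM ?M y)" using \<tau>D(6)[OF y] y by simp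
  have ey: "Cmp e y \<in> hom C (OM (Ro V) y) (OM ?M y \<otimes> OM ?B y)" using eD(6)[OF y] y by simp
  have b: "is_limit C (P y) (cst C \<one>) (OM ?B y) (rc oneX)"
  proof -
    have "OM (pb oneX y) j = OM (cst C \<one> :: (_, _, 'o, 'a) fct) j" if "j \<in> Ob (P y)" for j
      using that ob_PD[OF that] by (simp add: pb_sel)
    moreover have "AM (pb oneX y) s = AM (cst C \<one> :: (_, _, 'o, 'a) fct) s" if s: "s \<in> Ar (P y)" for s
    proof -
      obtain a m b where ss: "s = (a, m, b)" by (metis surj_pair)
      then have "m \<in> Ar X" using s X.homD[of m] unfolding ss ar_P by auto
      then show ?thesis using s by (simp add: ss pb_sel)
    qed
    ultimately show ?thesis
      using is_limit_cong[of "P y" "pb oneX y" "cst C \<one>" "rc oneX" "rc oneX" C] B(4)[OF y] G.P.dom_cod_ob by simp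
  qed
  have "Cmp \<tau> y \<cdot> Cmp e y = Sm (R y) (OM (Ro V) y) (OM ?M y) (\<lambda>c. lc V c \<cdot> rc V c)"
  proof (rule G.component_sum_eq[OF pb_functor[OF V] L(4)[OF y] Rn(4)[OF y] b ey _ \<tau>y])
    fix d assume d: "d \<in> Ob (P y)"
    note x = conjunct1[OF ob_PD[OF d]] and \<phi> = conjunct2[OF ob_PD[OF d]]
    note i = Y.inv_hom[OF \<phi>] and y' = fs(3)[OF x]
    note lcV = lc_hom[OF V y d] and rcV = rc_hom[OF V y d]
    have rc1: "rc oneX d \<in> hom C (OM ?B y) \<one>" using rc_hom[OF o y d] x by simp
    note Bi = is_functorD(4)[OF B(2) i] and B\<phi> = is_functorD(4)[OF B(2) \<phi>]
    note Mi = is_functorD(4)[OF L(2) i] and M\<phi> = is_functorD(4)[OF L(2) \<phi>]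
    have Mii: "AM ?M (snd d) \<cdot> AM ?M (inv_ar Y (snd d)) = Ident C (OM ?M y)"
      using is_functorD(6)[OF L(2) i \<phi>] Y.inv_comp(2)[OF \<phi>] is_functorD(5)[OF L(2) y] by simp
    have Bii: "AM ?B (snd d) \<cdot> AM ?B (inv_ar Y (snd d)) = Ident C (OM ?B y)"
      using is_functorD(6)[OF B(2) i \<phi>] Y.inv_comp(2)[OF \<phi>] is_functorD(5)[OF B(2) y] by simp
    note unx = L(5)[OF x]
    note cox = B(5)[OF x]
    have lcd: "lc V d = AM ?M (snd d) \<cdot> Cmp (Unit lk V) (fst d)" by (simp add: lan_cocone_def split_beta)
    have rcd: "rc oneX d = Cmp (Counit rk oneX) (fst d) \<cdot> AM ?B (inv_ar Y (snd d))" by (simp add: ran_cone_def split_beta)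
    define T1 where "T1 = V \<otimes>\<^bsub>CX\<^esub> ?fB"
    define T2 where "T2 = ?fM \<otimes>\<^bsub>CX\<^esub> oneX"
    have T1: "is_functor X C T1" and T2: "is_functor X C T2" and T3: "is_functor X C (V \<otimes>\<^bsub>CX\<^esub> oneX)"
      using hom_functor_catD[OF h1] hom_functor_catD[OF h2] by (auto simp: T1_def T2_def)
    note lct = lc_hom[OF T1 y d] and rct = rc_hom[OF T2 y d]
    have ct: "Cmp (Counit rk oneX) (fst d) \<in> hom C (OM ?B (OM f (fst d))) \<one>" using cox x by simp
    have T1o: "OM T1 (fst d) = OM V (fst d) \<otimes> OM ?B (OM f (fst d))" using x by (simp add: T1_def)
    have T2o: "OM T2 (fst d) = OM ?M (OM f (fst d)) \<otimes> \<one>" using x by (simp add: T2_def)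
    note ly = hom_functor_catD(6)[OF pl(1) y] and ry = hom_functor_catD(6)[OF pr(1) y]
    have lyd: "Cmp l y \<in> hom C (OM (Lo T1) y) (OM ?M y \<otimes> OM ?B y)" using ly y by (simp add: T1_def)
    have ryd: "Cmp r y \<in> hom C (OM ?M y \<otimes> OM ?B y) (OM (Ro T2) y)" using ry y by (simp add: T2_def)
    note g1y = hom_functor_catD(6)[OF g1 y] and g2y = hom_functor_catD(6)[OF g2 y, folded T1_def]
      and g5y = hom_functor_catD(6)[OF g5 y, folded T2_def] and g6y = hom_functor_catD(6)[OF g6 y]
    note lc3 = lc_hom[OF T3 y d] and rc3 = rc_hom[OF T3 y d]
    note [simp] = Ms Bs y Vs[OF x] x homD[OF lcV] homD[OF rcV] homD[OF rc1] homD[OF Bi] homD[OF B\<phi>] homD[OF Mi] homD[OF M\<phi>]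
      homD[OF unx] homD[OF ct] homD[OF lct] homD[OF rct] homD[OF lyd] homD[OF ryd] homD[OF g1y] homD[OF g2y] homD[OF g5y] homD[OF g6y]
      homD[OF lc3] homD[OF rc3] T1o T2o pl(3)[OF y] pr(3)[OF y]
      is_functorD(3)[OF L(2) y'] is_functorD(3)[OF B(2) y']
    have h1x: "Cmp h1 (fst d) = Ident C (OM V (fst d)) \<boxtimes> Cmp (Counit rk oneX) (fst d)" by (simp add: h1_def)
    have h2x: "Cmp h2 (fst d) = Cmp (Unit lk V) (fst d) \<boxtimes> Ident C \<one>" by (simp add: h2_def)
    show "(Ident C (OM ?M y) \<boxtimes> rc oneX d) \<cdot> Cmp e y = inv_ar C (runit C (OM ?M y)) \<cdot> (lc V d \<cdot> rc V d)"
    proof -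
      have re: "Cmp r y \<cdot> Cmp e y = Cmp (AM (Rgt rk) h2) y \<cdot> Cmp (AM (Rgt rk) (inv_ar CX r1)) y"
        by (simp add: e_def ri(2)[OF y])
      have R1: "rc T2 d \<cdot> Cmp (AM (Rgt rk) h2) y = Cmp h2 (fst d) \<cdot> rc (V \<otimes>\<^bsub>CX\<^esub> oneX) d"
        using Rgt_cmp(2)[OF h2 y d] by (simp add: T2_def)
      have R2: "rc (V \<otimes>\<^bsub>CX\<^esub> oneX) d \<cdot> Cmp (AM (Rgt rk) (inv_ar CX r1)) y = inv_ar C (runit C (OM V (fst d))) \<cdot> rc V d"
        using Rgt_cmp(2)[OF r1i y d] by (simp add: r1ix)
      have R3: "rc T2 d \<cdot> Cmp r y = AM ?M (inv_ar Y (snd d)) \<boxtimes> rc oneX d"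
        using pr(2)[OF y d] by (simp add: T2_def)
      note eyh = homD[OF ey]
      have "(AM ?M (inv_ar Y (snd d)) \<boxtimes> rc oneX d) \<cdot> Cmp e y = rc T2 d \<cdot> (Cmp r y \<cdot> Cmp e y)"
        using eyh by (simp add: reassoc[OF R3])
      also have "\<dots> = Cmp h2 (fst d) \<cdot> (inv_ar C (runit C (OM V (fst d))) \<cdot> rc V d)"
        unfolding re using R2 by (simp add: reassoc[OF R1] h2x)
      finally have "(AM ?M (snd d) \<boxtimes> Ident C \<one>) \<cdot> ((AM ?M (inv_ar Y (snd d)) \<boxtimes> rc oneX d) \<cdot> Cmp e y)
         = (AM ?M (snd d) \<boxtimes> Ident C \<one>) \<cdot> (Cmp h2 (fst d) \<cdot> (inv_ar C (runit C (OM V (fst d))) \<cdot> rc V d))" by simp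
      then have "(Ident C (OM ?M y) \<boxtimes> rc oneX d) \<cdot> Cmp e y = (lc V d \<boxtimes> Ident C \<one>) \<cdot> (inv_ar C (runit C (OM V (fst d))) \<cdot> rc V d)"
        using eyh by (simp add: interchange_assoc Mii h2x lcd)
      also have "\<dots> = inv_ar C (runit C (OM ?M y)) \<cdot> (lc V d \<cdot> rc V d)"
        using reassoc[OF runit_inv_nat_ar[of "lc V d" "OM ?M y"], of "rc V d"] by simp
      finally show ?thesis .
    qed
    show "Cmp \<tau> y \<cdot> (lc V d \<boxtimes> Ident C (OM ?B y)) = lc V d \<cdot> (runit C (OM (pb V y) d) \<cdot> (Ident C (OM (pb V y) d) \<boxtimes> rc oneX d))"
    proof -
      have L1: "Cmp (AM (Lft lk) h1) y \<cdot> lc T1 d = lc (V \<otimes>\<^bsub>CX\<^esub> oneX) d \<cdot> Cmp h1 (fst d)"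
        using Lft_cmp(2)[OF h1 y d] by (simp add: T1_def)
      have L2: "Cmp (AM (Lft lk) r1) y \<cdot> lc (V \<otimes>\<^bsub>CX\<^esub> oneX) d = lc V d \<cdot> runit C (OM V (fst d))"
        using Lft_cmp(2)[OF r1 y d] by (simp add: r1x)
      have L3: "Cmp l y \<cdot> lc T1 d = lc V d \<boxtimes> AM ?B (snd d)" using pl(2)[OF y d] by (simp add: T1_def)
      have "lc V d \<boxtimes> Ident C (OM ?B y) = Cmp l y \<cdot> lc T1 d \<cdot> (Ident C (OM V (fst d)) \<boxtimes> AM ?B (inv_ar Y (snd d)))"
        unfolding L3 by (simp add: interchange Bii)
      then have "inv_ar C (Cmp l y) \<cdot> (lc V d \<boxtimes> Ident C (OM ?B y)) = lc T1 d \<cdot> (Ident C (OM V (fst d)) \<boxtimes> AM ?B (inv_ar Y (snd d)))"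
        by simp
      then have "Cmp \<tau> y \<cdot> (lc V d \<boxtimes> Ident C (OM ?B y))
        = Cmp (AM (Lft lk) r1) y \<cdot> (Cmp (AM (Lft lk) h1) y \<cdot> (lc T1 d \<cdot> (Ident C (OM V (fst d)) \<boxtimes> AM ?B (inv_ar Y (snd d)))))"
        by (simp add: \<tau>_def li(2)[OF y])
      also have "\<dots> = Cmp (AM (Lft lk) r1) y \<cdot> (lc (V \<otimes>\<^bsub>CX\<^esub> oneX) d \<cdot> (Cmp h1 (fst d) \<cdot> (Ident C (OM V (fst d)) \<boxtimes> AM ?B (inv_ar Y (snd d)))))"
        by (simp add: reassoc[OF L1] h1x)
      also have "\<dots> = lc V d \<cdot> (runit C (OM V (fst d)) \<cdot> (Ident C (OM V (fst d)) \<boxtimes> rc oneX d))"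
        by (simp add: reassoc[OF L2] h1x interchange rcd)
      finally show ?thesis using d by (simp add: pb_sel)
    qed
  qed
  then show "Cmp (gamma C X Y f V) y = Sm (R y) (OM (Ro V) y) (OM (Lo V) y) (\<lambda>c. lc V c \<cdot> rc V c)"
    using y by (simp add: ge)
qed

lemma gamma_iso:
  assumes V: "is_functor X C V" and y: "y \<in> Ob Y"
  shows "is_iso C (Cmp (gamma C X Y f V) y)"
proof -
  interpret G: groupoid_diagrams C U "P y" "R y" by (rule fibre_diagrams[OF y])
  show ?thesis unfolding gamma(2)[OF V y]
    by (rule G.component_sum_iso[OF _ pb_functor[OF V] is_lanD(4)[OF lk_lan[OF V] y] is_ranD(4)[OF rk_ran[OF V] y]])
      (use orders_iso y in blast)
qed

end


section \<open>Colimits over groupoids of other types\<close>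

context fin_cocomplete_rigid
begin

text \<open>A copy of \<open>J\<close> inside the universe \<open>'u\<close> is built from the embeddings \<open>a\<close> and \<open>b\<close>.\<close>

lemma colimit_transport:
  fixes J :: "('j, 'k, 'e2) cat_scheme" and a :: "'j \<Rightarrow> 'u" and b :: "'k \<Rightarrow> 'u"
  assumes J: "ess_finite_groupoid J" and F: "is_functor J C F"
    and a: "inj_on a (Ob J)" and b: "inj_on b (Ar J)"
  shows "\<exists>v \<kappa>. is_colimit C J F v \<kappa>"
proof -
  obtain R where R: "finite_groupoid J R" using ess_finite_reps[OF J] .
  interpret J: finite_groupoid J R by (rule R)
  define a' where "a' = the_inv_into (Ob J) a"
  define b' where "b' = the_inv_into (Ar J) b"
  have aa [simp]: "x \<in> Ob J \<Longrightarrow> a' (a x) = x" for x unfolding a'_def by (rule the_inv_into_f_f[OF a])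
  have bb [simp]: "m \<in> Ar J \<Longrightarrow> b' (b m) = m" for m unfolding b'_def by (rule the_inv_into_f_f[OF b])
  define J' :: "('u, 'u) cat" where
    "J' = \<lparr>Ob = a ` Ob J, Ar = b ` Ar J, Dom = (\<lambda>m. a (Dom J (b' m))), Cod = (\<lambda>m. a (Cod J (b' m))),
      Ident = (\<lambda>x. b (Ident J (a' x))), Comp = (\<lambda>n m. b (b' n \<cdot>\<^bsub>J\<^esub> b' m))\<rparr>"
  have sel: "Ob J' = a ` Ob J" "Ar J' = b ` Ar J" "m \<in> Ar J \<Longrightarrow> Dom J' (b m) = a (Dom J m)"
    "m \<in> Ar J \<Longrightarrow> Cod J' (b m) = a (Cod J m)" "x \<in> Ob J \<Longrightarrow> Ident J' (a x) = b (Ident J x)"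
    "\<lbrakk>m \<in> Ar J; n \<in> Ar J\<rbrakk> \<Longrightarrow> b n \<cdot>\<^bsub>J'\<^esub> b m = b (n \<cdot>\<^bsub>J\<^esub> m)" for m n x
    by (simp_all add: J'_def)
  have hom': "hom J' (a x) (a y) = b ` hom J x y" if "x \<in> Ob J" "y \<in> Ob J" for x y
    using that inj_on_eq_iff[OF a] by (auto simp: hom_def sel)
  have hom_ex: "\<exists>x y m. A = a x \<and> B = a y \<and> g = b m \<and> m \<in> hom J x y" if "g \<in> hom J' A B" for g A B
  proof -
    from that obtain m where m: "m \<in> Ar J" "g = b m" by (auto simp: hom_def sel)
    then show ?thesis
      using that by (intro exI[of _ "Dom J m"] exI[of _ "Cod J m"] exI[of _ m]) (simp add: hom_def sel)
  qed
  have cat: "category J'"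
  proof
    fix g h k A B D E
    show "g \<in> Ar J' \<Longrightarrow> Dom J' g \<in> Ob J'" "g \<in> Ar J' \<Longrightarrow> Cod J' g \<in> Ob J'" by (auto simp: sel)
    show "A \<in> Ob J' \<Longrightarrow> Ident J' A \<in> hom J' A A" using J.ident_hom by (auto simp: sel hom')
    assume "g \<in> hom J' A B"
    from hom_ex[OF this] obtain x y m where m: "A = a x" "B = a y" "g = b m" "m \<in> hom J x y" by blast
    note [simp] = J.homD[OF m(4)] J.hom_ob[OF m(4)]
    show "g \<cdot>\<^bsub>J'\<^esub> Ident J' A = g" "Ident J' B \<cdot>\<^bsub>J'\<^esub> g = g" by (simp_all add: m sel)
    assume "h \<in> hom J' B D"
    from hom_ex[OF this] obtain y' z n where n: "B = a y'" "D = a z" "h = b n" "n \<in> hom J y' z" by blast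
    have [simp]: "y' = y" using inj_onD[OF a, of y' y] n(1) m(2) J.hom_ob[OF m(4)] J.hom_ob[OF n(4)] by simp
    note [simp] = J.homD[OF n(4)] J.hom_ob[OF n(4)]
    show "h \<cdot>\<^bsub>J'\<^esub> g \<in> hom J' A D"
      using J.comp_hom[OF m(4), of n z] n(4) by (simp add: m n sel hom' del: J.comp_ar)
    assume "k \<in> hom J' D E"
    from hom_ex[OF this] obtain z' w l where l: "D = a z'" "E = a w" "k = b l" "l \<in> hom J z' w" by blast
    have [simp]: "z' = z" using inj_onD[OF a, of z' z] l(1) n(2) J.hom_ob[OF n(4)] J.hom_ob[OF l(4)] by simp
    note [simp] = J.homD[OF l(4)] J.hom_ob[OF l(4)]
    show "k \<cdot>\<^bsub>J'\<^esub> h \<cdot>\<^bsub>J'\<^esub> g = k \<cdot>\<^bsub>J'\<^esub> (h \<cdot>\<^bsub>J'\<^esub> g)"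
      by (simp add: m n l sel)
  qed
  interpret J': category J' by (rule cat)
  have gr: "groupoid J'"
  proof
    fix g assume "g \<in> Ar J'"
    then obtain m where m: "m \<in> Ar J" "g = b m" by (auto simp: sel)
    note mh = J.ar_hom[OF m(1)]
    note i = J.inv_hom[OF mh]
    note [simp] = m(1) J.homD[OF i]
    show "is_iso J' g"
    proof (rule J'.is_isoI(1)[of _ "a (Dom J m)" "a (Cod J m)" "b (inv_ar J m)"])
      show "g \<in> hom J' (a (Dom J m)) (a (Cod J m))" using mh by (simp add: m(2) hom')
      show "b (inv_ar J m) \<in> hom J' (a (Cod J m)) (a (Dom J m))" using i by (simp add: hom')
    qed (simp_all add: m(2) sel J.inv_comp[OF mh])
  qed
  have "ess_finite_groupoid J'"
  proof (rule ess_finiteI[OF gr])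
    show "finite (hom J' c d)" if "c \<in> Ob J'" "d \<in> Ob J'" for c d
      using that J.fin_hom by (auto simp: sel hom')
    show "finite (a ` R)" using J.fin_reps by simp
    show "a ` R \<subseteq> Ob J'" using J.reps_ob by (auto simp: sel)
    fix c assume "c \<in> Ob J'"
    then obtain x where x: "x \<in> Ob J" "c = a x" by (auto simp: sel)
    have "hom J x (J.rep x) \<noteq> {}" using J.rep(3)[OF x(1)] J.connected_sym by blast
    then show "\<exists>r \<in> a ` R. hom J' c r \<noteq> {}"
      using J.rep(1,2)[OF x(1)] x by (intro bexI[of _ "a (J.rep x)"]) (simp_all add: hom')
  qed
  moreover define F' :: "('u, 'u, 'o, 'a) fct" where
    "F' = \<lparr>OM = (\<lambda>x \<in> Ob J'. OM F (a' x)), AM = (\<lambda>m \<in> Ar J'. AM F (b' m))\<rparr>"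
  have F'O: "OM F' (a x) = OM F x" if "x \<in> Ob J" for x using that by (simp add: F'_def sel)
  have F'A: "AM F' (b m) = AM F m" if "m \<in> Ar J" for m using that by (simp add: F'_def sel)
  note Fs = is_functorD[OF F]
  have "is_functor J' C F'"
  proof (rule is_functorI[OF cat category_axioms])
    show "OM F' x \<in> Ob C" if "x \<in> Ob J'" for x using that Fs(3) by (auto simp: sel F'O)
    show "AM F' g \<in> hom C (OM F' A) (OM F' B)" if g: "g \<in> hom J' A B" for g A B
    proof -
      from hom_ex[OF g] obtain x y m where m: "A = a x" "B = a y" "g = b m" "m \<in> hom J x y" by blast
      show ?thesis using Fs(4)[OF m(4)] J.homD[OF m(4)] J.hom_ob[OF m(4)] by (simp add: m F'A F'O)
    qed
    show "AM F' (Ident J' x) = Ident C (OM F' x)" if "x \<in> Ob J'" for x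
      using that Fs(5) by (auto simp: sel F'A F'O)
    show "AM F' (h \<cdot>\<^bsub>J'\<^esub> g) = AM F' h \<cdot> AM F' g" if g: "g \<in> hom J' A B" and h: "h \<in> hom J' B D" for g h A B D
    proof -
      from hom_ex[OF g] obtain x y m where m: "A = a x" "B = a y" "g = b m" "m \<in> hom J x y" by blast
      from hom_ex[OF h] obtain y' z n where n: "B = a y'" "D = a z" "h = b n" "n \<in> hom J y' z" by blast
      have yy: "y' = y" using inj_onD[OF a, of y' y] n(1) m(2) J.hom_ob[OF m(4)] J.hom_ob[OF n(4)] by simp
      have n': "n \<in> hom J y z" using n(4) yy by simp
      show ?thesis using Fs(6)[OF m(4) n'] J.homD[OF m(4)] J.homD[OF n'] by (simp add: m n sel F'A)
    qed
  qed (simp_all add: F'_def)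
  ultimately obtain v \<kappa> where c: "is_colimit C J' F' v \<kappa>"
    using colimits unfolding has_ess_finite_colimits_def by blast
  have co: "is_cocone C J' F' w \<tau> \<longleftrightarrow> is_cocone C J F w (\<lambda>x. \<tau> (a x))" for w \<tau>
    by (simp add: is_cocone_def sel F'O F'A)
  have "is_colimit C J F v (\<lambda>x. \<kappa> (a x))"
    unfolding is_colimit_def
  proof (intro conjI allI impI)
    show "is_cocone C J F v (\<lambda>x. \<kappa> (a x))" using is_colimit_cocone[OF c] co by simp
    fix w \<tau> assume t: "is_cocone C J F w \<tau>"
    have "is_cocone C J F w (\<lambda>x. \<tau> (a' (a x)))" using t by (simp add: is_cocone_def)
    then have t': "is_cocone C J' F' w (\<lambda>x. \<tau> (a' x))" using co by simp
    have "\<exists>!u. u \<in> hom C v w \<and> (\<forall>j \<in> Ob J'. u \<cdot> \<kappa> j = \<tau> (a' j))"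
      using c t' by (simp add: is_colimit_def)
    then show "\<exists>!u. u \<in> hom C v w \<and> (\<forall>j \<in> Ob J. u \<cdot> \<kappa> (a j) = \<tau> j)" by (simp add: sel)
  qed
  then show ?thesis by blast
qed

lemma mult_singleton:
  assumes "A \<in> Ob C"
  shows "mult {s} A = Ident C A"
  using Sm_single[of "{s}" s "\<lambda>_. Ident C A" A A] assms by (simp add: hom_iff)

end


section \<open>The endomorphism of the unit counts automorphisms\<close>

context kan
begin

text \<open>In the sum formula for \<open>\<gamma>\<close>, the term of \<open>(x, \<phi>)\<close> becomes \<open>W \<phi> \<cdot> W \<phi>\<inverse>\<close>, the identity, between the unit
  and the counit; so only the number of components remains.\<close>

lemma unit_gamma_counit:
  assumes W: "is_functor Y C W"
  defines "\<delta> \<equiv> Counit lk W \<cdot>\<^bsub>CY\<^esub> gamma C X Y f (OM rs W) \<cdot>\<^bsub>CY\<^esub> Unit rk W"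
  shows "y \<in> Ob Y \<Longrightarrow> Cmp \<delta> y = mult (R y) (OM W y)"
proof -
  assume y: "y \<in> Ob Y"
  note Ws = is_functorD[OF W]
  have WC: "W \<in> Ob CY" using W by simp
  define V where "V = OM rs W"
  have V: "is_functor X C V" and Ve: "V = fct_comp X W f" using functor_comp[OF f W] by (simp_all add: V_def restr_sel(1)[OF W])
  note L = is_lanD[OF lk_lan[OF V]] and Rn = is_ranD[OF rk_ran[OF V]]
  note cou = lkD(4)[OF WC, folded V_def] and un = rkD(3)[OF WC, folded V_def]
  note cD = hom_functor_catD[OF cou] and uD = hom_functor_catD[OF un]
  note gD = hom_functor_catD[OF gamma(1)[OF V]]
  interpret G: groupoid_diagrams C U "P y" "R y" by (rule fibre_diagrams[OF y])
  have RO: "d \<in> Ob (P y)" if "d \<in> R y" for d using that G.P.reps_ob by blast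
  have Wy: "OM W y \<in> Ob C" by (rule Ws(3)[OF y])
  have c: "Cmp (Counit lk W) y \<cdot> lc V d = AM W (snd d)" and u: "rc V d \<cdot> Cmp (Unit rk W) y = AM W (inv_ar Y (snd d))"
    if d: "d \<in> Ob (P y)" for d
  proof -
    note x = conjunct1[OF ob_PD[OF d]] and \<phi> = conjunct2[OF ob_PD[OF d]]
    note i = Y.inv_hom[OF \<phi>] and y' = fs(3)[OF x]
    have "Cmp (AM rs (Counit lk W) \<cdot>\<^bsub>CX\<^esub> Unit lk V) (fst d) = Cmp (Ident CX V) (fst d)"
      using lkD(8)[OF WC, folded V_def] by simp
    then have t: "Cmp (Counit lk W) (OM f (fst d)) \<cdot> Cmp (Unit lk V) (fst d) = Ident C (OM W (OM f (fst d)))"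
      using x by (simp add: restr_sel(4)[OF cD(5)] Ve)
    have "Cmp (Counit rk V \<cdot>\<^bsub>CX\<^esub> AM rs (Unit rk W)) (fst d) = Cmp (Ident CX V) (fst d)"
      using rkD(7)[OF WC, folded V_def] by simp
    then have t': "Cmp (Counit rk V) (fst d) \<cdot> Cmp (Unit rk W) (OM f (fst d)) = Ident C (OM W (OM f (fst d)))"
      using x by (simp add: restr_sel(4)[OF uD(5)] Ve)
    have Vx: "OM V (fst d) = OM W (OM f (fst d))" using x by (simp add: Ve)
    note [simp] = homD[OF cD(6)[OF y]] homD[OF cD(6)[OF y']] homD[OF uD(6)[OF y]] homD[OF uD(6)[OF y']]
      homD[OF L(5)[OF x]] homD[OF Rn(5)[OF x]] homD[OF is_functorD(4)[OF L(2) \<phi>]] homD[OF is_functorD(4)[OF Rn(2) i]]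
      homD[OF Ws(4)[OF \<phi>]] homD[OF Ws(4)[OF i]] Vx
    show "Cmp (Counit lk W) y \<cdot> lc V d = AM W (snd d)"
      by (simp add: lan_cocone_def split_beta reassoc[OF cD(7)[OF \<phi>]] t)
    have "rc V d \<cdot> Cmp (Unit rk W) y = Cmp (Counit rk V) (fst d) \<cdot> (Cmp (Unit rk W) (OM f (fst d)) \<cdot> AM W (inv_ar Y (snd d)))"
      using uD(7)[OF i] by (simp add: ran_cone_def split_beta)
    also have "\<dots> = AM W (inv_ar Y (snd d))"
      by (subst reassoc[OF t']) simp_all
    finally show "rc V d \<cdot> Cmp (Unit rk W) y = AM W (inv_ar Y (snd d))" .
  qed
  note cy = cD(6)[OF y] and uy = uD(6)[OF y] and gy = gD(6)[OF y]
  have sh: "lc V d \<cdot> rc V d \<in> hom C (OM (Ro V) y) (OM (Lo V) y)" if "d \<in> R y" for d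
    by (rule comp_hom[OF rc_hom[OF V y RO[OF that]] lc_hom[OF V y RO[OF that]]])
  have Lo: "OM (Lo V) y \<in> Ob C" and Roy: "OM (Ro V) y \<in> Ob C" using is_functorD(3)[OF L(2) y] is_functorD(3)[OF Rn(2) y] by auto
  have "Cmp \<delta> y = Cmp (Counit lk W) y \<cdot> Cmp (gamma C X Y f V) y \<cdot> Cmp (Unit rk W) y"
    using y by (simp add: \<delta>_def V_def)
  also have "\<dots> = Sm (R y) (OM (Ro V) y) (OM W y) (\<lambda>d. Cmp (Counit lk W) y \<cdot> (lc V d \<cdot> rc V d)) \<cdot> Cmp (Unit rk W) y"
    unfolding gamma(2)[OF V y] by (subst Sm_comp_left[OF _ Roy sh cy]) (simp_all add: G.P.fin_reps)
  also have "\<dots> = Sm (R y) (OM W y) (OM W y) (\<lambda>d. Cmp (Counit lk W) y \<cdot> (lc V d \<cdot> rc V d) \<cdot> Cmp (Unit rk W) y)"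
    by (rule Sm_comp_right[OF _ Wy _ uy]) (use comp_hom[OF sh cy] G.P.fin_reps in simp_all)
  also have "\<dots> = mult (R y) (OM W y)"
  proof (rule Sm_cong)
    fix d assume "d \<in> R y"
    then have d: "d \<in> Ob (P y)" by (rule RO)
    note \<phi> = conjunct2[OF ob_PD[OF d]]
    note i = Y.inv_hom[OF \<phi>]
    note [simp] = homD[OF lc_hom[OF V y d]] homD[OF rc_hom[OF V y d]] homD[OF cy] homD[OF uy]
    have "Cmp (Counit lk W) y \<cdot> (lc V d \<cdot> rc V d) \<cdot> Cmp (Unit rk W) y = (Cmp (Counit lk W) y \<cdot> lc V d) \<cdot> (rc V d \<cdot> Cmp (Unit rk W) y)"
      by simp
    also have "\<dots> = Ident C (OM W y)"
      unfolding c[OF d] u[OF d] using Ws(6)[OF i \<phi>] Y.inv_comp(2)[OF \<phi>] Ws(5)[OF y] by simp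
    finally show "Cmp (Counit lk W) y \<cdot> (lc V d \<cdot> rc V d) \<cdot> Cmp (Unit rk W) y = Ident C (OM W y)" .
  qed
  finally show "Cmp \<delta> y = mult (R y) (OM W y)" .
qed

end

lemma point_cat_sel [simp]:
  "Ob point_cat = UNIV" "Ar point_cat = UNIV" "hom point_cat x y = UNIV"
  by (auto simp: point_cat_def hom_def)

lemma groupoid_point_cat: "groupoid point_cat"
proof
  show "is_iso point_cat g" for g :: unit
    by (auto simp: is_iso_def inverse_arrows_def)
qed auto

lemma point_map_functor:
  assumes "category G" "e \<in> Ob G"
  shows "is_functor point_cat G (point_map G e)"
proof (rule is_functorI)
  interpret G: category G by fact
  show "category point_cat" using groupoid_point_cat by (simp add: groupoid_def)
qed (use assms category.ident_ar[OF assms] category.ident_hom[OF assms] category.comp_ident_ar(1)[OF assms(1)] in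
    \<open>auto simp: point_map_def extensional_def\<close>)

text \<open>The homotopy fibre of the point \<open>e\<close> at \<open>c\<close> is the discrete set of arrows from \<open>e\<close> to \<open>c\<close>. It is finite with
  trivial automorphism groups, so every arrow is its own component.\<close>

lemma (in fin_cocomplete_rigid) delta_connected:
  fixes Q :: "('q, 'r, 'e2) cat_scheme"
  assumes Q: "groupoid Q" and fin: "\<And>c. c \<in> Ob Q \<Longrightarrow> finite (hom Q e c)" and e: "e \<in> Ob Q" and c: "c \<in> Ob Q"
  shows "Cmp (delta_connected C Q e) c = mult (hom Q e c) \<one>"
proof -
  interpret Q: groupoid Q by (rule Q)
  let ?\<iota> = "point_map Q e"
  have \<iota>: "is_functor point_cat Q ?\<iota>" by (rule point_map_functor[OF Q.category_axioms e])
  interpret M: groupoid_map point_cat Q ?\<iota>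
    using \<iota> Q groupoid_point_cat by (simp add: groupoid_map_def groupoid_map_axioms_def)
  have \<iota>_sel: "OM ?\<iota> x = e" "AM ?\<iota> m = Ident Q e" for x m
    by (simp_all add: point_map_def)
  have ob: "Ob (M.P y) = Pair () ` hom Q e y" for y
    by (auto simp: M.ob_P \<iota>_sel image_iff)
  have hm: "hom (M.P y) a b = (if a \<in> Ob (M.P y) \<and> a = b then {(a, (), a)} else {})" for y a b
  proof -
    have "snd b \<cdot>\<^bsub>Q\<^esub> AM ?\<iota> m = snd b" if "b \<in> Ob (M.P y)" for m
      using that e Q.comp_ident_right by (auto simp: ob \<iota>_sel)
    moreover have "a = b \<longleftrightarrow> snd a = snd b" by (cases a, cases b) simp
    ultimately show ?thesis by (auto simp: M.hom_P)
  qed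
  have fo: "finite (Ob (M.P y))" if "y \<in> Ob Q" for y using fin[OF that] by (simp add: ob)
  have fg: "finite_groupoid (M.P y) (Ob (M.P y))" if "y \<in> Ob Q" for y
  proof (intro finite_groupoid.intro finite_groupoid_axioms.intro)
    show "\<exists>!r. r \<in> Ob (M.P y) \<and> hom (M.P y) r c \<noteq> {}" if "c \<in> Ob (M.P y)" for c
      using that by (intro ex1I[of _ c]) (simp_all only: hm, auto split: if_splits)
    show "finite (hom (M.P y) c d)" for c d by (simp only: hm) simp
  qed (use M.groupoid_P fo[OF that] in simp_all)
  interpret K: kan C U point_cat Q ?\<iota> "\<lambda>y. Ob (M.P y)"
  proof (intro kan.intro kan_axioms.intro fin_cocomplete_rigid_axioms M.groupoid_map_axioms)
    show "finite_groupoid (hfibre point_cat Q ?\<iota> y) (Ob (hfibre point_cat Q ?\<iota> y))" if "y \<in> Ob Q" for y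
      by (rule fg[OF that])
    show "\<exists>v \<kappa>. is_colimit C (hfibre point_cat Q ?\<iota> y) F v \<kappa>"
      if y: "y \<in> Ob Q" and F: "is_functor (hfibre point_cat Q ?\<iota> y) C F" for y F
    proof -
      have ar: "Ar (M.P y) \<subseteq> (\<lambda>a. (a, (), a)) ` Ob (M.P y)"
      proof
        fix g assume "g \<in> Ar (M.P y)"
        then have "g \<in> hom (M.P y) (Dom (M.P y) g) (Cod (M.P y) g)" by (simp add: hom_def)
        then show "g \<in> (\<lambda>a. (a, (), a)) ` Ob (M.P y)" unfolding hm by (auto split: if_splits)
      qed
      have ess: "ess_finite_groupoid (M.P y)"
        by (rule ess_finiteI[OF M.groupoid_P _ fo[OF y] order.refl]) (auto simp: hm)
      obtain a :: "unit \<times> 'r \<Rightarrow> 'u" where a: "inj_on a (Ob (M.P y))" using finite_inj_ex[OF fo[OF y]] by blast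
      obtain b :: "(unit \<times> 'r) \<times> unit \<times> (unit \<times> 'r) \<Rightarrow> 'u" where b: "inj_on b (Ar (M.P y))"
        using finite_inj_ex[OF finite_subset[OF ar finite_imageI[OF fo[OF y]]]] by blast
      show ?thesis by (rule colimit_transport[OF ess F a b])
    qed
    show "is_iso C (mult (hom (hfibre point_cat Q ?\<iota> y) a a) \<one>)" if "a \<in> Ob (hfibre point_cat Q ?\<iota> y)" for y a
      using that by (simp add: hm mult_singleton)
  qed
  have "Cmp (delta_connected C Q e) c = mult (Ob (M.P c)) (OM \<one>\<^bsub>functor_cat Q C\<^esub> c)"
    using K.unit_gamma_counit[OF one_functor[OF Q.category_axioms] c] by (simp add: delta_connected_def Let_def)
  also have "\<dots> = mult (Ob (M.P c)) \<one>" using c by simp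
  also have "\<dots> = mult (hom Q e c) \<one>"
    by (rule Sm_reindex[where \<sigma> = "Pair ()"]) (use fin[OF c] in \<open>auto simp: ob bij_betw_def inj_on_def hom_iff\<close>)
  finally show ?thesis .
qed

lemma component_groupoid:
  assumes "groupoid G"
  shows "groupoid (component G x)" "Ob (component G x) = {y \<in> Ob G. hom G x y \<noteq> {}}"
    "\<lbrakk>a \<in> Ob (component G x); b \<in> Ob (component G x)\<rbrakk> \<Longrightarrow> hom (component G x) a b = hom G a b"
proof -
  interpret groupoid G by fact
  let ?Q = "component G x"
  show ob: "Ob ?Q = {y \<in> Ob G. hom G x y \<noteq> {}}" by (simp add: component_def full_sub_def isomorphic_iff)
  have sel: "Dom ?Q = Dom G" "Cod ?Q = Cod G" "Ident ?Q = Ident G" "g \<cdot>\<^bsub>?Q\<^esub> h = g \<cdot>\<^bsub>G\<^esub> h"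
    "Ar ?Q = {g \<in> Ar G. Dom G g \<in> Ob ?Q \<and> Cod G g \<in> Ob ?Q}" for g h
    by (simp_all add: component_def full_sub_def)
  show hm: "hom ?Q a b = hom G a b" if "a \<in> Ob ?Q" "b \<in> Ob ?Q" for a b
    using that by (auto simp: hom_def sel)
  have hsub: "g \<in> hom ?Q a b \<longleftrightarrow> g \<in> hom G a b \<and> a \<in> Ob ?Q \<and> b \<in> Ob ?Q" for g a b by (auto simp: hom_def sel)
  have obG: "a \<in> Ob ?Q \<Longrightarrow> a \<in> Ob G" for a by (simp add: ob)
  have "category ?Q"
  proof
    fix g h k a b c d
    show "g \<in> Ar ?Q \<Longrightarrow> Dom ?Q g \<in> Ob ?Q" "g \<in> Ar ?Q \<Longrightarrow> Cod ?Q g \<in> Ob ?Q" by (simp_all add: sel)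
    show "a \<in> Ob ?Q \<Longrightarrow> Ident ?Q a \<in> hom ?Q a a" using ident_hom[OF obG] by (simp add: hsub sel)
    assume g: "g \<in> hom ?Q a b"
    then show "g \<cdot>\<^bsub>?Q\<^esub> Ident ?Q a = g" "Ident ?Q b \<cdot>\<^bsub>?Q\<^esub> g = g"
      using comp_ident_right[of g a b] comp_ident_left[of g a b] unfolding hsub sel by auto
    assume h: "h \<in> hom ?Q b c"
    show "h \<cdot>\<^bsub>?Q\<^esub> g \<in> hom ?Q a c" using g h comp_hom[of g a b h c] unfolding hsub sel by auto
    assume k: "k \<in> hom ?Q c d"
    show "k \<cdot>\<^bsub>?Q\<^esub> h \<cdot>\<^bsub>?Q\<^esub> g = k \<cdot>\<^bsub>?Q\<^esub> (h \<cdot>\<^bsub>?Q\<^esub> g)"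
      using g h k comp_assoc[of g a b h c k d] unfolding hsub sel by auto
  qed
  then interpret Q: category ?Q .
  show "groupoid ?Q"
  proof
    fix g assume g: "g \<in> Ar ?Q"
    then have gh: "g \<in> hom G (Dom G g) (Cod G g)" and o: "Dom G g \<in> Ob ?Q" "Cod G g \<in> Ob ?Q" by (auto simp: sel hom_def)
    show "is_iso ?Q g"
      by (rule Q.is_isoI(1)[of _ "Dom G g" "Cod G g" "inv_ar G g"])
        (use gh inv_hom[OF gh] inv_comp[OF gh] o in \<open>simp_all add: hsub sel\<close>)
  qed
qed

lemma (in groupoid_diagrams) delta_unit:
  assumes c: "c \<in> Ob P"
  shows "Cmp (delta_unit C P) c = mult (hom P c c) \<one>"
proof -
  let ?Q = "component P c"
  note Q = component_groupoid[OF P.groupoid_axioms, where x = c]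
  define e where "e = (SOME e. e \<in> Ob ?Q)"
  have cQ: "c \<in> Ob ?Q" using c P.ident_hom[OF c] unfolding Q(2) by blast
  then have e: "e \<in> Ob ?Q" unfolding e_def by (rule someI)
  then have eP: "e \<in> Ob P" and ce: "hom P c e \<noteq> {}" unfolding Q(2) by auto
  have "finite (hom ?Q e d)" if "d \<in> Ob ?Q" for d
    using Q(3)[OF e that] that P.fin_hom[OF eP, of d] by (simp add: Q(2))
  then have "Cmp (delta_connected C ?Q e) c = mult (hom ?Q e c) \<one>"
    by (rule delta_connected[OF Q(1) _ e cQ])
  also have "\<dots> = mult (hom P c c) \<one>"
    using Sm_hom_const(2)[OF c eP ident_hom[OF unit_ob] P.connected_sym[OF ce]] by (simp add: Q(3)[OF e cQ])
  finally show ?thesis using c by (simp add: delta_unit_def Let_def e_def)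
qed


section \<open>Fibres of maps of essentially finite groupoids\<close>

text \<open>The objects and arrows of a homotopy fibre are tuples of elements of \<open>'u\<close>; iterating the pairing
  embeds them into \<open>'u\<close>.\<close>

lemma infinite_pairing: "\<exists>p :: 'u::infinite \<times> 'u \<Rightarrow> 'u. inj p"
proof -
  have "\<exists>p. bij_betw p (UNIV \<times> UNIV :: ('u \<times> 'u) set) (UNIV :: 'u set)"
    using card_of_Times_same_infinite[OF infinite_UNIV] card_of_ordIso by blast
  then show ?thesis by (auto simp: bij_betw_def)
qed

text \<open>Every object of the fibre is isomorphic to some \<open>(r, \<phi>)\<close> with \<open>r\<close> among the representatives of \<open>X\<close>; as
  hom-sets of \<open>Y\<close> are finite, there are finitely many of these.\<close>

lemma ess_finite_hfibre:
  assumes X: "ess_finite_groupoid X" and Y: "ess_finite_groupoid Y" and f: "is_functor X Y f" and y: "y \<in> Ob Y"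
  shows "ess_finite_groupoid (hfibre X Y f y)"
proof -
  obtain RX where "finite_groupoid X RX" using ess_finite_reps[OF X] .
  then interpret X: finite_groupoid X RX .
  obtain RY where "finite_groupoid Y RY" using ess_finite_reps[OF Y] .
  then interpret Y: finite_groupoid Y RY .
  interpret M: groupoid_map X Y f
    by (intro groupoid_map.intro groupoid_map_axioms.intro X.groupoid_axioms Y.groupoid_axioms f)
  note fs = M.fs
  show ?thesis
  proof (rule ess_finiteI[OF M.groupoid_P])
    show "finite (hom (M.P y) c d)" if "c \<in> Ob (M.P y)" "d \<in> Ob (M.P y)" for c d
    proof (rule finite_subset)
      show "hom (M.P y) c d \<subseteq> (\<lambda>m. (c, m, d)) ` hom X (fst c) (fst d)"
        by (auto simp: M.hom_P)
      show "finite ((\<lambda>m. (c, m, d)) ` hom X (fst c) (fst d))"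
        using X.fin_hom M.ob_PD that by blast
    qed
    let ?R = "SIGMA r : RX. hom Y (OM f r) y"
    show "finite ?R" using X.fin_reps X.reps_ob Y.fin_hom fs(3) y by (intro finite_SigmaI) auto
    show "?R \<subseteq> Ob (M.P y)" using X.reps_ob by auto
    fix c assume c: "c \<in> Ob (M.P y)"
    obtain x \<phi> where cc: "c = (x, \<phi>)" by (cases c)
    have x: "x \<in> Ob X" and \<phi>: "\<phi> \<in> hom Y (OM f x) y" using c cc by auto
    obtain m where m: "m \<in> hom X (X.rep x) x" using X.rep(3)[OF x] by blast
    note i = X.inv_hom[OF m]
    have k: "\<phi> \<cdot>\<^bsub>Y\<^esub> AM f m \<in> hom Y (OM f (X.rep x)) y" by (rule Y.comp_hom[OF fs(4)[OF m] \<phi>])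
    have "(\<phi> \<cdot>\<^bsub>Y\<^esub> AM f m) \<cdot>\<^bsub>Y\<^esub> AM f (inv_ar X m) = \<phi> \<cdot>\<^bsub>Y\<^esub> AM f (m \<cdot>\<^bsub>X\<^esub> inv_ar X m)"
      using fs(6)[OF i m] Y.comp_assoc[OF fs(4)[OF i] fs(4)[OF m] \<phi>] by simp
    also have "\<dots> = \<phi>" using X.inv_comp(2)[OF m] fs(5)[OF x] Y.comp_ident_right[OF \<phi>] by simp
    finally have "(c, inv_ar X m, (X.rep x, \<phi> \<cdot>\<^bsub>Y\<^esub> AM f m)) \<in> hom (M.P y) c (X.rep x, \<phi> \<cdot>\<^bsub>Y\<^esub> AM f m)"
      using c k i X.rep(2)[OF x] by (simp add: M.hom_P cc)
    then show "\<exists>r \<in> ?R. hom (M.P y) c r \<noteq> {}"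
      using X.rep(1)[OF x] k by (intro bexI[of _ "(X.rep x, \<phi> \<cdot>\<^bsub>Y\<^esub> AM f m)"]) auto
  qed
qed

section \<open>Acting by the inverse of the unit endomorphism\<close>

lemma (in category) colimit_automorphism:
  assumes c: "is_colimit C J F v \<kappa>" and F: "is_functor J C F"
    and a: "\<And>j. j \<in> Ob J \<Longrightarrow> \<alpha> j \<in> hom C (OM F j) (OM F j)" "\<And>j. j \<in> Ob J \<Longrightarrow> is_iso C (\<alpha> j)"
    and nat: "\<And>m. m \<in> Ar J \<Longrightarrow> \<alpha> (Cod J m) \<cdot> AM F m = AM F m \<cdot> \<alpha> (Dom J m)"
  shows "\<exists>!u. u \<in> hom C v v \<and> (\<forall>j \<in> Ob J. u \<cdot> \<kappa> j = \<kappa> j \<cdot> \<alpha> j)"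
    and "\<lbrakk>u \<in> hom C v v; \<And>j. j \<in> Ob J \<Longrightarrow> u \<cdot> \<kappa> j = \<kappa> j \<cdot> \<alpha> j\<rbrakk> \<Longrightarrow> is_iso C u"
proof -
  have d: "diagram C J F" by (rule functor_diagram[OF F])
  have c': "is_colimit C J F v (\<lambda>j. \<kappa> j \<cdot> \<alpha> j)" by (rule colimit_iso_diagram[OF c d d a nat])
  show "\<exists>!u. u \<in> hom C v v \<and> (\<forall>j \<in> Ob J. u \<cdot> \<kappa> j = \<kappa> j \<cdot> \<alpha> j)"
    using c is_colimit_cocone[OF c'] by (simp add: is_colimit_def)
  show "is_iso C u" if "u \<in> hom C v v" "\<And>j. j \<in> Ob J \<Longrightarrow> u \<cdot> \<kappa> j = \<kappa> j \<cdot> \<alpha> j"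
    by (rule colimit_comparison_iso[OF c c' d that])
qed

lemma (in symmetric_monoidal_category) unit_endo_act_iso:
  assumes d: "d \<in> hom C \<one> \<one>" "is_iso C d" and A: "A \<in> Ob C"
  shows "is_iso C (unit_endo_act C d A)"
proof -
  note [simp] = homD[OF d(1)] d(2) A
  show ?thesis unfolding unit_endo_act_def by (intro is_iso_comp) simp_all
qed

context kan
begin

lemma delta_act:
  assumes V: "is_functor X C V" and y: "y \<in> Ob Y" and D: "delta C X Y f y \<in> Ar (functor_cat (P y) C)"
  defines "\<alpha> \<equiv> unit_endo_act (functor_cat (P y) C) (delta C X Y f y) (pb V y)"
  shows "\<alpha> \<in> hom (functor_cat (P y) C) (pb V y) (pb V y)"
    "c \<in> Ob (P y) \<Longrightarrow> Cmp \<alpha> c = unit_endo_act C (mult (hom (P y) c c) \<one>) (OM V (fst c))"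
    "c \<in> Ob (P y) \<Longrightarrow> is_iso C (Cmp \<alpha> c)"
proof -
  interpret G: groupoid_diagrams C U "P y" "R y" by (rule fibre_diagrams[OF y])
  note W = pb_functor[OF V, of y] and Vs = is_functorD[OF V]
  note l = lunit_ntr[OF W]
  have D1: "delta C X Y f y \<in> hom (functor_cat (P y) C) \<one>\<^bsub>functor_cat (P y) C\<^esub> \<one>\<^bsub>functor_cat (P y) C\<^esub>"
    using D by (simp add: hom_functor_cat delta_def delta_unit_def)
  have li: "is_iso C (Cmp (lunit (functor_cat (P y) C) (pb V y)) c)" if "c \<in> Ob (P y)" for c
    using that is_functorD(3)[OF W that] by simp
  note i = ntr_iso[OF l li]
  show "\<alpha> \<in> hom (functor_cat (P y) C) (pb V y) (pb V y)"
    unfolding \<alpha>_def unit_endo_act_def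
    by (rule comp_ntr[OF i(3)  comp_ntr[OF tens_ntr[OF D1 ident_ntr[OF W]] l]])
  have x: "OM V (fst c) \<in> Ob C" if "c \<in> Ob (P y)" for c using Vs(3) ob_PD[OF that] by blast
  show cmp: "Cmp \<alpha> c = unit_endo_act C (mult (hom (P y) c c) \<one>) (OM V (fst c))" if c: "c \<in> Ob (P y)" for c
    using c x[OF c] G.delta_unit[OF c] i(2)[OF _ c]
    by (simp add: \<alpha>_def unit_endo_act_def delta_def pb_sel)
  show "is_iso C (Cmp \<alpha> c)" if c: "c \<in> Ob (P y)" for c
    unfolding cmp[OF c] by (rule unit_endo_act_iso[OF mult_hom orders_iso[OF y c] x[OF c]]) (use G.P.fin_hom[OF c c] in simp_all)
qed

text \<open>The arrow induced by \<open>\<delta>\<inverse>\<close> is natural in \<open>y\<close> because \<open>sh n\<close> identifies automorphism groups in the two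
  fibres, so \<open>\<delta>\<close> has the same value at \<open>c\<close> and at \<open>sh n c\<close>.\<close>

lemma left_kan_delta_inv:
  assumes V: "is_functor X C V" and D: "\<And>y. y \<in> Ob Y \<Longrightarrow> delta C X Y f y \<in> Ar (functor_cat (P y) C)"
  shows "left_kan_delta_inv C X Y f V \<in> hom CY (Lo V) (Lo V)"
    and "y \<in> Ob Y \<Longrightarrow> is_iso C (Cmp (left_kan_delta_inv C X Y f V) y)"
proof -
  let ?\<delta> = "left_kan_delta_inv C X Y f V"
  note L = is_lanD[OF lk_lan[OF V]]
  define \<alpha> where "\<alpha> y = unit_endo_act (functor_cat (P y) C) (delta C X Y f y) (pb V y)" for y
  define \<beta> where "\<beta> y = inv_ar (functor_cat (P y) C) (\<alpha> y)" for y
  have a: "\<alpha> y \<in> hom (functor_cat (P y) C) (pb V y) (pb V y)"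
    and ac: "\<And>c. c \<in> Ob (P y) \<Longrightarrow> Cmp (\<alpha> y) c = unit_endo_act C (mult (hom (P y) c c) \<one>) (OM V (fst c))"
    and ai: "\<And>c. c \<in> Ob (P y) \<Longrightarrow> is_iso C (Cmp (\<alpha> y) c)" if "y \<in> Ob Y" for y
    using delta_act[OF V that D[OF that]] by (simp_all add: \<alpha>_def)
  have b: "\<beta> y \<in> hom (functor_cat (P y) C) (pb V y) (pb V y)"
    and bc: "\<And>c. c \<in> Ob (P y) \<Longrightarrow> Cmp (\<beta> y) c = inv_ar C (Cmp (\<alpha> y) c)" if "y \<in> Ob Y" for y
    using ntr_iso(2,3)[OF a[OF that] ai[OF that]] by (simp_all add: \<beta>_def)
  have bh: "Cmp (\<beta> y) c \<in> hom C (OM V (fst c)) (OM V (fst c))" if y: "y \<in> Ob Y" and c: "c \<in> Ob (P y)" for y c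
    using hom_functor_catD(6)[OF b[OF y] c] c by (simp add: pb_sel)
  have bs: "Cmp (\<beta> y') (sh n c) = Cmp (\<beta> y) c" if n: "n \<in> hom Y y y'" and c: "c \<in> Ob (P y)" for n y y' c
  proof -
    note [simp] = Y.hom_ob[OF n] c sh_ob[OF n c]
    interpret G: groupoid_diagrams C U "P y" "R y" by (rule fibre_diagrams) simp
    have "mult (hom (P y') (sh n c) (sh n c)) \<one> = mult (hom (P y) c c) \<one>"
      by (rule Sm_reindex[OF _ sh_bij[OF n c c]]) (use G.P.fin_hom[OF c c] in \<open>simp_all add: hom_iff\<close>)
    then have "Cmp (\<alpha> y') (sh n c) = Cmp (\<alpha> y) c" by (simp add: ac) (simp add: sh_def)
    then show ?thesis by (simp add: bc)
  qed
  have u: "\<exists>!u. u \<in> hom C (OM (Lo V) y) (OM (Lo V) y) \<and> (\<forall>c \<in> Ob (P y). u \<cdot> lc V c = lc V c \<cdot> Cmp (\<beta> y) c)"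
    "\<And>u. \<lbrakk>u \<in> hom C (OM (Lo V) y) (OM (Lo V) y); \<And>c. c \<in> Ob (P y) \<Longrightarrow> u \<cdot> lc V c = lc V c \<cdot> Cmp (\<beta> y) c\<rbrakk> \<Longrightarrow> is_iso C u"
    if y: "y \<in> Ob Y" for y
  proof -
    interpret P: groupoid "P y" by (rule groupoid_P)
    note [simp] = hom_functor_catD(6)[OF a[OF y]]
    have bi: "is_iso C (Cmp (\<beta> y) c)" if c: "c \<in> Ob (P y)" for c using ai[OF y c] by (simp add: bc[OF y c])
    have nat: "Cmp (\<beta> y) (Cod (P y) m) \<cdot> AM (pb V y) m = AM (pb V y) m \<cdot> Cmp (\<beta> y) (Dom (P y) m)" if m: "m \<in> Ar (P y)" for m
      using hom_functor_catD(7)[OF b[OF y] P.ar_hom[OF m]] .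
    show "\<exists>!u. u \<in> hom C (OM (Lo V) y) (OM (Lo V) y) \<and> (\<forall>c \<in> Ob (P y). u \<cdot> lc V c = lc V c \<cdot> Cmp (\<beta> y) c)"
      by (rule colimit_automorphism(1)[OF L(4)[OF y] pb_functor[OF V] hom_functor_catD(6)[OF b[OF y]] bi nat])
    show "is_iso C u" if "u \<in> hom C (OM (Lo V) y) (OM (Lo V) y)" "\<And>c. c \<in> Ob (P y) \<Longrightarrow> u \<cdot> lc V c = lc V c \<cdot> Cmp (\<beta> y) c" for u
      by (rule colimit_automorphism(2)[OF L(4)[OF y] pb_functor[OF V] hom_functor_catD(6)[OF b[OF y]] bi nat that])
  qed
  have sel: "Src ?\<delta> = Lo V" "Tgt ?\<delta> = Lo V" "Cmp ?\<delta> \<in> extensional (Ob Y)"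
    by (simp_all add: left_kan_delta_inv_def Let_def)
  have lcV: "left_kan_cocone C X Y f V = lc V" by (simp add: left_kan_cocone_def lan_cocone_def)
  have "Cmp ?\<delta> y = (THE u. u \<in> hom C (OM (Lo V) y) (OM (Lo V) y) \<and> (\<forall>c \<in> Ob (P y). u \<cdot> lc V c = lc V c \<cdot> Cmp (\<beta> y) c))"
    if y: "y \<in> Ob Y" for y
    using y by (simp add: left_kan_delta_inv_def Let_def lcV \<beta>_def \<alpha>_def pb_def)
  then have dd: "Cmp ?\<delta> y \<in> hom C (OM (Lo V) y) (OM (Lo V) y) \<and> (\<forall>c \<in> Ob (P y). Cmp ?\<delta> y \<cdot> lc V c = lc V c \<cdot> Cmp (\<beta> y) c)"
    if y: "y \<in> Ob Y" for y
    using theI'[OF u(1)[OF y]] y by simp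
  have dh: "Cmp ?\<delta> y \<in> hom C (OM (Lo V) y) (OM (Lo V) y)" if "y \<in> Ob Y" for y using dd[OF that] by blast
  have dc: "Cmp ?\<delta> y \<cdot> lc V c = lc V c \<cdot> Cmp (\<beta> y) c" if "y \<in> Ob Y" "c \<in> Ob (P y)" for y c using dd[OF that(1)] that(2) by blast
  show "is_iso C (Cmp ?\<delta> y)" if "y \<in> Ob Y" for y by (rule u(2)[OF that dh[OF that] dc[OF that]])
  show "?\<delta> \<in> hom CY (Lo V) (Lo V)"
  proof (rule hom_functor_catI[OF L(2) L(2)])
    fix n y y' assume n: "n \<in> hom Y y y'"
    note [simp] = Y.hom_ob[OF n]
    note Ln = is_functorD(4)[OF L(2) n]
    show "Cmp ?\<delta> y' \<cdot> AM (Lo V) n = AM (Lo V) n \<cdot> Cmp ?\<delta> y"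
    proof (rule is_colimit_eq[OF L(4) _ _ _ functor_diagram[OF pb_functor[OF V]]])
      fix c assume c: "c \<in> Ob (P y)"
      note s = lan_cocone_shift[OF lk_lan[OF V] n c] and s' = sh_ob[OF n c]
      note [simp] = homD[OF Ln] homD[OF dh[of y]] homD[OF dh[of y']] homD[OF lc_hom[OF V _ c]] homD[OF lc_hom[OF V _ s']]
        homD[OF bh[OF _ c]] c
      have "Cmp ?\<delta> y' \<cdot> AM (Lo V) n \<cdot> lc V c = lc V (sh n c) \<cdot> Cmp (\<beta> y) c"
        using s dc[OF _ s'] bs[OF n c] by simp
      also have "\<dots> = AM (Lo V) n \<cdot> Cmp ?\<delta> y \<cdot> lc V c"
        by (simp add: dc flip: s)
      finally show "Cmp ?\<delta> y' \<cdot> AM (Lo V) n \<cdot> lc V c = AM (Lo V) n \<cdot> Cmp ?\<delta> y \<cdot> lc V c" .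
    qed (use comp_hom[OF Ln dh] comp_hom[OF dh Ln] in simp_all)
  qed (simp_all add: dh sel)
qed

lemma nakayama_iso:
  assumes V: "is_functor X C V" and D: "\<And>y. y \<in> Ob Y \<Longrightarrow> delta C X Y f y \<in> Ar (functor_cat (P y) C)"
  shows "nakayama C X Y f V \<in> hom CY (Ro V) (Lo V)" "is_iso CY (nakayama C X Y f V)"
proof -
  note d = left_kan_delta_inv[OF V D] and g = gamma(1)[OF V]
  show "nakayama C X Y f V \<in> hom CY (Ro V) (Lo V)" unfolding nakayama_def by (rule comp_ntr[OF g d(1)])
  have "is_iso CY (gamma C X Y f V)" by (rule ntr_iso(1)[OF g gamma_iso[OF V]])
  moreover have "is_iso CY (left_kan_delta_inv C X Y f V)" by (rule ntr_iso(1)[OF d])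
  ultimately show "is_iso CY (nakayama C X Y f V)" unfolding nakayama_def
    by (rule CY.is_iso_comp) (use CY.homD[OF g] CY.homD[OF d(1)] in simp)
qed

end

theorem corollary5p5:
  fixes C :: "('o, 'a) smcat"
    and X Y :: "('u::infinite, 'u) cat"
    and f :: "('u, 'u, 'u, 'u) fct"
    and V :: "('u, 'u, 'o, 'a) fct"
  assumes "nakayama_category TYPE('u) C"
    and "ess_finite_groupoid X"
    and "ess_finite_groupoid Y"
    and "is_functor X Y f"
    and "is_functor X C V"
  shows "nakayama C X Y f V
           \<in> hom (functor_cat Y C) (OM (Rgt (right_kan C X Y f)) V) (OM (Lft (left_kan C X Y f)) V) \<and>
         is_iso (functor_cat Y C) (nakayama C X Y f V)"
proof -
  have colim: "has_ess_finite_colimits TYPE('u) C" and sm: "symmetric_monoidal_category C" and du: "has_duals C"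
    and D: "\<And>y. y \<in> Ob Y \<Longrightarrow> is_iso (functor_cat (hfibre X Y f y) C) (delta C X Y f y)"
    using assms by (auto simp: nakayama_category_def)
  interpret C: fin_cocomplete_rigid C "TYPE('u)"
    by (intro fin_cocomplete_rigid.intro rigid_category.intro rigid_category_axioms.intro
        fin_cocomplete_rigid_axioms.intro colim sm du)
  have "groupoid X" "groupoid Y" using assms(2,3) by (simp_all add: ess_finite_groupoid_def)
  then interpret M: groupoid_map X Y f using assms(4)
    by (intro groupoid_map.intro groupoid_map_axioms.intro)
  note ef = ess_finite_hfibre[OF assms(2-4)]
  have "\<forall>y \<in> Ob Y. \<exists>R. finite_groupoid (M.P y) R" using ef ess_finite_reps by metis
  then obtain R where R: "\<And>y. y \<in> Ob Y \<Longrightarrow> finite_groupoid (M.P y) (R y)" by metis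
  have DA: "delta C X Y f y \<in> Ar (functor_cat (M.P y) C)" if "y \<in> Ob Y" for y
    using D[OF that] by (auto simp: is_iso_def inverse_arrows_def)
  have fibre_diagrams: "groupoid_diagrams C TYPE('u) (M.P y) (R y)" if "y \<in> Ob Y" for y
    by (intro groupoid_diagrams.intro C.fin_cocomplete_rigid_axioms R that)
  interpret K: kan C "TYPE('u)" X Y f R
  proof (intro kan.intro kan_axioms.intro C.fin_cocomplete_rigid_axioms M.groupoid_map_axioms R)
    fix y assume y: "y \<in> Ob Y"
    show "\<exists>v \<kappa>. is_colimit C (M.P y) F v \<kappa>" if F: "is_functor (M.P y) C F" for F
    proof -
      obtain p :: "'u \<times> 'u \<Rightarrow> 'u" where p: "inj p" using infinite_pairing by blast
      have "inj_on p (Ob (M.P y))" using p by (rule inj_on_subset) simp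
      moreover have "inj_on (\<lambda>(a, m, b). p (p a, p (m, p b))) (Ar (M.P y))"
        by (auto intro!: inj_onI simp: inj_eq[OF p])
      ultimately show ?thesis by (rule C.colimit_transport[OF ef[OF y] F])
    qed
    fix c assume c: "c \<in> Ob (M.P y)"
    \<comment> \<open>the order of the automorphism group of \<open>c\<close> is the value of \<open>\<delta>\<close> there\<close>
    have "delta C X Y f y \<in> hom (functor_cat (M.P y) C) \<one>\<^bsub>functor_cat (M.P y) C\<^esub> \<one>\<^bsub>functor_cat (M.P y) C\<^esub>"
      using DA[OF y] by (simp add: hom_functor_cat delta_def delta_unit_def)
    then have "is_iso C (Cmp (delta C X Y f y) c)" by (rule C.ntr_iso_cmp[OF M.category_P _ D[OF y] c])
    then show "is_iso C (C.mult (hom (M.P y) c c) \<one>\<^bsub>C\<^esub>)"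
      using groupoid_diagrams.delta_unit[OF fibre_diagrams[OF y] c] by (simp add: delta_def)
  qed
  show ?thesis using K.nakayama_iso[OF assms(5) DA] by simp
qed

end
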